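(* Let $\mathbf n=(n_1,\dots,n_k)\in\mathbb N^k$, $\boldsymbol\rho=(\rho_1,\dots,\rho_k)$ with $\rho_i>0$, and let $F$ be a free holomorphic function on $\boldsymbol\rho\mathbf B_{\mathbf n}$ with coefficients in $B(\mathcal K)$, $F:\boldsymbol\rho\mathbf B_{\mathbf n}(\mathcal H)\to B(\mathcal K)\otimes_{min}B(\mathcal H)$, with representation $$F(\mathbf X)=\sum_{(p_1,\dots,p_k)\in\mathbb Z_+^k}\ \sum_{\substack{\alpha_i\in\mathbb F_{n_i}^+,\ |\alpha_i|=p_i\\ i\in\{1,\dots,k\}}}A_{(\alpha)}\otimes X_{(\alpha)}.$$ Let $\mathbf r=(r_1,\dots,r_k)$ with $0<r_i<\rho_i$ and define $M(\mathbf r):=\sup\|F(\mathbf X)\|$, the supremum being over all $\mathbf X\in\mathbf r\mathbf B_{\mathbf n}(\mathcal H)^-$ and all Hilbert spaces $\mathcal H$. Then, for each $(p_1,\dots,p_k)\in\mathbb Z_+^k$, $$\Big\|\sum_{\substack{\alpha_i\in\mathbb F_{n_i}^+,\ |\alpha_i|=p_i\\ i\in\{1,\dots,k\}}}A_{(\alpha)}^*A_{(\alpha)}\Big\|^{1/2}\le\frac1{r_1^{p_1}\cdots r_k^{p_k}}M(\mathbf r).$$ Moreover, $M(\mathbf r)=\|F(\mathbf r\mathbf S)\|$, where $\mathbf S$ is the universal model of the regular polyball $\mathbf B_{\mathbf n}$.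
   Context: **Polyball.** For a complex Hilbert space $\mathcal H$, $B(\mathcal H)^{n_1}\times_c\cdots\times_c B(\mathcal H)^{n_k}$ is the set of tuples $\mathbf X=(X_1,\dots,X_k)$, $X_i=(X_{i,1},\dots,X_{i,n_i})\in B(\mathcal H)^{n_i}$, such that each entry of $X_s$ commutes with each entry of $X_t$ whenever $s\neq t$ (entries of a single $X_s$ need not commute). Put $\Phi_{X_i}(Y)=\sum_{j=1}^{n_i}X_{i,j}YX_{i,j}^*$ and $\mathbf\Delta_{\mathbf X}=(id-\Phi_{X_1})\circ\cdots\circ(id-\Phi_{X_k})$ on $B(\mathcal H)$. The regular polyball $\mathbf B_{\mathbf n}(\mathcal H)$ is the set of all such $\mathbf X$ with $\|\sum_jX_{i,j}X_{i,j}^*\|<1$ for each $i$ and $\mathbf\Delta_{\mathbf X}(I)>0$ (positive and invertible); $\mathbf B_{\mathbf n}(\mathcal H)^-$ is its operator-norm closure. For $\mathbf r=(r_1,\dots,r_k)$, $\mathbf r\mathbf X=(r_1X_1,\dots,r_kX_k)$, and $\mathbf r\mathbf B_{\mathbf n}(\mathcal H)$, $\mathbf r\mathbf B_{\mathbf n}(\mathcal H)^-$ are the images of $\mathbf B_{\mathbf n}(\mathcal H)$, $\mathbf B_{\mathbf n}(\mathcal H)^-$ under $\mathbf X\mapsto\mathbf r\mathbf X$. **Free holomorphic functions.** $\mathbb F_{n_i}^+$ is the unital free semigroup on generators $g^i_1,\dots,g^i_{n_i}$, with word length $|\cdot|$. For $\alpha=g^i_{j_1}\cdots g^i_{j_p}$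 put $X_{i,\alpha}=X_{i,j_1}\cdots X_{i,j_p}$ ($I$ for the empty word), and for $(\alpha)=(\alpha_1,\dots,\alpha_k)$ put $X_{(\alpha)}=X_{1,\alpha_1}\cdots X_{k,\alpha_k}$. A free holomorphic function on $\boldsymbol\rho\mathbf B_{\mathbf n}=\{\boldsymbol\rho\mathbf B_{\mathbf n}(\mathcal H):\mathcal H\text{ a Hilbert space}\}$ with coefficients in $B(\mathcal K)$ is a formal power series $F=\sum_{(\alpha)}A_{(\alpha)}\otimes Z_{(\alpha)}$, $A_{(\alpha)}\in B(\mathcal K)$, such that the series $\sum_{(p_1,\dots,p_k)\in\mathbb Z_+^k}\sum_{|\alpha_i|=p_i}A_{(\alpha)}\otimes X_{(\alpha)}$ converges in operator norm for all $\mathbf X\in\boldsymbol\rho\mathbf B_{\mathbf n}(\mathcal H)$ and all Hilbert spaces $\mathcal H$. **Universal model.** $F^2(H_{n_i})=\mathbb C1\oplus\bigoplus_{p\ge1}H_{n_i}^{\otimes p}$ is the full Fock space over an $n_i$-dimensional Hilbert space with orthonormal basis $e^i_1,\dots,e^i_{n_i}$; $e^i_\alpha=e^i_{j_1}\otimes\cdots\otimes e^i_{j_p}$ for $\alpha=g^i_{j_1}\cdots g^i_{j_p}$ ($e^i_\alpha=1$ for the empty word). $S_{i,j}e^i_\alpha=e^i_{g^i_j\alpha}$, and $\mathbf S_{i,j}$ is $S_{i,j}$ acting on the $i$-th factor of $\bigotimes_{i=1}^kF^2(H_{n_i})$ (identity on the others); $\mathbf S=(\mathbf S_1,\dots,\mathbf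 S_k)$, $\mathbf S_i=(\mathbf S_{i,1},\dots,\mathbf S_{i,n_i})$. *)

theory Defs
  imports
    "HOL-Analysis.Analysis"
    "HOL-Algebra.Module"
    "HOL-Library.Equipollence"
    "HOL-Library.Extended_Real"
begin

section \<open>Complex Hilbert spaces\<close>

text \<open>
  The statement ranges over all Hilbert spaces, so a Hilbert space is a structure on a carrier set
  (a module over the field of complex numbers together with an inner product) and not a type.
  As always for modules in HOL-Algebra, the fields \<open>mult\<close> and \<open>one\<close> of the record play no role.
  The inner product is linear in the first and conjugate linear in the second argument.
\<close>

record 'a hilb = "(complex, 'a) module" +
  ip :: "'a \<Rightarrow> 'a \<Rightarrow> complex"

definition complex_field :: "complex ring" where
  "complex_field = \<lparr>carrier = UNIV, mult = (*), one = 1, zero = 0, add = (+)\<rparr>"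

definition hnorm :: "'a hilb \<Rightarrow> 'a \<Rightarrow> real" where
  "hnorm H x = sqrt (Re (ip H x x))"

locale hilbert_space = module complex_field H for H :: "'a hilb" (structure) +
  assumes ip_add_left: "\<And>x y z. \<lbrakk>x \<in> carrier H; y \<in> carrier H; z \<in> carrier H\<rbrakk>
      \<Longrightarrow> ip H (x \<oplus> y) z = ip H x z + ip H y z"
    and ip_smult_left: "\<And>c x y. \<lbrakk>x \<in> carrier H; y \<in> carrier H\<rbrakk>
      \<Longrightarrow> ip H (c \<odot>\<^bsub>H\<^esub> x) y = c * ip H x y"
    and ip_cnj: "\<And>x y. \<lbrakk>x \<in> carrier H; y \<in> carrier H\<rbrakk> \<Longrightarrow> ip H y x = cnj (ip H x y)"
    and ip_nonneg: "\<And>x. x \<in> carrier H \<Longrightarrow> 0 \<le> Re (ip H x x)"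
    and ip_definite: "\<And>x. \<lbrakk>x \<in> carrier H; ip H x x = 0\<rbrakk> \<Longrightarrow> x = \<zero>"
    and complete: "\<And>\<sigma> :: nat \<Rightarrow> 'a. \<lbrakk>\<And>m. \<sigma> m \<in> carrier H;
        \<And>e. 0 < e \<Longrightarrow> \<exists>N. \<forall>l\<ge>N. \<forall>m\<ge>N. hnorm H (\<sigma> l \<ominus> \<sigma> m) < e\<rbrakk>
      \<Longrightarrow> \<exists>x\<in>carrier H. (\<lambda>m. hnorm H (\<sigma> m \<ominus> x)) \<longlonglongrightarrow> 0"

definition orthonormal :: "'a hilb \<Rightarrow> 'a set \<Rightarrow> bool" where
  "orthonormal H E \<longleftrightarrow> E \<subseteq> carrier H \<and>
     (\<forall>x\<in>E. \<forall>y\<in>E. ip H x y = (if x = y then 1 else 0))"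

definition orthonormal_basis :: "'a hilb \<Rightarrow> 'a set \<Rightarrow> bool" where
  "orthonormal_basis H E \<longleftrightarrow> orthonormal H E \<and>
     (\<forall>x\<in>carrier H. (\<forall>e\<in>E. ip H x e = 0) \<longrightarrow> x = \<zero>\<^bsub>H\<^esub>)"

section \<open>Bounded operators\<close>

text \<open>Only the values of an operator on the carrier are meaningful.\<close>

definition bops :: "'a hilb \<Rightarrow> ('a \<Rightarrow> 'a) set" where
  "bops H = {T. T \<in> carrier H \<rightarrow> carrier H \<and>
     (\<forall>x\<in>carrier H. \<forall>y\<in>carrier H. T (x \<oplus>\<^bsub>H\<^esub> y) = T x \<oplus>\<^bsub>H\<^esub> T y) \<and>
     (\<forall>c. \<forall>x\<in>carrier H. T (c \<odot>\<^bsub>H\<^esub> x) = c \<odot>\<^bsub>H\<^esub> T x) \<and>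
     (\<exists>C. \<forall>x\<in>carrier H. hnorm H (T x) \<le> C * hnorm H x)}"

definition opnorm :: "'a hilb \<Rightarrow> ('a \<Rightarrow> 'a) \<Rightarrow> real" where
  "opnorm H T = (SUP x \<in> {x \<in> carrier H. hnorm H x \<le> 1}. hnorm H (T x))"

definition op_minus :: "'a hilb \<Rightarrow> ('a \<Rightarrow> 'a) \<Rightarrow> ('a \<Rightarrow> 'a) \<Rightarrow> 'a \<Rightarrow> 'a" where
  "op_minus H T U = (\<lambda>x. T x \<ominus>\<^bsub>H\<^esub> U x)"

definition op_sum :: "'a hilb \<Rightarrow> ('i \<Rightarrow> 'a \<Rightarrow> 'a) \<Rightarrow> 'i set \<Rightarrow> 'a \<Rightarrow> 'a" where
  "op_sum H T J = (\<lambda>x. finsum H (\<lambda>i. T i x) J)"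

definition adj :: "'a hilb \<Rightarrow> ('a \<Rightarrow> 'a) \<Rightarrow> 'a \<Rightarrow> 'a" where
  "adj H T y = (THE z. z \<in> carrier H \<and> (\<forall>x\<in>carrier H. ip H (T x) y = ip H x z))"

definition positive_invertible :: "'a hilb \<Rightarrow> ('a \<Rightarrow> 'a) \<Rightarrow> bool" where
  "positive_invertible H T \<longleftrightarrow> T \<in> bops H \<and>
     (\<forall>x\<in>carrier H. Im (ip H (T x) x) = 0 \<and> 0 \<le> Re (ip H (T x) x)) \<and>
     (\<exists>U\<in>bops H. \<forall>x\<in>carrier H. U (T x) = x \<and> T (U x) = x)"

text \<open>
  Convergence in operator norm of a series over an arbitrary index set, as in \<^const>\<open>has_sum\<close>.
\<close>

definition op_has_sum :: "'a hilb \<Rightarrow> ('i \<Rightarrow> 'a \<Rightarrow> 'a) \<Rightarrow> 'i set \<Rightarrow> ('a \<Rightarrow> 'a) \<Rightarrow> bool" where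
  "op_has_sum H T I Q \<longleftrightarrow> Q \<in> bops H \<and>
     ((\<lambda>J. opnorm H (op_minus H Q (op_sum H T J))) \<longlongrightarrow> 0) (finite_subsets_at_top I)"

definition op_infsum :: "'a hilb \<Rightarrow> ('i \<Rightarrow> 'a \<Rightarrow> 'a) \<Rightarrow> 'i set \<Rightarrow> 'a \<Rightarrow> 'a" where
  "op_infsum H T I = (SOME Q. op_has_sum H T I Q)"

section \<open>The Hilbert space tensor product\<close>

text \<open>
  The tensor product of \<open>K\<close> and \<open>H\<close> is realised as the space of conjugate linear Hilbert-Schmidt
  operators from \<open>K\<close> to \<open>H\<close>, the elementary tensor of \<open>k\<close> and \<open>h\<close> being the rank one operator
  \<open>\<lambda>x. \<langle>k, x\<rangle> h\<close>.  By Parseval's identity neither the carrier nor the inner product depends on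
  the orthonormal basis of \<open>K\<close> that is used to define them, and
  \<open>\<langle>k \<otimes> h, k' \<otimes> h'\<rangle> = \<langle>k, k'\<rangle> \<langle>h, h'\<rangle>\<close>.
\<close>

definition some_basis :: "'a hilb \<Rightarrow> 'a set" where
  "some_basis H = (SOME E. orthonormal_basis H E)"

definition tensor_space :: "'k hilb \<Rightarrow> 'h hilb \<Rightarrow> ('k \<Rightarrow> 'h) hilb" where
  "tensor_space K H = \<lparr>
     carrier = {T. T \<in> carrier K \<rightarrow>\<^sub>E carrier H \<and>
       (\<forall>x\<in>carrier K. \<forall>y\<in>carrier K. T (x \<oplus>\<^bsub>K\<^esub> y) = T x \<oplus>\<^bsub>H\<^esub> T y) \<and>
       (\<forall>c. \<forall>x\<in>carrier K. T (c \<odot>\<^bsub>K\<^esub> x) = cnj c \<odot>\<^bsub>H\<^esub> T x) \<and>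
       (\<exists>C. \<forall>x\<in>carrier K. hnorm H (T x) \<le> C * hnorm K x) \<and>
       (\<lambda>e. (hnorm H (T e))\<^sup>2) summable_on some_basis K},
     mult = undefined,
     one = undefined,
     zero = (\<lambda>x\<in>carrier K. \<zero>\<^bsub>H\<^esub>),
     add = (\<lambda>S T. \<lambda>x\<in>carrier K. S x \<oplus>\<^bsub>H\<^esub> T x),
     smult = (\<lambda>c T. \<lambda>x\<in>carrier K. c \<odot>\<^bsub>H\<^esub> T x),
     ip = (\<lambda>S T. \<Sum>\<^sub>\<infinity>e\<in>some_basis K. ip H (S e) (T e)) \<rparr>"

text \<open>
  The operator \<open>A \<otimes> B\<close>.  It maps \<open>k \<otimes> h\<close> to \<open>A k \<otimes> B h\<close>, since
  \<open>B (\<langle>k, A\<^sup>* x\<rangle> h) = \<langle>A k, x\<rangle> B h\<close>.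
\<close>

definition tensor_op :: "'k hilb \<Rightarrow> ('k \<Rightarrow> 'k) \<Rightarrow> ('h \<Rightarrow> 'h) \<Rightarrow> ('k \<Rightarrow> 'h) \<Rightarrow> 'k \<Rightarrow> 'h" where
  "tensor_op K A B T = (\<lambda>x\<in>carrier K. B (T (adj K A x)))"

section \<open>The regular polyball\<close>

text \<open>
  A tuple is a doubly indexed family \<open>X i j\<close> with \<open>1 \<le> i \<le> k\<close> and \<open>1 \<le> j \<le> n i\<close>; its values at
  other indices are irrelevant.
\<close>

definition op_tuples :: "nat \<Rightarrow> (nat \<Rightarrow> nat) \<Rightarrow> 'a hilb \<Rightarrow> (nat \<Rightarrow> nat \<Rightarrow> 'a \<Rightarrow> 'a) set" where
  "op_tuples k n H = {X. (\<forall>i\<in>{1..k}. \<forall>j\<in>{1..n i}. X i j \<in> bops H) \<and>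
     (\<forall>s\<in>{1..k}. \<forall>t\<in>{1..k}. s \<noteq> t \<longrightarrow> (\<forall>j\<in>{1..n s}. \<forall>l\<in>{1..n t}.
        \<forall>x\<in>carrier H. X s j (X t l x) = X t l (X s j x)))}"

definition Phi :: "'a hilb \<Rightarrow> nat \<Rightarrow> (nat \<Rightarrow> 'a \<Rightarrow> 'a) \<Rightarrow> ('a \<Rightarrow> 'a) \<Rightarrow> 'a \<Rightarrow> 'a" where
  "Phi H m Xi Y = op_sum H (\<lambda>j. Xi j \<circ> Y \<circ> adj H (Xi j)) {1..m}"

definition Delta :: "nat \<Rightarrow> (nat \<Rightarrow> nat) \<Rightarrow> 'a hilb \<Rightarrow> (nat \<Rightarrow> nat \<Rightarrow> 'a \<Rightarrow> 'a)
    \<Rightarrow> ('a \<Rightarrow> 'a) \<Rightarrow> 'a \<Rightarrow> 'a" where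
  "Delta k n H X = foldr (\<lambda>i Y. op_minus H Y (Phi H (n i) (X i) Y)) [1..<Suc k]"

definition polyball :: "nat \<Rightarrow> (nat \<Rightarrow> nat) \<Rightarrow> 'a hilb \<Rightarrow> (nat \<Rightarrow> nat \<Rightarrow> 'a \<Rightarrow> 'a) set" where
  "polyball k n H = {X \<in> op_tuples k n H.
     (\<forall>i\<in>{1..k}. opnorm H (op_sum H (\<lambda>j. X i j \<circ> adj H (X i j)) {1..n i}) < 1) \<and>
     positive_invertible H (Delta k n H X id)}"

definition polyball_closure ::
    "nat \<Rightarrow> (nat \<Rightarrow> nat) \<Rightarrow> 'a hilb \<Rightarrow> (nat \<Rightarrow> nat \<Rightarrow> 'a \<Rightarrow> 'a) set" where
  "polyball_closure k n H = {X \<in> op_tuples k n H.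
     \<forall>\<epsilon>>0. \<exists>Y\<in>polyball k n H. \<forall>i\<in>{1..k}. \<forall>j\<in>{1..n i}.
       opnorm H (op_minus H (X i j) (Y i j)) < \<epsilon>}"

definition scale_tuple :: "'a hilb \<Rightarrow> (nat \<Rightarrow> real) \<Rightarrow> (nat \<Rightarrow> nat \<Rightarrow> 'a \<Rightarrow> 'a)
    \<Rightarrow> nat \<Rightarrow> nat \<Rightarrow> 'a \<Rightarrow> 'a" where
  "scale_tuple H r X = (\<lambda>i j x. complex_of_real (r i) \<odot>\<^bsub>H\<^esub> X i j x)"

section \<open>Free holomorphic functions\<close>

text \<open>
  A word in the generators with indices \<open>1, \<dots>, n i\<close> is a list, and a multi-word is a family
  \<open>\<alpha> 1, \<dots>, \<alpha> k\<close> of words.  Multi-words and multi-degrees are extensional functions on \<open>{1..k}\<close>.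
\<close>

definition multiwords :: "nat \<Rightarrow> (nat \<Rightarrow> nat) \<Rightarrow> (nat \<Rightarrow> nat list) set" where
  "multiwords k n = (\<Pi>\<^sub>E i\<in>{1..k}. lists {1..n i})"

definition multiwords_deg ::
    "nat \<Rightarrow> (nat \<Rightarrow> nat) \<Rightarrow> (nat \<Rightarrow> nat) \<Rightarrow> (nat \<Rightarrow> nat list) set" where
  "multiwords_deg k n p = {\<alpha> \<in> multiwords k n. \<forall>i\<in>{1..k}. length (\<alpha> i) = p i}"

definition multidegrees :: "nat \<Rightarrow> (nat \<Rightarrow> nat) set" where
  "multidegrees k = (\<Pi>\<^sub>E i\<in>{1..k}. UNIV)"

definition word_op :: "(nat \<Rightarrow> 'a \<Rightarrow> 'a) \<Rightarrow> nat list \<Rightarrow> 'a \<Rightarrow> 'a" where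
  "word_op Xi w = foldr (\<lambda>j T. Xi j \<circ> T) w id"

definition multiword_op :: "nat \<Rightarrow> (nat \<Rightarrow> nat \<Rightarrow> 'a \<Rightarrow> 'a) \<Rightarrow> (nat \<Rightarrow> nat list) \<Rightarrow> 'a \<Rightarrow> 'a" where
  "multiword_op k X \<alpha> = foldr (\<lambda>i T. word_op (X i) (\<alpha> i) \<circ> T) [1..<Suc k] id"

definition homogeneous_part :: "nat \<Rightarrow> (nat \<Rightarrow> nat) \<Rightarrow> 'k hilb \<Rightarrow> ((nat \<Rightarrow> nat list) \<Rightarrow> 'k \<Rightarrow> 'k)
    \<Rightarrow> 'h hilb \<Rightarrow> (nat \<Rightarrow> nat \<Rightarrow> 'h \<Rightarrow> 'h) \<Rightarrow> (nat \<Rightarrow> nat) \<Rightarrow> ('k \<Rightarrow> 'h) \<Rightarrow> 'k \<Rightarrow> 'h" where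
  "homogeneous_part k n K A H X p =
     op_sum (tensor_space K H) (\<lambda>\<alpha>. tensor_op K (A \<alpha>) (multiword_op k X \<alpha>)) (multiwords_deg k n p)"

text \<open>The value \<open>F(X)\<close> for the formal power series \<open>F\<close> with coefficients \<open>A\<close>.\<close>

definition fps_apply :: "nat \<Rightarrow> (nat \<Rightarrow> nat) \<Rightarrow> 'k hilb \<Rightarrow> ((nat \<Rightarrow> nat list) \<Rightarrow> 'k \<Rightarrow> 'k)
    \<Rightarrow> 'h hilb \<Rightarrow> (nat \<Rightarrow> nat \<Rightarrow> 'h \<Rightarrow> 'h) \<Rightarrow> ('k \<Rightarrow> 'h) \<Rightarrow> 'k \<Rightarrow> 'h" where
  "fps_apply k n K A H X =
     op_infsum (tensor_space K H) (homogeneous_part k n K A H X) (multidegrees k)"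

text \<open>
  The quantification over all Hilbert spaces is over all Hilbert spaces whose carrier is a set of
  elements of the type \<open>'h\<close>, which plays the role of the universe.  A universe with at least as many elements as there are
  real numbers contains an infinite-dimensional Hilbert space; a finite one contains only the zero
  space.
\<close>

definition free_holomorphic :: "'h itself \<Rightarrow> nat \<Rightarrow> (nat \<Rightarrow> nat) \<Rightarrow> (nat \<Rightarrow> real) \<Rightarrow> 'k hilb
    \<Rightarrow> ((nat \<Rightarrow> nat list) \<Rightarrow> 'k \<Rightarrow> 'k) \<Rightarrow> bool" where
  "free_holomorphic U k n \<rho> K A \<longleftrightarrow>
     (\<forall>\<alpha>\<in>multiwords k n. A \<alpha> \<in> bops K) \<and>
     (\<forall>H :: 'h hilb. hilbert_space H \<longrightarrow>
        (\<forall>X\<in>scale_tuple H \<rho> ` polyball k n H.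
           \<exists>Q. op_has_sum (tensor_space K H) (homogeneous_part k n K A H X) (multidegrees k) Q))"

definition sup_norm :: "'h itself \<Rightarrow> nat \<Rightarrow> (nat \<Rightarrow> nat) \<Rightarrow> 'k hilb
    \<Rightarrow> ((nat \<Rightarrow> nat list) \<Rightarrow> 'k \<Rightarrow> 'k) \<Rightarrow> (nat \<Rightarrow> real) \<Rightarrow> ereal" where
  "sup_norm U k n K A r =
     Sup {ereal (opnorm (tensor_space K H) (fps_apply k n K A H X)) | (H :: 'h hilb) X.
            hilbert_space H \<and> X \<in> scale_tuple H r ` polyball_closure k n H}"

section \<open>The universal model\<close>

definition ell2 :: "'a set \<Rightarrow> ('a \<Rightarrow> complex) hilb" where
  "ell2 I = \<lparr>
     carrier = {f. (\<forall>x. x \<notin> I \<longrightarrow> f x = 0) \<and> (\<lambda>x. (cmod (f x))\<^sup>2) summable_on I},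
     mult = undefined,
     one = undefined,
     zero = (\<lambda>_. 0),
     add = (\<lambda>f g x. f x + g x),
     smult = (\<lambda>c f x. c * f x),
     ip = (\<lambda>f g. \<Sum>\<^sub>\<infinity>x\<in>I. f x * cnj (g x)) \<rparr>"

text \<open>
  The full Fock space has the orthonormal basis formed by the \<open>e\<^sub>w\<close> for words \<open>w\<close>, so it is the
  space of square summable families indexed by words; the tensor product of \<open>k\<close> of these spaces
  is the space of square summable families indexed by multi-words, with orthonormal basis
  \<open>e\<^sub>\<alpha> = e\<^sub>\<alpha>\<^sub>1 \<otimes> \<dots> \<otimes> e\<^sub>\<alpha>\<^sub>k\<close>.
\<close>

definition fock :: "nat \<Rightarrow> (nat \<Rightarrow> nat) \<Rightarrow> ((nat \<Rightarrow> nat list) \<Rightarrow> complex) hilb" where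
  "fock k n = ell2 (multiwords k n)"

definition fock_basis :: "(nat \<Rightarrow> nat list) \<Rightarrow> (nat \<Rightarrow> nat list) \<Rightarrow> complex" where
  "fock_basis \<alpha> = (\<lambda>\<beta>. if \<beta> = \<alpha> then 1 else 0)"

text \<open>The left creation operators, written down by the coefficients of the image vector.\<close>

definition creation :: "nat \<Rightarrow> nat \<Rightarrow> ((nat \<Rightarrow> nat list) \<Rightarrow> complex) \<Rightarrow> (nat \<Rightarrow> nat list) \<Rightarrow> complex" where
  "creation i j f =
     (\<lambda>\<alpha>. if \<alpha> i \<noteq> [] \<and> hd (\<alpha> i) = j then f (\<alpha>(i := tl (\<alpha> i))) else 0)"

lemma creation_fock_basis: "creation i j (fock_basis \<alpha>) = fock_basis (\<alpha>(i := j # \<alpha> i))"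
proof
  fix \<beta>
  have "\<beta> i \<noteq> [] \<and> hd (\<beta> i) = j \<and> \<beta>(i := tl (\<beta> i)) = \<alpha> \<longleftrightarrow> \<beta> = \<alpha>(i := j # \<alpha> i)"
    by (cases "\<beta> i") (auto simp: fun_eq_iff)
  then show "creation i j (fock_basis \<alpha>) \<beta> = fock_basis (\<alpha>(i := j # \<alpha> i)) \<beta>"
    by (auto simp: creation_def fock_basis_def)
qed

end

theory Submission
  imports Defs
begin

text \<open>
  Let \<open>S\<close> be the universal model and \<open>X\<close> a point of the polyball on \<open>H\<close>, with defect operator
  \<open>D = \<Delta>\<^bsub>X\<^esub>(I)\<close>.  Everything rests on the Poisson kernel, which compares \<open>X\<close> with \<open>S\<close>.

  Since \<open>D\<close> is positive and invertible, \<open>\<langle>D x, y\<rangle>\<close> is an equivalent inner product on \<open>H\<close>.  For \<open>s\<close> in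
  an orthonormal basis of \<open>H\<close> with this inner product, let \<open>P\<^sub>s h\<close> be the family of the numbers
  \<open>\<langle>D X\<^sub>\<beta>\<^sup>* h, s\<rangle>\<close>, indexed by the multi-words \<open>\<beta>\<close>.  Summation of \<open>\<Phi>\<^sup>N (Y - \<Phi>(Y))\<close> over \<open>N\<close> telescopes to
  \<open>Y\<close> for each of the strictly contractive maps \<open>\<Phi> = \<Phi>\<^bsub>X i\<^esub>\<close>; doing so for \<open>i = 1, \<dots>, k\<close> shows that the
  sum of the \<open>\<langle>D X\<^sub>\<beta>\<^sup>* h, X\<^sub>\<beta>\<^sup>* h\<rangle>\<close> over all \<open>\<beta>\<close> is \<open>\<parallel>h\<parallel>\<^sup>2\<close> (\<open>multi_form_has_sum\<close>).  Together with Parseval's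
  identity this says that the \<open>P\<^sub>s\<close> form an isometry from \<open>H\<close> into a direct sum of copies of the Fock
  space (\<open>poisson_isometry\<close>).  By construction \<open>P\<^sub>s X\<^sub>i\<^sub>j\<^sup>* = S\<^sub>i\<^sub>j\<^sup>* P\<^sub>s\<close> (\<open>poisson_intertwined\<close>).  So the
  adjoint of a polynomial in \<open>X\<close> with operator coefficients is a restriction of a direct
  sum of copies of the adjoint of the same polynomial in \<open>S\<close>, and its norm is not larger
  (\<open>compression_norm_le\<close>).  By continuity this inequality extends to the closed polyball (\<open>von_neumann_polyball_closure\<close>).

  Applied to the finite partial sums of the power series, the inequality transfers convergence
  from \<open>r S\<close> to \<open>r X\<close> and yields \<open>\<parallel>F(r X)\<parallel> \<le> \<parallel>F(r S)\<parallel>\<close> (\<open>op_has_sum_comparison\<close>).  For the converse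
  inequality, and for the convergence at \<open>r S\<close> itself, a copy of \<open>S\<close> in the universe is needed.  There
  is one, because the Fock space has at most as many vectors as there are real numbers
  (\<open>carrier_fock_lepoll_reals\<close>), and the universe has at least as many elements.  The defect
  operator of \<open>t S\<close> with \<open>0 < t i < 1\<close> is diagonal, with entries between \<open>\<Prod>\<^sub>i (1 - (t i)\<^sup>2)\<close> and \<open>1\<close>; hence \<open>t S\<close> belongs to the polyball (\<open>tS_in_polyball\<close>) and \<open>S\<close> to its
  closure.  With \<open>t = r / \<rho>\<close> the hypothesis on \<open>F\<close> gives the convergence at \<open>r S\<close>.

  Finally, \<open>F(r S)\<close> maps \<open>x \<otimes> 1\<close> to the orthogonal sum of the vectors \<open>r\<^sup>\<alpha> A\<^sub>\<alpha> x \<otimes> e\<^sub>\<alpha>\<close>, and the terms of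
  multi-degree \<open>p\<close> alone give the coefficient estimate (\<open>cauchy_estimate\<close>).
\<close>

section \<open>Sums of families\<close>

text \<open>
  Nonnegative families are summed through bounds on their finite sums.  The sets \<open>F m\<close> need not
  exhaust \<open>I\<close>, which matters for orthonormal bases that are not countable: it is enough that the
  sums over the \<open>F m\<close> reach the bound \<open>L\<close>.
\<close>

lemma has_sum_of_finite_bounds:
  fixes u :: "'i \<Rightarrow> real"
  assumes "\<And>i. i \<in> I \<Longrightarrow> 0 \<le> u i"
    and bound: "\<And>F. finite F \<Longrightarrow> F \<subseteq> I \<Longrightarrow> sum u F \<le> L"
    and F: "\<And>m :: nat. finite (F m)" "\<And>m. F m \<subseteq> I" and lim: "(\<lambda>m. sum u (F m)) \<longlonglongrightarrow> L"
  shows "(u has_sum L) I"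
proof -
  have "bdd_above (sum u ` {F. F \<subseteq> I \<and> finite F})"
    using bound by (intro bdd_aboveI[of _ L]) auto
  then have s: "u summable_on I"
    by (rule nonneg_bdd_above_summable_on[OF assms(1), rotated]) auto
  have "infsum u I \<le> L"
    by (rule infsum_le_finite_sums[OF s]) (use bound in auto)
  moreover have "L \<le> infsum u I"
    by (rule LIMSEQ_le_const2[OF lim]) (use finite_sum_le_infsum[OF s F] assms(1) in blast)
  ultimately show ?thesis
    using s has_sum_infsum by force
qed

lemma summable_on_of_finite_bounds:
  fixes u :: "'i \<Rightarrow> real"
  assumes "\<And>i. i \<in> I \<Longrightarrow> 0 \<le> u i"
    and bound: "\<And>F. finite F \<Longrightarrow> F \<subseteq> I \<Longrightarrow> sum u F \<le> L"
  shows "u summable_on I" "infsum u I \<le> L"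
proof -
  have "bdd_above (sum u ` {F. F \<subseteq> I \<and> finite F})"
    using bound by (intro bdd_aboveI[of _ L]) auto
  then show s: "u summable_on I"
    by (rule nonneg_bdd_above_summable_on[OF assms(1), rotated]) auto
  show "infsum u I \<le> L"
    by (rule infsum_le_finite_sums[OF s]) (use bound in auto)
qed

text \<open>
  Tonelli's theorem for a nonnegative matrix whose index sets may both be uncountable.
\<close>

lemma has_sum_swap_nonneg:
  fixes a :: "'i \<Rightarrow> 'j \<Rightarrow> real"
  assumes "\<And>i j. i \<in> I \<Longrightarrow> j \<in> J \<Longrightarrow> 0 \<le> a i j"
    and row: "\<And>i. i \<in> I \<Longrightarrow> (a i has_sum b i) J"
    and col: "\<And>j. j \<in> J \<Longrightarrow> ((\<lambda>i. a i j) has_sum c j) I"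
    and tot: "(b has_sum s) I"
  shows "(c has_sum s) J"
proof -
  have "(\<lambda>(i, j). a i j) summable_on I \<times> J"
    by (rule summable_on_SigmaI[where g = b]) (use assms has_sum_imp_summable in auto)
  then have "((\<lambda>(i, j). a i j) has_sum s) (I \<times> J)"
    by (intro has_sum_SigmaI[where g = b]) (use row tot in auto)
  then have "((\<lambda>(j, i). a i j) has_sum s) (J \<times> I)"
    by (subst (asm) has_sum_swap) (simp add: case_prod_unfold)
  then show ?thesis
    by (rule has_sum_SigmaD) (use col in auto)
qed

lemma of_real_cmod_sq: "(complex_of_real (cmod z))\<^sup>2 = z * cnj z"
  using complex_norm_square[of z] by simp

lemma has_sum_minus:
  fixes f g :: "'i \<Rightarrow> complex"
  assumes "(f has_sum a) I" "(g has_sum b) I"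
  shows "((\<lambda>i. f i - g i) has_sum (a - b)) I"
  using has_sum_add[OF assms(1), of "\<lambda>i. - g i" "- b"] assms(2) by (simp add: has_sum_uminus)

text \<open>
  The discriminant argument behind the Cauchy-Schwarz inequality, stated for the values of a
  quadratic form along a complex line.  It serves the inner product of a Hilbert space as well as
  the form \<open>\<langle>D x, y\<rangle>\<close> of a positive operator \<open>D\<close>, which is not known to be an inner product at the
  point where the inequality is needed.
\<close>

lemma form_cauchy_schwarz:
  fixes a b :: real and c :: complex
  assumes "0 \<le> a" "0 \<le> b" and pos: "\<And>z. 0 \<le> a + 2 * Re (z * c) + (cmod z)\<^sup>2 * b"
  shows "(cmod c)\<^sup>2 \<le> a * b"
proof (cases "b = 0")
  case True
  have "c = 0"
  proof (rule ccontr)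
    assume "c \<noteq> 0"
    then have p: "(cmod c)\<^sup>2 > 0" by simp
    have "0 \<le> a + 2 * Re (- of_real ((a + 1) / (cmod c)\<^sup>2) * cnj c * c)"
      using pos[of "- of_real ((a + 1) / (cmod c)\<^sup>2) * cnj c"] True by simp
    also have "- of_real ((a + 1) / (cmod c)\<^sup>2) * cnj c * c = - of_real (a + 1)"
      using p complex_norm_square[of c] by (simp add: mult.assoc mult.commute[of "cnj c"] flip: of_real_mult)
    finally show False using assms(1) by simp
  qed
  then show ?thesis using True by simp
next
  case False
  then have b: "b > 0" using assms by simp
  have cc: "c * cnj c = of_real ((cmod c)\<^sup>2)" by (simp only: complex_norm_square)
  have "0 \<le> a + 2 * Re (- of_real (1 / b) * cnj c * c) + (cmod (- of_real (1 / b) * cnj c))\<^sup>2 * b"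
    by (rule pos)
  also have "- of_real (1 / b) * cnj c * c = of_real (- (cmod c)\<^sup>2 / b)"
    using cc by (simp add: mult.assoc mult.commute[of "cnj c"])
  also have "(cmod (- of_real (1 / b) * cnj c))\<^sup>2 * b = (cmod c)\<^sup>2 / b"
    using b by (simp add: norm_mult power_mult_distrib norm_divide power2_eq_square)
  finally have "(cmod c)\<^sup>2 / b \<le> a" by simp
  then show ?thesis using b by (simp add: field_simps)
qed

section \<open>The calculus of inner products\<close>

lemma complex_field_simps [simp]:
  "carrier complex_field = UNIV" "x \<oplus>\<^bsub>complex_field\<^esub> y = x + y"
  "x \<otimes>\<^bsub>complex_field\<^esub> y = x * y" "\<zero>\<^bsub>complex_field\<^esub> = 0" "\<one>\<^bsub>complex_field\<^esub> = 1"
  by (simp_all add: complex_field_def)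

lemma cring_complex_field: "cring complex_field"
  by (intro cringI abelian_groupI comm_monoidI)
     (auto simp: algebra_simps intro!: exI[of _ "- x" for x])

context hilbert_space
begin

lemma smult_in [simp, intro]: "x \<in> carrier H \<Longrightarrow> c \<odot> x \<in> carrier H"
  by simp

lemma finsum_in [simp, intro]:
  "(\<And>i. i \<in> J \<Longrightarrow> f i \<in> carrier H) \<Longrightarrow> finsum H f J \<in> carrier H"
  by (rule M.finsum_closed) auto

lemma ip_zero_left [simp]: "y \<in> carrier H \<Longrightarrow> ip H \<zero> y = 0"
  using ip_add_left[of \<zero> \<zero> y] by simp

lemma ip_zero_right [simp]: "y \<in> carrier H \<Longrightarrow> ip H y \<zero> = 0"
  using ip_cnj[of \<zero> y] by simp

lemma ip_uminus_left: "x \<in> carrier H \<Longrightarrow> y \<in> carrier H \<Longrightarrow> ip H (\<ominus> x) y = - ip H x y"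
  using ip_add_left[of x "\<ominus> x" y] by (simp add: M.r_neg add_eq_0_iff)

lemma ip_minus_left:
  "x \<in> carrier H \<Longrightarrow> y \<in> carrier H \<Longrightarrow> z \<in> carrier H \<Longrightarrow> ip H (x \<ominus> y) z = ip H x z - ip H y z"
  by (simp add: M.minus_eq ip_add_left ip_uminus_left)

lemma ip_add_right:
  "x \<in> carrier H \<Longrightarrow> y \<in> carrier H \<Longrightarrow> z \<in> carrier H \<Longrightarrow> ip H z (x \<oplus> y) = ip H z x + ip H z y"
  using ip_cnj[of "x \<oplus> y" z] ip_cnj[of x z] ip_cnj[of y z] by (simp add: ip_add_left)

lemma ip_minus_right:
  "x \<in> carrier H \<Longrightarrow> y \<in> carrier H \<Longrightarrow> z \<in> carrier H \<Longrightarrow> ip H z (x \<ominus> y) = ip H z x - ip H z y"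
  using ip_cnj[of "x \<ominus> y" z] ip_cnj[of x z] ip_cnj[of y z] by (simp add: ip_minus_left)

lemma ip_smult_right: "x \<in> carrier H \<Longrightarrow> z \<in> carrier H \<Longrightarrow> ip H z (c \<odot> x) = cnj c * ip H z x"
  using ip_cnj[of "c \<odot> x" z] ip_cnj[of x z] by (simp add: ip_smult_left)

lemma ip_finsum_left:
  assumes "\<And>i. i \<in> J \<Longrightarrow> f i \<in> carrier H" "y \<in> carrier H"
  shows "ip H (finsum H f J) y = (\<Sum>i\<in>J. ip H (f i) y)"
  using assms(1)
proof (induction J rule: infinite_finite_induct)
  case (insert i F)
  then show ?case
    using assms(2) by (subst M.finsum_insert) (auto simp: ip_add_left)
qed (use assms in auto)

lemma ip_finsum_right:
  assumes "\<And>i. i \<in> J \<Longrightarrow> f i \<in> carrier H" "y \<in> carrier H"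
  shows "ip H y (finsum H f J) = (\<Sum>i\<in>J. ip H y (f i))"
  using assms(1)
proof (induction J rule: infinite_finite_induct)
  case (insert i F)
  then show ?case
    using assms(2) by (subst M.finsum_insert) (auto simp: ip_add_right)
qed (use assms in auto)

lemmas ip_simps = ip_add_left ip_add_right ip_minus_left ip_minus_right ip_smult_left ip_smult_right
  ip_finsum_left ip_finsum_right

lemma ip_Im_self: "x \<in> carrier H \<Longrightarrow> Im (ip H x x) = 0"
  using ip_cnj[of x x] by (simp add: complex_eq_iff)

lemma hnorm_sq: "x \<in> carrier H \<Longrightarrow> (hnorm H x)\<^sup>2 = Re (ip H x x)"
  by (simp add: hnorm_def ip_nonneg)

lemma ip_self: "x \<in> carrier H \<Longrightarrow> ip H x x = of_real ((hnorm H x)\<^sup>2)"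
  by (simp add: hnorm_sq complex_eq_iff ip_Im_self)

lemma hnorm_ge_0 [simp]: "x \<in> carrier H \<Longrightarrow> 0 \<le> hnorm H x"
  by (simp add: hnorm_def ip_nonneg)

lemma hnorm_eq_0: "x \<in> carrier H \<Longrightarrow> hnorm H x = 0 \<longleftrightarrow> x = \<zero>"
  using ip_self[of x] ip_definite[of x] by (auto simp: hnorm_def)

lemma hnorm_zero [simp]: "hnorm H \<zero> = 0"
  by (simp add: hnorm_eq_0)

lemma hnorm_smult: "x \<in> carrier H \<Longrightarrow> hnorm H (c \<odot> x) = cmod c * hnorm H x"
proof -
  assume x: "x \<in> carrier H"
  have "ip H (c \<odot> x) (c \<odot> x) = of_real ((cmod c * hnorm H x)\<^sup>2)"
    using x complex_norm_square[of c] by (simp add: ip_smult_left ip_smult_right ip_self[of x] power_mult_distrib)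
  then show ?thesis
    using x by (simp add: hnorm_def[of H "c \<odot> x"])
qed

lemma minus_eq_zeroD: "x \<in> carrier H \<Longrightarrow> y \<in> carrier H \<Longrightarrow> x \<ominus> y = \<zero> \<Longrightarrow> x = y"
  by (metis M.add.inv_closed M.minus_eq M.minus_equality M.minus_minus)

text \<open>
  The standard way to prove an identity between vectors below: pairing both sides with an arbitrary
  vector turns it into an identity between complex numbers.
\<close>

lemma eq_by_ip:
  assumes "x \<in> carrier H" "y \<in> carrier H" "\<And>z. z \<in> carrier H \<Longrightarrow> ip H x z = ip H y z"
  shows "x = y"
proof -
  have "ip H (x \<ominus> y) (x \<ominus> y) = 0"
    using assms by (simp add: ip_minus_left)
  then have "x \<ominus> y = \<zero>" using assms ip_definite by blast
  then show ?thesis using assms minus_eq_zeroD by blast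
qed

lemma minus_zero_right [simp]: "x \<in> carrier H \<Longrightarrow> x \<ominus> \<zero> = x"
  by (rule eq_by_ip) (auto simp: ip_minus_left)

lemma hnorm_minus_commute:
  "x \<in> carrier H \<Longrightarrow> y \<in> carrier H \<Longrightarrow> hnorm H (x \<ominus> y) = hnorm H (y \<ominus> x)"
  by (simp add: hnorm_def ip_simps)

lemma ip_le_hnorm:
  assumes "x \<in> carrier H" "y \<in> carrier H"
  shows "cmod (ip H x y) \<le> hnorm H x * hnorm H y"
proof -
  have "(cmod (ip H x y))\<^sup>2 \<le> (hnorm H x)\<^sup>2 * (hnorm H y)\<^sup>2"
  proof (rule form_cauchy_schwarz)
    fix z :: complex
    have "0 \<le> Re (ip H (x \<oplus> cnj z \<odot> y) (x \<oplus> cnj z \<odot> y))"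
      using assms by (intro ip_nonneg) auto
    also have "ip H (x \<oplus> cnj z \<odot> y) (x \<oplus> cnj z \<odot> y)
        = ip H x x + (z * ip H x y + cnj (z * ip H x y)) + (z * cnj z) * ip H y y"
      using assms ip_cnj[of x y] by (simp add: ip_simps algebra_simps)
    also have "Re \<dots> = (hnorm H x)\<^sup>2 + 2 * Re (z * ip H x y) + (cmod z)\<^sup>2 * (hnorm H y)\<^sup>2"
      using assms by (simp add: hnorm_sq ip_Im_self cmod_power2) (simp add: power2_eq_square)
    finally show "0 \<le> (hnorm H x)\<^sup>2 + 2 * Re (z * ip H x y) + (cmod z)\<^sup>2 * (hnorm H y)\<^sup>2" .
  qed auto
  then have "(cmod (ip H x y))\<^sup>2 \<le> (hnorm H x * hnorm H y)\<^sup>2"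
    by (simp add: power_mult_distrib)
  then show ?thesis
    using assms by (rule_tac power2_le_imp_le) auto
qed

lemma hnorm_triangle:
  assumes "x \<in> carrier H" "y \<in> carrier H"
  shows "hnorm H (x \<oplus> y) \<le> hnorm H x + hnorm H y"
proof (rule power2_le_imp_le)
  have "(hnorm H (x \<oplus> y))\<^sup>2 = (hnorm H x)\<^sup>2 + 2 * Re (ip H x y) + (hnorm H y)\<^sup>2"
    using assms ip_cnj[of x y] by (simp add: hnorm_sq ip_simps)
  also have "Re (ip H x y) \<le> hnorm H x * hnorm H y"
    using ip_le_hnorm[OF assms] complex_Re_le_cmod[of "ip H x y"] by linarith
  finally show "(hnorm H (x \<oplus> y))\<^sup>2 \<le> (hnorm H x + hnorm H y)\<^sup>2"
    by (simp add: power2_sum)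
qed (use assms in auto)

lemma hnorm_triangle_minus:
  assumes "x \<in> carrier H" "y \<in> carrier H" "z \<in> carrier H"
  shows "hnorm H (x \<ominus> z) \<le> hnorm H (x \<ominus> y) + hnorm H (y \<ominus> z)"
proof -
  have "x \<ominus> z = (x \<ominus> y) \<oplus> (y \<ominus> z)"
    using assms by (intro eq_by_ip) (auto simp: ip_simps)
  then show ?thesis using hnorm_triangle[of "x \<ominus> y" "y \<ominus> z"] assms by simp
qed

lemma hnorm_minus_le:
  assumes "x \<in> carrier H" "y \<in> carrier H"
  shows "hnorm H (x \<ominus> y) \<le> hnorm H x + hnorm H y"
proof -
  have "x \<ominus> y = x \<oplus> (- 1) \<odot> y"
    using assms by (intro eq_by_ip) (auto simp: ip_simps)
  then show ?thesis using hnorm_triangle[of x "(- 1) \<odot> y"] assms by (simp add: hnorm_smult)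
qed

lemma hnorm_le_minus_add:
  assumes "x \<in> carrier H" "y \<in> carrier H"
  shows "hnorm H x \<le> hnorm H (x \<ominus> y) + hnorm H y"
  using hnorm_triangle_minus[of x y \<zero>] assms by simp

lemma abs_hnorm_diff:
  assumes "x \<in> carrier H" "y \<in> carrier H"
  shows "\<bar>hnorm H x - hnorm H y\<bar> \<le> hnorm H (x \<ominus> y)"
  using hnorm_le_minus_add[of x y] hnorm_le_minus_add[of y x] hnorm_minus_commute[of x y] assms
  by linarith

lemma tendsto_ip_left:
  assumes "\<And>m. \<sigma> m \<in> carrier H" "x \<in> carrier H" "y \<in> carrier H"
    and "((\<lambda>m. hnorm H (\<sigma> m \<ominus> x)) \<longlongrightarrow> 0) F"
  shows "((\<lambda>m. ip H (\<sigma> m) y) \<longlongrightarrow> ip H x y) F"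
proof (rule Lim_null[THEN iffD2], rule Lim_null_comparison)
  show "\<forall>\<^sub>F m in F. norm (ip H (\<sigma> m) y - ip H x y) \<le> hnorm H (\<sigma> m \<ominus> x) * hnorm H y"
    using ip_le_hnorm[of "\<sigma> m \<ominus> x" y for m] assms by (intro always_eventually) (simp add: ip_simps)
  show "((\<lambda>m. hnorm H (\<sigma> m \<ominus> x) * hnorm H y) \<longlongrightarrow> 0) F"
    using tendsto_mult[OF assms(4) tendsto_const[of "hnorm H y"]] by simp
qed

lemma tendsto_hnorm:
  assumes "\<And>m. \<sigma> m \<in> carrier H" "x \<in> carrier H"
    and "((\<lambda>m. hnorm H (\<sigma> m \<ominus> x)) \<longlongrightarrow> 0) F"
  shows "((\<lambda>m. hnorm H (\<sigma> m)) \<longlongrightarrow> hnorm H x) F"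
proof (rule Lim_null[THEN iffD2], rule Lim_null_comparison)
  show "\<forall>\<^sub>F m in F. norm (hnorm H (\<sigma> m) - hnorm H x) \<le> hnorm H (\<sigma> m \<ominus> x)"
    using abs_hnorm_diff[of "\<sigma> m" x for m] assms by (intro always_eventually) simp
qed (rule assms(3))

section \<open>Orthonormal bases\<close>

text \<open>
  A maximal orthonormal set is a basis, because a nonzero vector orthogonal to it could be normalised
  and added; Zorn's lemma provides a maximal one.
\<close>

lemma ex_orthonormal_basis: "\<exists>E. orthonormal_basis H E"
proof -
  have "\<exists>M\<in>{E. orthonormal H E}. \<forall>X\<in>{E. orthonormal H E}. M \<subseteq> X \<longrightarrow> X = M"
  proof (rule subset_Zorn_nonempty)
    show "{E. orthonormal H E} \<noteq> {}"
      by (auto simp: orthonormal_def intro!: exI[of _ "{}"])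
    fix C assume C: "C \<noteq> {}" "subset.chain {E. orthonormal H E} C"
    have o: "orthonormal H E" if "E \<in> C" for E
      using C that by (auto simp: subset.chain_def)
    have "ip H x y = (if x = y then 1 else 0)" if xy: "x \<in> \<Union>C" "y \<in> \<Union>C" for x y
    proof -
      obtain X Y where XY: "X \<in> C" "x \<in> X" "Y \<in> C" "y \<in> Y"
        using xy by blast
      then have "X \<subseteq> Y \<or> Y \<subseteq> X"
        using C by (auto simp: subset_chain_def)
      then obtain E where "E \<in> C" "x \<in> E" "y \<in> E"
        using XY by blast
      then show ?thesis using o by (auto simp: orthonormal_def)
    qed
    then show "\<Union>C \<in> {E. orthonormal H E}"
      using o by (force simp: orthonormal_def)
  qed
  then obtain E where E: "orthonormal H E" and max: "\<And>X. orthonormal H X \<Longrightarrow> E \<subseteq> X \<Longrightarrow> X = E"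
    by auto
  have "x = \<zero>" if x: "x \<in> carrier H" and perp: "\<forall>e\<in>E. ip H x e = 0" for x
  proof (rule ccontr)
    assume "x \<noteq> \<zero>"
    then have n: "hnorm H x > 0"
      using x hnorm_eq_0 hnorm_ge_0 by (metis order_le_less)
    define u where "u = of_real (1 / hnorm H x) \<odot> x"
    have u: "u \<in> carrier H" using x by (simp add: u_def)
    have uu: "ip H u u = 1"
      using x n by (simp add: u_def ip_smult_left ip_smult_right ip_self[of x] power2_eq_square)
    have ue: "ip H u e = 0" "ip H e u = 0" if "e \<in> E" for e
      using that perp x E ip_cnj[of x e] by (auto simp: u_def ip_simps orthonormal_def)
    have "orthonormal H (insert u E)"
      using E u uu ue by (auto simp: orthonormal_def)
    then have "u \<in> E" using max by blast
    then show False using ue uu by force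
  qed
  then show ?thesis using E by (auto simp: orthonormal_basis_def)
qed

lemma some_basis: "orthonormal_basis H (some_basis H)"
  unfolding some_basis_def by (rule someI_ex[OF ex_orthonormal_basis])

lemma orthonormal_in: "orthonormal H E \<Longrightarrow> e \<in> E \<Longrightarrow> e \<in> carrier H"
  by (auto simp: orthonormal_def)

lemma basis_in: "orthonormal_basis H E \<Longrightarrow> e \<in> E \<Longrightarrow> e \<in> carrier H"
  by (auto simp: orthonormal_basis_def orthonormal_def)

lemma some_basis_in [simp]: "e \<in> some_basis H \<Longrightarrow> e \<in> carrier H"
  using basis_in[OF some_basis] .

lemma ip_lincomb_basis:
  assumes E: "orthonormal H E" and F: "finite F" "F \<subseteq> E" and e: "e \<in> E"
  shows "ip H (finsum H (\<lambda>f. c f \<odot> f) F) e = (if e \<in> F then c e else 0)"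
proof -
  have "ip H (finsum H (\<lambda>f. c f \<odot> f) F) e = (\<Sum>f\<in>F. c f * ip H f e)"
    using E F e orthonormal_in[OF E] by (subst ip_finsum_left) (auto simp: ip_smult_left subset_iff intro!: sum.cong)
  also have "\<dots> = (\<Sum>f\<in>F. if e = f then c e else 0)"
    using E F e by (intro sum.cong) (auto simp: orthonormal_def)
  also have "\<dots> = (if e \<in> F then c e else 0)" using F by simp
  finally show ?thesis .
qed

lemma hnorm_lincomb_basis:
  assumes E: "orthonormal H E" and F: "finite F" "F \<subseteq> E"
  shows "(hnorm H (finsum H (\<lambda>f. c f \<odot> f) F))\<^sup>2 = (\<Sum>f\<in>F. (cmod (c f))\<^sup>2)"
proof -
  let ?s = "finsum H (\<lambda>f. c f \<odot> f) F"
  have in_E: "f \<in> carrier H" if "f \<in> F" for f using that F orthonormal_in[OF E] by auto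
  then have s: "?s \<in> carrier H" by auto
  have "ip H ?s ?s = (\<Sum>f\<in>F. cnj (c f) * ip H ?s f)"
    using s in_E by (subst ip_finsum_right) (auto simp: ip_smult_right)
  also have "\<dots> = (\<Sum>f\<in>F. of_real ((cmod (c f))\<^sup>2))"
    using F by (intro sum.cong refl, subst ip_lincomb_basis[OF E])
       (auto simp: of_real_cmod_sq mult.commute)
  finally show ?thesis using s by (simp add: hnorm_sq)
qed

text \<open>
  The sets \<open>F m\<close> where \<open>\<bar>c e\<bar>\<^sup>2 > 1 / (m + 1)\<close> are finite because \<open>\<bar>c\<bar>\<^sup>2\<close> is summable, and they
  increase with \<open>m\<close>.  The partial sums over them are a Cauchy sequence by Pythagoras, so a sequence is
  enough to reach the limit even if \<open>E\<close> is uncountable.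
\<close>

lemma riesz_fischer:
  assumes E: "orthonormal H E" and c: "(\<lambda>e. (cmod (c e))\<^sup>2) summable_on E"
  obtains z F where "z \<in> carrier H" "\<And>m :: nat. finite (F m)" "\<And>m. F m \<subseteq> E"
    "(\<lambda>m. hnorm H (finsum H (\<lambda>f. c f \<odot> f) (F m) \<ominus> z)) \<longlonglongrightarrow> 0"
    "\<And>e. e \<in> E \<Longrightarrow> ip H z e = c e"
proof -
  define S where "S = infsum (\<lambda>e. (cmod (c e))\<^sup>2) E"
  have le_S: "(\<Sum>e\<in>F. (cmod (c e))\<^sup>2) \<le> S" if "finite F" "F \<subseteq> E" for F
    unfolding S_def using that by (intro finite_sum_le_infsum c) auto
  define F where "F m = {e \<in> E. 1 / real (Suc m) < (cmod (c e))\<^sup>2}" for m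
  have FE: "F m \<subseteq> E" for m by (auto simp: F_def)
  have fin: "finite (F m)" for m
  proof (rule ccontr)
    assume "infinite (F m)"
    then obtain B where B: "finite B" "card B = Suc (nat \<lceil>S * Suc m\<rceil>)" "B \<subseteq> F m"
      using infinite_arbitrarily_large by blast
    have "S < real (card B) * (1 / real (Suc m))"
    proof -
      have "S * Suc m < real (card B)" unfolding B(2) by linarith
      then show ?thesis by (simp add: field_simps)
    qed
    also have "\<dots> = (\<Sum>e\<in>B. 1 / real (Suc m))" by simp
    also have "\<dots> \<le> (\<Sum>e\<in>B. (cmod (c e))\<^sup>2)"
      using B by (intro sum_mono) (auto simp: F_def)
    also have "\<dots> \<le> S" using B FE by (intro le_S) auto
    finally show False by simp
  qed
  have mono: "F l \<subseteq> F m" if "l \<le> m" for l m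
  proof
    fix e assume "e \<in> F l"
    moreover have "1 / real (Suc m) \<le> 1 / real (Suc l)" using that by (simp add: frac_le)
    ultimately show "e \<in> F m" by (auto simp: F_def)
  qed
  define s where "s m = finsum H (\<lambda>f. c f \<odot> f) (F m)" for m
  define a where "a m = (\<Sum>e\<in>F m. (cmod (c e))\<^sup>2)" for m
  have in_E: "e \<in> carrier H" if "e \<in> E" for e using that orthonormal_in[OF E] by auto
  have s: "s m \<in> carrier H" for m unfolding s_def using FE in_E by (intro finsum_in) auto
  have diff: "(hnorm H (s m \<ominus> s l))\<^sup>2 = a m - a l" if "l \<le> m" for l m
  proof -
    have "s m = finsum H (\<lambda>f. c f \<odot> f) (F l \<union> (F m - F l))"
      unfolding s_def using mono[OF that] by (simp add: Un_absorb1)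
    also have "\<dots> = s l \<oplus> finsum H (\<lambda>f. c f \<odot> f) (F m - F l)"
      unfolding s_def using fin FE in_E by (intro M.finsum_Un_disjoint) (auto simp: subset_iff)
    finally have eq: "s m = s l \<oplus> finsum H (\<lambda>f. c f \<odot> f) (F m - F l)" .
    have d: "finsum H (\<lambda>f. c f \<odot> f) (F m - F l) \<in> carrier H"
      using FE in_E by (intro finsum_in) auto
    have "s m \<ominus> s l = finsum H (\<lambda>f. c f \<odot> f) (F m - F l)"
      unfolding eq using s[of l] d by (intro eq_by_ip) (auto simp: ip_add_left ip_minus_left)
    then have "(hnorm H (s m \<ominus> s l))\<^sup>2 = (\<Sum>e\<in>F m - F l. (cmod (c e))\<^sup>2)"
      using fin FE by (auto intro!: hnorm_lincomb_basis[OF E])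
    also have "\<dots> = a m - a l"
      unfolding a_def using fin mono[OF that] by (subst sum_diff) auto
    finally show ?thesis .
  qed
  have "incseq a"
    unfolding a_def incseq_def using fin mono by (auto intro!: sum_mono2)
  moreover have "a m \<le> S" for m unfolding a_def using fin FE by (intro le_S) auto
  ultimately have "convergent a"
    by (metis incseq_convergent convergentI)
  then have "Cauchy a" by (rule convergent_Cauchy)
  have "\<exists>N. \<forall>l\<ge>N. \<forall>m\<ge>N. hnorm H (s l \<ominus> s m) < e" if e: "0 < e" for e
  proof -
    obtain N where N: "\<And>l m. l \<ge> N \<Longrightarrow> m \<ge> N \<Longrightarrow> \<bar>a l - a m\<bar> < e\<^sup>2"
      using \<open>Cauchy a\<close>[unfolded Cauchy_def dist_real_def, rule_format, of "e\<^sup>2"] e by auto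
    have *: "hnorm H (s l \<ominus> s m) < e" if "l \<ge> N" "m \<ge> N" "m \<le> l" for l m
    proof -
      have "(hnorm H (s l \<ominus> s m))\<^sup>2 < e\<^sup>2"
        unfolding diff[OF that(3)] using N[OF that(1,2)] by linarith
      then show ?thesis using e by (simp add: power2_less_imp_less)
    qed
    have "hnorm H (s l \<ominus> s m) < e" if "l \<ge> N" "m \<ge> N" for l m
      using *[OF that] *[OF that(2,1)] hnorm_minus_commute[OF s s, of l m] by (cases "m \<le> l") simp_all
    then show ?thesis by blast
  qed
  then obtain z where z: "z \<in> carrier H" "(\<lambda>m. hnorm H (s m \<ominus> z)) \<longlonglongrightarrow> 0"
    using complete[of s] s by blast
  have "ip H z e = c e" if e: "e \<in> E" for e
  proof (rule LIMSEQ_unique)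
    show "(\<lambda>m. ip H (s m) e) \<longlonglongrightarrow> ip H z e"
      using s z in_E e by (intro tendsto_ip_left) auto
    have "\<exists>N. \<forall>m\<ge>N. ip H (s m) e = c e"
    proof (cases "c e = 0")
      case True
      then have "ip H (s m) e = c e" for m
        unfolding s_def using e fin FE by (subst ip_lincomb_basis[OF E]) auto
      then show ?thesis by blast
    next
      case False
      then obtain N where "1 / real (Suc N) < (cmod (c e))\<^sup>2"
        by (metis inverse_eq_divide norm_eq_zero reals_Archimedean zero_less_power2)
      then have "e \<in> F N" using e by (simp add: F_def)
      then have "ip H (s m) e = c e" if "m \<ge> N" for m
        unfolding s_def using e fin FE mono[OF that] by (subst ip_lincomb_basis[OF E]) auto
      then show ?thesis by blast
    qed
    then show "(\<lambda>m. ip H (s m) e) \<longlonglongrightarrow> c e"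
      by (metis (mono_tags, lifting) eventually_sequentially tendsto_eventually)
  qed
  then show thesis using that[of z F] z fin FE unfolding s_def by blast
qed

lemma bessel:
  assumes E: "orthonormal H E" and F: "finite F" "F \<subseteq> E" and x: "x \<in> carrier H"
  shows "(hnorm H (finsum H (\<lambda>f. ip H x f \<odot> f) F \<ominus> x))\<^sup>2
    = (hnorm H x)\<^sup>2 - (\<Sum>e\<in>F. (cmod (ip H x e))\<^sup>2)"
proof -
  let ?s = "finsum H (\<lambda>f. ip H x f \<odot> f) F"
  have in_E: "f \<in> carrier H" if "f \<in> F" for f using that F orthonormal_in[OF E] by auto
  then have s: "?s \<in> carrier H" by auto
  have "ip H x ?s = (\<Sum>f\<in>F. of_real ((cmod (ip H x f))\<^sup>2))"
    using s in_E x by (subst ip_finsum_right) (auto simp: ip_smult_right of_real_cmod_sq mult.commute)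
  then have r: "Re (ip H x ?s) = (\<Sum>e\<in>F. (cmod (ip H x e))\<^sup>2)" by simp
  have "(hnorm H (?s \<ominus> x))\<^sup>2 = (hnorm H ?s)\<^sup>2 - 2 * Re (ip H x ?s) + (hnorm H x)\<^sup>2"
    using s x ip_cnj[of x ?s] by (simp add: hnorm_sq ip_minus_left ip_minus_right)
  then show ?thesis
    unfolding hnorm_lincomb_basis[OF E F] r by simp
qed

lemma bessel_le:
  assumes "orthonormal H E" "finite F" "F \<subseteq> E" "x \<in> carrier H"
  shows "(\<Sum>e\<in>F. (cmod (ip H x e))\<^sup>2) \<le> (hnorm H x)\<^sup>2"
  using bessel[OF assms] zero_le_power2[of "hnorm H (finsum H (\<lambda>f. ip H x f \<odot> f) F \<ominus> x)"] by linarith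

lemma basis_expansion:
  assumes B: "orthonormal_basis H E" and x: "x \<in> carrier H"
  obtains F where "\<And>m :: nat. finite (F m)" "\<And>m. F m \<subseteq> E"
    "(\<lambda>m. hnorm H (finsum H (\<lambda>f. ip H x f \<odot> f) (F m) \<ominus> x)) \<longlonglongrightarrow> 0"
proof -
  have E: "orthonormal H E" using B by (simp add: orthonormal_basis_def)
  have "(\<lambda>e. (cmod (ip H x e))\<^sup>2) summable_on E"
  proof (rule summable_on_of_finite_bounds)
    fix F assume "finite F" "F \<subseteq> E"
    then show "(\<Sum>e\<in>F. (cmod (ip H x e))\<^sup>2) \<le> (hnorm H x)\<^sup>2"
      by (rule bessel_le[OF E _ _ x])
  qed auto
  from riesz_fischer[OF E this] obtain z F where zF: "z \<in> carrier H" "\<And>m :: nat. finite (F m)" "\<And>m. F m \<subseteq> E"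
    "(\<lambda>m. hnorm H (finsum H (\<lambda>f. ip H x f \<odot> f) (F m) \<ominus> z)) \<longlonglongrightarrow> 0"
    "\<And>e. e \<in> E \<Longrightarrow> ip H z e = ip H x e" by blast
  have "z \<ominus> x = \<zero>"
    using B zF x basis_in[OF B] unfolding orthonormal_basis_def by (auto simp: ip_minus_left)
  then have "z = x" using zF x minus_eq_zeroD by blast
  then show thesis using that zF by blast
qed

lemma parseval:
  assumes B: "orthonormal_basis H E" and x: "x \<in> carrier H"
  shows "((\<lambda>e. (cmod (ip H x e))\<^sup>2) has_sum (hnorm H x)\<^sup>2) E"
proof -
  have E: "orthonormal H E" using B by (simp add: orthonormal_basis_def)
  obtain F where F: "\<And>m :: nat. finite (F m)" "\<And>m. F m \<subseteq> E"
    "(\<lambda>m. hnorm H (finsum H (\<lambda>f. ip H x f \<odot> f) (F m) \<ominus> x)) \<longlonglongrightarrow> 0"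
    using basis_expansion[OF B x] by blast
  show ?thesis
  proof (rule has_sum_of_finite_bounds)
    fix G assume "finite G" "G \<subseteq> E"
    then show "(\<Sum>e\<in>G. (cmod (ip H x e))\<^sup>2) \<le> (hnorm H x)\<^sup>2"
      by (rule bessel_le[OF E _ _ x])
  next
    have "(\<lambda>m. (hnorm H x)\<^sup>2 - (hnorm H (finsum H (\<lambda>f. ip H x f \<odot> f) (F m) \<ominus> x))\<^sup>2) \<longlonglongrightarrow> (hnorm H x)\<^sup>2 - 0\<^sup>2"
      using F by (intro tendsto_intros)
    then show "(\<lambda>m. \<Sum>e\<in>F m. (cmod (ip H x e))\<^sup>2) \<longlonglongrightarrow> (hnorm H x)\<^sup>2"
      using bessel[OF E F(1,2) x] by simp
  qed (use F in auto)
qed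

text \<open>
  A representing vector must have the coordinates \<open>cnj (\<phi> e)\<close>.  Applying \<open>\<phi>\<close> to the finite
  combinations with these coefficients bounds their squares by \<open>C\<^sup>2\<close>, so that the Riesz-Fischer
  theorem yields the vector.
\<close>

lemma riesz:
  assumes add: "\<And>x y. x \<in> carrier H \<Longrightarrow> y \<in> carrier H \<Longrightarrow> \<phi> (x \<oplus> y) = \<phi> x + \<phi> y"
    and smult: "\<And>c x. x \<in> carrier H \<Longrightarrow> \<phi> (c \<odot> x) = c * \<phi> x"
    and bd: "\<And>x. x \<in> carrier H \<Longrightarrow> cmod (\<phi> x) \<le> C * hnorm H x"
  obtains z where "z \<in> carrier H" "\<And>x. x \<in> carrier H \<Longrightarrow> \<phi> x = ip H x z"
proof -
  define E where "E = some_basis H"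
  have B: "orthonormal_basis H E" unfolding E_def by (rule some_basis)
  then have E: "orthonormal H E" by (simp add: orthonormal_basis_def)
  have zero: "\<phi> \<zero> = 0" using smult[of \<zero> 0] by simp
  have fs: "\<phi> (finsum H (\<lambda>f. c f \<odot> f) F) = (\<Sum>f\<in>F. c f * \<phi> f)" if "finite F" "F \<subseteq> E" for c F
    using that
  proof (induction F rule: finite_induct)
    case (insert f F)
    then show ?case using basis_in[OF B]
      by (subst M.finsum_insert) (auto simp: add smult subset_iff)
  qed (simp add: zero)
  have bound: "(\<Sum>e\<in>F. (cmod (cnj (\<phi> e)))\<^sup>2) \<le> C\<^sup>2" if F: "finite F" "F \<subseteq> E" for F
  proof -
    let ?s = "finsum H (\<lambda>f. cnj (\<phi> f) \<odot> f) F"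
    let ?a = "\<Sum>e\<in>F. (cmod (\<phi> e))\<^sup>2"
    have s: "?s \<in> carrier H" using F basis_in[OF B] by (intro finsum_in) auto
    have "\<phi> ?s = of_real ?a"
      using fs[OF F, of "\<lambda>f. cnj (\<phi> f)"] by (simp add: of_real_cmod_sq mult.commute)
    moreover have a: "?a \<ge> 0" by (intro sum_nonneg) auto
    ultimately have "?a \<le> C * hnorm H ?s"
      using bd[OF s] by (metis abs_of_nonneg norm_of_real)
    moreover have n: "(hnorm H ?s)\<^sup>2 = ?a"
      using hnorm_lincomb_basis[OF E F, of "\<lambda>f. cnj (\<phi> f)"] by simp
    ultimately have "(hnorm H ?s)\<^sup>2 \<le> C * hnorm H ?s" by simp
    then have "hnorm H ?s \<le> \<bar>C\<bar>"
      using hnorm_ge_0[OF s] by (cases "hnorm H ?s = 0") (auto simp: power2_eq_square)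
    then have "(hnorm H ?s)\<^sup>2 \<le> C\<^sup>2" using hnorm_ge_0[OF s] by (metis abs_le_square_iff abs_of_nonneg abs_abs)
    then show ?thesis using n by simp
  qed
  have "(\<lambda>e. (cmod (cnj (\<phi> e)))\<^sup>2) summable_on E"
    by (rule summable_on_of_finite_bounds[OF _ bound]) auto
  from riesz_fischer[OF E this] obtain z where z: "z \<in> carrier H" "\<And>e. e \<in> E \<Longrightarrow> ip H z e = cnj (\<phi> e)"
    by metis
  have ze: "ip H e z = \<phi> e" if "e \<in> E" for e
    using ip_cnj[of z e] z that basis_in[OF B] by simp
  have "\<phi> x = ip H x z" if x: "x \<in> carrier H" for x
  proof -
    obtain F where F: "\<And>m :: nat. finite (F m)" "\<And>m. F m \<subseteq> E"
      "(\<lambda>m. hnorm H (finsum H (\<lambda>f. ip H x f \<odot> f) (F m) \<ominus> x)) \<longlonglongrightarrow> 0"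
      using basis_expansion[OF B x] by blast
    define s where "s m = finsum H (\<lambda>f. ip H x f \<odot> f) (F m)" for m
    have s: "s m \<in> carrier H" for m unfolding s_def using F(2)[of m] basis_in[OF B] by (intro finsum_in) auto
    have "(\<lambda>m. ip H (s m) z) \<longlonglongrightarrow> ip H x z"
      using F s x z unfolding s_def by (intro tendsto_ip_left) auto
    moreover have "ip H (s m) z = \<phi> (s m)" for m
      unfolding s_def fs[OF F(1,2)]
      using F(2)[of m] basis_in[OF B] z ze
      by (subst ip_finsum_left) (auto simp: ip_smult_left subset_iff intro!: sum.cong)
    ultimately have 1: "(\<lambda>m. \<phi> (s m)) \<longlonglongrightarrow> ip H x z" by simp
    have "(\<lambda>m. \<phi> (s m)) \<longlonglongrightarrow> \<phi> x"
    proof (rule Lim_null[THEN iffD2], rule Lim_null_comparison)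
      have "\<phi> (s m) - \<phi> x = \<phi> (s m \<ominus> x)" for m
        using add[of "s m \<ominus> x" x] s[of m] x by (simp add: M.minus_eq M.a_assoc M.l_neg)
      then show "\<forall>\<^sub>F m in sequentially. norm (\<phi> (s m) - \<phi> x) \<le> C * hnorm H (s m \<ominus> x)"
        using bd s x by (intro always_eventually) auto
      show "(\<lambda>m. C * hnorm H (s m \<ominus> x)) \<longlonglongrightarrow> 0"
        using tendsto_mult[OF tendsto_const[of C] F(3)] unfolding s_def by simp
    qed
    then show ?thesis using 1 LIMSEQ_unique by blast
  qed
  then show thesis using that z by blast
qed

end

section \<open>Bounded operators and adjoints\<close>

definition hlinear :: "'a hilb \<Rightarrow> 'b hilb \<Rightarrow> ('a \<Rightarrow> 'b) \<Rightarrow> bool" where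
  "hlinear H G L \<longleftrightarrow> L \<in> carrier H \<rightarrow> carrier G \<and>
     (\<forall>x\<in>carrier H. \<forall>y\<in>carrier H. L (x \<oplus>\<^bsub>H\<^esub> y) = L x \<oplus>\<^bsub>G\<^esub> L y) \<and>
     (\<forall>c. \<forall>x\<in>carrier H. L (c \<odot>\<^bsub>H\<^esub> x) = c \<odot>\<^bsub>G\<^esub> L x)"

lemma hlinear_in: "hlinear H G L \<Longrightarrow> x \<in> carrier H \<Longrightarrow> L x \<in> carrier G"
  by (auto simp: hlinear_def)

lemma hlinear_zero:
  assumes "hilbert_space H" "hilbert_space G" "hlinear H G L"
  shows "L \<zero>\<^bsub>H\<^esub> = \<zero>\<^bsub>G\<^esub>"
proof -
  interpret H: hilbert_space H by fact
  interpret G: hilbert_space G by fact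
  have "L \<zero>\<^bsub>H\<^esub> = L (0 \<odot>\<^bsub>H\<^esub> \<zero>\<^bsub>H\<^esub>)" using H.smult_l_null[of "\<zero>\<^bsub>H\<^esub>"] by simp
  also have "\<dots> = 0 \<odot>\<^bsub>G\<^esub> L \<zero>\<^bsub>H\<^esub>" using assms(3) H.M.zero_closed unfolding hlinear_def by blast
  also have "\<dots> = \<zero>\<^bsub>G\<^esub>" using G.smult_l_null[of "L \<zero>\<^bsub>H\<^esub>"] hlinear_in[OF assms(3)] by simp
  finally show ?thesis .
qed

lemma hlinear_finsum:
  assumes "hilbert_space H" "hilbert_space G" "hlinear H G L"
    and "\<And>i. i \<in> J \<Longrightarrow> f i \<in> carrier H"
  shows "L (finsum H f J) = finsum G (\<lambda>i. L (f i)) J"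
proof -
  interpret H: hilbert_space H by fact
  interpret G: hilbert_space G by fact
  show ?thesis using assms(4)
  proof (induction J rule: infinite_finite_induct)
    case (insert i F)
    have s: "finsum H f F \<in> carrier H" using insert by (intro H.finsum_in) auto
    have "L (finsum H f (insert i F)) = L (f i \<oplus>\<^bsub>H\<^esub> finsum H f F)"
      using insert by (subst H.M.finsum_insert) auto
    also have "\<dots> = L (f i) \<oplus>\<^bsub>G\<^esub> finsum G (\<lambda>i. L (f i)) F"
      using insert s assms(3) by (simp add: hlinear_def)
    also have "\<dots> = finsum G (\<lambda>i. L (f i)) (insert i F)"
      using insert hlinear_in[OF assms(3)] by (subst G.M.finsum_insert) auto
    finally show ?case .
  qed (use hlinear_zero[OF assms(1-3)] in auto)
qed

lemma bops_hlinear: "T \<in> bops H \<Longrightarrow> hlinear H H T"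
  by (auto simp: bops_def hlinear_def)

lemma bopsI:
  assumes "hlinear H H T" "\<And>x. x \<in> carrier H \<Longrightarrow> hnorm H (T x) \<le> C * hnorm H x"
  shows "T \<in> bops H"
  using assms by (auto simp: bops_def hlinear_def)

lemma bops_in: "T \<in> bops H \<Longrightarrow> x \<in> carrier H \<Longrightarrow> T x \<in> carrier H"
  by (auto simp: bops_def)

lemma bops_add: "T \<in> bops H \<Longrightarrow> x \<in> carrier H \<Longrightarrow> y \<in> carrier H \<Longrightarrow> T (x \<oplus>\<^bsub>H\<^esub> y) = T x \<oplus>\<^bsub>H\<^esub> T y"
  by (auto simp: bops_def)

lemma bops_smult: "T \<in> bops H \<Longrightarrow> x \<in> carrier H \<Longrightarrow> T (c \<odot>\<^bsub>H\<^esub> x) = c \<odot>\<^bsub>H\<^esub> T x"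
  by (auto simp: bops_def)

text \<open>
  An operator together with a candidate for its adjoint.  Explicit adjoints are found by exhibiting
  such a pair, since the adjoint is unique by \<open>adj_eq\<close>.
\<close>

definition adjoint_pair :: "'a hilb \<Rightarrow> ('a \<Rightarrow> 'a) \<Rightarrow> ('a \<Rightarrow> 'a) \<Rightarrow> bool" where
  "adjoint_pair H T T' \<longleftrightarrow> T \<in> bops H \<and> T' \<in> bops H \<and>
     (\<forall>x\<in>carrier H. \<forall>y\<in>carrier H. ip H (T x) y = ip H x (T' y))"

context hilbert_space
begin

lemma opnorm_bdd:
  assumes "T \<in> bops H"
  shows "bdd_above ((\<lambda>x. hnorm H (T x)) ` {x \<in> carrier H. hnorm H x \<le> 1})"
proof -
  obtain C where C: "\<And>x. x \<in> carrier H \<Longrightarrow> hnorm H (T x) \<le> C * hnorm H x"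
    using assms unfolding bops_def by blast
  have "hnorm H (T x) \<le> \<bar>C\<bar>" if "x \<in> carrier H" "hnorm H x \<le> 1" for x
  proof -
    have "C * hnorm H x \<le> \<bar>C\<bar> * 1"
      using that by (intro mult_mono) auto
    then show ?thesis using C[OF that(1)] by simp
  qed
  then show ?thesis by (intro bdd_aboveI[of _ "\<bar>C\<bar>"]) auto
qed

lemma opnorm_nonneg: "T \<in> bops H \<Longrightarrow> 0 \<le> opnorm H T"
  unfolding opnorm_def
  by (rule cSUP_upper2[OF opnorm_bdd, of _ \<zero>]) (auto simp: bops_in)

lemma opnorm_bound:
  assumes T: "T \<in> bops H" and x: "x \<in> carrier H"
  shows "hnorm H (T x) \<le> opnorm H T * hnorm H x"
proof (cases "hnorm H x = 0")
  case True
  then have "x = \<zero>" using x hnorm_eq_0 by blast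
  then have "T x = \<zero>" using hlinear_zero[OF _ _ bops_hlinear[OF T]] hilbert_space_axioms by blast
  then show ?thesis using True by simp
next
  case False
  then have n: "hnorm H x > 0" using hnorm_ge_0[OF x] by simp
  define u where "u = of_real (1 / hnorm H x) \<odot> x"
  have u: "u \<in> carrier H" "hnorm H u = 1" using x n by (simp_all add: u_def hnorm_smult norm_divide)
  have "hnorm H (T u) \<le> opnorm H T"
    unfolding opnorm_def using u by (intro cSUP_upper opnorm_bdd T) auto
  moreover have "hnorm H (T u) = hnorm H (T x) / hnorm H x"
    using x n T by (simp add: u_def bops_smult hnorm_smult bops_in norm_divide)
  ultimately show ?thesis using n by (simp add: field_simps)
qed

lemma opnorm_le:
  assumes "0 \<le> C" "\<And>x. x \<in> carrier H \<Longrightarrow> hnorm H (T x) \<le> C * hnorm H x"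
  shows "opnorm H T \<le> C"
  unfolding opnorm_def
proof (rule cSUP_least)
  show "{x \<in> carrier H. hnorm H x \<le> 1} \<noteq> {}"
    by (auto intro!: exI[of _ \<zero>])
  fix x assume "x \<in> {x \<in> carrier H. hnorm H x \<le> 1}"
  then have x: "x \<in> carrier H" "hnorm H x \<le> 1" by auto
  have "hnorm H (T x) \<le> C * hnorm H x" by (rule assms(2)[OF x(1)])
  also have "\<dots> \<le> C * 1" using x assms(1) by (intro mult_left_mono) auto
  finally show "hnorm H (T x) \<le> C" by simp
qed

lemma bops_id: "id \<in> bops H"
  by (rule bopsI[of _ _ 1]) (auto simp: hlinear_def)

lemma bops_comp:
  assumes "T \<in> bops H" "U \<in> bops H"
  shows "T \<circ> U \<in> bops H"
proof (rule bopsI)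
  show "hlinear H H (T \<circ> U)"
    using assms by (auto simp: hlinear_def bops_in bops_add bops_smult)
  fix x assume x: "x \<in> carrier H"
  have "hnorm H ((T \<circ> U) x) \<le> opnorm H T * hnorm H (U x)"
    using opnorm_bound[OF assms(1) bops_in[OF assms(2) x]] by simp
  also have "\<dots> \<le> opnorm H T * (opnorm H U * hnorm H x)"
    using opnorm_bound[OF assms(2) x] opnorm_nonneg[OF assms(1)] by (intro mult_left_mono)
  finally show "hnorm H ((T \<circ> U) x) \<le> (opnorm H T * opnorm H U) * hnorm H x" by (simp add: mult.assoc)
qed

lemma smult_add: "x \<in> carrier H \<Longrightarrow> y \<in> carrier H \<Longrightarrow> c \<odot> (x \<oplus> y) = c \<odot> x \<oplus> c \<odot> y"
  by (simp add: smult_r_distr)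

lemma smult_smult: "x \<in> carrier H \<Longrightarrow> c \<odot> (d \<odot> x) = (c * d) \<odot> x"
  using smult_assoc1[of c d x] by simp

lemma bops_scale:
  assumes "T \<in> bops H"
  shows "(\<lambda>x. c \<odot> T x) \<in> bops H"
proof (rule bopsI)
  show "hlinear H H (\<lambda>x. c \<odot> T x)"
    using assms by (auto simp: hlinear_def bops_in bops_add bops_smult smult_add smult_smult mult.commute)
  fix x assume x: "x \<in> carrier H"
  show "hnorm H (c \<odot> T x) \<le> (cmod c * opnorm H T) * hnorm H x"
    using opnorm_bound[OF assms x] x by (simp add: hnorm_smult bops_in[OF assms] mult.assoc mult_left_mono)
qed

lemma bops_minus:
  assumes "T \<in> bops H" "U \<in> bops H"
  shows "op_minus H T U \<in> bops H"
proof (rule bopsI)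
  have "T (x \<oplus> y) \<ominus> U (x \<oplus> y) = (T x \<ominus> U x) \<oplus> (T y \<ominus> U y)"
    if "x \<in> carrier H" "y \<in> carrier H" for x y
    using assms that by (intro eq_by_ip) (auto simp: bops_in bops_add ip_simps)
  moreover have "T (c \<odot> x) \<ominus> U (c \<odot> x) = c \<odot> (T x \<ominus> U x)" if "x \<in> carrier H" for c x
    using assms that by (intro eq_by_ip) (auto simp: bops_in bops_smult ip_simps algebra_simps)
  ultimately show "hlinear H H (op_minus H T U)"
    using assms by (auto simp: hlinear_def op_minus_def bops_in)
  fix x assume x: "x \<in> carrier H"
  have "hnorm H (T x \<ominus> U x) \<le> hnorm H (T x) + hnorm H (U x)"
    using assms x by (intro hnorm_minus_le) (auto simp: bops_in)
  then show "hnorm H (op_minus H T U x) \<le> (opnorm H T + opnorm H U) * hnorm H x"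
    using opnorm_bound[OF assms(1) x] opnorm_bound[OF assms(2) x]
    by (simp add: op_minus_def algebra_simps)
qed

lemma hnorm_finsum:
  "(\<And>j. j \<in> J \<Longrightarrow> f j \<in> carrier H) \<Longrightarrow> hnorm H (finsum H f J) \<le> (\<Sum>j\<in>J. hnorm H (f j))"
proof (induction J rule: infinite_finite_induct)
  case (insert i F)
  have "finsum H f (insert i F) = f i \<oplus> finsum H f F"
    using insert by (subst M.finsum_insert) auto
  then have "hnorm H (finsum H f (insert i F)) \<le> hnorm H (f i) + hnorm H (finsum H f F)"
    using insert by (simp add: hnorm_triangle)
  then show ?case using insert by force
qed auto

lemma bops_sum:
  assumes "\<And>j. j \<in> J \<Longrightarrow> T j \<in> bops H"
  shows "op_sum H T J \<in> bops H"
proof (rule bopsI)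
  have "finsum H (\<lambda>j. T j (x \<oplus> y)) J = finsum H (\<lambda>j. T j x) J \<oplus> finsum H (\<lambda>j. T j y) J"
    if "x \<in> carrier H" "y \<in> carrier H" for x y
    using assms that
    by (intro eq_by_ip) (auto simp: bops_in bops_add ip_add_left ip_finsum_left sum.distrib)
  moreover have "finsum H (\<lambda>j. T j (c \<odot> x)) J = c \<odot> finsum H (\<lambda>j. T j x) J" if "x \<in> carrier H" for c x
    using assms that
    by (intro eq_by_ip) (auto simp: bops_in bops_smult ip_smult_left ip_finsum_left sum_distrib_left)
  ultimately show "hlinear H H (op_sum H T J)"
    using assms by (auto simp: hlinear_def op_sum_def bops_in)
  fix x assume x: "x \<in> carrier H"
  have "hnorm H (op_sum H T J x) \<le> (\<Sum>j\<in>J. hnorm H (T j x))"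
    unfolding op_sum_def using assms x by (intro hnorm_finsum) (auto simp: bops_in)
  also have "\<dots> \<le> (\<Sum>j\<in>J. opnorm H (T j) * hnorm H x)"
    using assms x by (intro sum_mono opnorm_bound) auto
  finally show "hnorm H (op_sum H T J x) \<le> (\<Sum>j\<in>J. opnorm H (T j)) * hnorm H x"
    by (simp add: sum_distrib_right)
qed

lemma op_sum_in: "(\<And>j. j \<in> J \<Longrightarrow> T j \<in> bops H) \<Longrightarrow> x \<in> carrier H \<Longrightarrow> op_sum H T J x \<in> carrier H"
  using bops_in[OF bops_sum, of J T x] by blast

lemma ip_op_sum_left:
  assumes "\<And>j. j \<in> J \<Longrightarrow> T j \<in> bops H" "x \<in> carrier H" "y \<in> carrier H"
  shows "ip H (op_sum H T J x) y = (\<Sum>j\<in>J. ip H (T j x) y)"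
  unfolding op_sum_def using assms by (intro ip_finsum_left) (auto simp: bops_in)

lemma ip_op_sum_right:
  assumes "\<And>j. j \<in> J \<Longrightarrow> T j \<in> bops H" "x \<in> carrier H" "y \<in> carrier H"
  shows "ip H y (op_sum H T J x) = (\<Sum>j\<in>J. ip H y (T j x))"
  unfolding op_sum_def using assms by (intro ip_finsum_right) (auto simp: bops_in)

lemma adjoint_pairD:
  assumes "adjoint_pair H T T'"
  shows "T \<in> bops H" "T' \<in> bops H"
    "\<And>x y. x \<in> carrier H \<Longrightarrow> y \<in> carrier H \<Longrightarrow> ip H (T x) y = ip H x (T' y)"
    "\<And>x y. x \<in> carrier H \<Longrightarrow> y \<in> carrier H \<Longrightarrow> ip H (T' x) y = ip H x (T y)"
proof -
  show p: "T \<in> bops H" "T' \<in> bops H"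
    "\<And>x y. x \<in> carrier H \<Longrightarrow> y \<in> carrier H \<Longrightarrow> ip H (T x) y = ip H x (T' y)"
    using assms by (auto simp: adjoint_pair_def)
  show "ip H (T' x) y = ip H x (T y)" if "x \<in> carrier H" "y \<in> carrier H" for x y
    using p(3)[OF that(2,1)] ip_cnj[of x "T y"] ip_cnj[of y "T' x"] p that by (simp add: bops_in)
qed

lemma adjoint_pair_sym: "adjoint_pair H T T' \<Longrightarrow> adjoint_pair H T' T"
  unfolding adjoint_pair_def[of H T' T] by (intro conjI ballI) (simp_all add: adjoint_pairD(1,2,4))

lemma adj_eq:
  assumes "adjoint_pair H T T'" "y \<in> carrier H"
  shows "adj H T y = T' y"
  unfolding adj_def
proof (rule the_equality)
  show "T' y \<in> carrier H \<and> (\<forall>x\<in>carrier H. ip H (T x) y = ip H x (T' y))"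
    by (intro conjI ballI bops_in[OF adjoint_pairD(2)[OF assms(1)] assms(2)]
        adjoint_pairD(3)[OF assms(1) _ assms(2)])
  fix z assume z: "z \<in> carrier H \<and> (\<forall>x\<in>carrier H. ip H (T x) y = ip H x z)"
  have Ty: "T' y \<in> carrier H" using bops_in[OF adjoint_pairD(2)[OF assms(1)] assms(2)] .
  show "z = T' y"
  proof (rule eq_by_ip)
    fix x assume x: "x \<in> carrier H"
    have "ip H x z = ip H x (T' y)"
      using z x adjoint_pairD(3)[OF assms(1) x assms(2)] by simp
    then show "ip H z x = ip H (T' y) x"
      using ip_cnj[of x z] ip_cnj[of x "T' y"] x z Ty by simp
  qed (use z Ty in auto)
qed

text \<open>
  Here \<open>y\<close> plays the role of the adjoint of \<open>T\<close> applied to \<open>x\<close>; the bound comes from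
  \<open>\<parallel>y\<parallel>\<^sup>2 = \<langle>T y, x\<rangle>\<close>.  It is stated for vectors because the adjoint is shown to be bounded with its
  help.
\<close>

lemma adjoint_pair_bound:
  assumes "x \<in> carrier H" "y \<in> carrier H" "\<And>u. u \<in> carrier H \<Longrightarrow> ip H (T u) x = ip H u y"
    and "\<And>u. u \<in> carrier H \<Longrightarrow> T u \<in> carrier H"
    and "0 \<le> C" and "\<And>u. u \<in> carrier H \<Longrightarrow> hnorm H (T u) \<le> C * hnorm H u"
  shows "hnorm H y \<le> C * hnorm H x"
proof (cases "hnorm H y = 0")
  case False
  then have n: "hnorm H y > 0" using hnorm_ge_0[OF assms(2)] by simp
  have "(hnorm H y)\<^sup>2 = cmod (ip H (T y) x)"
    using assms by (simp add: ip_self norm_power del: of_real_power)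
  also have "\<dots> \<le> hnorm H (T y) * hnorm H x"
    using assms by (intro ip_le_hnorm) auto
  also have "\<dots> \<le> (C * hnorm H y) * hnorm H x"
    using assms by (intro mult_right_mono) auto
  finally have "hnorm H y * hnorm H y \<le> hnorm H y * (C * hnorm H x)"
    by (simp add: power2_eq_square mult.assoc mult.left_commute)
  then show ?thesis using n by simp
qed (use assms in auto)

lemma adjoint_pair_norm:
  assumes "adjoint_pair H T T'" "0 \<le> C" "\<And>u. u \<in> carrier H \<Longrightarrow> hnorm H (T u) \<le> C * hnorm H u"
    and "x \<in> carrier H"
  shows "hnorm H (T' x) \<le> C * hnorm H x"
proof (rule adjoint_pair_bound[where T = T])
  note T = adjoint_pairD[OF assms(1)]
  show "T' x \<in> carrier H" using bops_in[OF T(2) assms(4)] .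
  show "T u \<in> carrier H" if "u \<in> carrier H" for u using bops_in[OF T(1) that] .
  show "ip H (T u) x = ip H u (T' x)" if "u \<in> carrier H" for u using T(3)[OF that assms(4)] .
qed (use assms in auto)

lemma adjoint_pair_adj:
  assumes T: "T \<in> bops H"
  shows "adjoint_pair H T (adj H T)"
proof -
  have ex: "\<exists>z. z \<in> carrier H \<and> (\<forall>x\<in>carrier H. ip H (T x) y = ip H x z)" if y: "y \<in> carrier H" for y
  proof -
    have "\<exists>z\<in>carrier H. \<forall>x\<in>carrier H. ip H (T x) y = ip H x z"
    proof (rule riesz[of "\<lambda>x. ip H (T x) y" "opnorm H T * hnorm H y"])
      fix x assume x: "x \<in> carrier H"
      have "cmod (ip H (T x) y) \<le> hnorm H (T x) * hnorm H y"
        using x y T by (intro ip_le_hnorm) (auto simp: bops_in)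
      also have "\<dots> \<le> (opnorm H T * hnorm H x) * hnorm H y"
        using y by (intro mult_right_mono opnorm_bound T x) auto
      finally show "cmod (ip H (T x) y) \<le> opnorm H T * hnorm H y * hnorm H x"
        by (simp add: mult_ac)
    qed (use T y in \<open>auto simp: bops_in bops_add bops_smult ip_add_left ip_smult_left\<close>)
    then show ?thesis by blast
  qed
  then obtain T' where T': "\<And>y. y \<in> carrier H \<Longrightarrow> T' y \<in> carrier H"
      "\<And>x y. x \<in> carrier H \<Longrightarrow> y \<in> carrier H \<Longrightarrow> ip H (T x) y = ip H x (T' y)"
    by metis
  have T'r: "ip H (T' y) x = ip H y (T x)" if "x \<in> carrier H" "y \<in> carrier H" for x y
    using T'(2)[OF that] ip_cnj[of "T x" y] ip_cnj[of x "T' y"] T' T that by (simp add: bops_in)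
  have pair: "adjoint_pair H T T'"
    unfolding adjoint_pair_def
  proof (intro conjI ballI T T'(2))
    show "T' \<in> bops H"
    proof (rule bopsI)
      have "T' (x \<oplus> y) = T' x \<oplus> T' y" if "x \<in> carrier H" "y \<in> carrier H" for x y
        using that T' T by (intro eq_by_ip) (auto simp: T'r ip_add_left bops_in)
      moreover have "T' (c \<odot> x) = c \<odot> T' x" if "x \<in> carrier H" for c x
        using that T' T by (intro eq_by_ip) (auto simp: T'r ip_smult_left bops_in)
      ultimately show "hlinear H H T'" using T' by (auto simp: hlinear_def)
      show "hnorm H (T' x) \<le> opnorm H T * hnorm H x" if "x \<in> carrier H" for x
        by (rule adjoint_pair_bound[where T = T])
           (use that T' T in \<open>auto simp: bops_in opnorm_bound opnorm_nonneg\<close>)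
    qed
  qed
  have "adj H T \<in> bops H"
    using adjoint_pairD(2)[OF pair] adj_eq[OF pair] unfolding bops_def
    by (auto simp: Pi_iff)
  then show ?thesis
    using pair adj_eq[OF pair] unfolding adjoint_pair_def by simp
qed

lemma adjoint_pair_id: "adjoint_pair H id id"
  by (simp add: adjoint_pair_def bops_id)

lemma adjoint_pair_comp:
  assumes "adjoint_pair H T T'" "adjoint_pair H U U'"
  shows "adjoint_pair H (T \<circ> U) (U' \<circ> T')"
  using assms adjoint_pairD(1-3)[OF assms(1)] adjoint_pairD(1-3)[OF assms(2)]
  by (auto simp: adjoint_pair_def bops_comp bops_in)

lemma adjoint_pair_scale:
  assumes "adjoint_pair H T T'"
  shows "adjoint_pair H (\<lambda>x. c \<odot> T x) (\<lambda>x. cnj c \<odot> T' x)"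
  using adjoint_pairD(1-3)[OF assms]
  by (auto simp: adjoint_pair_def bops_scale bops_in ip_smult_left ip_smult_right)

lemma adjoint_pair_sum:
  assumes "\<And>j. j \<in> J \<Longrightarrow> adjoint_pair H (T j) (T' j)"
  shows "adjoint_pair H (op_sum H T J) (op_sum H T' J)"
  unfolding adjoint_pair_def
  using adjoint_pairD(1-3)[OF assms]
  by (auto intro!: bops_sum simp: ip_op_sum_left ip_op_sum_right)

text \<open>
  This makes statements about inner products follow from statements about norms: in \<open>hs_ip_dual\<close> it
  spares the rearrangement of a double series.
\<close>

lemma polarization:
  assumes "x \<in> carrier H" "y \<in> carrier H"
  shows "ip H x y = (1/4) * (of_real ((hnorm H (x \<oplus> 1 \<odot> y))\<^sup>2) - of_real ((hnorm H (x \<oplus> (-1) \<odot> y))\<^sup>2)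
       + \<i> * (of_real ((hnorm H (x \<oplus> \<i> \<odot> y))\<^sup>2) - of_real ((hnorm H (x \<oplus> (-\<i>) \<odot> y))\<^sup>2)))"
proof -
  have "complex_of_real ((hnorm H (x \<oplus> c \<odot> y))\<^sup>2)
      = ip H x x + cnj c * ip H x y + c * cnj (ip H x y) + c * cnj c * ip H y y" for c
    using assms ip_cnj[of x y] ip_self[of "x \<oplus> c \<odot> y", symmetric]
    by (simp add: ip_simps algebra_simps)
  then show ?thesis by (simp only:) (simp add: algebra_simps)
qed

end

section \<open>The tensor product as a Hilbert space\<close>

locale tensor = K: hilbert_space K + H: hilbert_space H
  for K :: "'k hilb" and H :: "'h hilb"
begin

text \<open>
  The elements of the tensor product are conjugate linear operators from \<open>K\<close> to \<open>H\<close>; the adjoint of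
  such an operator is again conjugate linear, which explains the position of \<open>g\<close> and \<open>x\<close>.
\<close>

definition cadjoint :: "('k \<Rightarrow> 'h) \<Rightarrow> ('h \<Rightarrow> 'k) \<Rightarrow> bool" where
  "cadjoint T t \<longleftrightarrow> (\<forall>x\<in>carrier K. T x \<in> carrier H) \<and> (\<forall>g\<in>carrier H. t g \<in> carrier K \<and>
     (\<forall>x\<in>carrier K. ip H (T x) g = ip K (t g) x))"

text \<open>
  Both series are obtained from the matrix \<open>\<bar>\<langle>T e, g\<rangle>\<bar>\<^sup>2 = \<bar>\<langle>t g, e\<rangle>\<bar>\<^sup>2\<close> by Parseval's identity, the first
  by summing over \<open>g\<close> and the second by summing over \<open>e\<close>.
\<close>

lemma hs_norm_dual:
  assumes c: "cadjoint T t" and E: "orthonormal_basis K E" and G: "orthonormal_basis H G"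
  shows "((\<lambda>e. (hnorm H (T e))\<^sup>2) has_sum s) E \<longleftrightarrow> ((\<lambda>g. (hnorm K (t g))\<^sup>2) has_sum s) G"
proof -
  have row: "((\<lambda>g. (cmod (ip H (T e) g))\<^sup>2) has_sum (hnorm H (T e))\<^sup>2) G" if "e \<in> E" for e
    using that c K.basis_in[OF E] by (intro H.parseval G) (auto simp: cadjoint_def)
  have col: "((\<lambda>e. (cmod (ip H (T e) g))\<^sup>2) has_sum (hnorm K (t g))\<^sup>2) E" if g: "g \<in> G" for g
  proof -
    have gH: "g \<in> carrier H" using g H.basis_in[OF G] by blast
    have "((\<lambda>e. (cmod (ip K (t g) e))\<^sup>2) has_sum (hnorm K (t g))\<^sup>2) E"
      using c gH by (intro K.parseval E) (auto simp: cadjoint_def)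
    then show ?thesis
      by (rule has_sum_cong[THEN iffD1, rotated])
         (use c gH K.basis_in[OF E] in \<open>auto simp: cadjoint_def\<close>)
  qed
  show ?thesis
    using has_sum_swap_nonneg[OF _ row col] has_sum_swap_nonneg[OF _ col row] by auto
qed

lemma cadjoint_lincomb:
  assumes "cadjoint T t" "cadjoint W w"
  shows "cadjoint (\<lambda>x. T x \<oplus>\<^bsub>H\<^esub> c \<odot>\<^bsub>H\<^esub> W x) (\<lambda>g. t g \<oplus>\<^bsub>K\<^esub> c \<odot>\<^bsub>K\<^esub> w g)"
  using assms by (auto simp: cadjoint_def H.ip_add_left H.ip_smult_left K.ip_add_left K.ip_smult_left)

lemma hs_add_summable:
  assumes T: "\<And>e. e \<in> E \<Longrightarrow> T e \<in> carrier H" and W: "\<And>e. e \<in> E \<Longrightarrow> W e \<in> carrier H"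
    and "(\<lambda>e. (hnorm H (T e))\<^sup>2) summable_on E" "(\<lambda>e. (hnorm H (W e))\<^sup>2) summable_on E"
  shows "(\<lambda>e. (hnorm H (T e \<oplus>\<^bsub>H\<^esub> c \<odot>\<^bsub>H\<^esub> W e))\<^sup>2) summable_on E"
proof (rule summable_on_comparison_test)
  show "(\<lambda>e. 2 * (hnorm H (T e))\<^sup>2 + 2 * (cmod c)\<^sup>2 * (hnorm H (W e))\<^sup>2) summable_on E"
    using assms by (intro summable_on_add summable_on_cmult_right) auto
  fix e assume e: "e \<in> E"
  have "hnorm H (T e \<oplus>\<^bsub>H\<^esub> c \<odot>\<^bsub>H\<^esub> W e) \<le> hnorm H (T e) + cmod c * hnorm H (W e)"
    using H.hnorm_triangle[of "T e" "c \<odot>\<^bsub>H\<^esub> W e"] e T W by (simp add: H.hnorm_smult)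
  then have "(hnorm H (T e \<oplus>\<^bsub>H\<^esub> c \<odot>\<^bsub>H\<^esub> W e))\<^sup>2 \<le> (hnorm H (T e) + cmod c * hnorm H (W e))\<^sup>2"
    using e T W by (intro power_mono) auto
  also have "\<dots> \<le> 2 * (hnorm H (T e))\<^sup>2 + 2 * (cmod c * hnorm H (W e))\<^sup>2"
    using zero_le_power2[of "hnorm H (T e) - cmod c * hnorm H (W e)"]
    by (simp add: power2_sum power2_diff)
  finally show "(hnorm H (T e \<oplus>\<^bsub>H\<^esub> c \<odot>\<^bsub>H\<^esub> W e))\<^sup>2 \<le> 2 * (hnorm H (T e))\<^sup>2 + 2 * (cmod c)\<^sup>2 * (hnorm H (W e))\<^sup>2"
    by (simp add: power_mult_distrib)
qed auto

lemma hs_ip_summable: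
  assumes T: "\<And>e. e \<in> E \<Longrightarrow> T e \<in> carrier H" and W: "\<And>e. e \<in> E \<Longrightarrow> W e \<in> carrier H"
    and "(\<lambda>e. (hnorm H (T e))\<^sup>2) summable_on E" "(\<lambda>e. (hnorm H (W e))\<^sup>2) summable_on E"
  shows "(\<lambda>e. ip H (T e) (W e)) summable_on E"
proof (rule abs_summable_summable, rule Infinite_Sum.abs_summable_on_comparison_test)
  have "(\<lambda>e. (hnorm H (T e))\<^sup>2 + (hnorm H (W e))\<^sup>2) summable_on E"
    using assms by (intro summable_on_add) auto
  then show "(\<lambda>e. norm ((hnorm H (T e))\<^sup>2 + (hnorm H (W e))\<^sup>2)) summable_on E" by simp
  fix e assume e: "e \<in> E"
  have "cmod (ip H (T e) (W e)) \<le> hnorm H (T e) * hnorm H (W e)"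
    using e T W by (intro H.ip_le_hnorm)
  also have "\<dots> \<le> (hnorm H (T e))\<^sup>2 + (hnorm H (W e))\<^sup>2"
    using zero_le_power2[of "hnorm H (T e) - hnorm H (W e)"] zero_le_power2[of "hnorm H (T e)"]
      zero_le_power2[of "hnorm H (W e)"]
    by (simp only: power2_diff)
  finally show "cmod (ip H (T e) (W e)) \<le> norm ((hnorm H (T e))\<^sup>2 + (hnorm H (W e))\<^sup>2)" by simp
qed

text \<open>
  The polarised form of \<open>hs_norm_dual\<close>.
\<close>

lemma hs_ip_dual:
  assumes T: "cadjoint T t" and W: "cadjoint W w"
    and E: "orthonormal_basis K E" and G: "orthonormal_basis H G"
    and s: "(\<lambda>e. (hnorm H (T e))\<^sup>2) summable_on E" "(\<lambda>e. (hnorm H (W e))\<^sup>2) summable_on E"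
  shows "((\<lambda>g. ip K (t g) (w g)) has_sum (\<Sum>\<^sub>\<infinity>e\<in>E. ip H (T e) (W e))) G"
proof -
  have in_K: "e \<in> carrier K" if "e \<in> E" for e using that K.basis_in[OF E] by blast
  have in_H: "g \<in> carrier H" if "g \<in> G" for g using that H.basis_in[OF G] by blast
  define S where "S c = infsum (\<lambda>e. (hnorm H (T e \<oplus>\<^bsub>H\<^esub> c \<odot>\<^bsub>H\<^esub> W e))\<^sup>2) E" for c
  have 1: "((\<lambda>e. (hnorm H (T e \<oplus>\<^bsub>H\<^esub> c \<odot>\<^bsub>H\<^esub> W e))\<^sup>2) has_sum S c) E" for c
    unfolding S_def using T W in_K s
    by (intro has_sum_infsum hs_add_summable) (auto simp: cadjoint_def)
  have 2: "((\<lambda>g. (hnorm K (t g \<oplus>\<^bsub>K\<^esub> c \<odot>\<^bsub>K\<^esub> w g))\<^sup>2) has_sum S c) G" for c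
    using 1 hs_norm_dual[OF cadjoint_lincomb[OF T W] E G] by blast
  let ?z = "(1/4) * (of_real (S 1) - of_real (S (-1)) + \<i> * (of_real (S \<i>) - of_real (S (-\<i>))))"
  have "((\<lambda>e. ip H (T e) (W e)) has_sum ?z) E"
  proof (rule has_sum_cong[THEN iffD2, OF H.polarization])
    show "((\<lambda>e. (1/4) * (of_real ((hnorm H (T e \<oplus>\<^bsub>H\<^esub> 1 \<odot>\<^bsub>H\<^esub> W e))\<^sup>2)
        - of_real ((hnorm H (T e \<oplus>\<^bsub>H\<^esub> (-1) \<odot>\<^bsub>H\<^esub> W e))\<^sup>2)
        + \<i> * (of_real ((hnorm H (T e \<oplus>\<^bsub>H\<^esub> \<i> \<odot>\<^bsub>H\<^esub> W e))\<^sup>2)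
        - of_real ((hnorm H (T e \<oplus>\<^bsub>H\<^esub> (-\<i>) \<odot>\<^bsub>H\<^esub> W e))\<^sup>2)))) has_sum ?z) E"
      by (intro has_sum_cmult_right has_sum_add has_sum_minus has_sum_of_real 1)
  qed (use T W in_K in \<open>auto simp: cadjoint_def\<close>)
  then have z: "(\<Sum>\<^sub>\<infinity>e\<in>E. ip H (T e) (W e)) = ?z" by (rule infsumI)
  show ?thesis unfolding z
  proof (rule has_sum_cong[THEN iffD2, OF K.polarization])
    show "((\<lambda>g. (1/4) * (of_real ((hnorm K (t g \<oplus>\<^bsub>K\<^esub> 1 \<odot>\<^bsub>K\<^esub> w g))\<^sup>2)
        - of_real ((hnorm K (t g \<oplus>\<^bsub>K\<^esub> (-1) \<odot>\<^bsub>K\<^esub> w g))\<^sup>2)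
        + \<i> * (of_real ((hnorm K (t g \<oplus>\<^bsub>K\<^esub> \<i> \<odot>\<^bsub>K\<^esub> w g))\<^sup>2)
        - of_real ((hnorm K (t g \<oplus>\<^bsub>K\<^esub> (-\<i>) \<odot>\<^bsub>K\<^esub> w g))\<^sup>2)))) has_sum ?z) G"
      by (intro has_sum_cmult_right has_sum_add has_sum_minus has_sum_of_real 2)
  qed (use T W in_H in \<open>auto simp: cadjoint_def\<close>)
qed

definition clinear :: "('k \<Rightarrow> 'h) \<Rightarrow> bool" where
  "clinear T \<longleftrightarrow> T \<in> carrier K \<rightarrow> carrier H \<and>
     (\<forall>x\<in>carrier K. \<forall>y\<in>carrier K. T (x \<oplus>\<^bsub>K\<^esub> y) = T x \<oplus>\<^bsub>H\<^esub> T y) \<and>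
     (\<forall>c. \<forall>x\<in>carrier K. T (c \<odot>\<^bsub>K\<^esub> x) = cnj c \<odot>\<^bsub>H\<^esub> T x) \<and>
     (\<exists>C. \<forall>x\<in>carrier K. hnorm H (T x) \<le> C * hnorm K x)"

lemma ex_cadjoint:
  assumes T: "clinear T"
  shows "\<exists>t. cadjoint T t"
proof -
  obtain C where C: "\<And>x. x \<in> carrier K \<Longrightarrow> hnorm H (T x) \<le> C * hnorm K x"
    using T unfolding clinear_def by blast
  have in_H: "T x \<in> carrier H" if "x \<in> carrier K" for x using T that by (auto simp: clinear_def)
  have "\<exists>z. z \<in> carrier K \<and> (\<forall>x\<in>carrier K. ip H (T x) g = ip K z x)" if g: "g \<in> carrier H" for g
  proof (rule K.riesz[of "\<lambda>x. cnj (ip H (T x) g)" "C * hnorm H g"])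
    fix x assume x: "x \<in> carrier K"
    have "cmod (ip H (T x) g) \<le> hnorm H (T x) * hnorm H g"
      using x g in_H by (intro H.ip_le_hnorm) auto
    also have "\<dots> \<le> (C * hnorm K x) * hnorm H g"
      using g C[OF x] by (intro mult_right_mono) auto
    finally show "cmod (cnj (ip H (T x) g)) \<le> C * hnorm H g * hnorm K x" by (simp add: mult_ac)
  next
    fix z assume z: "z \<in> carrier K" "\<And>x. x \<in> carrier K \<Longrightarrow> cnj (ip H (T x) g) = ip K x z"
    have "ip H (T x) g = ip K z x" if "x \<in> carrier K" for x
      using z(2)[OF that] K.ip_cnj[OF that z(1)] by (metis complex_cnj_cnj)
    then show ?thesis using z by blast
  qed (use T g in_H in \<open>auto simp: clinear_def H.ip_add_left H.ip_smult_left\<close>)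
  then show ?thesis using in_H unfolding cadjoint_def by metis
qed

abbreviation "TS \<equiv> tensor_space K H"
abbreviation "E \<equiv> some_basis K"

lemmas E_basis = K.some_basis

lemma ts_iff:
  "T \<in> carrier TS \<longleftrightarrow> clinear T \<and> T \<in> extensional (carrier K) \<and> (\<lambda>e. (hnorm H (T e))\<^sup>2) summable_on E"
  by (auto simp: tensor_space_def clinear_def PiE_def)

lemma ts_simps:
  "\<zero>\<^bsub>TS\<^esub> = (\<lambda>x\<in>carrier K. \<zero>\<^bsub>H\<^esub>)" "S \<oplus>\<^bsub>TS\<^esub> T = (\<lambda>x\<in>carrier K. S x \<oplus>\<^bsub>H\<^esub> T x)"
  "c \<odot>\<^bsub>TS\<^esub> T = (\<lambda>x\<in>carrier K. c \<odot>\<^bsub>H\<^esub> T x)" "ip TS S T = (\<Sum>\<^sub>\<infinity>e\<in>E. ip H (S e) (T e))"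
  by (simp_all add: tensor_space_def)

lemma ts_in: "T \<in> carrier TS \<Longrightarrow> x \<in> carrier K \<Longrightarrow> T x \<in> carrier H"
  by (auto simp: ts_iff clinear_def)

lemma ts_summable: "T \<in> carrier TS \<Longrightarrow> (\<lambda>e. (hnorm H (T e))\<^sup>2) summable_on E"
  by (simp add: ts_iff)

lemma ts_eqI:
  assumes "S \<in> carrier TS" "T \<in> carrier TS" "\<And>x. x \<in> carrier K \<Longrightarrow> S x = T x"
  shows "S = T"
  using assms by (auto simp: ts_iff intro: extensionalityI)

lemma clinear_lincomb:
  assumes S: "clinear S" and T: "clinear T"
  shows "clinear (\<lambda>x\<in>carrier K. S x \<oplus>\<^bsub>H\<^esub> c \<odot>\<^bsub>H\<^esub> T x)"
proof -
  obtain C D where CD: "\<And>x. x \<in> carrier K \<Longrightarrow> hnorm H (S x) \<le> C * hnorm K x"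
      "\<And>x. x \<in> carrier K \<Longrightarrow> hnorm H (T x) \<le> D * hnorm K x"
    using assms unfolding clinear_def by metis
  have in_H: "S x \<in> carrier H" "T x \<in> carrier H" if "x \<in> carrier K" for x
    using assms that by (auto simp: clinear_def)
  have "hnorm H (S x \<oplus>\<^bsub>H\<^esub> c \<odot>\<^bsub>H\<^esub> T x) \<le> (C + cmod c * D) * hnorm K x" if x: "x \<in> carrier K" for x
  proof -
    have "hnorm H (S x \<oplus>\<^bsub>H\<^esub> c \<odot>\<^bsub>H\<^esub> T x) \<le> hnorm H (S x) + cmod c * hnorm H (T x)"
      using H.hnorm_triangle[of "S x" "c \<odot>\<^bsub>H\<^esub> T x"] in_H[OF x] by (simp add: H.hnorm_smult)
    also have "\<dots> \<le> C * hnorm K x + cmod c * (D * hnorm K x)"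
      by (intro add_mono mult_left_mono CD x) auto
    finally show ?thesis by (simp add: algebra_simps)
  qed
  moreover have "S (x \<oplus>\<^bsub>K\<^esub> y) \<oplus>\<^bsub>H\<^esub> c \<odot>\<^bsub>H\<^esub> T (x \<oplus>\<^bsub>K\<^esub> y)
      = (S x \<oplus>\<^bsub>H\<^esub> c \<odot>\<^bsub>H\<^esub> T x) \<oplus>\<^bsub>H\<^esub> (S y \<oplus>\<^bsub>H\<^esub> c \<odot>\<^bsub>H\<^esub> T y)"
    if "x \<in> carrier K" "y \<in> carrier K" for x y
    using assms that in_H by (intro H.eq_by_ip) (auto simp: clinear_def H.ip_simps algebra_simps)
  moreover have "S (d \<odot>\<^bsub>K\<^esub> x) \<oplus>\<^bsub>H\<^esub> c \<odot>\<^bsub>H\<^esub> T (d \<odot>\<^bsub>K\<^esub> x)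
      = cnj d \<odot>\<^bsub>H\<^esub> (S x \<oplus>\<^bsub>H\<^esub> c \<odot>\<^bsub>H\<^esub> T x)"
    if "x \<in> carrier K" for d x
    using assms that in_H by (intro H.eq_by_ip) (auto simp: clinear_def H.ip_simps algebra_simps)
  ultimately show ?thesis using in_H by (auto simp: clinear_def)
qed

lemma ts_lincomb:
  assumes "S \<in> carrier TS" "T \<in> carrier TS"
  shows "(\<lambda>x\<in>carrier K. S x \<oplus>\<^bsub>H\<^esub> c \<odot>\<^bsub>H\<^esub> T x) \<in> carrier TS"
proof -
  have "(\<lambda>e. (hnorm H (S e \<oplus>\<^bsub>H\<^esub> c \<odot>\<^bsub>H\<^esub> T e))\<^sup>2) summable_on E"
    using assms by (intro hs_add_summable) (auto simp: ts_in ts_summable)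
  then have "(\<lambda>e. (hnorm H ((\<lambda>x\<in>carrier K. S x \<oplus>\<^bsub>H\<^esub> c \<odot>\<^bsub>H\<^esub> T x) e))\<^sup>2) summable_on E"
    by (rule summable_on_cong[THEN iffD1, rotated]) auto
  then show ?thesis using assms clinear_lincomb[of S T c] by (auto simp: ts_iff)
qed

lemma ts_zero: "(\<lambda>x\<in>carrier K. \<zero>\<^bsub>H\<^esub>) \<in> carrier TS"
proof -
  have "(\<lambda>e. (hnorm H ((\<lambda>x\<in>carrier K. \<zero>\<^bsub>H\<^esub>) e))\<^sup>2) summable_on E"
    by (rule summable_on_cong[THEN iffD1, of _ "\<lambda>_. 0"]) auto
  moreover have "clinear (\<lambda>x\<in>carrier K. \<zero>\<^bsub>H\<^esub>)"
    by (auto simp: clinear_def intro!: exI[of _ 0])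
  ultimately show ?thesis by (auto simp: ts_iff)
qed

lemma ts_ip_has_sum:
  assumes "S \<in> carrier TS" "T \<in> carrier TS"
  shows "((\<lambda>e. ip H (S e) (T e)) has_sum ip TS S T) E"
  unfolding ts_simps using assms
  by (intro has_sum_infsum hs_ip_summable) (auto simp: ts_in ts_summable)

lemma ts_norm_sum:
  assumes T: "T \<in> carrier TS"
  shows "((\<lambda>e. (hnorm H (T e))\<^sup>2) has_sum Re (ip TS T T)) E"
proof -
  have "((\<lambda>e. Re (ip H (T e) (T e))) has_sum Re (ip TS T T)) E"
    using has_sum_bounded_linear[OF bounded_linear_Re ts_ip_has_sum[OF T T]] .
  then show ?thesis
    by (rule has_sum_cong[THEN iffD1, rotated]) (use T in \<open>auto simp: ts_in H.hnorm_sq\<close>)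
qed

lemma ts_cadjoint: "T \<in> carrier TS \<Longrightarrow> \<exists>t. cadjoint T t"
  by (auto simp: ts_iff ex_cadjoint)

lemma ts_ip_nonneg:
  assumes T: "T \<in> carrier TS" shows "0 \<le> Re (ip TS T T)"
  by (rule has_sum_nonneg[OF ts_norm_sum[OF T]]) auto

text \<open>
  The Hilbert-Schmidt norm dominates the operator norm.  This is visible on the adjoint side, where
  \<open>\<parallel>T x\<parallel>\<^sup>2\<close> is the sum of the \<open>\<bar>\<langle>t g, x\<rangle>\<bar>\<^sup>2\<close>.
\<close>

lemma ts_apply_bound:
  assumes T: "T \<in> carrier TS" and x: "x \<in> carrier K"
  shows "hnorm H (T x) \<le> hnorm TS T * hnorm K x"
proof (rule power2_le_imp_le)
  obtain t where t: "cadjoint T t" using ts_cadjoint[OF T] by blast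
  define G where "G = some_basis H"
  have G: "orthonormal_basis H G" unfolding G_def by (rule H.some_basis)
  have 1: "((\<lambda>g. (hnorm K (t g))\<^sup>2 * (hnorm K x)\<^sup>2) has_sum (hnorm TS T)\<^sup>2 * (hnorm K x)\<^sup>2) G"
    using has_sum_cmult_left[OF iffD1[OF hs_norm_dual[OF t E_basis G] ts_norm_sum[OF T]]]
    by (simp add: hnorm_def ts_ip_nonneg[OF T])
  have 2: "((\<lambda>g. (cmod (ip H (T x) g))\<^sup>2) has_sum (hnorm H (T x))\<^sup>2) G"
    using H.parseval[OF G] ts_in[OF T x] by blast
  have "(hnorm H (T x))\<^sup>2 \<le> (hnorm TS T)\<^sup>2 * (hnorm K x)\<^sup>2"
  proof (rule has_sum_mono[OF 2 1])
    fix g assume g: "g \<in> G"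
    then have tg: "t g \<in> carrier K" "ip H (T x) g = ip K (t g) x"
      using t x H.basis_in[OF G] by (auto simp: cadjoint_def)
    have "cmod (ip K (t g) x) \<le> hnorm K (t g) * hnorm K x"
      by (rule K.ip_le_hnorm[OF tg(1) x])
    then have "(cmod (ip K (t g) x))\<^sup>2 \<le> (hnorm K (t g) * hnorm K x)\<^sup>2"
      by (intro power_mono) auto
    then show "(cmod (ip H (T x) g))\<^sup>2 \<le> (hnorm K (t g))\<^sup>2 * (hnorm K x)\<^sup>2"
      by (simp add: tg power_mult_distrib)
  qed
  then show "(hnorm H (T x))\<^sup>2 \<le> (hnorm TS T * hnorm K x)\<^sup>2" by (simp add: power_mult_distrib)
  show "0 \<le> hnorm TS T * hnorm K x" using x by (simp add: hnorm_def[of TS] ts_ip_nonneg[OF T])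
qed

end

lemma (in hilbert_space) one_smult [simp]: "x \<in> carrier H \<Longrightarrow> 1 \<odot> x = x"
  using smult_one[of x] by simp

lemma (in hilbert_space) eq_by_limits:
  assumes "\<And>m :: nat. \<sigma> m \<in> carrier H" "x \<in> carrier H" "(\<lambda>m. hnorm H (\<sigma> m \<ominus> x)) \<longlonglongrightarrow> 0"
    and "y \<in> carrier H" "\<And>z. z \<in> carrier H \<Longrightarrow> (\<lambda>m. ip H (\<sigma> m) z) \<longlonglongrightarrow> ip H y z"
  shows "x = y"
proof (rule eq_by_ip)
  fix z assume z: "z \<in> carrier H"
  show "ip H x z = ip H y z"
    using LIMSEQ_unique[OF tendsto_ip_left[OF assms(1,2) z assms(3)] assms(5)[OF z]] .
qed (use assms in auto)

context tensor
begin

lemma ts_add_closed: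
  assumes "S \<in> carrier TS" "T \<in> carrier TS"
  shows "S \<oplus>\<^bsub>TS\<^esub> T \<in> carrier TS"
proof -
  have "S \<oplus>\<^bsub>TS\<^esub> T = (\<lambda>x\<in>carrier K. S x \<oplus>\<^bsub>H\<^esub> 1 \<odot>\<^bsub>H\<^esub> T x)"
    unfolding ts_simps using assms by (intro restrict_ext) (simp add: ts_in)
  then show ?thesis using ts_lincomb[OF assms] by simp
qed

lemma ts_smult_closed:
  assumes "T \<in> carrier TS"
  shows "c \<odot>\<^bsub>TS\<^esub> T \<in> carrier TS"
proof -
  have "c \<odot>\<^bsub>TS\<^esub> T = (\<lambda>x\<in>carrier K. (\<lambda>x\<in>carrier K. \<zero>\<^bsub>H\<^esub>) x \<oplus>\<^bsub>H\<^esub> c \<odot>\<^bsub>H\<^esub> T x)"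
    unfolding ts_simps using assms by (intro restrict_ext) (simp add: ts_in)
  then show ?thesis using ts_lincomb[OF ts_zero assms] by simp
qed

lemma ts_zero_closed: "\<zero>\<^bsub>TS\<^esub> \<in> carrier TS"
  using ts_zero by (simp add: ts_simps)

lemma ts_apply:
  assumes "x \<in> carrier K"
  shows "\<zero>\<^bsub>TS\<^esub> x = \<zero>\<^bsub>H\<^esub>" "(S \<oplus>\<^bsub>TS\<^esub> T) x = S x \<oplus>\<^bsub>H\<^esub> T x" "(c \<odot>\<^bsub>TS\<^esub> T) x = c \<odot>\<^bsub>H\<^esub> T x"
  using assms by (simp_all add: ts_simps)

lemma ts_module: "module complex_field TS"
proof (rule moduleI)
  show "abelian_group TS"
  proof (rule abelian_groupI)
    fix S assume S: "S \<in> carrier TS"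
    show "\<exists>T\<in>carrier TS. T \<oplus>\<^bsub>TS\<^esub> S = \<zero>\<^bsub>TS\<^esub>"
    proof (rule bexI[OF _ ts_smult_closed[OF S, of "-1"]], rule ts_eqI)
      fix x assume x: "x \<in> carrier K"
      show "((-1) \<odot>\<^bsub>TS\<^esub> S \<oplus>\<^bsub>TS\<^esub> S) x = \<zero>\<^bsub>TS\<^esub> x"
        using ts_in[OF S x] x by (intro H.eq_by_ip) (auto simp: ts_apply H.ip_add_left H.ip_smult_left)
    qed (use S in \<open>auto intro: ts_add_closed ts_smult_closed ts_zero_closed\<close>)
  next
    fix S T U assume STU: "S \<in> carrier TS" "T \<in> carrier TS" "U \<in> carrier TS"
    show "S \<oplus>\<^bsub>TS\<^esub> T \<oplus>\<^bsub>TS\<^esub> U = S \<oplus>\<^bsub>TS\<^esub> (T \<oplus>\<^bsub>TS\<^esub> U)"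
      using STU by (intro ts_eqI ts_add_closed) (auto simp: ts_apply ts_in H.M.a_assoc)
  next
    fix S T assume ST: "S \<in> carrier TS" "T \<in> carrier TS"
    show "S \<oplus>\<^bsub>TS\<^esub> T = T \<oplus>\<^bsub>TS\<^esub> S"
      using ST by (intro ts_eqI ts_add_closed) (auto simp: ts_apply ts_in H.M.a_comm)
  next
    fix S assume S: "S \<in> carrier TS"
    show "\<zero>\<^bsub>TS\<^esub> \<oplus>\<^bsub>TS\<^esub> S = S"
      using S by (intro ts_eqI ts_add_closed ts_zero_closed) (auto simp: ts_apply ts_in)
  qed (auto intro: ts_add_closed ts_zero_closed)
next
  fix c d :: complex and S T assume ST: "S \<in> carrier TS" "T \<in> carrier TS"
  show "(c \<oplus>\<^bsub>complex_field\<^esub> d) \<odot>\<^bsub>TS\<^esub> S = c \<odot>\<^bsub>TS\<^esub> S \<oplus>\<^bsub>TS\<^esub> d \<odot>\<^bsub>TS\<^esub> S"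
    using ST H.smult_l_distr[of c d]
    by (intro ts_eqI ts_add_closed ts_smult_closed) (auto simp: ts_apply ts_in)
  show "c \<odot>\<^bsub>TS\<^esub> (S \<oplus>\<^bsub>TS\<^esub> T) = c \<odot>\<^bsub>TS\<^esub> S \<oplus>\<^bsub>TS\<^esub> c \<odot>\<^bsub>TS\<^esub> T"
    using ST by (intro ts_eqI ts_add_closed ts_smult_closed) (auto simp: ts_apply ts_in H.smult_add)
  show "c \<otimes>\<^bsub>complex_field\<^esub> d \<odot>\<^bsub>TS\<^esub> S = c \<odot>\<^bsub>TS\<^esub> (d \<odot>\<^bsub>TS\<^esub> S)"
    using ST by (intro ts_eqI ts_smult_closed) (auto simp: ts_apply ts_in H.smult_smult)
  show "\<one>\<^bsub>complex_field\<^esub> \<odot>\<^bsub>TS\<^esub> S = S"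
    using ST by (intro ts_eqI ts_smult_closed) (auto simp: ts_apply ts_in)
qed (auto intro: cring_complex_field ts_smult_closed)

lemma ts_minus_apply:
  assumes "S \<in> carrier TS" "T \<in> carrier TS" "x \<in> carrier K"
  shows "(S \<ominus>\<^bsub>TS\<^esub> T) x = S x \<ominus>\<^bsub>H\<^esub> T x"
proof -
  interpret TS: module complex_field TS by (rule ts_module)
  have inv: "\<ominus>\<^bsub>TS\<^esub> T \<in> carrier TS" using assms by simp
  have "(T \<oplus>\<^bsub>TS\<^esub> \<ominus>\<^bsub>TS\<^esub> T) x = \<zero>\<^bsub>TS\<^esub> x" using assms by (simp add: TS.M.r_neg)
  then have "T x \<oplus>\<^bsub>H\<^esub> (\<ominus>\<^bsub>TS\<^esub> T) x = \<zero>\<^bsub>H\<^esub>" using assms by (simp add: ts_apply)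
  then have "(\<ominus>\<^bsub>TS\<^esub> T) x = \<ominus>\<^bsub>H\<^esub> (T x)"
    using ts_in[OF assms(2,3)] ts_in[OF inv assms(3)] H.M.minus_equality H.M.a_comm by metis
  then show ?thesis using assms by (simp add: TS.M.minus_eq H.M.minus_eq ts_apply)
qed

lemma ts_hnorm_sum:
  assumes T: "T \<in> carrier TS"
  shows "((\<lambda>e. (hnorm H (T e))\<^sup>2) has_sum (hnorm TS T)\<^sup>2) E"
  using ts_norm_sum[OF T] by (simp add: hnorm_def[of TS] ts_ip_nonneg[OF T])

lemma ts_hnorm_le_of_finite:
  assumes T: "T \<in> carrier TS" and "0 \<le> C"
    and "\<And>F. finite F \<Longrightarrow> F \<subseteq> E \<Longrightarrow> (\<Sum>e\<in>F. (hnorm H (T e))\<^sup>2) \<le> C\<^sup>2"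
  shows "hnorm TS T \<le> C"
proof -
  have "(hnorm TS T)\<^sup>2 \<le> C\<^sup>2"
    by (rule has_sum_le_finite_sums[OF ts_hnorm_sum[OF T]]) (rule assms(3))
  then show ?thesis using assms(2) by (rule power2_le_imp_le)
qed

lemma ts_finite_sum_le:
  assumes T: "T \<in> carrier TS" and F: "finite F" "F \<subseteq> E"
  shows "(\<Sum>e\<in>F. (hnorm H (T e))\<^sup>2) \<le> (hnorm TS T)\<^sup>2"
  by (rule finite_sum_le_has_sum[OF ts_hnorm_sum[OF T] F]) auto

text \<open>
  A Cauchy sequence converges pointwise because point evaluations are continuous; the limit is
  approached in norm because the bounds on finite sums over \<open>E\<close> survive pointwise limits.
\<close>

lemma ts_complete:
  assumes \<sigma>: "\<And>m :: nat. \<sigma> m \<in> carrier TS"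
    and cauchy: "\<And>e. 0 < e \<Longrightarrow> \<exists>N. \<forall>l\<ge>N. \<forall>m\<ge>N. hnorm TS (\<sigma> l \<ominus>\<^bsub>TS\<^esub> \<sigma> m) < e"
  shows "\<exists>T\<in>carrier TS. (\<lambda>m. hnorm TS (\<sigma> m \<ominus>\<^bsub>TS\<^esub> T)) \<longlonglongrightarrow> 0"
proof -
  interpret TS: module complex_field TS by (rule ts_module)
  have diff: "hnorm H (\<sigma> l x \<ominus>\<^bsub>H\<^esub> \<sigma> m x) \<le> hnorm TS (\<sigma> l \<ominus>\<^bsub>TS\<^esub> \<sigma> m) * hnorm K x"
    if "x \<in> carrier K" for l m x
    using ts_apply_bound[OF TS.M.minus_closed[OF \<sigma> \<sigma>] that, of l m] ts_minus_apply[OF \<sigma> \<sigma> that] by simp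
  have "\<exists>y\<in>carrier H. (\<lambda>m. hnorm H (\<sigma> m x \<ominus>\<^bsub>H\<^esub> y)) \<longlonglongrightarrow> 0" if x: "x \<in> carrier K" for x
  proof (rule H.complete)
    show "\<sigma> m x \<in> carrier H" for m using ts_in[OF \<sigma> x] .
    fix e :: real assume e: "0 < e"
    have n: "hnorm K x + 1 > 0" using K.hnorm_ge_0[OF x] by linarith
    obtain N where N: "\<And>l m. l \<ge> N \<Longrightarrow> m \<ge> N \<Longrightarrow> hnorm TS (\<sigma> l \<ominus>\<^bsub>TS\<^esub> \<sigma> m) < e / (hnorm K x + 1)"
      using cauchy[of "e / (hnorm K x + 1)"] e n by auto
    have "hnorm H (\<sigma> l x \<ominus>\<^bsub>H\<^esub> \<sigma> m x) < e" if lm: "l \<ge> N" "m \<ge> N" for l m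
    proof -
      have "hnorm TS (\<sigma> l \<ominus>\<^bsub>TS\<^esub> \<sigma> m) * hnorm K x \<le> e / (hnorm K x + 1) * hnorm K x"
        using N[OF lm] x by (intro mult_right_mono) auto
      also have "\<dots> < e" using e n by (simp add: field_simps)
      finally show ?thesis using diff[OF x, of l m] by simp
    qed
    then show "\<exists>N. \<forall>l\<ge>N. \<forall>m\<ge>N. hnorm H (\<sigma> l x \<ominus>\<^bsub>H\<^esub> \<sigma> m x) < e" by blast
  qed
  then have "\<forall>x\<in>carrier K. \<exists>y. y \<in> carrier H \<and> (\<lambda>m. hnorm H (\<sigma> m x \<ominus>\<^bsub>H\<^esub> y)) \<longlonglongrightarrow> 0" by blast
  then obtain T0 where T0: "\<forall>x\<in>carrier K. T0 x \<in> carrier H \<and> (\<lambda>m. hnorm H (\<sigma> m x \<ominus>\<^bsub>H\<^esub> T0 x)) \<longlonglongrightarrow> 0"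
    by (rule bchoice[THEN exE])
  define T where "T = restrict T0 (carrier K)"
  have T: "T x \<in> carrier H" "(\<lambda>m. hnorm H (\<sigma> m x \<ominus>\<^bsub>H\<^esub> T x)) \<longlonglongrightarrow> 0" if "x \<in> carrier K" for x
    using T0 that by (auto simp: T_def)
  have lim: "(\<lambda>m. ip H (\<sigma> m x) z) \<longlonglongrightarrow> ip H (T x) z" if "x \<in> carrier K" "z \<in> carrier H" for x z
    using H.tendsto_ip_left[OF ts_in[OF \<sigma> that(1)] T(1)[OF that(1)] that(2) T(2)[OF that(1)]] .
  have nlim: "(\<lambda>m. hnorm H (\<sigma> m x)) \<longlonglongrightarrow> hnorm H (T x)" if "x \<in> carrier K" for x
    using H.tendsto_hnorm[OF ts_in[OF \<sigma> that] T(1)[OF that] T(2)[OF that]] .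
  obtain N1 where N1: "\<And>m. m \<ge> N1 \<Longrightarrow> hnorm TS (\<sigma> m \<ominus>\<^bsub>TS\<^esub> \<sigma> N1) < 1"
    using cauchy[of 1] by auto
  have norm_le: "hnorm H (\<sigma> m x) \<le> hnorm H (\<sigma> m x \<ominus>\<^bsub>H\<^esub> \<sigma> N1 x) + hnorm H (\<sigma> N1 x)"
    if "x \<in> carrier K" for m x
    using H.hnorm_le_minus_add[OF ts_in[OF \<sigma> that] ts_in[OF \<sigma> that]] .
  have lin: "clinear T"
    unfolding clinear_def
  proof (intro conjI ballI allI)
    show "T \<in> carrier K \<rightarrow> carrier H" using T by auto
    fix x y assume xy: "x \<in> carrier K" "y \<in> carrier K"
    have \<sigma>a: "\<sigma> m (x \<oplus>\<^bsub>K\<^esub> y) = \<sigma> m x \<oplus>\<^bsub>H\<^esub> \<sigma> m y" for m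
      using \<sigma>[of m] xy by (simp add: ts_iff clinear_def)
    show "T (x \<oplus>\<^bsub>K\<^esub> y) = T x \<oplus>\<^bsub>H\<^esub> T y"
    proof (rule H.eq_by_limits[OF _ _ T(2)])
      fix z assume z: "z \<in> carrier H"
      show "(\<lambda>m. ip H (\<sigma> m (x \<oplus>\<^bsub>K\<^esub> y)) z) \<longlonglongrightarrow> ip H (T x \<oplus>\<^bsub>H\<^esub> T y) z"
        unfolding \<sigma>a using tendsto_add[OF lim[OF xy(1) z] lim[OF xy(2) z]] xy z T
        by (simp add: H.ip_add_left ts_in[OF \<sigma>])
    qed (use xy T ts_in[OF \<sigma>] in auto)
  next
    fix c x assume x: "x \<in> carrier K"
    have \<sigma>a: "\<sigma> m (c \<odot>\<^bsub>K\<^esub> x) = cnj c \<odot>\<^bsub>H\<^esub> \<sigma> m x" for m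
      using \<sigma>[of m] x by (simp add: ts_iff clinear_def)
    show "T (c \<odot>\<^bsub>K\<^esub> x) = cnj c \<odot>\<^bsub>H\<^esub> T x"
    proof (rule H.eq_by_limits[OF _ _ T(2)])
      fix z assume z: "z \<in> carrier H"
      show "(\<lambda>m. ip H (\<sigma> m (c \<odot>\<^bsub>K\<^esub> x)) z) \<longlonglongrightarrow> ip H (cnj c \<odot>\<^bsub>H\<^esub> T x) z"
        unfolding \<sigma>a using tendsto_mult[OF tendsto_const[of "cnj c"] lim[OF x z]] x z T
        by (simp add: H.ip_smult_left ts_in[OF \<sigma>])
    qed (use x T ts_in[OF \<sigma>] in auto)
  next
    show "\<exists>C. \<forall>x\<in>carrier K. hnorm H (T x) \<le> C * hnorm K x"
    proof (intro exI ballI)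
      fix x assume x: "x \<in> carrier K"
      show "hnorm H (T x) \<le> (1 + hnorm TS (\<sigma> N1)) * hnorm K x"
      proof (rule LIMSEQ_le_const2[OF nlim[OF x]], intro exI allI impI)
        fix m assume m: "m \<ge> N1"
        have "hnorm H (\<sigma> m x \<ominus>\<^bsub>H\<^esub> \<sigma> N1 x) \<le> 1 * hnorm K x"
          using diff[OF x, of m N1] N1[OF m] mult_right_mono[of "hnorm TS (\<sigma> m \<ominus>\<^bsub>TS\<^esub> \<sigma> N1)" 1 "hnorm K x"]
            K.hnorm_ge_0[OF x] by linarith
        then show "hnorm H (\<sigma> m x) \<le> (1 + hnorm TS (\<sigma> N1)) * hnorm K x"
          using norm_le[OF x, of m] ts_apply_bound[OF \<sigma>[of N1] x] by (simp add: distrib_right)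
      qed
    qed
  qed
  have close: "\<exists>N. \<forall>m\<ge>N. \<forall>F. finite F \<longrightarrow> F \<subseteq> E \<longrightarrow> (\<Sum>e\<in>F. (hnorm H (\<sigma> m e \<ominus>\<^bsub>H\<^esub> T e))\<^sup>2) \<le> \<epsilon>\<^sup>2"
    if \<epsilon>: "0 < \<epsilon>" for \<epsilon>
  proof -
    obtain N where N: "\<And>l m. l \<ge> N \<Longrightarrow> m \<ge> N \<Longrightarrow> hnorm TS (\<sigma> l \<ominus>\<^bsub>TS\<^esub> \<sigma> m) < \<epsilon>"
      using cauchy[OF \<epsilon>] by auto
    have "(\<Sum>e\<in>F. (hnorm H (\<sigma> m e \<ominus>\<^bsub>H\<^esub> T e))\<^sup>2) \<le> \<epsilon>\<^sup>2" if m: "m \<ge> N" and F: "finite F" "F \<subseteq> E" for m F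
    proof (rule LIMSEQ_le_const2)
      have el: "(\<lambda>l. hnorm H (\<sigma> m e \<ominus>\<^bsub>H\<^esub> \<sigma> l e)) \<longlonglongrightarrow> hnorm H (\<sigma> m e \<ominus>\<^bsub>H\<^esub> T e)" if e: "e \<in> F" for e
      proof (rule H.tendsto_hnorm)
        have eK: "e \<in> carrier K" using e F by auto
        note in_H = ts_in[OF \<sigma> eK] T(1)[OF eK]
        show "\<sigma> m e \<ominus>\<^bsub>H\<^esub> \<sigma> l e \<in> carrier H" "\<sigma> m e \<ominus>\<^bsub>H\<^esub> T e \<in> carrier H" for l
          using in_H by auto
        have "(\<sigma> m e \<ominus>\<^bsub>H\<^esub> \<sigma> l e) \<ominus>\<^bsub>H\<^esub> (\<sigma> m e \<ominus>\<^bsub>H\<^esub> T e) = T e \<ominus>\<^bsub>H\<^esub> \<sigma> l e" for l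
          using in_H by (intro H.eq_by_ip) (auto simp: H.ip_minus_left)
        then show "(\<lambda>l. hnorm H ((\<sigma> m e \<ominus>\<^bsub>H\<^esub> \<sigma> l e) \<ominus>\<^bsub>H\<^esub> (\<sigma> m e \<ominus>\<^bsub>H\<^esub> T e))) \<longlonglongrightarrow> 0"
          using T(2)[OF eK] H.hnorm_minus_commute[OF in_H(2,1)] by simp
      qed
      show "(\<lambda>l. \<Sum>e\<in>F. (hnorm H (\<sigma> m e \<ominus>\<^bsub>H\<^esub> \<sigma> l e))\<^sup>2) \<longlonglongrightarrow> (\<Sum>e\<in>F. (hnorm H (\<sigma> m e \<ominus>\<^bsub>H\<^esub> T e))\<^sup>2)"
        by (intro tendsto_sum tendsto_power el)
      show "\<exists>N. \<forall>l\<ge>N. (\<Sum>e\<in>F. (hnorm H (\<sigma> m e \<ominus>\<^bsub>H\<^esub> \<sigma> l e))\<^sup>2) \<le> \<epsilon>\<^sup>2"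
      proof (intro exI allI impI)
        fix l assume l: "l \<ge> N"
        have "(\<Sum>e\<in>F. (hnorm H ((\<sigma> m \<ominus>\<^bsub>TS\<^esub> \<sigma> l) e))\<^sup>2) \<le> (hnorm TS (\<sigma> m \<ominus>\<^bsub>TS\<^esub> \<sigma> l))\<^sup>2"
          by (intro ts_finite_sum_le TS.M.minus_closed \<sigma> F)
        also have "\<dots> \<le> \<epsilon>\<^sup>2"
          using N[OF m l] ts_ip_nonneg[OF TS.M.minus_closed[OF \<sigma> \<sigma>]]
          by (intro power_mono) (auto simp: hnorm_def[of TS])
        also have "(\<Sum>e\<in>F. (hnorm H ((\<sigma> m \<ominus>\<^bsub>TS\<^esub> \<sigma> l) e))\<^sup>2) = (\<Sum>e\<in>F. (hnorm H (\<sigma> m e \<ominus>\<^bsub>H\<^esub> \<sigma> l e))\<^sup>2)"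
          using F by (intro sum.cong refl) (auto simp: ts_minus_apply[OF \<sigma> \<sigma>] subset_iff)
        finally show "(\<Sum>e\<in>F. (hnorm H (\<sigma> m e \<ominus>\<^bsub>H\<^esub> \<sigma> l e))\<^sup>2) \<le> \<epsilon>\<^sup>2" .
      qed
    qed
    then show ?thesis by blast
  qed
  have T_TS: "T \<in> carrier TS"
  proof -
    obtain N where N: "\<And>F. finite F \<Longrightarrow> F \<subseteq> E \<Longrightarrow> (\<Sum>e\<in>F. (hnorm H (\<sigma> N e \<ominus>\<^bsub>H\<^esub> T e))\<^sup>2) \<le> 1\<^sup>2"
      using close[of 1] by auto
    have s: "(\<lambda>e. (hnorm H (\<sigma> N e \<ominus>\<^bsub>H\<^esub> T e))\<^sup>2) summable_on E"
      by (rule summable_on_of_finite_bounds[OF _ N]) auto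
    have "(\<lambda>e. (hnorm H (\<sigma> N e \<oplus>\<^bsub>H\<^esub> (-1) \<odot>\<^bsub>H\<^esub> (\<sigma> N e \<ominus>\<^bsub>H\<^esub> T e)))\<^sup>2) summable_on E"
      using T ts_in[OF \<sigma>] by (intro hs_add_summable s ts_summable[OF \<sigma>]) auto
    then have "(\<lambda>e. (hnorm H (T e))\<^sup>2) summable_on E"
    proof (rule summable_on_cong[THEN iffD1, rotated])
      fix e assume "e \<in> E"
      then have eK: "e \<in> carrier K" by simp
      have "\<sigma> N e \<oplus>\<^bsub>H\<^esub> (-1) \<odot>\<^bsub>H\<^esub> (\<sigma> N e \<ominus>\<^bsub>H\<^esub> T e) = T e"
        using ts_in[OF \<sigma> eK] T(1)[OF eK] by (intro H.eq_by_ip) (auto simp: H.ip_simps)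
      then show "(hnorm H (\<sigma> N e \<oplus>\<^bsub>H\<^esub> (-1) \<odot>\<^bsub>H\<^esub> (\<sigma> N e \<ominus>\<^bsub>H\<^esub> T e)))\<^sup>2 = (hnorm H (T e))\<^sup>2" by simp
    qed
    then show ?thesis using lin by (simp add: ts_iff T_def)
  qed
  have "(\<lambda>m. hnorm TS (\<sigma> m \<ominus>\<^bsub>TS\<^esub> T)) \<longlonglongrightarrow> 0"
  proof (rule LIMSEQ_I)
    fix r :: real assume r: "0 < r"
    obtain N where N: "\<And>m F. m \<ge> N \<Longrightarrow> finite F \<Longrightarrow> F \<subseteq> E \<Longrightarrow> (\<Sum>e\<in>F. (hnorm H (\<sigma> m e \<ominus>\<^bsub>H\<^esub> T e))\<^sup>2) \<le> (r/2)\<^sup>2"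
      using close[of "r/2"] r by auto
    have "norm (hnorm TS (\<sigma> m \<ominus>\<^bsub>TS\<^esub> T) - 0) < r" if m: "m \<ge> N" for m
    proof -
      have d: "\<sigma> m \<ominus>\<^bsub>TS\<^esub> T \<in> carrier TS" using \<sigma> T_TS by simp
      have "hnorm TS (\<sigma> m \<ominus>\<^bsub>TS\<^esub> T) \<le> r/2"
      proof (rule ts_hnorm_le_of_finite[OF d])
        fix F assume F: "finite F" "F \<subseteq> E"
        have "(\<Sum>e\<in>F. (hnorm H ((\<sigma> m \<ominus>\<^bsub>TS\<^esub> T) e))\<^sup>2) = (\<Sum>e\<in>F. (hnorm H (\<sigma> m e \<ominus>\<^bsub>H\<^esub> T e))\<^sup>2)"
          using F by (intro sum.cong refl) (auto simp: ts_minus_apply[OF \<sigma> T_TS] subset_iff)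
        then show "(\<Sum>e\<in>F. (hnorm H ((\<sigma> m \<ominus>\<^bsub>TS\<^esub> T) e))\<^sup>2) \<le> (r/2)\<^sup>2"
          using N[OF m F] by simp
      qed (use r in simp)
      moreover have "0 \<le> hnorm TS (\<sigma> m \<ominus>\<^bsub>TS\<^esub> T)" by (simp add: hnorm_def[of TS] ts_ip_nonneg[OF d])
      ultimately show ?thesis using r by simp
    qed
    then show "\<exists>N. \<forall>m\<ge>N. norm (hnorm TS (\<sigma> m \<ominus>\<^bsub>TS\<^esub> T) - 0) < r" by blast
  qed
  then show ?thesis using T_TS by blast
qed

lemma ts_hilbert: "hilbert_space TS"
proof (rule hilbert_space.intro[OF ts_module], unfold_locales)
  fix S T U assume "S \<in> carrier TS" "T \<in> carrier TS" "U \<in> carrier TS"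
  note STU = this
  have "((\<lambda>e. ip H (S e) (U e) + ip H (T e) (U e)) has_sum ip TS S U + ip TS T U) E"
    using STU by (intro has_sum_add ts_ip_has_sum)
  then have "((\<lambda>e. ip H ((S \<oplus>\<^bsub>TS\<^esub> T) e) (U e)) has_sum ip TS S U + ip TS T U) E"
    by (rule has_sum_cong[THEN iffD1, rotated]) (use STU in \<open>auto simp: ts_apply ts_in H.ip_add_left\<close>)
  then show "ip TS (S \<oplus>\<^bsub>TS\<^esub> T) U = ip TS S U + ip TS T U"
    using has_sum_unique ts_ip_has_sum[OF ts_add_closed[OF STU(1,2)] STU(3)] by blast
next
  fix c S T assume ST: "S \<in> carrier TS" "T \<in> carrier TS"
  have "((\<lambda>e. c * ip H (S e) (T e)) has_sum c * ip TS S T) E"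
    using ST by (intro has_sum_cmult_right ts_ip_has_sum)
  then have "((\<lambda>e. ip H ((c \<odot>\<^bsub>TS\<^esub> S) e) (T e)) has_sum c * ip TS S T) E"
    by (rule has_sum_cong[THEN iffD1, rotated]) (use ST in \<open>auto simp: ts_apply ts_in H.ip_smult_left\<close>)
  then show "ip TS (c \<odot>\<^bsub>TS\<^esub> S) T = c * ip TS S T"
    using has_sum_unique ts_ip_has_sum[OF ts_smult_closed[OF ST(1)] ST(2)] by blast
next
  fix S T assume ST: "S \<in> carrier TS" "T \<in> carrier TS"
  have "((\<lambda>e. cnj (ip H (S e) (T e))) has_sum cnj (ip TS S T)) E"
    using has_sum_bounded_linear[OF bounded_linear_cnj ts_ip_has_sum[OF ST]] .
  then have "((\<lambda>e. ip H (T e) (S e)) has_sum cnj (ip TS S T)) E"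
    by (rule has_sum_cong[THEN iffD1, rotated]) (simp add: H.ip_cnj[OF ts_in[OF ST(1)] ts_in[OF ST(2)], symmetric])
  then show "ip TS T S = cnj (ip TS S T)"
    using has_sum_unique ts_ip_has_sum[OF ST(2,1)] by blast
next
  fix T assume T: "T \<in> carrier TS"
  then show "0 \<le> Re (ip TS T T)" by (rule ts_ip_nonneg)
  assume "ip TS T T = 0"
  then have "hnorm TS T = 0" by (simp add: hnorm_def)
  then have "hnorm H (T x) = 0" if "x \<in> carrier K" for x
    using ts_apply_bound[OF T that] H.hnorm_ge_0[OF ts_in[OF T that]] by simp
  then show "T = \<zero>\<^bsub>TS\<^esub>"
    using T by (intro ts_eqI ts_zero_closed) (auto simp: ts_apply H.hnorm_eq_0[OF ts_in[OF T]])
qed (use ts_complete in blast)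

sublocale TS: hilbert_space TS by (rule ts_hilbert)

lemma ts_finsum_apply:
  assumes "\<And>j. j \<in> J \<Longrightarrow> f j \<in> carrier TS" "x \<in> carrier K"
  shows "finsum TS f J x = finsum H (\<lambda>j. f j x) J"
  using assms(1)
proof (induction J rule: infinite_finite_induct)
  case (insert i F)
  have "finsum TS f (insert i F) = f i \<oplus>\<^bsub>TS\<^esub> finsum TS f F"
    using insert by (subst TS.M.finsum_insert) auto
  then have "finsum TS f (insert i F) x = f i x \<oplus>\<^bsub>H\<^esub> finsum H (\<lambda>j. f j x) F"
    using insert assms(2) by (simp add: ts_apply)
  also have "\<dots> = finsum H (\<lambda>j. f j x) (insert i F)"
    using insert assms(2) by (subst H.M.finsum_insert) (auto simp: ts_in)
  finally show ?case .
qed (use assms(2) in \<open>auto simp: ts_apply\<close>)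

section \<open>Tensor products of operators\<close>

text \<open>
  Composition with the adjoint of \<open>A\<close> on the right becomes composition with \<open>A\<close> on the left after
  taking adjoints.  Only on that side is it evident that the Hilbert-Schmidt norm grows by at most
  the factor \<open>\<parallel>A\<parallel>\<close>.
\<close>

lemma ts_comp_adj:
  assumes A: "adjoint_pair K A A'" and t: "cadjoint T t"
  shows "cadjoint (\<lambda>x. T (A' x)) (\<lambda>g. A (t g))"
  using t K.adjoint_pairD(1,2)[OF A] K.adjoint_pairD(3)[OF A]
  by (auto simp: cadjoint_def bops_in)

lemma ts_comp_adj_norm:
  assumes A: "adjoint_pair K A A'" and T: "T \<in> carrier TS"
  shows "(\<lambda>e. (hnorm H (T (A' e)))\<^sup>2) summable_on E"
    "(\<Sum>\<^sub>\<infinity>e\<in>E. (hnorm H (T (A' e)))\<^sup>2) \<le> (opnorm K A)\<^sup>2 * (hnorm TS T)\<^sup>2"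
proof -
  obtain t where t: "cadjoint T t" using ts_cadjoint[OF T] by blast
  define G where "G = some_basis H"
  have G: "orthonormal_basis H G" unfolding G_def by (rule H.some_basis)
  have tK: "t g \<in> carrier K" if "g \<in> G" for g using t H.basis_in[OF G that] by (simp add: cadjoint_def)
  have 1: "((\<lambda>g. (opnorm K A)\<^sup>2 * (hnorm K (t g))\<^sup>2) has_sum (opnorm K A)\<^sup>2 * (hnorm TS T)\<^sup>2) G"
    by (rule has_sum_cmult_right[OF iffD1[OF hs_norm_dual[OF t E_basis G] ts_hnorm_sum[OF T]]])
  have le: "(hnorm K (A (t g)))\<^sup>2 \<le> (opnorm K A)\<^sup>2 * (hnorm K (t g))\<^sup>2" if "g \<in> G" for g
  proof -
    have AK: "A \<in> bops K" using K.adjoint_pairD(1)[OF A] .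
    have "(hnorm K (A (t g)))\<^sup>2 \<le> (opnorm K A * hnorm K (t g))\<^sup>2"
      using K.opnorm_bound[OF AK tK[OF that]] bops_in[OF AK tK[OF that]] by (intro power_mono) auto
    then show ?thesis by (simp add: power_mult_distrib)
  qed
  have "(\<lambda>g. (hnorm K (A (t g)))\<^sup>2) summable_on G"
    by (rule summable_on_comparison_test[OF has_sum_imp_summable[OF 1] le]) auto
  then obtain s where s: "((\<lambda>g. (hnorm K (A (t g)))\<^sup>2) has_sum s) G" by (auto simp: summable_on_def)
  have "s \<le> (opnorm K A)\<^sup>2 * (hnorm TS T)\<^sup>2"
    by (rule has_sum_mono[OF s 1 le])
  moreover have "((\<lambda>e. (hnorm H (T (A' e)))\<^sup>2) has_sum s) E"
    using hs_norm_dual[OF ts_comp_adj[OF A t] E_basis G] s by blast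
  ultimately show "(\<lambda>e. (hnorm H (T (A' e)))\<^sup>2) summable_on E"
    "(\<Sum>\<^sub>\<infinity>e\<in>E. (hnorm H (T (A' e)))\<^sup>2) \<le> (opnorm K A)\<^sup>2 * (hnorm TS T)\<^sup>2"
    by (auto simp: summable_on_def infsumI)
qed

lemma tensor_op_apply:
  assumes "adjoint_pair K A A'" "x \<in> carrier K"
  shows "tensor_op K A B T x = B (T (A' x))"
  using assms by (simp add: tensor_op_def K.adj_eq)

lemma tensor_op_in_and_norm:
  assumes A: "adjoint_pair K A A'" and B: "B \<in> bops H" and T: "T \<in> carrier TS"
  shows "tensor_op K A B T \<in> carrier TS"
    "hnorm TS (tensor_op K A B T) \<le> opnorm H B * opnorm K A * hnorm TS T"
proof -
  have A': "A' \<in> bops K" using K.adjoint_pairD(2)[OF A] .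
  have in_H: "T (A' x) \<in> carrier H" if "x \<in> carrier K" for x
    using ts_in[OF T bops_in[OF A' that]] .
  have app: "tensor_op K A B T x = B (T (A' x))" if "x \<in> carrier K" for x
    using tensor_op_apply[OF A that] .
  have le: "(hnorm H (B (T (A' e))))\<^sup>2 \<le> (opnorm H B)\<^sup>2 * (hnorm H (T (A' e)))\<^sup>2" if "e \<in> carrier K" for e
  proof -
    have "(hnorm H (B (T (A' e))))\<^sup>2 \<le> (opnorm H B * hnorm H (T (A' e)))\<^sup>2"
      using H.opnorm_bound[OF B in_H[OF that]] bops_in[OF B in_H[OF that]] by (intro power_mono) auto
    then show ?thesis by (simp add: power_mult_distrib)
  qed
  note s1 = summable_on_cmult_right[OF ts_comp_adj_norm(1)[OF A T], of "(opnorm H B)\<^sup>2"]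
  have s2: "(\<lambda>e. (hnorm H (B (T (A' e))))\<^sup>2) summable_on E"
    by (rule summable_on_comparison_test[OF s1 le]) auto
  have "clinear (tensor_op K A B T)"
    unfolding clinear_def
  proof (intro conjI ballI allI)
    show "tensor_op K A B T \<in> carrier K \<rightarrow> carrier H"
      using app in_H B by (auto simp: bops_in)
    have Tl: "T (x \<oplus>\<^bsub>K\<^esub> y) = T x \<oplus>\<^bsub>H\<^esub> T y" "T (c \<odot>\<^bsub>K\<^esub> x) = cnj c \<odot>\<^bsub>H\<^esub> T x"
      if "x \<in> carrier K" "y \<in> carrier K" for x y c
      using T that by (auto simp: ts_iff clinear_def)
    show "tensor_op K A B T (x \<oplus>\<^bsub>K\<^esub> y) = tensor_op K A B T x \<oplus>\<^bsub>H\<^esub> tensor_op K A B T y"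
      if "x \<in> carrier K" "y \<in> carrier K" for x y
      using that A' B in_H by (simp add: app bops_add Tl bops_in)
    show "tensor_op K A B T (c \<odot>\<^bsub>K\<^esub> x) = cnj c \<odot>\<^bsub>H\<^esub> tensor_op K A B T x"
      if "x \<in> carrier K" for x c
      using that A' B in_H by (simp add: app bops_smult Tl bops_in)
    show "\<exists>C. \<forall>x\<in>carrier K. hnorm H (tensor_op K A B T x) \<le> C * hnorm K x"
    proof (intro exI ballI)
      fix x assume x: "x \<in> carrier K"
      have "hnorm H (tensor_op K A B T x) \<le> opnorm H B * hnorm H (T (A' x))"
        unfolding app[OF x] by (rule H.opnorm_bound[OF B in_H[OF x]])
      also have "\<dots> \<le> opnorm H B * (hnorm TS T * hnorm K (A' x))"
        by (intro mult_left_mono ts_apply_bound T bops_in[OF A' x] H.opnorm_nonneg B)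
      also have "\<dots> \<le> opnorm H B * (hnorm TS T * (opnorm K A' * hnorm K x))"
        by (intro mult_left_mono K.opnorm_bound A' x H.opnorm_nonneg B TS.hnorm_ge_0 T)
      finally show "hnorm H (tensor_op K A B T x) \<le> (opnorm H B * hnorm TS T * opnorm K A') * hnorm K x"
        by (simp add: mult.assoc)
    qed
  qed
  moreover have "(\<lambda>e. (hnorm H (tensor_op K A B T e))\<^sup>2) summable_on E"
    by (rule summable_on_cong[THEN iffD2, OF _ s2]) (simp add: app)
  ultimately show TT: "tensor_op K A B T \<in> carrier TS"
    by (simp add: ts_iff tensor_op_def)
  have "((\<lambda>e. (hnorm H (B (T (A' e))))\<^sup>2) has_sum (hnorm TS (tensor_op K A B T))\<^sup>2) E"
    by (rule has_sum_cong[THEN iffD1, OF _ ts_hnorm_sum[OF TT]]) (simp add: app)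
  then have "(hnorm TS (tensor_op K A B T))\<^sup>2 \<le> (opnorm H B)\<^sup>2 * (\<Sum>\<^sub>\<infinity>e\<in>E. (hnorm H (T (A' e)))\<^sup>2)"
    by (rule has_sum_mono[OF _ has_sum_cmult_right[OF has_sum_infsum[OF ts_comp_adj_norm(1)[OF A T]]]])
       (use le in auto)
  also have "\<dots> \<le> (opnorm H B)\<^sup>2 * ((opnorm K A)\<^sup>2 * (hnorm TS T)\<^sup>2)"
    by (intro mult_left_mono ts_comp_adj_norm(2)[OF A T]) auto
  also have "\<dots> = (opnorm H B * opnorm K A * hnorm TS T)\<^sup>2"
    by (simp add: power_mult_distrib mult.assoc)
  finally show "hnorm TS (tensor_op K A B T) \<le> opnorm H B * opnorm K A * hnorm TS T"
    by (rule power2_le_imp_le)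
       (intro mult_nonneg_nonneg H.opnorm_nonneg B K.opnorm_nonneg K.adjoint_pairD(1)[OF A] TS.hnorm_ge_0 T)
qed

lemma tensor_op_bops:
  assumes "A \<in> bops K" "B \<in> bops H"
  shows "tensor_op K A B \<in> bops TS"
proof (rule bopsI)
  note A = K.adjoint_pair_adj[OF assms(1)]
  note A' = K.adjoint_pairD(2)[OF A]
  note cl = tensor_op_in_and_norm(1)[OF A assms(2)]
  have app: "tensor_op K A B T x = B (T (adj K A x))" if "x \<in> carrier K" for x T
    using that by (simp add: tensor_op_def)
  have "tensor_op K A B (S \<oplus>\<^bsub>TS\<^esub> T) = tensor_op K A B S \<oplus>\<^bsub>TS\<^esub> tensor_op K A B T"
    if "S \<in> carrier TS" "T \<in> carrier TS" for S T
    using that assms A'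
    by (intro ts_eqI cl ts_add_closed) (auto simp: app ts_apply bops_in bops_add ts_in)
  moreover have "tensor_op K A B (c \<odot>\<^bsub>TS\<^esub> T) = c \<odot>\<^bsub>TS\<^esub> tensor_op K A B T"
    if "T \<in> carrier TS" for c T
    using that assms A'
    by (intro ts_eqI cl ts_smult_closed) (auto simp: app ts_apply bops_in bops_smult ts_in)
  ultimately show "hlinear TS TS (tensor_op K A B)"
    using cl by (auto simp: hlinear_def)
  show "hnorm TS (tensor_op K A B T) \<le> (opnorm H B * opnorm K A) * hnorm TS T"
    if "T \<in> carrier TS" for T
    using tensor_op_in_and_norm(2)[OF A assms(2) that] .
qed

text \<open>
  The factor \<open>B\<close> moves across the inner product term by term.  The factor \<open>A\<close> moves after both
  vectors have been replaced by their adjoints, where it acts on the values in \<open>K\<close>.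
\<close>

lemma tensor_op_adjoint:
  assumes A: "adjoint_pair K A A'" and B: "adjoint_pair H B B'"
  shows "adjoint_pair TS (tensor_op K A B) (tensor_op K A' B')"
  unfolding adjoint_pair_def
proof (intro conjI ballI tensor_op_bops)
  note A_bops = K.adjoint_pairD(1,2)[OF A] and B_bops = H.adjoint_pairD(1,2)[OF B]
  show "A \<in> bops K" "A' \<in> bops K" "B \<in> bops H" "B' \<in> bops H" by (rule A_bops B_bops)+
  fix T U assume T: "T \<in> carrier TS" and U: "U \<in> carrier TS"
  define W where "W = tensor_op K id B' U"
  have W: "W \<in> carrier TS"
    unfolding W_def by (rule tensor_op_in_and_norm(1)[OF K.adjoint_pair_id B_bops(2) U])
  have Wapp: "W x = B' (U x)" if "x \<in> carrier K" for x
    unfolding W_def using tensor_op_apply[OF K.adjoint_pair_id that] by simp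
  obtain t w where t: "cadjoint T t" and w: "cadjoint W w"
    using ts_cadjoint[OF T] ts_cadjoint[OF W] by blast
  define G where "G = some_basis H"
  have G: "orthonormal_basis H G" unfolding G_def by (rule H.some_basis)
  note A_sym = K.adjoint_pair_sym[OF A]
  have "ip TS (tensor_op K A B T) U = (\<Sum>\<^sub>\<infinity>e\<in>E. ip H (B (T (A' e))) (U e))"
    unfolding ts_simps by (rule infsum_cong) (simp add: tensor_op_apply[OF A])
  also have "\<dots> = (\<Sum>\<^sub>\<infinity>e\<in>E. ip H (T (A' e)) (W e))"
    using T U A_bops by (intro infsum_cong) (simp add: Wapp ts_in bops_in H.adjoint_pairD(3)[OF B])
  also have "\<dots> = (\<Sum>\<^sub>\<infinity>g\<in>G. ip K (A (t g)) (w g))"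
    by (rule infsumI[symmetric], rule hs_ip_dual[OF ts_comp_adj[OF A t] w E_basis G
          ts_comp_adj_norm(1)[OF A T] ts_summable[OF W]])
  also have "\<dots> = (\<Sum>\<^sub>\<infinity>g\<in>G. ip K (t g) (A' (w g)))"
    using t w H.basis_in[OF G] by (intro infsum_cong) (auto simp: cadjoint_def K.adjoint_pairD(3)[OF A])
  also have "\<dots> = (\<Sum>\<^sub>\<infinity>e\<in>E. ip H (T e) (W (A e)))"
    by (rule infsumI, rule hs_ip_dual[OF t ts_comp_adj[OF A_sym w] E_basis G
          ts_summable[OF T] ts_comp_adj_norm(1)[OF A_sym W]])
  also have "\<dots> = ip TS T (tensor_op K A' B' U)"
    unfolding ts_simps using A_bops
    by (intro infsum_cong) (simp add: tensor_op_apply[OF A_sym] Wapp bops_in)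
  finally show "ip TS (tensor_op K A B T) U = ip TS T (tensor_op K A' B' U)" .
qed

end

section \<open>Compressions of operator polynomials\<close>

text \<open>
  Taken together, the maps \<open>L s\<close> form an isometry from \<open>H\<close> into a direct sum of copies of \<open>G\<close>, and
  they intertwine the adjoints of the \<open>P \<alpha>\<close> with the adjoints of the \<open>R \<alpha>\<close>.  So the adjoint of
  \<open>\<Sum> A \<alpha> \<otimes> P \<alpha>\<close> is the restriction to an invariant subspace of a direct sum of copies of the adjoint of
  \<open>\<Sum> A \<alpha> \<otimes> R \<alpha>\<close>, and its norm is not larger.  A family \<open>L\<close> is used instead of a single isometry so
  that no direct sum has to be formed: the norms are compared for each \<open>s\<close> and then summed.
\<close>

theorem compression_norm_le:
  fixes K :: "'k hilb" and H :: "'h hilb" and G :: "'g hilb" and L :: "'s \<Rightarrow> 'h \<Rightarrow> 'g"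
  assumes "hilbert_space K" "hilbert_space H" "hilbert_space G"
    and A: "\<And>\<alpha>. \<alpha> \<in> J \<Longrightarrow> A \<alpha> \<in> bops K"
    and P: "\<And>\<alpha>. \<alpha> \<in> J \<Longrightarrow> adjoint_pair H (P \<alpha>) (P' \<alpha>)"
    and R: "\<And>\<alpha>. \<alpha> \<in> J \<Longrightarrow> adjoint_pair G (R \<alpha>) (R' \<alpha>)"
    and L: "\<And>s. s \<in> S \<Longrightarrow> hlinear H G (L s)"
    and iso: "\<And>h. h \<in> carrier H \<Longrightarrow> ((\<lambda>s. (hnorm G (L s h))\<^sup>2) has_sum (hnorm H h)\<^sup>2) S"
    and inter: "\<And>s \<alpha> h. s \<in> S \<Longrightarrow> \<alpha> \<in> J \<Longrightarrow> h \<in> carrier H \<Longrightarrow> L s (P' \<alpha> h) = R' \<alpha> (L s h)"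
  shows "opnorm (tensor_space K H) (op_sum (tensor_space K H) (\<lambda>\<alpha>. tensor_op K (A \<alpha>) (P \<alpha>)) J)
    \<le> opnorm (tensor_space K G) (op_sum (tensor_space K G) (\<lambda>\<alpha>. tensor_op K (A \<alpha>) (R \<alpha>)) J)"
proof -
  interpret KH: tensor K H using assms by (simp add: tensor_def)
  interpret KG: tensor K G using assms by (simp add: tensor_def)
  let ?TH = "tensor_space K H" and ?TG = "tensor_space K G"
  define Q where "Q = op_sum ?TH (\<lambda>\<alpha>. tensor_op K (A \<alpha>) (P \<alpha>)) J"
  define Q' where "Q' = op_sum ?TH (\<lambda>\<alpha>. tensor_op K (adj K (A \<alpha>)) (P' \<alpha>)) J"
  define M where "M = op_sum ?TG (\<lambda>\<alpha>. tensor_op K (A \<alpha>) (R \<alpha>)) J"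
  define M' where "M' = op_sum ?TG (\<lambda>\<alpha>. tensor_op K (adj K (A \<alpha>)) (R' \<alpha>)) J"
  have pQ: "adjoint_pair ?TH Q Q'"
    unfolding Q_def Q'_def
    by (intro KH.TS.adjoint_pair_sum KH.tensor_op_adjoint KH.K.adjoint_pair_adj A P)
  have pM: "adjoint_pair ?TG M M'"
    unfolding M_def M'_def
    by (intro KG.TS.adjoint_pair_sum KG.tensor_op_adjoint KH.K.adjoint_pair_adj A R)
  define C where "C = opnorm ?TG M"
  have M: "M \<in> bops ?TG" using KG.TS.adjoint_pairD(1)[OF pM] .
  have Q: "Q \<in> bops ?TH" "Q' \<in> bops ?TH" using KH.TS.adjoint_pairD(1,2)[OF pQ] .
  have C: "0 \<le> C" unfolding C_def by (rule KG.TS.opnorm_nonneg[OF M])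
  have M'_le: "hnorm ?TG (M' W) \<le> C * hnorm ?TG W" if "W \<in> carrier ?TG" for W
    unfolding C_def
    by (rule KG.TS.adjoint_pair_norm[OF pM KG.TS.opnorm_nonneg[OF M] KG.TS.opnorm_bound[OF M] that])
  have L_in: "L s h \<in> carrier G" if "s \<in> S" "h \<in> carrier H" for s h
    using hlinear_in[OF L[OF that(1)] that(2)] .
  have L_le: "hnorm G (L s h) \<le> hnorm H h" if "s \<in> S" "h \<in> carrier H" for s h
  proof (rule power2_le_imp_le)
    show "(hnorm G (L s h))\<^sup>2 \<le> (hnorm H h)\<^sup>2"
      using finite_sum_le_has_sum[OF iso[OF that(2)], of "{s}"] that by auto
  qed (use that in auto)
  \<comment> \<open>\<open>V s U\<close> is the image of \<open>U\<close> under the tensor product of the identity of \<open>K\<close> with \<open>L s\<close>\<close>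
  define V where "V s U = restrict (\<lambda>x. L s (U x)) (carrier K)" for s and U :: "'k \<Rightarrow> 'h"
  have V_in: "V s U \<in> carrier ?TG" if s: "s \<in> S" and U: "U \<in> carrier ?TH" for s U
  proof -
    have "KG.clinear (V s U)"
      unfolding KG.clinear_def
    proof (intro conjI ballI allI)
      have Ul: "U (x \<oplus>\<^bsub>K\<^esub> y) = U x \<oplus>\<^bsub>H\<^esub> U y" "U (c \<odot>\<^bsub>K\<^esub> x) = cnj c \<odot>\<^bsub>H\<^esub> U x"
        if "x \<in> carrier K" "y \<in> carrier K" for x y c
        using U that by (auto simp: KH.ts_iff KH.clinear_def)
      have Ll: "L s (x \<oplus>\<^bsub>H\<^esub> y) = L s x \<oplus>\<^bsub>G\<^esub> L s y" "L s (c \<odot>\<^bsub>H\<^esub> x) = c \<odot>\<^bsub>G\<^esub> L s x"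
        if "x \<in> carrier H" "y \<in> carrier H" for x y c
        using L[OF s] that by (auto simp: hlinear_def)
      show "V s U \<in> carrier K \<rightarrow> carrier G"
        using L_in[OF s] KH.ts_in[OF U] by (auto simp: V_def)
      show "V s U (x \<oplus>\<^bsub>K\<^esub> y) = V s U x \<oplus>\<^bsub>G\<^esub> V s U y" if "x \<in> carrier K" "y \<in> carrier K" for x y
        using that KH.ts_in[OF U] by (simp add: V_def Ul Ll)
      show "V s U (c \<odot>\<^bsub>K\<^esub> x) = cnj c \<odot>\<^bsub>G\<^esub> V s U x" if "x \<in> carrier K" for c x
        using that Ll(2)[OF KH.ts_in[OF U that] KH.ts_in[OF U that]] by (simp add: V_def Ul)
      have "hnorm G (V s U x) \<le> hnorm ?TH U * hnorm K x" if "x \<in> carrier K" for x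
        using L_le[OF s KH.ts_in[OF U that]] KH.ts_apply_bound[OF U that] that by (simp add: V_def)
      then show "\<exists>C. \<forall>x\<in>carrier K. hnorm G (V s U x) \<le> C * hnorm K x" by blast
    qed
    moreover have "(\<lambda>e. (hnorm G (V s U e))\<^sup>2) summable_on some_basis K"
    proof (rule summable_on_comparison_test[OF KH.ts_summable[OF U]])
      fix e assume "e \<in> some_basis K"
      then have e: "e \<in> carrier K" by simp
      show "(hnorm G (V s U e))\<^sup>2 \<le> (hnorm H (U e))\<^sup>2"
        using e L_le[OF s KH.ts_in[OF U e]] L_in[OF s KH.ts_in[OF U e]]
        by (simp add: V_def power_mono)
    qed auto
    ultimately show ?thesis by (simp add: KG.ts_iff V_def)
  qed
  have V_norm: "((\<lambda>s. (hnorm ?TG (V s U))\<^sup>2) has_sum (hnorm ?TH U)\<^sup>2) S" if U: "U \<in> carrier ?TH" for U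
  proof (rule has_sum_swap_nonneg[where I = "some_basis K"])
    show "((\<lambda>s. (hnorm G (V s U e))\<^sup>2) has_sum (hnorm H (U e))\<^sup>2) S" if "e \<in> some_basis K" for e
      using iso[OF KH.ts_in[OF U]] that by (simp add: V_def)
    show "((\<lambda>e. (hnorm G (V s U e))\<^sup>2) has_sum (hnorm ?TG (V s U))\<^sup>2) (some_basis K)" if "s \<in> S" for s
      by (rule KG.ts_hnorm_sum[OF V_in[OF that U]])
  qed (use KH.ts_hnorm_sum[OF U] in auto)
  have V_inter: "V s (Q' U) = M' (V s U)" if s: "s \<in> S" and U: "U \<in> carrier ?TH" for s U
  proof (rule KG.ts_eqI)
    have A': "adjoint_pair K (adj K (A \<alpha>)) (A \<alpha>)" if "\<alpha> \<in> J" for \<alpha>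
      by (rule KH.K.adjoint_pair_sym[OF KH.K.adjoint_pair_adj[OF A[OF that]]])
    show "V s (Q' U) \<in> carrier ?TG" by (rule V_in[OF s bops_in[OF Q(2) U]])
    show "M' (V s U) \<in> carrier ?TG"
      by (rule bops_in[OF KG.TS.adjoint_pairD(2)[OF pM] V_in[OF s U]])
    fix x assume x: "x \<in> carrier K"
    have "V s (Q' U) x = L s (finsum ?TH (\<lambda>\<alpha>. tensor_op K (adj K (A \<alpha>)) (P' \<alpha>) U) J x)"
      using x by (simp add: V_def Q'_def op_sum_def)
    also have "finsum ?TH (\<lambda>\<alpha>. tensor_op K (adj K (A \<alpha>)) (P' \<alpha>) U) J x
        = finsum H (\<lambda>\<alpha>. tensor_op K (adj K (A \<alpha>)) (P' \<alpha>) U x) J"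
      by (rule KH.ts_finsum_apply[OF _ x],
          rule KH.tensor_op_in_and_norm(1)[OF A' KH.H.adjoint_pairD(2)[OF P] U])
    also have "\<dots> = finsum H (\<lambda>\<alpha>. P' \<alpha> (U (A \<alpha> x))) J"
      using KH.H.adjoint_pairD(2)[OF P] A x KH.ts_in[OF U]
      by (intro KH.H.M.finsum_cong') (auto simp: KH.tensor_op_apply[OF A'] bops_in)
    also have "L s \<dots> = finsum G (\<lambda>\<alpha>. L s (P' \<alpha> (U (A \<alpha> x)))) J"
      using KH.H.adjoint_pairD(2)[OF P] A x KH.ts_in[OF U]
      by (intro hlinear_finsum assms L s) (auto simp: bops_in)
    also have "\<dots> = finsum G (\<lambda>\<alpha>. tensor_op K (adj K (A \<alpha>)) (R' \<alpha>) (V s U) x) J"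
    proof (rule KG.H.M.finsum_cong')
      fix \<alpha> assume \<alpha>: "\<alpha> \<in> J"
      have UA: "A \<alpha> x \<in> carrier K" "U (A \<alpha> x) \<in> carrier H"
        using bops_in[OF A[OF \<alpha>] x] KH.ts_in[OF U] by auto
      show "L s (P' \<alpha> (U (A \<alpha> x))) = tensor_op K (adj K (A \<alpha>)) (R' \<alpha>) (V s U) x"
        using UA inter[OF s \<alpha> UA(2)] by (simp add: KG.tensor_op_apply[OF A'[OF \<alpha>] x] V_def)
    next
      show "(\<lambda>\<alpha>. tensor_op K (adj K (A \<alpha>)) (R' \<alpha>) (V s U) x) \<in> J \<rightarrow> carrier G"
        using KG.ts_in[OF KG.tensor_op_in_and_norm(1)[OF A' KG.H.adjoint_pairD(2)[OF R] V_in[OF s U]] x] by auto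
    qed auto
    also have "\<dots> = finsum ?TG (\<lambda>\<alpha>. tensor_op K (adj K (A \<alpha>)) (R' \<alpha>) (V s U)) J x"
      by (rule KG.ts_finsum_apply[OF _ x, symmetric],
          rule KG.tensor_op_in_and_norm(1)[OF A' KG.H.adjoint_pairD(2)[OF R] V_in[OF s U]])
    also have "\<dots> = M' (V s U) x" by (simp add: M'_def op_sum_def)
    finally show "V s (Q' U) x = M' (V s U) x" .
  qed
  have Q'_le: "hnorm ?TH (Q' U) \<le> C * hnorm ?TH U" if U: "U \<in> carrier ?TH" for U
  proof (rule power2_le_imp_le)
    have "(hnorm ?TH (Q' U))\<^sup>2 \<le> C\<^sup>2 * (hnorm ?TH U)\<^sup>2"
    proof (rule has_sum_mono[OF V_norm[OF bops_in[OF Q(2) U]] has_sum_cmult_right[OF V_norm[OF U]]])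
      fix s assume s: "s \<in> S"
      have "(hnorm ?TG (V s (Q' U)))\<^sup>2 \<le> (C * hnorm ?TG (V s U))\<^sup>2"
        unfolding V_inter[OF s U] using M'_le[OF V_in[OF s U]]
          bops_in[OF KG.TS.adjoint_pairD(2)[OF pM] V_in[OF s U]] by (intro power_mono) auto
      then show "(hnorm ?TG (V s (Q' U)))\<^sup>2 \<le> C\<^sup>2 * (hnorm ?TG (V s U))\<^sup>2"
        by (simp add: power_mult_distrib)
    qed
    then show "(hnorm ?TH (Q' U))\<^sup>2 \<le> (C * hnorm ?TH U)\<^sup>2" by (simp add: power_mult_distrib)
  qed (use C U in auto)
  have "hnorm ?TH (Q T) \<le> C * hnorm ?TH T" if "T \<in> carrier ?TH" for T
    by (rule KH.TS.adjoint_pair_norm[OF KH.TS.adjoint_pair_sym[OF pQ] C Q'_le that])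
  then show ?thesis
    unfolding Q_def[symmetric] M_def[symmetric] C_def[symmetric]
    by (intro KH.TS.opnorm_le[OF C])
qed

section \<open>Series of operators\<close>

context hilbert_space
begin

lemma op_minus_apply: "op_minus H T U x = T x \<ominus> U x"
  by (simp add: op_minus_def)

lemma opnorm_cong: "(\<And>x. x \<in> carrier H \<Longrightarrow> T x = U x) \<Longrightarrow> opnorm H T = opnorm H U"
  unfolding opnorm_def by (intro SUP_cong) auto

lemma opnorm_minus_commute:
  "T \<in> bops H \<Longrightarrow> U \<in> bops H \<Longrightarrow> opnorm H (op_minus H T U) = opnorm H (op_minus H U T)"
  unfolding opnorm_def op_minus_def by (intro SUP_cong) (auto simp: bops_in hnorm_minus_commute)

lemma opnorm_triangle:
  assumes T: "T \<in> bops H" and U: "U \<in> bops H"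
  shows "opnorm H T \<le> opnorm H (op_minus H T U) + opnorm H U"
proof (rule opnorm_le)
  note TU = bops_minus[OF T U]
  show "0 \<le> opnorm H (op_minus H T U) + opnorm H U"
    using opnorm_nonneg[OF TU] opnorm_nonneg[OF U] by simp
  fix x assume x: "x \<in> carrier H"
  have "hnorm H (T x) \<le> hnorm H (T x \<ominus> U x) + hnorm H (U x)"
    by (rule hnorm_le_minus_add[OF bops_in[OF T x] bops_in[OF U x]])
  then show "hnorm H (T x) \<le> (opnorm H (op_minus H T U) + opnorm H U) * hnorm H x"
    using opnorm_bound[OF TU x] opnorm_bound[OF U x] by (simp add: op_minus_def distrib_right)
qed

lemma op_has_sum_opnorm:
  assumes T: "\<And>i. i \<in> I \<Longrightarrow> T i \<in> bops H" and Q: "op_has_sum H T I Q"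
  shows "((\<lambda>J. opnorm H (op_sum H T J)) \<longlongrightarrow> opnorm H Q) (finite_subsets_at_top I)"
proof (rule Lim_null[THEN iffD2], rule Lim_null_comparison)
  have Qb: "Q \<in> bops H" using Q by (simp add: op_has_sum_def)
  show "((\<lambda>J. opnorm H (op_minus H Q (op_sum H T J))) \<longlongrightarrow> 0) (finite_subsets_at_top I)"
    using Q by (simp add: op_has_sum_def)
  have "norm (opnorm H (op_sum H T J) - opnorm H Q) \<le> opnorm H (op_minus H Q (op_sum H T J))"
    if "finite J" "J \<subseteq> I" for J
  proof -
    have S: "op_sum H T J \<in> bops H" using that T by (intro bops_sum) auto
    show ?thesis
      using opnorm_triangle[OF S Qb] opnorm_triangle[OF Qb S] opnorm_minus_commute[OF S Qb] by simp
  qed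
  then show "\<forall>\<^sub>F J in finite_subsets_at_top I.
      norm (opnorm H (op_sum H T J) - opnorm H Q) \<le> opnorm H (op_minus H Q (op_sum H T J))"
    by (auto simp: eventually_finite_subsets_at_top)
qed

lemma op_sum_diff:
  assumes T: "\<And>i. i \<in> J \<Longrightarrow> T i \<in> bops H" and J: "finite J" "J0 \<subseteq> J" and x: "x \<in> carrier H"
  shows "op_sum H T J x \<ominus> op_sum H T J0 x = op_sum H T (J - J0) x"
proof (rule eq_by_ip)
  have T0: "T i \<in> bops H" if "i \<in> J0" for i using that T J by auto
  have T1: "T i \<in> bops H" if "i \<in> J - J0" for i using that T J by auto
  show "op_sum H T J x \<ominus> op_sum H T J0 x \<in> carrier H"
    by (intro M.minus_closed op_sum_in T T0 x)
  show "op_sum H T (J - J0) x \<in> carrier H" by (intro op_sum_in T1 x)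
  fix z assume z: "z \<in> carrier H"
  have "ip H (op_sum H T (J - J0) x) z = (\<Sum>i\<in>J - J0. ip H (T i x) z)"
    using T x z by (intro ip_op_sum_left) auto
  then show "ip H (op_sum H T J x \<ominus> op_sum H T J0 x) z = ip H (op_sum H T (J - J0) x) z"
    using sum_diff[OF J, of "\<lambda>i. ip H (T i x) z"]
    by (simp add: ip_minus_left op_sum_in ip_op_sum_left T T0 T1 x z)
qed

end

text \<open>
  The Cauchy criterion for unordered sums: blocks of indices outside \<open>J0\<close> contribute little, being
  differences of two partial sums that are both close to the limit.
\<close>

lemma op_has_sum_small_blocks:
  assumes "hilbert_space G" and U: "\<And>i. i \<in> I \<Longrightarrow> U i \<in> bops G" and Q: "op_has_sum G U I Q" and "0 < \<epsilon>"
  shows "\<exists>J0. finite J0 \<and> J0 \<subseteq> I \<and>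
    (\<forall>J. finite J \<longrightarrow> J \<subseteq> I - J0 \<longrightarrow> opnorm G (op_sum G U J) \<le> \<epsilon>)"
proof -
  interpret G: hilbert_space G by fact
  have Qb: "Q \<in> bops G" using Q by (simp add: op_has_sum_def)
  have "\<forall>\<^sub>F J in finite_subsets_at_top I. opnorm G (op_minus G Q (op_sum G U J)) < \<epsilon> / 2"
    using Q \<open>0 < \<epsilon>\<close> unfolding op_has_sum_def by (intro order_tendstoD(2)) auto
  then obtain J0 where "finite J0 \<and> J0 \<subseteq> I \<and>
    (\<forall>J. finite J \<and> J0 \<subseteq> J \<and> J \<subseteq> I \<longrightarrow> opnorm G (op_minus G Q (op_sum G U J)) < \<epsilon> / 2)"
    unfolding eventually_finite_subsets_at_top by (elim exE)
  then have J0: "finite J0" "J0 \<subseteq> I"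
    "\<And>J. finite J \<Longrightarrow> J0 \<subseteq> J \<Longrightarrow> J \<subseteq> I \<Longrightarrow> opnorm G (op_minus G Q (op_sum G U J)) < \<epsilon> / 2"
    by simp_all
  have "opnorm G (op_sum G U J) \<le> \<epsilon>" if J: "finite J" "J \<subseteq> I - J0" for J
  proof (rule G.opnorm_le)
    fix x assume x: "x \<in> carrier G"
    have J': "finite (J0 \<union> J)" "J0 \<union> J \<subseteq> I" "J0 \<union> J - J0 = J" using J J0 by auto
    have U0: "U i \<in> bops G" if "i \<in> J0" for i using that J0 U by auto
    have U1: "U i \<in> bops G" if "i \<in> J0 \<union> J" for i using that J' U by auto
    let ?a = "op_sum G U (J0 \<union> J) x" and ?b = "op_sum G U J0 x"
    have ab: "?a \<in> carrier G" "?b \<in> carrier G" "Q x \<in> carrier G"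
      using G.op_sum_in[of "J0 \<union> J" U x] G.op_sum_in[of J0 U x] U0 U1 x bops_in[OF Qb x] by auto
    have "op_sum G U J x = ?a \<ominus>\<^bsub>G\<^esub> ?b"
      using G.op_sum_diff[of "J0 \<union> J" U J0 x] U1 J' x by simp
    then have "hnorm G (op_sum G U J x) \<le> hnorm G (?a \<ominus>\<^bsub>G\<^esub> Q x) + hnorm G (Q x \<ominus>\<^bsub>G\<^esub> ?b)"
      using G.hnorm_triangle_minus[OF ab(1,3,2)] by simp
    also have "hnorm G (?a \<ominus>\<^bsub>G\<^esub> Q x) = hnorm G (op_minus G Q (op_sum G U (J0 \<union> J)) x)"
      unfolding G.op_minus_apply by (rule G.hnorm_minus_commute[OF ab(1,3)])
    also have "\<dots> \<le> opnorm G (op_minus G Q (op_sum G U (J0 \<union> J))) * hnorm G x"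
      by (intro G.opnorm_bound G.bops_minus G.bops_sum Qb U1 x)
    also have "\<dots> \<le> \<epsilon> / 2 * hnorm G x"
      using J0(3)[OF J'(1) _ J'(2)] x by (intro mult_right_mono) auto
    also have "hnorm G (Q x \<ominus>\<^bsub>G\<^esub> ?b) = hnorm G (op_minus G Q (op_sum G U J0) x)"
      unfolding G.op_minus_apply ..
    also have "\<dots> \<le> opnorm G (op_minus G Q (op_sum G U J0)) * hnorm G x"
      by (intro G.opnorm_bound G.bops_minus G.bops_sum Qb U0 x)
    also have "\<dots> \<le> \<epsilon> / 2 * hnorm G x"
      using J0(3)[OF J0(1) _ J0(2)] x by (intro mult_right_mono) auto
    finally show "hnorm G (op_sum G U J x) \<le> \<epsilon> * hnorm G x" by simp
  qed (use \<open>0 < \<epsilon>\<close> in simp)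
  then show ?thesis using J0(1,2) by (intro exI[of _ J0]) simp
qed

text \<open>
  Completeness of a Hilbert space speaks of sequences only, so the limit is taken along an increasing
  sequence \<open>L m\<close> of finite sets that contain the exceptional sets for \<open>\<epsilon> = 1 / (m + 1)\<close>.
\<close>

lemma (in hilbert_space) op_cauchy_summable:
  assumes T: "\<And>i. i \<in> I \<Longrightarrow> T i \<in> bops H"
    and cauchy: "\<And>\<epsilon>. 0 < \<epsilon> \<Longrightarrow> \<exists>J0. finite J0 \<and> J0 \<subseteq> I \<and>
      (\<forall>J. finite J \<longrightarrow> J \<subseteq> I - J0 \<longrightarrow> opnorm H (op_sum H T J) \<le> \<epsilon>)"
  shows "\<exists>Q. op_has_sum H T I Q"
proof -
  have "\<forall>m :: nat. \<exists>J0. finite J0 \<and> J0 \<subseteq> I \<and>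
      (\<forall>J. finite J \<longrightarrow> J \<subseteq> I - J0 \<longrightarrow> opnorm H (op_sum H T J) \<le> 1 / Suc m)"
    using cauchy by simp
  then obtain B where "\<forall>m :: nat. finite (B m) \<and> B m \<subseteq> I \<and>
      (\<forall>J. finite J \<longrightarrow> J \<subseteq> I - B m \<longrightarrow> opnorm H (op_sum H T J) \<le> 1 / Suc m)"
    by (rule choice[THEN exE])
  then have B: "finite (B m)" "B m \<subseteq> I"
    "\<And>J. finite J \<Longrightarrow> J \<subseteq> I - B m \<Longrightarrow> opnorm H (op_sum H T J) \<le> 1 / Suc m" for m
    by auto
  define L where "L m = (\<Union>l\<le>m. B l)" for m
  have L: "finite (L m)" "L m \<subseteq> I" "m \<le> l \<Longrightarrow> B m \<subseteq> L l" for m l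
    using B by (auto simp: L_def)
  have TJ: "op_sum H T J \<in> bops H" if "J \<subseteq> I" for J
    using that T by (intro bops_sum) auto
  have step: "hnorm H (op_sum H T J x \<ominus> op_sum H T (B m) x) \<le> 1 / Suc m * hnorm H x"
    if J: "finite J" "J \<subseteq> I" "B m \<subseteq> J" and x: "x \<in> carrier H" for J m x
  proof -
    have "op_sum H T J x \<ominus> op_sum H T (B m) x = op_sum H T (J - B m) x"
      by (rule op_sum_diff[OF _ J(1,3) x]) (use T J in auto)
    also have "hnorm H \<dots> \<le> opnorm H (op_sum H T (J - B m)) * hnorm H x"
      using J by (intro opnorm_bound TJ x) auto
    also have "\<dots> \<le> 1 / Suc m * hnorm H x"
      using J x by (intro mult_right_mono B(3)) auto
    finally show ?thesis .
  qed
  have near: "hnorm H (op_sum H T J x \<ominus> op_sum H T J' x) \<le> 2 / Suc m * hnorm H x"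
    if J: "finite J" "J \<subseteq> I" "B m \<subseteq> J" and J': "finite J'" "J' \<subseteq> I" "B m \<subseteq> J'" and x: "x \<in> carrier H" for J J' m x
  proof -
    note ins = bops_in[OF TJ[OF J(2)] x] bops_in[OF TJ[OF B(2)] x, of m] bops_in[OF TJ[OF J'(2)] x]
    have "hnorm H (op_sum H T J x \<ominus> op_sum H T J' x)
        \<le> hnorm H (op_sum H T J x \<ominus> op_sum H T (B m) x) + hnorm H (op_sum H T (B m) x \<ominus> op_sum H T J' x)"
      by (rule hnorm_triangle_minus[OF ins])
    also have "\<dots> \<le> 1 / Suc m * hnorm H x + 1 / Suc m * hnorm H x"
      using step[OF J x] step[OF J' x] hnorm_minus_commute[OF ins(2,3)] by simp
    finally show ?thesis by simp
  qed
  have arch: "\<exists>m. c / real (Suc m) < e" if "0 < e" "0 \<le> c" for c e :: real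
  proof -
    obtain m where "c / e < real (Suc m)" using reals_Archimedean2 less_Suc_eq by (metis of_nat_less_iff less_trans lessI)
    then show ?thesis using that by (auto simp: field_simps)
  qed
  have "\<exists>y. y \<in> carrier H \<and> (\<lambda>m. hnorm H (op_sum H T (L m) x \<ominus> y)) \<longlonglongrightarrow> 0" if x: "x \<in> carrier H" for x
  proof -
    have "\<exists>y\<in>carrier H. (\<lambda>m. hnorm H (op_sum H T (L m) x \<ominus> y)) \<longlonglongrightarrow> 0"
    proof (rule complete)
      show "op_sum H T (L m) x \<in> carrier H" for m by (rule bops_in[OF TJ[OF L(2)] x])
      fix e :: real assume "0 < e"
      then obtain m where m: "(2 * hnorm H x) / Suc m < e" using arch[of e "2 * hnorm H x"] x by auto
      have "hnorm H (op_sum H T (L l) x \<ominus> op_sum H T (L l') x) < e" if "l \<ge> m" "l' \<ge> m" for l l'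
        using near[OF L(1,2) L(3)[OF that(1)] L(1,2) L(3)[OF that(2)] x] m by simp
      then show "\<exists>N. \<forall>l\<ge>N. \<forall>m\<ge>N. hnorm H (op_sum H T (L l) x \<ominus> op_sum H T (L m) x) < e" by blast
    qed
    then show ?thesis by blast
  qed
  then obtain Q where "\<forall>x\<in>carrier H. Q x \<in> carrier H \<and> (\<lambda>m. hnorm H (op_sum H T (L m) x \<ominus> Q x)) \<longlonglongrightarrow> 0"
    using bchoice[of "carrier H" "\<lambda>x y. y \<in> carrier H \<and> (\<lambda>m. hnorm H (op_sum H T (L m) x \<ominus> y)) \<longlonglongrightarrow> 0"] by blast
  then have Q: "Q x \<in> carrier H" "(\<lambda>m. hnorm H (op_sum H T (L m) x \<ominus> Q x)) \<longlonglongrightarrow> 0" if "x \<in> carrier H" for x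
    using that by auto
  note LH = bops_in[OF TJ[OF L(2)]]
  have lim: "(\<lambda>m. ip H (op_sum H T (L m) x) z) \<longlonglongrightarrow> ip H (Q x) z" if "x \<in> carrier H" "z \<in> carrier H" for x z
    by (rule tendsto_ip_left[OF LH[OF that(1)] Q(1)[OF that(1)] that(2) Q(2)[OF that(1)]])
  have lin: "hlinear H H Q"
    unfolding hlinear_def
  proof (intro conjI ballI allI)
    show "Q \<in> carrier H \<rightarrow> carrier H" using Q by auto
    fix x y assume xy: "x \<in> carrier H" "y \<in> carrier H"
    show "Q (x \<oplus> y) = Q x \<oplus> Q y"
    proof (rule eq_by_limits[OF _ _ Q(2)])
      fix z assume z: "z \<in> carrier H"
      have "(\<lambda>m. ip H (op_sum H T (L m) x \<oplus> op_sum H T (L m) y) z) \<longlonglongrightarrow> ip H (Q x \<oplus> Q y) z"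
        using tendsto_add[OF lim[OF xy(1) z] lim[OF xy(2) z]] xy z Q(1)
        by (simp add: ip_add_left LH)
      then show "(\<lambda>m. ip H (op_sum H T (L m) (x \<oplus> y)) z) \<longlonglongrightarrow> ip H (Q x \<oplus> Q y) z"
        using xy by (simp add: bops_add[OF TJ[OF L(2)]])
    qed (use xy Q(1) LH in auto)
  next
    fix c x assume x: "x \<in> carrier H"
    show "Q (c \<odot> x) = c \<odot> Q x"
    proof (rule eq_by_limits[OF _ _ Q(2)])
      fix z assume z: "z \<in> carrier H"
      have "(\<lambda>m. ip H (c \<odot> op_sum H T (L m) x) z) \<longlonglongrightarrow> ip H (c \<odot> Q x) z"
        using tendsto_mult[OF tendsto_const[of c] lim[OF x z]] x z Q(1)
        by (simp add: ip_smult_left LH)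
      then show "(\<lambda>m. ip H (op_sum H T (L m) (c \<odot> x)) z) \<longlonglongrightarrow> ip H (c \<odot> Q x) z"
        using x by (simp add: bops_smult[OF TJ[OF L(2)]])
    qed (use x Q(1) LH in auto)
  qed
  have close: "hnorm H (Q x \<ominus> op_sum H T J x) \<le> 2 / Suc m * hnorm H x"
    if J: "finite J" "J \<subseteq> I" "B m \<subseteq> J" and x: "x \<in> carrier H" for J m x
  proof (rule LIMSEQ_le_const)
    note Jx = bops_in[OF TJ[OF J(2)] x]
    show "(\<lambda>l. hnorm H (op_sum H T (L l) x \<ominus> Q x) + 2 / Suc m * hnorm H x) \<longlonglongrightarrow> 2 / Suc m * hnorm H x"
      using tendsto_add[OF Q(2)[OF x] tendsto_const[of "2 / Suc m * hnorm H x"]] by simp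
    show "\<exists>N. \<forall>l\<ge>N. hnorm H (Q x \<ominus> op_sum H T J x) \<le> hnorm H (op_sum H T (L l) x \<ominus> Q x) + 2 / Suc m * hnorm H x"
    proof (intro exI allI impI)
      fix l assume "m \<le> l"
      then have "hnorm H (op_sum H T (L l) x \<ominus> op_sum H T J x) \<le> 2 / Suc m * hnorm H x"
        by (intro near J L x)
      then show "hnorm H (Q x \<ominus> op_sum H T J x) \<le> hnorm H (op_sum H T (L l) x \<ominus> Q x) + 2 / Suc m * hnorm H x"
        using hnorm_triangle_minus[OF Q(1)[OF x] LH[OF x] Jx, of l] hnorm_minus_commute[OF Q(1)[OF x] LH[OF x], of l]
        by simp
    qed
  qed
  have Qb: "Q \<in> bops H"
  proof (rule bopsI[OF lin])
    fix x assume x: "x \<in> carrier H"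
    have "hnorm H (Q x) \<le> hnorm H (Q x \<ominus> op_sum H T (B 0) x) + hnorm H (op_sum H T (B 0) x)"
      by (rule hnorm_le_minus_add[OF Q(1)[OF x] bops_in[OF TJ[OF B(2)] x]])
    also have "\<dots> \<le> 2 / Suc 0 * hnorm H x + opnorm H (op_sum H T (B 0)) * hnorm H x"
      by (intro add_mono close B x opnorm_bound TJ) auto
    finally show "hnorm H (Q x) \<le> (2 + opnorm H (op_sum H T (B 0))) * hnorm H x"
      by (simp add: distrib_right)
  qed
  have "((\<lambda>J. opnorm H (op_minus H Q (op_sum H T J))) \<longlongrightarrow> 0) (finite_subsets_at_top I)"
  proof (rule tendstoI)
    fix e :: real assume e: "0 < e"
    then obtain m where m: "2 / Suc m < e" using arch[of e 2] by auto
    have "dist (opnorm H (op_minus H Q (op_sum H T J))) 0 < e"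
      if J: "finite J" "J \<subseteq> I" "B m \<subseteq> J" for J
    proof -
      have "opnorm H (op_minus H Q (op_sum H T J)) \<le> 2 / Suc m"
        using close[OF J] by (intro opnorm_le) (auto simp: op_minus_def)
      then show ?thesis
        using m opnorm_nonneg[OF bops_minus[OF Qb TJ[OF J(2)]]] by (simp add: dist_real_def)
    qed
    then show "\<forall>\<^sub>F J in finite_subsets_at_top I. dist (opnorm H (op_minus H Q (op_sum H T J))) 0 < e"
      unfolding eventually_finite_subsets_at_top using B(1,2)[of m] by (intro exI[of _ "B m"]) simp
  qed
  then show ?thesis using Qb by (auto simp: op_has_sum_def)
qed

text \<open>
  Domination of all finite partial sums suffices to transfer convergence, since it also controls the
  differences of partial sums in the Cauchy criterion.
\<close>

theorem op_has_sum_comparison: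
  assumes "hilbert_space H" "hilbert_space G"
    and T: "\<And>i. i \<in> I \<Longrightarrow> T i \<in> bops H" and U: "\<And>i. i \<in> I \<Longrightarrow> U i \<in> bops G"
    and le: "\<And>J. finite J \<Longrightarrow> J \<subseteq> I \<Longrightarrow> opnorm H (op_sum H T J) \<le> opnorm G (op_sum G U J)"
    and Q: "\<exists>Q. op_has_sum G U I Q"
  shows "\<exists>Q. op_has_sum H T I Q" "opnorm H (op_infsum H T I) \<le> opnorm G (op_infsum G U I)"
proof -
  interpret H: hilbert_space H by fact
  interpret G: hilbert_space G by fact
  have QG: "op_has_sum G U I (op_infsum G U I)"
    unfolding op_infsum_def by (rule someI_ex[OF Q])
  show ex: "\<exists>Q. op_has_sum H T I Q"
  proof (rule H.op_cauchy_summable[OF T])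
    fix \<epsilon> :: real assume "0 < \<epsilon>"
    then obtain J0 where J0: "finite J0" "J0 \<subseteq> I"
        "\<And>J. finite J \<Longrightarrow> J \<subseteq> I - J0 \<Longrightarrow> opnorm G (op_sum G U J) \<le> \<epsilon>"
      using op_has_sum_small_blocks[OF assms(2) U QG, of \<epsilon>] by auto
    have "opnorm H (op_sum H T J) \<le> \<epsilon>" if "finite J" "J \<subseteq> I - J0" for J
      using J0(3)[OF that] le[of J] that by force
    then show "\<exists>J0. finite J0 \<and> J0 \<subseteq> I \<and>
      (\<forall>J. finite J \<longrightarrow> J \<subseteq> I - J0 \<longrightarrow> opnorm H (op_sum H T J) \<le> \<epsilon>)"
      using J0(1,2) by (intro exI[of _ J0]) simp
  qed
  have QH: "op_has_sum H T I (op_infsum H T I)"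
    unfolding op_infsum_def by (rule someI_ex[OF ex])
  show "opnorm H (op_infsum H T I) \<le> opnorm G (op_infsum G U I)"
    by (rule tendsto_le[OF _ G.op_has_sum_opnorm[OF U QG] H.op_has_sum_opnorm[OF T QH]])
       (auto simp: eventually_finite_subsets_at_top intro!: le)
qed

section \<open>Polynomials in tuples of operators\<close>

lemma finite_multiwords_deg: "finite (multiwords_deg k n p)"
proof (rule finite_subset)
  show "multiwords_deg k n p \<subseteq> (\<Pi>\<^sub>E i\<in>{1..k}. {w. set w \<subseteq> {1..n i} \<and> length w = p i})"
    unfolding multiwords_deg_def multiwords_def lists_eq_set by (intro subsetI PiE_I) (auto simp: PiE_iff extensional_def)
  show "finite (\<Pi>\<^sub>E i\<in>{1..k}. {w. set w \<subseteq> {1..n i} \<and> length w = p i})"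
    by (intro finite_PiE finite_lists_length_eq) auto
qed

lemma multiwords_deg_disjoint:
  assumes "p \<in> multidegrees k" "q \<in> multidegrees k" "p \<noteq> q"
  shows "multiwords_deg k n p \<inter> multiwords_deg k n q = {}"
proof (rule ccontr)
  assume "\<not> ?thesis"
  then obtain \<alpha> where "\<alpha> \<in> multiwords_deg k n p" "\<alpha> \<in> multiwords_deg k n q" by blast
  then have 1: "length (\<alpha> i) = p i" "length (\<alpha> i) = q i" if "i \<in> {1..k}" for i
    using that unfolding multiwords_deg_def by blast+
  have "p i = q i" if "i \<in> {1..k}" for i using 1[OF that] by simp
  then have "p = q"
    using assms(1,2) by (intro PiE_ext[of p "{1..k}" "\<lambda>_. UNIV" q]) (auto simp: multidegrees_def)
  then show False using assms by blast
qed

lemma multiwords_in: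
  assumes "\<alpha> \<in> multiwords k n" "i \<in> {1..k}"
  shows "set (\<alpha> i) \<subseteq> {1..n i}"
  using PiE_mem[OF assms[unfolded multiwords_def]] by auto

context hilbert_space
begin

lemma word_op_bops: "(\<And>j. j \<in> set w \<Longrightarrow> Xi j \<in> bops H) \<Longrightarrow> word_op Xi w \<in> bops H"
  by (induction w) (auto simp: word_op_def bops_id bops_comp)

lemma multiword_op_bops:
  assumes X: "\<And>i j. i \<in> {1..k} \<Longrightarrow> j \<in> {1..n i} \<Longrightarrow> X i j \<in> bops H" and \<alpha>: "\<alpha> \<in> multiwords k n"
  shows "multiword_op k X \<alpha> \<in> bops H"
proof -
  have w: "word_op (X i) (\<alpha> i) \<in> bops H" if "i \<in> {1..k}" for i
    using multiwords_in[OF \<alpha> that] X[OF that] by (intro word_op_bops) blast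
  have "foldr (\<lambda>i T. word_op (X i) (\<alpha> i) \<circ> T) is id \<in> bops H" if "set is \<subseteq> {1..k}" for "is"
    using that w by (induction "is") (auto intro!: bops_id bops_comp)
  from this[of "[1..<Suc k]"] show ?thesis
    unfolding multiword_op_def by (simp del: upt_Suc add: atLeastLessThanSuc_atLeastAtMost)
qed

end

text \<open>
  The maps \<open>L s\<close> carry the adjoint of \<open>P\<close> to the adjoint of \<open>R\<close>.  This relation is preserved by
  products and multiples, so that it need only be checked for the generators of an algebra.
\<close>

definition intertwined :: "'a hilb \<Rightarrow> 'b hilb \<Rightarrow> ('s \<Rightarrow> 'a \<Rightarrow> 'b) \<Rightarrow> 's set \<Rightarrow> ('a \<Rightarrow> 'a) \<Rightarrow> ('b \<Rightarrow> 'b) \<Rightarrow> bool" where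
  "intertwined H G L S P R \<longleftrightarrow> P \<in> bops H \<and> R \<in> bops G \<and>
     (\<forall>s\<in>S. \<forall>h\<in>carrier H. L s (adj H P h) = adj G R (L s h))"

locale intertwining = H: hilbert_space H + G: hilbert_space G
  for H :: "'a hilb" and G :: "'b hilb" +
  fixes L :: "'s \<Rightarrow> 'a \<Rightarrow> 'b" and S :: "'s set"
  assumes L: "\<And>s. s \<in> S \<Longrightarrow> hlinear H G (L s)"
begin

lemma L_in: "s \<in> S \<Longrightarrow> h \<in> carrier H \<Longrightarrow> L s h \<in> carrier G"
  using hlinear_in[OF L] by blast

lemma intertwined_id: "intertwined H G L S id id"
  using L_in H.adj_eq[OF H.adjoint_pair_id] G.adj_eq[OF G.adjoint_pair_id]
  by (auto simp: intertwined_def H.bops_id G.bops_id)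

lemma intertwined_comp:
  assumes 1: "intertwined H G L S P R" and 2: "intertwined H G L S P' R'"
  shows "intertwined H G L S (P \<circ> P') (R \<circ> R')"
proof -
  have b: "P \<in> bops H" "P' \<in> bops H" "R \<in> bops G" "R' \<in> bops G"
    using assms by (auto simp: intertwined_def)
  note aH = H.adjoint_pair_adj[OF b(1)] H.adjoint_pair_adj[OF b(2)]
  note aG = G.adjoint_pair_adj[OF b(3)] G.adjoint_pair_adj[OF b(4)]
  have "L s (adj H (P \<circ> P') h) = adj G (R \<circ> R') (L s h)" if "s \<in> S" "h \<in> carrier H" for s h
    using 1 2 that L_in[OF that] bops_in[OF H.adjoint_pairD(2)[OF aH(1)] that(2)]
    by (simp add: H.adj_eq[OF H.adjoint_pair_comp[OF aH]] G.adj_eq[OF G.adjoint_pair_comp[OF aG]]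
        intertwined_def)
  then show ?thesis using b by (auto simp: intertwined_def H.bops_comp G.bops_comp)
qed

lemma intertwined_scale:
  assumes "intertwined H G L S P R"
  shows "intertwined H G L S (\<lambda>x. c \<odot>\<^bsub>H\<^esub> P x) (\<lambda>x. c \<odot>\<^bsub>G\<^esub> R x)"
proof -
  have b: "P \<in> bops H" "R \<in> bops G"
    using assms by (auto simp: intertwined_def)
  note aH = H.adjoint_pair_adj[OF b(1)] and aG = G.adjoint_pair_adj[OF b(2)]
  have "L s (adj H (\<lambda>x. c \<odot>\<^bsub>H\<^esub> P x) h) = adj G (\<lambda>x. c \<odot>\<^bsub>G\<^esub> R x) (L s h)"
    if s: "s \<in> S" and h: "h \<in> carrier H" for s h
    using assms s h L_in[OF s h] bops_in[OF H.adjoint_pairD(2)[OF aH] h] L[OF s]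
    by (simp add: H.adj_eq[OF H.adjoint_pair_scale[OF aH]] G.adj_eq[OF G.adjoint_pair_scale[OF aG]]
        intertwined_def hlinear_def)
  then show ?thesis using b by (auto simp: intertwined_def H.bops_scale G.bops_scale)
qed

lemma intertwined_multiword_op:
  assumes X: "\<And>i j. i \<in> {1..k} \<Longrightarrow> j \<in> {1..n i} \<Longrightarrow> intertwined H G L S (X i j) (Z i j)"
    and \<alpha>: "\<alpha> \<in> multiwords k n"
  shows "intertwined H G L S (multiword_op k X \<alpha>) (multiword_op k Z \<alpha>)"
proof -
  have w: "intertwined H G L S (word_op (X i) w) (word_op (Z i) w)"
    if "i \<in> {1..k}" "set w \<subseteq> {1..n i}" for i w
    using that(2) by (induction w) (auto simp: word_op_def intro!: intertwined_id intertwined_comp X that(1))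
  have "intertwined H G L S (foldr (\<lambda>i T. word_op (X i) (\<alpha> i) \<circ> T) is id)
      (foldr (\<lambda>i T. word_op (Z i) (\<alpha> i) \<circ> T) is id)" if "set is \<subseteq> {1..k}" for "is"
    using that w[OF _ multiwords_in[OF \<alpha>]]
    by (induction "is") (auto intro!: intertwined_id intertwined_comp)
  from this[of "[1..<Suc k]"] show ?thesis
    unfolding multiword_op_def by (simp del: upt_Suc add: atLeastLessThanSuc_atLeastAtMost)
qed

end

context tensor
begin

lemma homogeneous_part_bops:
  assumes "\<And>\<alpha>. \<alpha> \<in> multiwords k n \<Longrightarrow> A \<alpha> \<in> bops K"
    and "\<And>i j. i \<in> {1..k} \<Longrightarrow> j \<in> {1..n i} \<Longrightarrow> X i j \<in> bops H"
  shows "homogeneous_part k n K A H X p \<in> bops TS"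
  unfolding homogeneous_part_def
  by (intro TS.bops_sum tensor_op_bops H.multiword_op_bops[of k n] assms) (auto simp: multiwords_deg_def)

lemma partial_sum_flatten:
  assumes A: "\<And>\<alpha>. \<alpha> \<in> multiwords k n \<Longrightarrow> A \<alpha> \<in> bops K"
    and X: "\<And>i j. i \<in> {1..k} \<Longrightarrow> j \<in> {1..n i} \<Longrightarrow> X i j \<in> bops H"
    and D: "finite D" "D \<subseteq> multidegrees k" and T: "T \<in> carrier TS"
  shows "op_sum TS (homogeneous_part k n K A H X) D T
    = op_sum TS (\<lambda>\<alpha>. tensor_op K (A \<alpha>) (multiword_op k X \<alpha>)) (\<Union>p\<in>D. multiwords_deg k n p) T"
  unfolding op_sum_def homogeneous_part_def
proof (rule TS.M.add.finprod_UN_disjoint[symmetric])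
  show "pairwise (\<lambda>p q. disjnt (multiwords_deg k n p) (multiwords_deg k n q)) D"
    unfolding pairwise_def disjnt_def using multiwords_deg_disjoint D(2) by blast
  show "\<And>p \<alpha>. p \<in> D \<Longrightarrow> \<alpha> \<in> multiwords_deg k n p
      \<Longrightarrow> tensor_op K (A \<alpha>) (multiword_op k X \<alpha>) T \<in> carrier TS"
    by (intro bops_in[OF tensor_op_bops T] A H.multiword_op_bops[of k n] X) (auto simp: multiwords_deg_def)
qed (auto simp: D finite_multiwords_deg)

end

section \<open>Square summable families and the creation operators\<close>

lemma ell2_iff:
  "f \<in> carrier (ell2 I) \<longleftrightarrow> (\<forall>x. x \<notin> I \<longrightarrow> f x = 0) \<and> (\<lambda>x. (cmod (f x))\<^sup>2) summable_on I"
  by (auto simp: ell2_def)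

lemma ell2_simps:
  "\<zero>\<^bsub>ell2 I\<^esub> = (\<lambda>_. 0)" "f \<oplus>\<^bsub>ell2 I\<^esub> g = (\<lambda>x. f x + g x)" "c \<odot>\<^bsub>ell2 I\<^esub> f = (\<lambda>x. c * f x)"
  "ip (ell2 I) f g = (\<Sum>\<^sub>\<infinity>x\<in>I. f x * cnj (g x))"
  by (simp_all add: ell2_def)

lemma ell2_lincomb:
  assumes "f \<in> carrier (ell2 I)" "g \<in> carrier (ell2 I)"
  shows "(\<lambda>x. f x + c * g x) \<in> carrier (ell2 I)"
proof -
  have "(\<lambda>x. (cmod (f x + c * g x))\<^sup>2) summable_on I"
  proof (rule summable_on_comparison_test)
    show "(\<lambda>x. 2 * (cmod (f x))\<^sup>2 + 2 * (cmod c)\<^sup>2 * (cmod (g x))\<^sup>2) summable_on I"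
      using assms by (intro summable_on_add summable_on_cmult_right) (auto simp: ell2_iff)
    fix x
    have "(cmod (f x + c * g x))\<^sup>2 \<le> (cmod (f x) + cmod c * cmod (g x))\<^sup>2"
      using norm_triangle_ineq[of "f x" "c * g x"] by (intro power_mono) (auto simp: norm_mult)
    also have "\<dots> \<le> 2 * (cmod (f x))\<^sup>2 + 2 * (cmod c * cmod (g x))\<^sup>2"
      using zero_le_power2[of "cmod (f x) - cmod c * cmod (g x)"] by (simp add: power2_sum power2_diff)
    finally show "(cmod (f x + c * g x))\<^sup>2 \<le> 2 * (cmod (f x))\<^sup>2 + 2 * (cmod c)\<^sup>2 * (cmod (g x))\<^sup>2"
      by (simp add: power_mult_distrib)
  qed auto
  then show ?thesis using assms by (auto simp: ell2_iff)
qed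

lemma ell2_zero_closed: "(\<lambda>_. 0) \<in> carrier (ell2 I)"
  by (simp add: ell2_iff)

lemma ell2_add_closed:
  "f \<in> carrier (ell2 I) \<Longrightarrow> g \<in> carrier (ell2 I) \<Longrightarrow> (\<lambda>x. f x + g x) \<in> carrier (ell2 I)"
  using ell2_lincomb[of f I g 1] by simp

lemma ell2_smult_closed: "g \<in> carrier (ell2 I) \<Longrightarrow> (\<lambda>x. c * g x) \<in> carrier (ell2 I)"
  using ell2_lincomb[OF ell2_zero_closed, of g I c] by simp

lemma ell2_module: "module complex_field (ell2 I)"
proof (rule moduleI)
  show "abelian_group (ell2 I)"
  proof (rule abelian_groupI)
    fix f assume "f \<in> carrier (ell2 I)"
    then show "\<exists>g\<in>carrier (ell2 I). g \<oplus>\<^bsub>ell2 I\<^esub> f = \<zero>\<^bsub>ell2 I\<^esub>"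
      by (intro bexI[OF _ ell2_smult_closed[of f I "-1"]]) (auto simp: ell2_simps)
  qed (auto simp: ell2_simps ell2_add_closed ell2_zero_closed algebra_simps)
qed (auto intro: cring_complex_field simp: ell2_simps ell2_smult_closed algebra_simps)

lemma ell2_minus:
  assumes "f \<in> carrier (ell2 I)" "g \<in> carrier (ell2 I)"
  shows "f \<ominus>\<^bsub>ell2 I\<^esub> g = (\<lambda>x. f x - g x)"
proof -
  interpret M: module complex_field "ell2 I" by (rule ell2_module)
  have "g \<oplus>\<^bsub>ell2 I\<^esub> (\<ominus>\<^bsub>ell2 I\<^esub> g) = \<zero>\<^bsub>ell2 I\<^esub>" using assms by (simp add: M.r_neg)
  then have "(\<ominus>\<^bsub>ell2 I\<^esub> g) = (\<lambda>x. - g x)"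
    by (simp add: ell2_simps fun_eq_iff add_eq_0_iff)
  then show ?thesis by (simp add: M.minus_eq ell2_simps)
qed

lemma ell2_ip_has_sum:
  assumes "f \<in> carrier (ell2 I)" "g \<in> carrier (ell2 I)"
  shows "((\<lambda>x. f x * cnj (g x)) has_sum ip (ell2 I) f g) I"
proof -
  have "(\<lambda>x. f x * cnj (g x)) summable_on I"
  proof (rule abs_summable_summable, rule Infinite_Sum.abs_summable_on_comparison_test)
    show "(\<lambda>x. norm ((cmod (f x))\<^sup>2 + (cmod (g x))\<^sup>2)) summable_on I"
      using assms by (auto simp: ell2_iff intro!: summable_on_add)
    fix x
    have "cmod (f x) * cmod (g x) \<le> (cmod (f x))\<^sup>2 + (cmod (g x))\<^sup>2"
      using zero_le_power2[of "cmod (f x) - cmod (g x)"] zero_le_power2[of "cmod (f x)"]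
        zero_le_power2[of "cmod (g x)"]
      by (simp only: power2_diff)
    then show "cmod (f x * cnj (g x)) \<le> norm ((cmod (f x))\<^sup>2 + (cmod (g x))\<^sup>2)"
      by (simp add: norm_mult)
  qed
  then show ?thesis by (simp add: ell2_simps)
qed

lemma ell2_norm_sum:
  assumes "f \<in> carrier (ell2 I)"
  shows "((\<lambda>x. (cmod (f x))\<^sup>2) has_sum Re (ip (ell2 I) f f)) I"
proof -
  have "((\<lambda>x. Re (f x * cnj (f x))) has_sum Re (ip (ell2 I) f f)) I"
    using has_sum_bounded_linear[OF bounded_linear_Re ell2_ip_has_sum[OF assms assms]] .
  then show ?thesis
    by (rule has_sum_cong[THEN iffD1, rotated]) (simp add: of_real_cmod_sq[symmetric] flip: of_real_power)
qed

lemma ell2_hnorm_sum: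
  assumes "f \<in> carrier (ell2 I)"
  shows "((\<lambda>x. (cmod (f x))\<^sup>2) has_sum (hnorm (ell2 I) f)\<^sup>2) I"
proof -
  have "0 \<le> Re (ip (ell2 I) f f)" by (rule has_sum_nonneg[OF ell2_norm_sum[OF assms]]) auto
  then show ?thesis using ell2_norm_sum[OF assms] by (simp add: hnorm_def)
qed

lemma ell2_hnorm_nonneg: "f \<in> carrier (ell2 I) \<Longrightarrow> 0 \<le> hnorm (ell2 I) f"
  using has_sum_nonneg[OF ell2_norm_sum] by (force simp: hnorm_def)

lemma ell2_finite_sum_le:
  assumes "f \<in> carrier (ell2 I)" "finite F" "F \<subseteq> I"
  shows "(\<Sum>x\<in>F. (cmod (f x))\<^sup>2) \<le> (hnorm (ell2 I) f)\<^sup>2"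
  by (rule finite_sum_le_has_sum[OF ell2_hnorm_sum[OF assms(1)] assms(2,3)]) auto

lemma ell2_coordinate_le:
  assumes "f \<in> carrier (ell2 I)"
  shows "cmod (f x) \<le> hnorm (ell2 I) f"
proof (cases "x \<in> I")
  case True
  then have "(cmod (f x))\<^sup>2 \<le> (hnorm (ell2 I) f)\<^sup>2"
    using ell2_finite_sum_le[OF assms, of "{x}"] by simp
  then show ?thesis using ell2_hnorm_nonneg[OF assms] by (rule power2_le_imp_le)
qed (use assms ell2_hnorm_nonneg in \<open>auto simp: ell2_iff\<close>)

text \<open>
  The argument of \<open>ts_complete\<close>, with coordinates in place of point evaluations.
\<close>

lemma ell2_complete:
  assumes \<sigma>: "\<And>m :: nat. \<sigma> m \<in> carrier (ell2 I)"
    and cauchy: "\<And>e. 0 < e \<Longrightarrow> \<exists>N. \<forall>l\<ge>N. \<forall>m\<ge>N. hnorm (ell2 I) (\<sigma> l \<ominus>\<^bsub>ell2 I\<^esub> \<sigma> m) < e"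
  shows "\<exists>f\<in>carrier (ell2 I). (\<lambda>m. hnorm (ell2 I) (\<sigma> m \<ominus>\<^bsub>ell2 I\<^esub> f)) \<longlonglongrightarrow> 0"
proof -
  interpret M: module complex_field "ell2 I" by (rule ell2_module)
  have diff_in: "(\<lambda>x. \<sigma> l x - \<sigma> m x) \<in> carrier (ell2 I)" for l m
    using M.minus_closed[OF \<sigma> \<sigma>, of l m] by (simp add: ell2_minus \<sigma>)
  have cauchy': "\<exists>N. \<forall>l\<ge>N. \<forall>m\<ge>N. hnorm (ell2 I) (\<lambda>x. \<sigma> l x - \<sigma> m x) < e" if "0 < e" for e
    using cauchy[OF that] by (simp add: ell2_minus \<sigma>)
  have "convergent (\<lambda>m. \<sigma> m x)" for x
  proof (rule Cauchy_convergent, rule CauchyI)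
    fix e :: real assume "0 < e"
    then obtain N where N: "\<And>l m. l \<ge> N \<Longrightarrow> m \<ge> N \<Longrightarrow> hnorm (ell2 I) (\<lambda>x. \<sigma> l x - \<sigma> m x) < e"
      using cauchy'[of e] by auto
    have "norm (\<sigma> l x - \<sigma> m x) < e" if "l \<ge> N" "m \<ge> N" for l m
      using N[OF that] ell2_coordinate_le[OF diff_in[of l m], of x] by simp
    then show "\<exists>N. \<forall>l\<ge>N. \<forall>m\<ge>N. norm (\<sigma> l x - \<sigma> m x) < e" by blast
  qed
  then obtain f where f: "\<And>x. (\<lambda>m. \<sigma> m x) \<longlonglongrightarrow> f x"
    unfolding convergent_def by metis
  have f0: "f x = 0" if "x \<notin> I" for x
  proof -
    have "\<sigma> m x = 0" for m using \<sigma>[of m] that by (auto simp: ell2_iff)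
    then show ?thesis using f[of x] by (simp add: LIMSEQ_const_iff)
  qed
  have close: "\<exists>N. \<forall>m\<ge>N. \<forall>F. finite F \<longrightarrow> F \<subseteq> I \<longrightarrow> (\<Sum>x\<in>F. (cmod (\<sigma> m x - f x))\<^sup>2) \<le> \<epsilon>\<^sup>2"
    if \<epsilon>: "0 < \<epsilon>" for \<epsilon>
  proof -
    obtain N where N: "\<And>l m. l \<ge> N \<Longrightarrow> m \<ge> N \<Longrightarrow> hnorm (ell2 I) (\<lambda>x. \<sigma> l x - \<sigma> m x) < \<epsilon>"
      using cauchy'[OF \<epsilon>] by auto
    have "(\<Sum>x\<in>F. (cmod (\<sigma> m x - f x))\<^sup>2) \<le> \<epsilon>\<^sup>2" if m: "m \<ge> N" and F: "finite F" "F \<subseteq> I" for m F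
    proof (rule LIMSEQ_le_const2)
      show "(\<lambda>l. \<Sum>x\<in>F. (cmod (\<sigma> m x - \<sigma> l x))\<^sup>2) \<longlonglongrightarrow> (\<Sum>x\<in>F. (cmod (\<sigma> m x - f x))\<^sup>2)"
        by (intro tendsto_intros f)
      have "(\<Sum>x\<in>F. (cmod (\<sigma> m x - \<sigma> l x))\<^sup>2) \<le> \<epsilon>\<^sup>2" if l: "l \<ge> N" for l
      proof -
        have "(\<Sum>x\<in>F. (cmod (\<sigma> m x - \<sigma> l x))\<^sup>2) \<le> (hnorm (ell2 I) (\<lambda>x. \<sigma> m x - \<sigma> l x))\<^sup>2"
          by (rule ell2_finite_sum_le[OF diff_in F])
        also have "\<dots> \<le> \<epsilon>\<^sup>2"
          using N[OF m l] ell2_hnorm_nonneg[OF diff_in, of m l] by (intro power_mono) auto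
        finally show ?thesis .
      qed
      then show "\<exists>N. \<forall>l\<ge>N. (\<Sum>x\<in>F. (cmod (\<sigma> m x - \<sigma> l x))\<^sup>2) \<le> \<epsilon>\<^sup>2" by blast
    qed
    then show ?thesis by blast
  qed
  have d_in: "(\<lambda>x. \<sigma> m x - f x) \<in> carrier (ell2 I)"
    if "\<And>F. finite F \<Longrightarrow> F \<subseteq> I \<Longrightarrow> (\<Sum>x\<in>F. (cmod (\<sigma> m x - f x))\<^sup>2) \<le> c" for m c
    using summable_on_of_finite_bounds(1)[OF _ that] \<sigma>[of m] f0 by (auto simp: ell2_iff)
  obtain N where N: "\<And>F. finite F \<Longrightarrow> F \<subseteq> I \<Longrightarrow> (\<Sum>x\<in>F. (cmod (\<sigma> N x - f x))\<^sup>2) \<le> 1\<^sup>2"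
    using close[of 1] by auto
  have "(\<lambda>x. \<sigma> N x + (-1) * (\<sigma> N x - f x)) \<in> carrier (ell2 I)"
    by (intro ell2_lincomb[of "\<sigma> N"] \<sigma> d_in[OF N])
  then have f_in: "f \<in> carrier (ell2 I)" by simp
  have "(\<lambda>m. hnorm (ell2 I) (\<lambda>x. \<sigma> m x - f x)) \<longlonglongrightarrow> 0"
  proof (rule LIMSEQ_I)
    fix r :: real assume r: "0 < r"
    obtain N where N: "\<And>m F. m \<ge> N \<Longrightarrow> finite F \<Longrightarrow> F \<subseteq> I \<Longrightarrow> (\<Sum>x\<in>F. (cmod (\<sigma> m x - f x))\<^sup>2) \<le> (r/2)\<^sup>2"
      using close[of "r/2"] r by auto
    have "norm (hnorm (ell2 I) (\<lambda>x. \<sigma> m x - f x) - 0) < r" if m: "m \<ge> N" for m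
    proof -
      have d: "(\<lambda>x. \<sigma> m x - f x) \<in> carrier (ell2 I)" by (rule d_in[OF N[OF m]])
      have "(hnorm (ell2 I) (\<lambda>x. \<sigma> m x - f x))\<^sup>2 \<le> (r/2)\<^sup>2"
        by (rule has_sum_le_finite_sums[OF ell2_hnorm_sum[OF d] N[OF m]])
      then have "hnorm (ell2 I) (\<lambda>x. \<sigma> m x - f x) \<le> r/2" by (rule power2_le_imp_le) (use r in simp)
      then show ?thesis using r ell2_hnorm_nonneg[OF d] by simp
    qed
    then show "\<exists>N. \<forall>m\<ge>N. norm (hnorm (ell2 I) (\<lambda>x. \<sigma> m x - f x) - 0) < r" by blast
  qed
  then show ?thesis using f_in by (intro bexI[of _ f]) (simp_all add: ell2_minus \<sigma>)
qed

lemma ell2_hilbert: "hilbert_space (ell2 I)"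
proof (rule hilbert_space.intro[OF ell2_module], unfold_locales)
  fix f g h assume fgh: "f \<in> carrier (ell2 I)" "g \<in> carrier (ell2 I)" "h \<in> carrier (ell2 I)"
  have "((\<lambda>x. f x * cnj (h x) + g x * cnj (h x)) has_sum ip (ell2 I) f h + ip (ell2 I) g h) I"
    by (intro has_sum_add ell2_ip_has_sum fgh)
  then have "((\<lambda>x. (f \<oplus>\<^bsub>ell2 I\<^esub> g) x * cnj (h x)) has_sum ip (ell2 I) f h + ip (ell2 I) g h) I"
    by (simp add: ell2_simps distrib_right)
  moreover have "((\<lambda>x. (f \<oplus>\<^bsub>ell2 I\<^esub> g) x * cnj (h x)) has_sum ip (ell2 I) (f \<oplus>\<^bsub>ell2 I\<^esub> g) h) I"
    using fgh by (intro ell2_ip_has_sum) (auto simp: ell2_simps(2) ell2_add_closed)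
  ultimately show "ip (ell2 I) (f \<oplus>\<^bsub>ell2 I\<^esub> g) h = ip (ell2 I) f h + ip (ell2 I) g h"
    by (rule has_sum_unique[rotated])
next
  fix c f g assume fg: "f \<in> carrier (ell2 I)" "g \<in> carrier (ell2 I)"
  have "((\<lambda>x. c * (f x * cnj (g x))) has_sum c * ip (ell2 I) f g) I"
    by (intro has_sum_cmult_right ell2_ip_has_sum fg)
  then have "((\<lambda>x. (c \<odot>\<^bsub>ell2 I\<^esub> f) x * cnj (g x)) has_sum c * ip (ell2 I) f g) I"
    by (simp add: ell2_simps mult.assoc)
  moreover have "((\<lambda>x. (c \<odot>\<^bsub>ell2 I\<^esub> f) x * cnj (g x)) has_sum ip (ell2 I) (c \<odot>\<^bsub>ell2 I\<^esub> f) g) I"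
    using fg by (intro ell2_ip_has_sum) (auto simp: ell2_simps(3) ell2_smult_closed)
  ultimately show "ip (ell2 I) (c \<odot>\<^bsub>ell2 I\<^esub> f) g = c * ip (ell2 I) f g"
    by (rule has_sum_unique[rotated])
next
  fix f g assume fg: "f \<in> carrier (ell2 I)" "g \<in> carrier (ell2 I)"
  have "((\<lambda>x. cnj (f x * cnj (g x))) has_sum cnj (ip (ell2 I) f g)) I"
    using has_sum_bounded_linear[OF bounded_linear_cnj ell2_ip_has_sum[OF fg]] .
  then have "((\<lambda>x. g x * cnj (f x)) has_sum cnj (ip (ell2 I) f g)) I"
    by (simp add: mult.commute)
  then show "ip (ell2 I) g f = cnj (ip (ell2 I) f g)"
    by (rule has_sum_unique[OF ell2_ip_has_sum[OF fg(2,1)]])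
next
  fix f assume f: "f \<in> carrier (ell2 I)"
  show "0 \<le> Re (ip (ell2 I) f f)" by (rule has_sum_nonneg[OF ell2_norm_sum[OF f]]) auto
  assume "ip (ell2 I) f f = 0"
  then have "hnorm (ell2 I) f = 0" by (simp add: hnorm_def)
  then show "f = \<zero>\<^bsub>ell2 I\<^esub>"
    using ell2_coordinate_le[OF f] by (simp add: ell2_simps fun_eq_iff)
qed (use ell2_complete in blast)

definition push :: "nat \<Rightarrow> nat \<Rightarrow> (nat \<Rightarrow> nat list) \<Rightarrow> nat \<Rightarrow> nat list" where
  "push i j \<alpha> = \<alpha>(i := j # \<alpha> i)"

definition annihilation :: "nat \<Rightarrow> (nat \<Rightarrow> nat) \<Rightarrow> nat \<Rightarrow> nat \<Rightarrow> ((nat \<Rightarrow> nat list) \<Rightarrow> complex)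
    \<Rightarrow> (nat \<Rightarrow> nat list) \<Rightarrow> complex" where
  "annihilation k n i j f = (\<lambda>\<alpha>. if \<alpha> \<in> multiwords k n then f (push i j \<alpha>) else 0)"

lemma inj_push: "inj (push i j)"
proof (rule injI)
  fix \<alpha> \<beta> assume eq: "push i j \<alpha> = push i j \<beta>"
  have "\<alpha> l = \<beta> l" for l
    using fun_cong[OF eq, of l] by (cases "l = i") (auto simp: push_def)
  then show "\<alpha> = \<beta>" by blast
qed

lemma push_in:
  assumes "i \<in> {1..k}" "j \<in> {1..n i}"
  shows "push i j \<alpha> \<in> multiwords k n \<longleftrightarrow> \<alpha> \<in> multiwords k n"
proof
  assume p: "push i j \<alpha> \<in> multiwords k n"
  show "\<alpha> \<in> multiwords k n"
    unfolding multiwords_def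
  proof (rule PiE_I)
    fix l assume "l \<in> {1..k}"
    then have "push i j \<alpha> l \<in> lists {1..n l}" using p by (auto simp: multiwords_def PiE_iff)
    then show "\<alpha> l \<in> lists {1..n l}" by (auto simp: push_def split: if_splits)
  next
    fix l assume "l \<notin> {1..k}"
    then have "push i j \<alpha> l = undefined" "l \<noteq> i"
      using p assms by (auto simp: multiwords_def PiE_iff extensional_def)
    then show "\<alpha> l = undefined" by (simp add: push_def)
  qed
next
  assume a: "\<alpha> \<in> multiwords k n"
  show "push i j \<alpha> \<in> multiwords k n"
    unfolding multiwords_def
  proof (rule PiE_I)
    fix l assume "l \<in> {1..k}"
    then show "push i j \<alpha> l \<in> lists {1..n l}"
      using a assms PiE_mem[OF a[unfolded multiwords_def], of l] by (auto simp: push_def)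
  next
    fix l assume "l \<notin> {1..k}"
    then show "push i j \<alpha> l = undefined"
      using a assms by (auto simp: push_def multiwords_def PiE_iff extensional_def)
  qed
qed

lemma creation_push: "creation i j f (push i j \<alpha>) = f \<alpha>"
  by (simp add: creation_def push_def)

lemma creation_not_push: "\<alpha> \<notin> range (push i j) \<Longrightarrow> creation i j f \<alpha> = 0"
proof (rule ccontr)
  assume 1: "\<alpha> \<notin> range (push i j)" and "creation i j f \<alpha> \<noteq> 0"
  then have "\<alpha> i \<noteq> []" "hd (\<alpha> i) = j" by (auto simp: creation_def split: if_splits)
  then have "\<alpha> = push i j (\<alpha>(i := tl (\<alpha> i)))" by (auto simp: push_def fun_eq_iff)
  then show False using 1 by blast
qed

lemma creation_eq_0:
  assumes f: "\<And>\<beta>. \<beta> \<notin> W \<Longrightarrow> f \<beta> = 0" and \<alpha>: "\<alpha> \<notin> push i j ` W"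
  shows "creation i j f \<alpha> = 0"
proof (cases "\<alpha> \<in> range (push i j)")
  case True
  then obtain \<beta> where \<beta>: "\<alpha> = push i j \<beta>" by blast
  then have "\<beta> \<notin> W" using \<alpha> by blast
  then show ?thesis using f by (simp add: \<beta> creation_push)
qed (rule creation_not_push)

lemma fock_iff:
  "f \<in> carrier (fock k n) \<longleftrightarrow>
    (\<forall>\<alpha>. \<alpha> \<notin> multiwords k n \<longrightarrow> f \<alpha> = 0) \<and> (\<lambda>\<alpha>. (cmod (f \<alpha>))\<^sup>2) summable_on multiwords k n"
  by (simp add: fock_def ell2_iff)

lemma fock_hilbert: "hilbert_space (fock k n)"
  unfolding fock_def by (rule ell2_hilbert)

lemmas fock_simps = ell2_simps[of "multiwords k n", folded fock_def] for k n

lemmas fock_hnorm_sum = ell2_hnorm_sum[of f "multiwords k n", folded fock_def] for f k n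

lemma has_sum_push:
  "(g has_sum s) (push i j ` W) \<longleftrightarrow> ((\<lambda>\<alpha>. g (push i j \<alpha>)) has_sum s) W"
  using has_sum_reindex[OF inj_on_subset[OF inj_push[of i j] subset_UNIV[of W]], of g s] by (simp add: o_def)

text \<open>
  The creation operator moves the coefficient at \<open>\<alpha>\<close> to the position \<open>push i j \<alpha>\<close>, and \<open>push i j\<close> is
  injective.
\<close>

lemma creation_norm:
  assumes "i \<in> {1..k}" "j \<in> {1..n i}" and f: "f \<in> carrier (fock k n)"
  shows "creation i j f \<in> carrier (fock k n)" "hnorm (fock k n) (creation i j f) = hnorm (fock k n) f"
proof -
  let ?W = "multiwords k n"
  have f0: "f \<alpha> = 0" if "\<alpha> \<notin> ?W" for \<alpha> using f that by (auto simp: fock_iff)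
  have sub: "push i j ` ?W \<subseteq> ?W" using push_in[of i k j n, OF assms(1,2)] by auto
  have 1: "((\<lambda>\<alpha>. (cmod (creation i j f \<alpha>))\<^sup>2) has_sum (hnorm (fock k n) f)\<^sup>2) (push i j ` ?W)"
    using fock_hnorm_sum[OF f] by (simp add: has_sum_push creation_push)
  have van: "creation i j f \<alpha> = 0" if "\<alpha> \<notin> push i j ` ?W" for \<alpha>
    using creation_eq_0[OF f0 that] .
  have 2: "((\<lambda>\<alpha>. (cmod (creation i j f \<alpha>))\<^sup>2) has_sum (hnorm (fock k n) f)\<^sup>2) ?W"
    by (rule has_sum_cong_neutral[THEN iffD1, OF _ _ _ 1]) (use sub van in auto)
  show c: "creation i j f \<in> carrier (fock k n)"
    using 2 van sub by (auto simp: fock_iff summable_on_def)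
  have "(hnorm (fock k n) (creation i j f))\<^sup>2 = (hnorm (fock k n) f)\<^sup>2"
    by (rule has_sum_unique[OF fock_hnorm_sum[OF c] 2])
  moreover have "0 \<le> hnorm (fock k n) f" "0 \<le> hnorm (fock k n) (creation i j f)"
    using hilbert_space.hnorm_ge_0[OF fock_hilbert] f c by auto
  ultimately show "hnorm (fock k n) (creation i j f) = hnorm (fock k n) f" by simp
qed

lemma annihilation_norm:
  assumes "i \<in> {1..k}" "j \<in> {1..n i}" and f: "f \<in> carrier (fock k n)"
  shows "annihilation k n i j f \<in> carrier (fock k n)"
    "hnorm (fock k n) (annihilation k n i j f) \<le> hnorm (fock k n) f"
proof -
  let ?W = "multiwords k n"
  have f0: "f \<alpha> = 0" if "\<alpha> \<notin> ?W" for \<alpha> using f that by (auto simp: fock_iff)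
  have sub: "push i j ` ?W \<subseteq> ?W" using push_in[of i k j n, OF assms(1,2)] by auto
  have "(\<lambda>\<alpha>. (cmod (f \<alpha>))\<^sup>2) summable_on push i j ` ?W"
    by (rule summable_on_subset[OF _ sub]) (use f in \<open>auto simp: fock_iff\<close>)
  then obtain s where s: "((\<lambda>\<alpha>. (cmod (f \<alpha>))\<^sup>2) has_sum s) (push i j ` ?W)" by (auto simp: summable_on_def)
  have "((\<lambda>\<alpha>. (cmod (f (push i j \<alpha>)))\<^sup>2) has_sum s) ?W"
    using s by (simp add: has_sum_push)
  then have 2: "((\<lambda>\<alpha>. (cmod (annihilation k n i j f \<alpha>))\<^sup>2) has_sum s) ?W"
    by (rule has_sum_cong[THEN iffD1, rotated]) (simp add: annihilation_def)
  show c: "annihilation k n i j f \<in> carrier (fock k n)"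
    using 2 by (auto simp: fock_iff summable_on_def annihilation_def)
  have "(hnorm (fock k n) (annihilation k n i j f))\<^sup>2 = s"
    by (rule has_sum_unique[OF fock_hnorm_sum[OF c] 2])
  also have "s \<le> (hnorm (fock k n) f)\<^sup>2"
    by (rule has_sum_mono2[OF s fock_hnorm_sum[OF f] sub]) auto
  finally show "hnorm (fock k n) (annihilation k n i j f) \<le> hnorm (fock k n) f"
    using hilbert_space.hnorm_ge_0[OF fock_hilbert f] by (rule power2_le_imp_le)
qed

lemma creation_adjoint:
  assumes "i \<in> {1..k}" "j \<in> {1..n i}"
  shows "adjoint_pair (fock k n) (creation i j) (annihilation k n i j)"
  unfolding adjoint_pair_def
proof (intro conjI ballI)
  let ?W = "multiwords k n"
  note c = creation_norm[of i k j n, OF assms] and a = annihilation_norm[of i k j n, OF assms]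
  show "creation i j \<in> bops (fock k n)"
  proof (rule bopsI[of _ _ 1])
    show "hlinear (fock k n) (fock k n) (creation i j)"
      unfolding hlinear_def fock_simps
      by (intro conjI ballI allI funcsetI c(1)) (simp_all add: creation_def fun_eq_iff)
  qed (use c(2) in simp)
  show "annihilation k n i j \<in> bops (fock k n)"
  proof (rule bopsI[of _ _ 1])
    show "hlinear (fock k n) (fock k n) (annihilation k n i j)"
      unfolding hlinear_def fock_simps
      by (intro conjI ballI allI funcsetI a(1)) (simp_all add: annihilation_def fun_eq_iff)
  qed (use a(2) in simp)
  fix f g assume f: "f \<in> carrier (fock k n)" and g: "g \<in> carrier (fock k n)"
  have f0: "f \<alpha> = 0" if "\<alpha> \<notin> ?W" for \<alpha> using f that by (auto simp: fock_iff)
  have sub: "push i j ` ?W \<subseteq> ?W" using push_in[of i k j n, OF assms(1,2)] by auto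
  have van: "creation i j f \<alpha> = 0" if "\<alpha> \<notin> push i j ` ?W" for \<alpha>
    using creation_eq_0[OF f0 that] .
  have "ip (fock k n) (creation i j f) g = (\<Sum>\<^sub>\<infinity>\<alpha>\<in>?W. creation i j f \<alpha> * cnj (g \<alpha>))"
    by (simp add: fock_simps)
  also have "\<dots> = (\<Sum>\<^sub>\<infinity>\<alpha>\<in>push i j ` ?W. creation i j f \<alpha> * cnj (g \<alpha>))"
    by (rule infsum_cong_neutral) (use sub van in auto)
  also have "\<dots> = (\<Sum>\<^sub>\<infinity>\<alpha>\<in>?W. creation i j f (push i j \<alpha>) * cnj (g (push i j \<alpha>)))"
    by (subst infsum_reindex[OF inj_on_subset[OF inj_push subset_UNIV]]) (simp add: o_def)
  also have "\<dots> = (\<Sum>\<^sub>\<infinity>\<alpha>\<in>?W. f \<alpha> * cnj (annihilation k n i j g \<alpha>))"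
    by (rule infsum_cong) (simp add: creation_push annihilation_def)
  also have "\<dots> = ip (fock k n) f (annihilation k n i j g)" by (simp add: fock_simps)
  finally show "ip (fock k n) (creation i j f) g = ip (fock k n) f (annihilation k n i j g)" .
qed

section \<open>Telescoping sums over words\<close>

text \<open>
  If \<open>Q j\<close> is the adjoint of \<open>X j\<close>, then \<open>back_word Q w\<close> is the adjoint of the product of the \<open>X j\<close>
  along the word \<open>w\<close>: the first letter acts first.
\<close>

primrec back_word :: "(nat \<Rightarrow> 'a \<Rightarrow> 'a) \<Rightarrow> nat list \<Rightarrow> 'a \<Rightarrow> 'a" where
  "back_word Q [] = id"
| "back_word Q (j # w) = back_word Q w \<circ> Q j"

text \<open>
  The same for a multi-word, restricted to the components \<open>1, \<dots>, m\<close>.  The component \<open>m\<close> acts first,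
  so that it can be summed last; for adjoints of operators whose components commute the
  order makes no difference.
\<close>

primrec back_multi :: "(nat \<Rightarrow> nat \<Rightarrow> 'a \<Rightarrow> 'a) \<Rightarrow> nat \<Rightarrow> (nat \<Rightarrow> nat list) \<Rightarrow> 'a \<Rightarrow> 'a" where
  "back_multi Q 0 \<beta> = id"
| "back_multi Q (Suc m) \<beta> = back_multi Q m \<beta> \<circ> back_word (Q (Suc m)) (\<beta> (Suc m))"

definition words :: "nat \<Rightarrow> nat \<Rightarrow> nat list set" where
  "words m N = {w. set w \<subseteq> {1..m} \<and> length w = N}"

lemma finite_words: "finite (words m N)"
  unfolding words_def by (rule finite_lists_length_eq) simp

lemma words_0: "words m 0 = {[]}"
  by (auto simp: words_def)

lemma sum_words_Suc:
  fixes g :: "nat list \<Rightarrow> real"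
  shows "(\<Sum>w\<in>words m (Suc N). g w) = (\<Sum>j\<in>{1..m}. \<Sum>w\<in>words m N. g (j # w))"
proof -
  have "words m (Suc N) = (\<lambda>(j, w). j # w) ` ({1..m} \<times> words m N)"
  proof (rule Set.set_eqI)
    fix w
    show "w \<in> words m (Suc N) \<longleftrightarrow> w \<in> (\<lambda>(j, w). j # w) ` ({1..m} \<times> words m N)"
      by (cases w) (auto simp: words_def)
  qed
  moreover have "inj_on (\<lambda>(j, w). j # w) ({1..m} \<times> words m N)"
    by (auto simp: inj_on_def)
  ultimately show ?thesis
    by (simp add: sum.reindex sum.cartesian_product case_prod_unfold del: One_nat_def)
qed

context hilbert_space
begin

lemma back_word_in:
  assumes "\<And>j. j \<in> {1..m} \<Longrightarrow> Q j \<in> bops H"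
  shows "set w \<subseteq> {1..m} \<Longrightarrow> h \<in> carrier H \<Longrightarrow> back_word Q w h \<in> carrier H"
  by (induction w arbitrary: h) (simp_all add: bops_in[OF assms])

text \<open>
  The sum equals \<open>\<langle>\<Phi>\<^sup>N(I) h, h\<rangle>\<close> for the completely positive map \<open>\<Phi>\<close> with coefficients \<open>P\<close>, and the
  norm of \<open>\<Phi>(I)\<close> is the base of the power on the right.
\<close>

lemma word_norm_sum_le:
  assumes PQ: "\<And>j. j \<in> {1..m} \<Longrightarrow> adjoint_pair H (P j) (Q j)"
    and h: "h \<in> carrier H"
  shows "(\<Sum>w\<in>words m N. (hnorm H (back_word Q w h))\<^sup>2)
    \<le> opnorm H (op_sum H (\<lambda>j. P j \<circ> Q j) {1..m}) ^ N * (hnorm H h)\<^sup>2"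
  using h
proof (induction N arbitrary: h)
  case 0
  then show ?case by (simp add: words_0)
next
  case (Suc N)
  let ?c = "opnorm H (op_sum H (\<lambda>j. P j \<circ> Q j) {1..m})"
  note P = adjoint_pairD(1)[OF PQ] and Q = adjoint_pairD(2)[OF PQ]
  have PQb: "P j \<circ> Q j \<in> bops H" if "j \<in> {1..m}" for j
    by (rule bops_comp[OF P[OF that] Q[OF that]])
  have R: "op_sum H (\<lambda>j. P j \<circ> Q j) {1..m} \<in> bops H"
    by (rule bops_sum[OF PQb])
  note c = opnorm_nonneg[OF R]
  have Qh: "Q j h \<in> carrier H" if "j \<in> {1..m}" for j using bops_in[OF Q[OF that] Suc.prems] .
  have "(\<Sum>j\<in>{1..m}. (hnorm H (Q j h))\<^sup>2) = (\<Sum>j\<in>{1..m}. Re (ip H ((P j \<circ> Q j) h) h))"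
  proof (rule sum.cong[OF refl])
    fix j assume j: "j \<in> {1..m}"
    show "(hnorm H (Q j h))\<^sup>2 = Re (ip H ((P j \<circ> Q j) h) h)"
      using adjoint_pairD(3)[OF PQ[OF j] Qh[OF j] Suc.prems] Qh[OF j] by (simp add: hnorm_sq)
  qed
  also have "\<dots> = Re (ip H (op_sum H (\<lambda>j. P j \<circ> Q j) {1..m} h) h)"
    using ip_op_sum_left[of "{1..m}" "\<lambda>j. P j \<circ> Q j" h h] PQb Suc.prems by (simp add: Re_sum)
  also have "\<dots> \<le> cmod (ip H (op_sum H (\<lambda>j. P j \<circ> Q j) {1..m} h) h)" by (rule complex_Re_le_cmod)
  also have "\<dots> \<le> hnorm H (op_sum H (\<lambda>j. P j \<circ> Q j) {1..m} h) * hnorm H h"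
    by (rule ip_le_hnorm[OF bops_in[OF R Suc.prems] Suc.prems])
  also have "\<dots> \<le> (?c * hnorm H h) * hnorm H h"
    by (rule mult_right_mono[OF opnorm_bound[OF R Suc.prems] hnorm_ge_0[OF Suc.prems]])
  finally have Q_le: "(\<Sum>j\<in>{1..m}. (hnorm H (Q j h))\<^sup>2) \<le> ?c * (hnorm H h)\<^sup>2"
    by (simp add: power2_eq_square mult.assoc)
  have "(\<Sum>w\<in>words m (Suc N). (hnorm H (back_word Q w h))\<^sup>2)
      = (\<Sum>j\<in>{1..m}. \<Sum>w\<in>words m N. (hnorm H (back_word Q w (Q j h)))\<^sup>2)"
    by (simp add: sum_words_Suc del: One_nat_def)
  also have "\<dots> \<le> (\<Sum>j\<in>{1..m}. ?c ^ N * (hnorm H (Q j h))\<^sup>2)"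
    by (rule sum_mono) (rule Suc.IH[OF Qh])
  also have "\<dots> = ?c ^ N * (\<Sum>j\<in>{1..m}. (hnorm H (Q j h))\<^sup>2)"
    by (simp only: sum_distrib_left)
  also have "\<dots> \<le> ?c ^ N * (?c * (hnorm H h)\<^sup>2)"
    by (intro mult_left_mono Q_le zero_le_power c)
  finally show ?case by (simp only: power_Suc mult_ac)
qed

text \<open>
  With \<open>D' = D - \<Phi>(D)\<close> this is \<open>\<Phi>\<^sup>N(D') = \<Phi>\<^sup>N(D) - \<Phi>\<^sup>N\<^sup>+\<^sup>1(D)\<close>, evaluated at \<open>h\<close>.
\<close>

lemma word_form_telescope:
  assumes PQ: "\<And>j. j \<in> {1..m} \<Longrightarrow> adjoint_pair H (P j) (Q j)" and D: "D \<in> bops H"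
    and D': "\<And>h. h \<in> carrier H \<Longrightarrow> D' h = D h \<ominus> op_sum H (\<lambda>j. P j \<circ> D \<circ> Q j) {1..m} h"
    and h: "h \<in> carrier H"
  shows "(\<Sum>w\<in>words m N. Re (ip H (D' (back_word Q w h)) (back_word Q w h)))
    = (\<Sum>w\<in>words m N. Re (ip H (D (back_word Q w h)) (back_word Q w h)))
      - (\<Sum>w\<in>words m (Suc N). Re (ip H (D (back_word Q w h)) (back_word Q w h)))"
  using h
proof (induction N arbitrary: h)
  case 0
  note P = adjoint_pairD(1)[OF PQ] and Q = adjoint_pairD(2)[OF PQ]
  have b: "P j \<circ> D \<circ> Q j \<in> bops H" if "j \<in> {1..m}" for j
    by (rule bops_comp[OF bops_comp[OF P[OF that] D] Q[OF that]])
  have "ip H (op_sum H (\<lambda>j. P j \<circ> D \<circ> Q j) {1..m} h) h = (\<Sum>j\<in>{1..m}. ip H ((P j \<circ> D \<circ> Q j) h) h)"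
    using b 0 by (intro ip_op_sum_left) auto
  also have "\<dots> = (\<Sum>j\<in>{1..m}. ip H (D (Q j h)) (Q j h))"
  proof (rule sum.cong[OF refl])
    fix j assume j: "j \<in> {1..m}"
    show "ip H ((P j \<circ> D \<circ> Q j) h) h = ip H (D (Q j h)) (Q j h)"
      using adjoint_pairD(3)[OF PQ[OF j] bops_in[OF D bops_in[OF Q[OF j] 0]] 0] by simp
  qed
  finally have "ip H (D' h) h = ip H (D h) h - (\<Sum>j\<in>{1..m}. ip H (D (Q j h)) (Q j h))"
    using D'[OF 0] ip_minus_left[OF bops_in[OF D 0] op_sum_in[of "{1..m}" "\<lambda>j. P j \<circ> D \<circ> Q j" h] 0] b 0
    by simp
  then show ?case by (simp add: words_0 sum_words_Suc Re_sum del: One_nat_def)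
next
  case (Suc N)
  have Qh: "Q j h \<in> carrier H" if "j \<in> {1..m}" for j
    using bops_in[OF adjoint_pairD(2)[OF PQ[OF that]] Suc.prems] .
  show ?case
    unfolding sum_words_Suc[of _ m "Suc N"] sum_words_Suc[of _ m N] back_word.simps o_apply
    unfolding sum_subtractf[symmetric]
    by (rule sum.cong[OF refl]) (use Suc.IH[OF Qh] in \<open>simp add: sum_words_Suc\<close>)
qed

text \<open>
  If \<open>\<Phi>\<close> is a strict contraction, then \<open>\<Phi>\<^sup>N(D)\<close> tends to \<open>0\<close>, so the telescoping series of
  \<open>\<Phi>\<^sup>N(D - \<Phi>(D))\<close> sums to \<open>D\<close>.  Positivity of \<open>D - \<Phi>(D)\<close> makes the order of the words irrelevant.
\<close>

lemma word_form_has_sum: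
  assumes PQ: "\<And>j. j \<in> {1..m} \<Longrightarrow> adjoint_pair H (P j) (Q j)" and D: "D \<in> bops H"
    and D': "\<And>h. h \<in> carrier H \<Longrightarrow> D' h = D h \<ominus> op_sum H (\<lambda>j. P j \<circ> D \<circ> Q j) {1..m} h"
    and pos: "\<And>h. h \<in> carrier H \<Longrightarrow> 0 \<le> Re (ip H (D' h) h)"
    and contr: "opnorm H (op_sum H (\<lambda>j. P j \<circ> Q j) {1..m}) < 1"
    and h: "h \<in> carrier H"
  shows "((\<lambda>w. Re (ip H (D' (back_word Q w h)) (back_word Q w h))) has_sum Re (ip H (D h) h)) (lists {1..m})"
proof -
  let ?c = "opnorm H (op_sum H (\<lambda>j. P j \<circ> Q j) {1..m})"
  note P = adjoint_pairD(1)[OF PQ] and Q = adjoint_pairD(2)[OF PQ]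
  define u where "u w = Re (ip H (D' (back_word Q w h)) (back_word Q w h))" for w
  define s where "s N = (\<Sum>w\<in>words m N. Re (ip H (D (back_word Q w h)) (back_word Q w h)))" for N
  define F where "F N = {w \<in> lists {1..m}. length w < N}" for N
  have Zin: "back_word Q w h \<in> carrier H" if "w \<in> lists {1..m}" for w
    using back_word_in[of m Q w h] Q that h by auto
  have u: "0 \<le> u w" if "w \<in> lists {1..m}" for w
    unfolding u_def by (rule pos[OF Zin[OF that]])
  have F_Suc: "F (Suc N) = F N \<union> words m N" and F_disj: "F N \<inter> words m N = {}" for N
    by (auto simp: F_def words_def lists_eq_set)
  have fin: "finite (F N)" for N
    by (induction N) (simp_all add: F_Suc finite_words, simp add: F_def)
  have sum_F: "sum u (F N) = Re (ip H (D h) h) - s N" for N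
  proof (induction N)
    case 0
    show ?case by (simp add: F_def s_def words_0)
  next
    case (Suc N)
    have "sum u (F (Suc N)) = sum u (F N) + sum u (words m N)"
      unfolding F_Suc by (rule sum.union_disjoint[OF fin finite_words F_disj])
    also have "sum u (words m N) = s N - s (Suc N)"
      unfolding u_def s_def using word_form_telescope[OF PQ D D' h, of N] by simp
    finally show ?case using Suc.IH by simp
  qed
  have PQb: "P j \<circ> Q j \<in> bops H" if "j \<in> {1..m}" for j
    by (rule bops_comp[OF P[OF that] Q[OF that]])
  have c: "0 \<le> ?c" by (rule opnorm_nonneg[OF bops_sum[OF PQb]])
  have s_le: "\<bar>s N\<bar> \<le> opnorm H D * (?c ^ N * (hnorm H h)\<^sup>2)" for N
  proof -
    have "\<bar>s N\<bar> \<le> (\<Sum>w\<in>words m N. \<bar>Re (ip H (D (back_word Q w h)) (back_word Q w h))\<bar>)"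
      unfolding s_def by (rule sum_abs)
    also have "\<dots> \<le> (\<Sum>w\<in>words m N. opnorm H D * (hnorm H (back_word Q w h))\<^sup>2)"
    proof (rule sum_mono)
      fix w assume "w \<in> words m N"
      then have z: "back_word Q w h \<in> carrier H" by (intro Zin) (auto simp: words_def)
      have "\<bar>Re (ip H (D (back_word Q w h)) (back_word Q w h))\<bar> \<le> cmod (ip H (D (back_word Q w h)) (back_word Q w h))"
        by (rule abs_Re_le_cmod)
      also have "\<dots> \<le> hnorm H (D (back_word Q w h)) * hnorm H (back_word Q w h)"
        by (rule ip_le_hnorm[OF bops_in[OF D z] z])
      also have "\<dots> \<le> (opnorm H D * hnorm H (back_word Q w h)) * hnorm H (back_word Q w h)"
        by (rule mult_right_mono[OF opnorm_bound[OF D z] hnorm_ge_0[OF z]])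
      finally show "\<bar>Re (ip H (D (back_word Q w h)) (back_word Q w h))\<bar> \<le> opnorm H D * (hnorm H (back_word Q w h))\<^sup>2"
        by (simp add: power2_eq_square mult.assoc)
    qed
    also have "\<dots> = opnorm H D * (\<Sum>w\<in>words m N. (hnorm H (back_word Q w h))\<^sup>2)"
      by (simp only: sum_distrib_left)
    also have "\<dots> \<le> opnorm H D * (?c ^ N * (hnorm H h)\<^sup>2)"
      by (intro mult_left_mono word_norm_sum_le PQ h opnorm_nonneg D)
    finally show ?thesis .
  qed
  have "s \<longlonglongrightarrow> 0"
  proof (rule Lim_null_comparison)
    show "\<forall>\<^sub>F N in sequentially. norm (s N) \<le> opnorm H D * (?c ^ N * (hnorm H h)\<^sup>2)"
      using s_le by (intro always_eventually) simp
    have "(\<lambda>N. opnorm H D * (?c ^ N * (hnorm H h)\<^sup>2)) \<longlonglongrightarrow> opnorm H D * (0 * (hnorm H h)\<^sup>2)"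
      by (intro tendsto_intros LIMSEQ_power_zero) (use c contr in simp)
    then show "(\<lambda>N. opnorm H D * (?c ^ N * (hnorm H h)\<^sup>2)) \<longlonglongrightarrow> 0" by simp
  qed
  then have "(\<lambda>N. Re (ip H (D h) h) - s N) \<longlonglongrightarrow> Re (ip H (D h) h) - 0"
    by (intro tendsto_intros)
  then have lim: "(\<lambda>N. sum u (F N)) \<longlonglongrightarrow> Re (ip H (D h) h)" by (simp add: sum_F)
  have "incseq (\<lambda>N. sum u (F N))"
    by (rule incseq_SucI) (use fin u in \<open>auto simp: F_def intro!: sum_mono2\<close>)
  then have le: "sum u (F N) \<le> Re (ip H (D h) h)" for N
    using incseq_le lim by blast
  show ?thesis unfolding u_def[symmetric]
  proof (rule has_sum_of_finite_bounds[OF u _ fin _ lim])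
    fix G assume G: "finite G" "G \<subseteq> lists {1..m}"
    have "G \<subseteq> F (Suc (Max (length ` G)))"
      using G by (auto simp: F_def less_Suc_eq_le intro!: Max_ge)
    then have "sum u G \<le> sum u (F (Suc (Max (length ` G))))"
      using u by (intro sum_mono2 fin) (auto simp: F_def)
    also have "\<dots> \<le> Re (ip H (D h) h)" by (rule le)
    finally show "sum u G \<le> Re (ip H (D h) h)" .
  qed (auto simp: F_def)
qed

section \<open>Renorming by a positive invertible operator\<close>

text \<open>
  The space \<open>H\<close> with the equivalent inner product \<open>\<langle>D x, y\<rangle>\<close>.  An orthonormal basis of it
  expands \<open>\<langle>D x, x\<rangle>\<close> into squares and thereby plays the part of a square root of \<open>D\<close>.
\<close>

definition form_space :: "('a \<Rightarrow> 'a) \<Rightarrow> 'a hilb" where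
  "form_space D = H\<lparr>ip := \<lambda>x y. ip H (D x) y\<rparr>"

lemma form_space_simps:
  "carrier (form_space D) = carrier H" "x \<oplus>\<^bsub>form_space D\<^esub> y = x \<oplus> y" "\<zero>\<^bsub>form_space D\<^esub> = \<zero>"
  "c \<odot>\<^bsub>form_space D\<^esub> x = c \<odot> x" "ip (form_space D) x y = ip H (D x) y" "x \<ominus>\<^bsub>form_space D\<^esub> y = x \<ominus> y"
  by (simp_all add: form_space_def a_minus_def a_inv_def)

lemma positive_form_bound:
  assumes D: "D \<in> bops H" and real: "\<And>x. x \<in> carrier H \<Longrightarrow> Im (ip H (D x) x) = 0"
    and pos: "\<And>x. x \<in> carrier H \<Longrightarrow> 0 \<le> Re (ip H (D x) x)"
    and x: "x \<in> carrier H" and y: "y \<in> carrier H"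
  shows "ip H (D y) x = cnj (ip H (D x) y)"
    "(cmod (ip H (D x) y))\<^sup>2 \<le> Re (ip H (D x) x) * Re (ip H (D y) y)"
proof -
  have exp: "ip H (D (x \<oplus> c \<odot> y)) (x \<oplus> c \<odot> y)
      = ip H (D x) x + cnj c * ip H (D x) y + c * ip H (D y) x + c * cnj c * ip H (D y) y" for c
    using x y D by (simp add: bops_add bops_smult bops_in ip_simps algebra_simps)
  have im: "Im (cnj c * ip H (D x) y + c * ip H (D y) x) = 0" for c
  proof -
    have "Im (ip H (D (x \<oplus> c \<odot> y)) (x \<oplus> c \<odot> y)) = 0" using x y by (intro real) auto
    then show ?thesis unfolding exp using real[OF x] real[OF y] by (simp add: of_real_cmod_sq[symmetric])
  qed
  show herm: "ip H (D y) x = cnj (ip H (D x) y)"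
    using im[of 1] im[of \<i>] by (simp add: complex_eq_iff)
  show "(cmod (ip H (D x) y))\<^sup>2 \<le> Re (ip H (D x) x) * Re (ip H (D y) y)"
  proof (rule form_cauchy_schwarz[OF pos[OF x] pos[OF y]])
    fix z
    have "0 \<le> Re (ip H (D (x \<oplus> cnj z \<odot> y)) (x \<oplus> cnj z \<odot> y))" using x y by (intro pos) auto
    also have "\<dots> = Re (ip H (D x) x) + 2 * Re (z * ip H (D x) y) + (cmod z)\<^sup>2 * Re (ip H (D y) y)"
      unfolding exp herm using real[OF y]
      by (simp add: cmod_power2) (simp add: power2_eq_square algebra_simps)
    finally show "0 \<le> Re (ip H (D x) x) + 2 * Re (z * ip H (D x) y) + (cmod z)\<^sup>2 * Re (ip H (D y) y)" .
  qed
qed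

text \<open>
  The Cauchy-Schwarz inequality for the form \<open>\<langle>D x, y\<rangle>\<close> at \<open>y = D x\<close> gives
  \<open>\<parallel>D x\<parallel>\<^sup>2 \<le> \<parallel>D\<parallel> \<langle>D x, x\<rangle>\<close>, and \<open>D\<close> is bounded below because it has a bounded inverse.
\<close>

lemma form_space_lower_bound:
  assumes "positive_invertible H D"
  obtains c where "0 \<le> c" "\<And>x. x \<in> carrier H \<Longrightarrow> (hnorm H x)\<^sup>2 \<le> c * Re (ip H (D x) x)"
proof -
  have D: "D \<in> bops H" and real: "\<And>x. x \<in> carrier H \<Longrightarrow> Im (ip H (D x) x) = 0"
    and pos: "\<And>x. x \<in> carrier H \<Longrightarrow> 0 \<le> Re (ip H (D x) x)"
    using assms by (auto simp: positive_invertible_def)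
  obtain U where U: "U \<in> bops H" "\<And>x. x \<in> carrier H \<Longrightarrow> U (D x) = x"
    using assms by (auto simp: positive_invertible_def)
  have "(hnorm H x)\<^sup>2 \<le> ((opnorm H U)\<^sup>2 * opnorm H D) * Re (ip H (D x) x)" if x: "x \<in> carrier H" for x
  proof -
    have Dx: "D x \<in> carrier H" using bops_in[OF D x] .
    have "((hnorm H (D x))\<^sup>2)\<^sup>2 = (cmod (ip H (D x) (D x)))\<^sup>2"
      using Dx by (simp add: ip_self norm_power)
    also have "\<dots> \<le> Re (ip H (D x) x) * Re (ip H (D (D x)) (D x))"
      by (rule positive_form_bound(2)[OF D real pos x Dx])
    also have "Re (ip H (D (D x)) (D x)) \<le> opnorm H D * (hnorm H (D x))\<^sup>2"
    proof -
      have "Re (ip H (D (D x)) (D x)) \<le> cmod (ip H (D (D x)) (D x))" by (rule complex_Re_le_cmod)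
      also have "\<dots> \<le> hnorm H (D (D x)) * hnorm H (D x)"
        by (rule ip_le_hnorm[OF bops_in[OF D Dx] Dx])
      also have "\<dots> \<le> (opnorm H D * hnorm H (D x)) * hnorm H (D x)"
        by (rule mult_right_mono[OF opnorm_bound[OF D Dx] hnorm_ge_0[OF Dx]])
      finally show ?thesis by (simp add: power2_eq_square mult.assoc)
    qed
    finally have 1: "((hnorm H (D x))\<^sup>2)\<^sup>2 \<le> Re (ip H (D x) x) * (opnorm H D * (hnorm H (D x))\<^sup>2)"
      using pos[OF x] by (simp add: mult_left_mono)
    have 2: "(hnorm H (D x))\<^sup>2 \<le> opnorm H D * Re (ip H (D x) x)"
    proof (cases "hnorm H (D x) = 0")
      case True
      then show ?thesis using pos[OF x] opnorm_nonneg[OF D] by simp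
    next
      case False
      then have p: "0 < (hnorm H (D x))\<^sup>2" by simp
      have "(hnorm H (D x))\<^sup>2 * (hnorm H (D x))\<^sup>2 \<le> (hnorm H (D x))\<^sup>2 * (opnorm H D * Re (ip H (D x) x))"
        using 1 by (simp only: power2_eq_square[of "(hnorm H (D x))\<^sup>2"] mult_ac)
      then show ?thesis by (simp only: mult_le_cancel_left_pos[OF p])
    qed
    have "hnorm H x \<le> opnorm H U * hnorm H (D x)"
      using opnorm_bound[OF U(1) Dx] U(2)[OF x] by simp
    then have "(hnorm H x)\<^sup>2 \<le> (opnorm H U * hnorm H (D x))\<^sup>2"
      using x by (intro power_mono) auto
    also have "\<dots> = (opnorm H U)\<^sup>2 * (hnorm H (D x))\<^sup>2" by (simp add: power_mult_distrib)
    also have "\<dots> \<le> (opnorm H U)\<^sup>2 * (opnorm H D * Re (ip H (D x) x))"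
      by (intro mult_left_mono 2) auto
    finally show ?thesis by (simp add: mult.assoc)
  qed
  moreover have "0 \<le> (opnorm H U)\<^sup>2 * opnorm H D"
    using opnorm_nonneg[OF D] by simp
  ultimately show thesis using that by blast
qed

lemma form_space_hilbert:
  assumes "positive_invertible H D"
  shows "hilbert_space (form_space D)"
proof -
  let ?F = "form_space D"
  have D: "D \<in> bops H" and real: "\<And>x. x \<in> carrier H \<Longrightarrow> Im (ip H (D x) x) = 0"
    and pos: "\<And>x. x \<in> carrier H \<Longrightarrow> 0 \<le> Re (ip H (D x) x)"
    using assms by (auto simp: positive_invertible_def)
  obtain c where c: "0 \<le> c" "\<And>x. x \<in> carrier H \<Longrightarrow> (hnorm H x)\<^sup>2 \<le> c * Re (ip H (D x) x)"
    using form_space_lower_bound[OF assms] by blast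
  have le: "hnorm H x \<le> sqrt c * hnorm ?F x" if "x \<in> carrier H" for x
    using real_sqrt_le_mono[OF c(2)[OF that]] that by (simp add: hnorm_def[of ?F] form_space_simps real_sqrt_mult)
  have ge: "hnorm ?F x \<le> sqrt (opnorm H D) * hnorm H x" if x: "x \<in> carrier H" for x
  proof -
    have "Re (ip H (D x) x) \<le> hnorm H (D x) * hnorm H x"
      using complex_Re_le_cmod[of "ip H (D x) x"] ip_le_hnorm[OF bops_in[OF D x] x] by linarith
    also have "\<dots> \<le> (opnorm H D * hnorm H x) * hnorm H x"
      by (rule mult_right_mono[OF opnorm_bound[OF D x] hnorm_ge_0[OF x]])
    finally have "sqrt (Re (ip H (D x) x)) \<le> sqrt (opnorm H D * (hnorm H x)\<^sup>2)"
      by (intro real_sqrt_le_mono) (simp add: power2_eq_square mult.assoc)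
    then show ?thesis using x by (simp add: hnorm_def[of ?F] form_space_simps real_sqrt_mult)
  qed
  show ?thesis
  proof (rule hilbert_space.intro)
    show "module complex_field ?F"
    proof (rule moduleI)
      show "abelian_group ?F"
        by (rule abelian_groupI)
           (auto simp: form_space_simps M.a_ac intro!: bexI[of _ "\<ominus> x" for x] M.l_neg)
    qed (auto intro: cring_complex_field simp: form_space_simps smult_add smult_smult smult_l_distr[simplified])
    show "hilbert_space_axioms ?F"
    proof (unfold_locales, unfold form_space_simps)
      fix x y z assume xyz: "x \<in> carrier H" "y \<in> carrier H" "z \<in> carrier H"
      show "ip H (D (x \<oplus> y)) z = ip H (D x) z + ip H (D y) z"
        using xyz D by (simp add: bops_add bops_in ip_add_left)
    next
      fix d x y assume xy: "x \<in> carrier H" "y \<in> carrier H"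
      show "ip H (D (d \<odot> x)) y = d * ip H (D x) y"
        using xy D by (simp add: bops_smult bops_in ip_smult_left)
      show "ip H (D y) x = cnj (ip H (D x) y)" by (rule positive_form_bound(1)[OF D real pos xy])
    next
      fix x assume x: "x \<in> carrier H"
      show "0 \<le> Re (ip H (D x) x)" by (rule pos[OF x])
      assume "ip H (D x) x = 0"
      then have "(hnorm H x)\<^sup>2 \<le> 0" using c(2)[OF x] by simp
      then show "x = \<zero>" using hnorm_eq_0[OF x] by simp
    next
      fix \<sigma> :: "nat \<Rightarrow> 'a"
      assume \<sigma>: "\<And>m. \<sigma> m \<in> carrier H"
        and cauchy: "\<And>e. 0 < e \<Longrightarrow> \<exists>N. \<forall>l\<ge>N. \<forall>m\<ge>N. hnorm ?F (\<sigma> l \<ominus> \<sigma> m) < e"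
      have "\<exists>x\<in>carrier H. (\<lambda>m. hnorm H (\<sigma> m \<ominus> x)) \<longlonglongrightarrow> 0"
      proof (rule complete[OF \<sigma>])
        fix e :: real assume e: "0 < e"
        have n: "sqrt c + 1 > 0" using c by (intro add_nonneg_pos) auto
        obtain N where N: "\<And>l m. l \<ge> N \<Longrightarrow> m \<ge> N \<Longrightarrow> hnorm ?F (\<sigma> l \<ominus> \<sigma> m) < e / (sqrt c + 1)"
          using cauchy[of "e / (sqrt c + 1)"] e n by auto
        have "hnorm H (\<sigma> l \<ominus> \<sigma> m) < e" if lm: "l \<ge> N" "m \<ge> N" for l m
        proof -
          have "hnorm H (\<sigma> l \<ominus> \<sigma> m) \<le> sqrt c * hnorm ?F (\<sigma> l \<ominus> \<sigma> m)"
            by (intro le M.minus_closed \<sigma>)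
          also have "\<dots> \<le> sqrt c * (e / (sqrt c + 1))"
            using N[OF lm] c by (intro mult_left_mono) auto
          also have "\<dots> < e" using e n by (simp add: field_simps)
          finally show ?thesis .
        qed
        then show "\<exists>N. \<forall>l\<ge>N. \<forall>m\<ge>N. hnorm H (\<sigma> l \<ominus> \<sigma> m) < e" by blast
      qed
      then obtain x where x: "x \<in> carrier H" "(\<lambda>m. hnorm H (\<sigma> m \<ominus> x)) \<longlonglongrightarrow> 0" by blast
      have "(\<lambda>m. hnorm ?F (\<sigma> m \<ominus> x)) \<longlonglongrightarrow> 0"
      proof (rule Lim_null_comparison)
        show "\<forall>\<^sub>F m in sequentially. norm (hnorm ?F (\<sigma> m \<ominus> x)) \<le> sqrt (opnorm H D) * hnorm H (\<sigma> m \<ominus> x)"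
          using ge[OF M.minus_closed[OF \<sigma> x(1)]] pos[OF M.minus_closed[OF \<sigma> x(1)]]
          by (intro always_eventually) (simp add: hnorm_def[of ?F] form_space_simps)
        show "(\<lambda>m. sqrt (opnorm H D) * hnorm H (\<sigma> m \<ominus> x)) \<longlonglongrightarrow> 0"
          using tendsto_mult[OF tendsto_const[of "sqrt (opnorm H D)"] x(2)] by simp
      qed
      then show "\<exists>x\<in>carrier H. (\<lambda>m. hnorm ?F (\<sigma> m \<ominus> x)) \<longlonglongrightarrow> 0" using x by blast
    qed
  qed
qed

end

section \<open>The Poisson kernel of a point of the polyball\<close>

lemma back_multi_cong:
  "(\<And>l. l \<in> {1..m} \<Longrightarrow> \<beta> l = \<gamma> l) \<Longrightarrow> back_multi Q m \<beta> = back_multi Q m \<gamma>"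
  by (induction m) auto

lemma (in hilbert_space) back_word_bops:
  assumes "\<And>j. j \<in> {1..m} \<Longrightarrow> Q j \<in> bops H"
  shows "set w \<subseteq> {1..m} \<Longrightarrow> back_word Q w \<in> bops H"
  by (induction w) (auto intro!: bops_id bops_comp assms)

locale polyball_point = hilbert_space H for H :: "'a hilb" (structure) +
  fixes k :: nat and n :: "nat \<Rightarrow> nat" and X :: "nat \<Rightarrow> nat \<Rightarrow> 'a \<Rightarrow> 'a"
  assumes X: "X \<in> polyball k n H"
begin

abbreviation "Q \<equiv> \<lambda>i j. adj H (X i j)"

lemma X_bops: "i \<in> {1..k} \<Longrightarrow> j \<in> {1..n i} \<Longrightarrow> X i j \<in> bops H"
  using X by (simp add: polyball_def op_tuples_def)

lemma X_commute:
  "s \<in> {1..k} \<Longrightarrow> t \<in> {1..k} \<Longrightarrow> s \<noteq> t \<Longrightarrow> j \<in> {1..n s} \<Longrightarrow> l \<in> {1..n t} \<Longrightarrow> x \<in> carrier H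
    \<Longrightarrow> X s j (X t l x) = X t l (X s j x)"
  using X by (simp add: polyball_def op_tuples_def)

lemma pair: "i \<in> {1..k} \<Longrightarrow> j \<in> {1..n i} \<Longrightarrow> adjoint_pair H (X i j) (Q i j)"
  by (rule adjoint_pair_adj[OF X_bops])

lemma Q_bops: "i \<in> {1..k} \<Longrightarrow> j \<in> {1..n i} \<Longrightarrow> Q i j \<in> bops H"
  by (rule adjoint_pairD(2)[OF pair])

lemma Q_commute:
  assumes "s \<in> {1..k}" "t \<in> {1..k}" "s \<noteq> t" "j \<in> {1..n s}" "l \<in> {1..n t}" "x \<in> carrier H"
  shows "Q s j (Q t l x) = Q t l (Q s j x)"
proof (rule eq_by_ip)
  note b = bops_in[OF X_bops] bops_in[OF Q_bops]
  note ps = adjoint_pairD(4)[OF pair[OF assms(1,4)]] and pt = adjoint_pairD(4)[OF pair[OF assms(2,5)]]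
  show "Q s j (Q t l x) \<in> carrier H" "Q t l (Q s j x) \<in> carrier H"
    by (intro b(2) assms)+
  fix z assume z: "z \<in> carrier H"
  have "ip H (Q s j (Q t l x)) z = ip H x (X t l (X s j z))"
    using ps[OF b(2)[OF assms(2,5,6)] z] pt[OF assms(6) b(1)[OF assms(1,4) z]] by simp
  also have "\<dots> = ip H x (X s j (X t l z))"
    using X_commute[OF assms(1-5) z] by simp
  also have "\<dots> = ip H (Q t l (Q s j x)) z"
    using pt[OF b(2)[OF assms(1,4,6)] z] ps[OF assms(6) b(1)[OF assms(2,5) z]] by simp
  finally show "ip H (Q s j (Q t l x)) z = ip H (Q t l (Q s j x)) z" .
qed

lemma back_word_commute:
  assumes "s \<in> {1..k}" "t \<in> {1..k}" "s \<noteq> t" "j \<in> {1..n s}"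
  shows "set w \<subseteq> {1..n t} \<Longrightarrow> x \<in> carrier H \<Longrightarrow> back_word (Q t) w (Q s j x) = Q s j (back_word (Q t) w x)"
proof (induction w arbitrary: x)
  case (Cons l w)
  have l: "l \<in> {1..n t}" using Cons.prems by simp
  have "back_word (Q t) (l # w) (Q s j x) = back_word (Q t) w (Q s j (Q t l x))"
    using Q_commute[OF assms(2,1) assms(3)[symmetric] l assms(4) Cons.prems(2)] by simp
  also have "\<dots> = Q s j (back_word (Q t) (l # w) x)"
    using Cons bops_in[OF Q_bops[OF assms(2) l] Cons.prems(2)] by simp
  finally show ?case .
qed simp

lemma back_word_Q_bops: "i \<in> {1..k} \<Longrightarrow> set w \<subseteq> {1..n i} \<Longrightarrow> back_word (Q i) w \<in> bops H"
  using back_word_bops[of "n i" "Q i" w] Q_bops by blast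

lemma back_multi_bops:
  "m \<le> k \<Longrightarrow> (\<And>l. l \<in> {1..m} \<Longrightarrow> set (\<beta> l) \<subseteq> {1..n l}) \<Longrightarrow> back_multi Q m \<beta> \<in> bops H"
proof (induction m)
  case (Suc m)
  have "back_multi Q m \<beta> \<in> bops H" using Suc.prems by (intro Suc.IH) auto
  moreover have "back_word (Q (Suc m)) (\<beta> (Suc m)) \<in> bops H"
    using Suc.prems(1) Suc.prems(2)[of "Suc m"] by (intro back_word_Q_bops) auto
  ultimately show ?case unfolding back_multi.simps by (rule bops_comp)
qed (simp add: bops_id)

text \<open>
  The letter \<open>j\<close> of the component \<open>i\<close> acts before all others.  It commutes with the components
  different from \<open>i\<close> and becomes the first letter of the component \<open>i\<close>.
\<close>

lemma back_multi_push:
  "m \<le> k \<Longrightarrow> (\<And>l. l \<in> {1..m} \<Longrightarrow> set (\<beta> l) \<subseteq> {1..n l}) \<Longrightarrow> i \<in> {1..m} \<Longrightarrow> j \<in> {1..n i}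
    \<Longrightarrow> h \<in> carrier H \<Longrightarrow> back_multi Q m \<beta> (Q i j h) = back_multi Q m (push i j \<beta>) h"
proof (induction m arbitrary: h)
  case (Suc m)
  have \<beta>: "set (\<beta> (Suc m)) \<subseteq> {1..n (Suc m)}" using Suc.prems(2)[of "Suc m"] by simp
  have m: "Suc m \<in> {1..k}" using Suc.prems(1) by simp
  have i: "i \<in> {1..k}" using Suc.prems(1,3) by simp
  show ?case
  proof (cases "i = Suc m")
    case True
    have 1: "back_multi Q m (push i j \<beta>) = back_multi Q m \<beta>"
      by (rule back_multi_cong) (simp add: push_def True)
    have 2: "push i j \<beta> (Suc m) = j # \<beta> (Suc m)" by (simp add: push_def True)
    show ?thesis by (simp only: back_multi.simps o_apply 1 2 back_word.simps) (simp add: True)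
  next
    case False
    have z: "back_word (Q (Suc m)) (\<beta> (Suc m)) h \<in> carrier H"
      by (rule bops_in[OF back_word_Q_bops[OF m \<beta>] Suc.prems(5)])
    have "back_multi Q (Suc m) \<beta> (Q i j h) = back_multi Q m \<beta> (Q i j (back_word (Q (Suc m)) (\<beta> (Suc m)) h))"
      using back_word_commute[OF i m False Suc.prems(4) \<beta> Suc.prems(5)] by simp
    also have "\<dots> = back_multi Q m (push i j \<beta>) (back_word (Q (Suc m)) (\<beta> (Suc m)) h)"
      using Suc.prems False by (intro Suc.IH z) auto
    also have "\<dots> = back_multi Q (Suc m) (push i j \<beta>) h"
    proof -
      have "push i j \<beta> (Suc m) = \<beta> (Suc m)" using False by (simp add: push_def)
      then show ?thesis by (simp only: back_multi.simps o_apply)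
    qed
    finally show ?thesis .
  qed
qed simp

text \<open>
  The defect operator with respect to the components \<open>m, \<dots>, k\<close> only.  It interpolates between the
  full defect operator at \<open>m = 1\<close> and the identity at \<open>m = k + 1\<close>.
\<close>

definition D :: "nat \<Rightarrow> 'a \<Rightarrow> 'a" where
  "D m = foldr (\<lambda>i Y. op_minus H Y (Phi H (n i) (X i) Y)) [m..<Suc k] id"

lemma Phi_bops: "i \<in> {1..k} \<Longrightarrow> Y \<in> bops H \<Longrightarrow> Phi H (n i) (X i) Y \<in> bops H"
  unfolding Phi_def by (intro bops_sum bops_comp X_bops Q_bops)

lemma D_step: "1 \<le> m \<Longrightarrow> m \<le> k \<Longrightarrow> D m = op_minus H (D (Suc m)) (Phi H (n m) (X m) (D (Suc m)))"
  by (simp add: D_def upt_conv_Cons del: upt_Suc)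

lemma D_top: "D (Suc k) = id"
  by (simp add: D_def)

lemma D_bops: "1 \<le> m \<Longrightarrow> m \<le> Suc k \<Longrightarrow> D m \<in> bops H"
proof (induction "Suc k - m" arbitrary: m)
  case 0
  then have "m = Suc k" by simp
  then show ?case by (simp only: D_top bops_id)
next
  case (Suc d)
  then have m: "m \<le> k" by simp
  have "D (Suc m) \<in> bops H" using Suc m by (intro Suc.hyps(1)) auto
  then show ?case
    unfolding D_step[OF Suc.prems(1) m] using Suc.prems(1) m by (intro bops_minus Phi_bops) auto
qed

lemma D_1: "D 1 = Delta k n H X id"
  unfolding D_def Delta_def by simp

lemma D_1_positive: "positive_invertible H (D 1)"
  using X unfolding D_1 by (simp add: polyball_def)

lemma D_1_nonneg: "x \<in> carrier H \<Longrightarrow> 0 \<le> Re (ip H (D 1 x) x)"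
  using D_1_positive by (simp add: positive_invertible_def)

text \<open>
  Summation over the words of the component \<open>m\<close> undoes the factor \<open>id - \<Phi>\<^bsub>X m\<^esub>\<close> and turns \<open>D m\<close>
  into \<open>D (m + 1)\<close>.  Positivity of \<open>D m\<close>, which allows for the next summation, is a by-product:
  it is a sum of terms \<open>\<langle>D 1 x, x\<rangle>\<close>.
\<close>

lemma multi_form_has_sum:
  assumes "m \<le> k" "h \<in> carrier H"
  shows "((\<lambda>\<beta>. Re (ip H (D 1 (back_multi Q m \<beta> h)) (back_multi Q m \<beta> h))) has_sum Re (ip H (D (Suc m) h) h))
    (\<Pi>\<^sub>E i\<in>{1..m}. lists {1..n i})"
  using assms
proof (induction m arbitrary: h)
  case 0
  then show ?case by (simp add: has_sum_finite_iff)
next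
  case (Suc m)
  let ?W = "\<Pi>\<^sub>E i\<in>{1..m}. lists {1..n i}" and ?L = "lists {1..n (Suc m)}"
  have m: "m \<le> k" "Suc m \<in> {1..k}" using Suc.prems(1) by auto
  have Wset: "set (\<beta> l) \<subseteq> {1..n l}" if "\<beta> \<in> ?W" "l \<in> {1..m}" for \<beta> l
    using PiE_mem[OF that] by auto
  have Zin: "back_multi Q m \<beta> x \<in> carrier H" if "\<beta> \<in> ?W" "x \<in> carrier H" for \<beta> x
    by (rule bops_in[OF back_multi_bops[OF m(1) Wset[OF that(1)]] that(2)])
  have pos: "0 \<le> Re (ip H (D (Suc m) x) x)" if x: "x \<in> carrier H" for x
    by (rule has_sum_nonneg[OF Suc.IH[OF m(1) x]]) (rule D_1_nonneg[OF Zin[OF _ x]])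
  define bw where "bw w = back_word (Q (Suc m)) w h" for w
  have bw: "bw w \<in> carrier H" if "w \<in> ?L" for w
    unfolding bw_def using that by (intro bops_in[OF back_word_Q_bops[OF m(2)] Suc.prems(2)]) auto
  have outer: "((\<lambda>w. Re (ip H (D (Suc m) (bw w)) (bw w))) has_sum Re (ip H (D (Suc (Suc m)) h) h)) ?L"
    unfolding bw_def
  proof (rule word_form_has_sum[OF pair[OF m(2)]])
    show "D (Suc (Suc m)) \<in> bops H" using Suc.prems by (intro D_bops) auto
    show "opnorm H (op_sum H (\<lambda>j. X (Suc m) j \<circ> Q (Suc m) j) {1..n (Suc m)}) < 1"
      using X m(2) by (simp add: polyball_def)
    show "D (Suc m) h = D (Suc (Suc m)) h \<ominus> op_sum H (\<lambda>j. X (Suc m) j \<circ> D (Suc (Suc m)) \<circ> Q (Suc m) j) {1..n (Suc m)} h" for h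
      using D_step[of "Suc m"] m(2) by (simp add: op_minus_def Phi_def)
  qed (use pos Suc.prems(2) in auto)
  define f where "f = (\<lambda>(w, \<beta>). Re (ip H (D 1 (back_multi Q m \<beta> (bw w))) (back_multi Q m \<beta> (bw w))))"
  have inner: "((\<lambda>\<beta>. f (w, \<beta>)) has_sum Re (ip H (D (Suc m) (bw w)) (bw w))) ?W" if "w \<in> ?L" for w
    unfolding f_def prod.case by (rule Suc.IH[OF m(1) bw[OF that]])
  have f0: "0 \<le> f (w, \<beta>)" if "w \<in> ?L" "\<beta> \<in> ?W" for w \<beta>
    unfolding f_def prod.case by (rule D_1_nonneg[OF Zin[OF that(2) bw[OF that(1)]]])
  have "f summable_on Sigma ?L (\<lambda>_. ?W)"
    by (rule summable_on_SigmaI[OF inner has_sum_imp_summable[OF outer] f0])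
  then have total: "(f has_sum Re (ip H (D (Suc (Suc m)) h) h)) (?L \<times> ?W)"
    by (intro has_sum_SigmaI[OF inner outer])
  let ?g = "\<lambda>(w, \<beta>). \<beta>(Suc m := w)"
  have img: "(\<Pi>\<^sub>E i\<in>{1..Suc m}. lists {1..n i}) = ?g ` (?L \<times> ?W)"
    using PiE_insert_eq[of "Suc m" "{1..m}" "\<lambda>i. lists {1..n i}"] atLeastAtMostSuc_conv[of 1 m] by simp
  have inj: "inj_on ?g (?L \<times> ?W)"
    by (rule inj_combinator[of "Suc m" "{1..m}" "\<lambda>i. lists {1..n i}"]) simp
  show ?case
    unfolding img
  proof (rule has_sum_reindex[OF inj, THEN iffD2], rule has_sum_cong[THEN iffD2, OF _ total])
    fix p assume "p \<in> ?L \<times> ?W"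
    then obtain w \<beta> where p: "p = (w, \<beta>)" by (cases p)
    have "back_multi Q m (\<beta>(Suc m := w)) = back_multi Q m \<beta>"
      by (rule back_multi_cong) simp
    then show "((\<lambda>\<beta>. Re (ip H (D 1 (back_multi Q (Suc m) \<beta> h)) (back_multi Q (Suc m) \<beta> h))) \<circ> ?g) p = f p"
      by (simp add: p f_def bw_def)
  qed
qed

text \<open>
  The component along the basis vector \<open>s\<close> of the Poisson kernel \<open>h \<mapsto> \<Sum>\<^sub>\<beta> e\<^sub>\<beta> \<otimes> X\<^sub>\<beta>\<^sup>* h\<close>, whose second
  factor lies in the space with the inner product \<open>\<langle>D 1 x, y\<rangle>\<close>.
\<close>

definition poisson :: "'a \<Rightarrow> 'a \<Rightarrow> (nat \<Rightarrow> nat list) \<Rightarrow> complex" where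
  "poisson s h = (\<lambda>\<beta>. if \<beta> \<in> multiwords k n then ip H (D 1 (back_multi Q k \<beta> h)) s else 0)"

abbreviation "B \<equiv> some_basis (form_space (D 1))"

lemma B_in: "s \<in> B \<Longrightarrow> s \<in> carrier H"
  using hilbert_space.some_basis_in[OF form_space_hilbert[OF D_1_positive]] by (simp add: form_space_simps)

lemma form_parseval:
  assumes "x \<in> carrier H"
  shows "((\<lambda>s. (cmod (ip H (D 1 x) s))\<^sup>2) has_sum Re (ip H (D 1 x) x)) B"
proof -
  interpret F: hilbert_space "form_space (D 1)" by (rule form_space_hilbert[OF D_1_positive])
  show ?thesis
    using F.parseval[OF F.some_basis, of x] assms F.hnorm_sq[of x] by (simp only: form_space_simps)
qed

lemma back_multi_k_bops: "\<beta> \<in> multiwords k n \<Longrightarrow> back_multi Q k \<beta> \<in> bops H"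
  using back_multi_bops[of k \<beta>] multiwords_in[of \<beta> k n] by blast

lemma multi_k_has_sum:
  assumes "h \<in> carrier H"
  shows "((\<lambda>\<beta>. Re (ip H (D 1 (back_multi Q k \<beta> h)) (back_multi Q k \<beta> h))) has_sum (hnorm H h)\<^sup>2) (multiwords k n)"
  using multi_form_has_sum[OF order_refl assms] assms by (simp add: D_top multiwords_def hnorm_sq)

lemma poisson_in:
  assumes s: "s \<in> B" and h: "h \<in> carrier H"
  shows "poisson s h \<in> carrier (fock k n)"
proof -
  have "(\<lambda>\<beta>. (cmod (poisson s h \<beta>))\<^sup>2) summable_on multiwords k n"
  proof (rule summable_on_comparison_test[OF has_sum_imp_summable[OF multi_k_has_sum[OF h]]])
    fix \<beta> assume \<beta>: "\<beta> \<in> multiwords k n"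
    have "(\<Sum>s\<in>{s}. (cmod (ip H (D 1 (back_multi Q k \<beta> h)) s))\<^sup>2)
        \<le> Re (ip H (D 1 (back_multi Q k \<beta> h)) (back_multi Q k \<beta> h))"
      by (rule finite_sum_le_has_sum[OF form_parseval[OF bops_in[OF back_multi_k_bops[OF \<beta>] h]]])
         (use s in auto)
    then show "(cmod (poisson s h \<beta>))\<^sup>2 \<le> Re (ip H (D 1 (back_multi Q k \<beta> h)) (back_multi Q k \<beta> h))"
      using \<beta> by (simp add: poisson_def)
  qed auto
  then show ?thesis by (simp add: fock_iff poisson_def)
qed

lemma poisson_hlinear:
  assumes s: "s \<in> B"
  shows "hlinear H (fock k n) (poisson s)"
proof -
  have D: "D 1 \<in> bops H" by (rule D_bops) auto
  note Z = bops_in[OF back_multi_k_bops] and sH = B_in[OF s]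
  have "poisson s (x \<oplus> y) = (\<lambda>\<beta>. poisson s x \<beta> + poisson s y \<beta>)"
    if "x \<in> carrier H" "y \<in> carrier H" for x y
    using that D sH
    by (auto simp: fun_eq_iff poisson_def bops_add[OF back_multi_k_bops] bops_add[OF D] Z bops_in[OF D] ip_add_left simp del: One_nat_def)
  moreover have "poisson s (c \<odot> x) = (\<lambda>\<beta>. c * poisson s x \<beta>)" if "x \<in> carrier H" for c x
    using that D sH
    by (auto simp: fun_eq_iff poisson_def bops_smult[OF back_multi_k_bops] bops_smult[OF D] Z bops_in[OF D] ip_smult_left simp del: One_nat_def)
  ultimately show ?thesis
    using poisson_in[OF s] by (simp add: hlinear_def fock_simps)
qed

text \<open>
  Parseval's identity turns the sum over \<open>s\<close> into \<open>\<langle>D 1 x, x\<rangle>\<close> at \<open>x = X\<^sub>\<beta>\<^sup>* h\<close>, and the sum of these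
  over \<open>\<beta>\<close> is \<open>\<parallel>h\<parallel>\<^sup>2\<close>.
\<close>

lemma poisson_isometry:
  assumes h: "h \<in> carrier H"
  shows "((\<lambda>s. (hnorm (fock k n) (poisson s h))\<^sup>2) has_sum (hnorm H h)\<^sup>2) B"
proof (rule has_sum_swap_nonneg[where I = "multiwords k n" and a = "\<lambda>\<beta> s. (cmod (poisson s h \<beta>))\<^sup>2"])
  show "((\<lambda>s. (cmod (poisson s h \<beta>))\<^sup>2) has_sum
      Re (ip H (D 1 (back_multi Q k \<beta> h)) (back_multi Q k \<beta> h))) B" if "\<beta> \<in> multiwords k n" for \<beta>
    using form_parseval[OF bops_in[OF back_multi_k_bops[OF that] h]] that by (simp add: poisson_def)
  show "((\<lambda>\<beta>. (cmod (poisson s h \<beta>))\<^sup>2) has_sum (hnorm (fock k n) (poisson s h))\<^sup>2) (multiwords k n)"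
    if "s \<in> B" for s
    by (rule fock_hnorm_sum[OF poisson_in[OF that h]])
  show "((\<lambda>\<beta>. Re (ip H (D 1 (back_multi Q k \<beta> h)) (back_multi Q k \<beta> h))) has_sum (hnorm H h)\<^sup>2) (multiwords k n)"
    by (rule multi_k_has_sum[OF h])
qed simp

text \<open>
  The operator \<open>X\<^sub>\<beta>\<^sup>*\<close> preceded by the adjoint of \<open>X i j\<close> is the one that belongs to the multi-word
  \<open>push i j \<beta>\<close>, and the annihilation operator replaces the coefficient at \<open>\<beta>\<close> by the one at \<open>push i j \<beta>\<close>.
\<close>

lemma poisson_intertwined:
  assumes i: "i \<in> {1..k}" and j: "j \<in> {1..n i}"
  shows "intertwined H (fock k n) poisson B (X i j) (creation i j)"
proof -
  note S = creation_adjoint[of i k j n, OF i j]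
  have "poisson s (Q i j h) = adj (fock k n) (creation i j) (poisson s h)"
    if s: "s \<in> B" and h: "h \<in> carrier H" for s h
    unfolding hilbert_space.adj_eq[OF fock_hilbert S poisson_in[OF s h]]
    using back_multi_push[OF order_refl _ i j h] multiwords_in[of _ k n] push_in[of i k j n, OF i j]
    by (auto simp: poisson_def annihilation_def fun_eq_iff)
  then show ?thesis
    using X_bops[OF i j] hilbert_space.adjoint_pairD(1)[OF fock_hilbert S] by (simp add: intertwined_def)
qed

end

section \<open>The von Neumann inequality for polynomials\<close>

lemma partial_sums_le_of_intertwining:
  fixes K :: "'k hilb" and H :: "'h hilb" and G :: "'g hilb"
  assumes K: "hilbert_space K" and I: "intertwining H G L S"
    and iso: "\<And>h. h \<in> carrier H \<Longrightarrow> ((\<lambda>s. (hnorm G (L s h))\<^sup>2) has_sum (hnorm H h)\<^sup>2) S"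
    and A: "\<And>\<alpha>. \<alpha> \<in> multiwords k n \<Longrightarrow> A \<alpha> \<in> bops K"
    and X: "\<And>i j. i \<in> {1..k} \<Longrightarrow> j \<in> {1..n i} \<Longrightarrow> intertwined H G L S (X i j) (Z i j)"
    and D: "finite D" "D \<subseteq> multidegrees k"
  shows "opnorm (tensor_space K H) (op_sum (tensor_space K H) (homogeneous_part k n K A H X) D)
    \<le> opnorm (tensor_space K G) (op_sum (tensor_space K G) (homogeneous_part k n K A G Z) D)"
proof -
  interpret intertwining H G L S by fact
  interpret KH: tensor K H using K H.hilbert_space_axioms by (simp add: tensor_def)
  interpret KG: tensor K G using K G.hilbert_space_axioms by (simp add: tensor_def)
  have Xb: "X i j \<in> bops H" "Z i j \<in> bops G" if "i \<in> {1..k}" "j \<in> {1..n i}" for i j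
    using X[OF that] by (simp_all add: intertwined_def)
  let ?J = "\<Union>p\<in>D. multiwords_deg k n p"
  have J: "\<alpha> \<in> multiwords k n" if "\<alpha> \<in> ?J" for \<alpha> using that by (auto simp: multiwords_deg_def)
  note IM = intertwined_multiword_op[of k n X Z, OF X]
  have "opnorm (tensor_space K H) (op_sum (tensor_space K H) (homogeneous_part k n K A H X) D)
      = opnorm (tensor_space K H) (op_sum (tensor_space K H) (\<lambda>\<alpha>. tensor_op K (A \<alpha>) (multiword_op k X \<alpha>)) ?J)"
    by (rule KH.TS.opnorm_cong, rule KH.partial_sum_flatten[OF A Xb(1) D])
  also have "\<dots> \<le> opnorm (tensor_space K G) (op_sum (tensor_space K G) (\<lambda>\<alpha>. tensor_op K (A \<alpha>) (multiword_op k Z \<alpha>)) ?J)"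
  proof (rule compression_norm_le[OF K H.hilbert_space_axioms G.hilbert_space_axioms])
    fix \<alpha> assume \<alpha>: "\<alpha> \<in> ?J"
    note im = IM[OF _ _ J[OF \<alpha>]]
    show "A \<alpha> \<in> bops K" by (rule A[OF J[OF \<alpha>]])
    show "adjoint_pair H (multiword_op k X \<alpha>) (adj H (multiword_op k X \<alpha>))"
      using im by (intro H.adjoint_pair_adj) (simp add: intertwined_def)
    show "adjoint_pair G (multiword_op k Z \<alpha>) (adj G (multiword_op k Z \<alpha>))"
      using im by (intro G.adjoint_pair_adj) (simp add: intertwined_def)
    show "L s (adj H (multiword_op k X \<alpha>) h) = adj G (multiword_op k Z \<alpha>) (L s h)"
      if "s \<in> S" "h \<in> carrier H" for s h
      using im that by (simp add: intertwined_def)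
  qed (use L iso in auto)
  also have "\<dots> = opnorm (tensor_space K G) (op_sum (tensor_space K G) (homogeneous_part k n K A G Z) D)"
    by (rule KG.TS.opnorm_cong, rule KG.partial_sum_flatten[OF A Xb(2) D, symmetric])
  finally show ?thesis .
qed

text \<open>
  The von Neumann inequality for polynomials with operator coefficients, from the Poisson kernel.
\<close>

theorem von_neumann_polyball:
  fixes K :: "'k hilb" and H :: "'h hilb"
  assumes K: "hilbert_space K" and H: "hilbert_space H" and X: "X \<in> polyball k n H"
    and A: "\<And>\<alpha>. \<alpha> \<in> multiwords k n \<Longrightarrow> A \<alpha> \<in> bops K"
    and D: "finite D" "D \<subseteq> multidegrees k"
  shows "opnorm (tensor_space K H) (op_sum (tensor_space K H) (homogeneous_part k n K A H (scale_tuple H r X)) D)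
    \<le> opnorm (tensor_space K (fock k n)) (op_sum (tensor_space K (fock k n))
        (homogeneous_part k n K A (fock k n) (scale_tuple (fock k n) r creation)) D)"
proof -
  interpret P: polyball_point H k n X using H X by (simp add: polyball_point_def polyball_point_axioms_def)
  have I: "intertwining H (fock k n) P.poisson P.B"
    using H fock_hilbert P.poisson_hlinear by (simp add: intertwining_def intertwining_axioms_def)
  show ?thesis
  proof (rule partial_sums_le_of_intertwining[OF K I P.poisson_isometry A _ D])
    show "intertwined H (fock k n) P.poisson P.B (scale_tuple H r X i j) (scale_tuple (fock k n) r creation i j)"
      if "i \<in> {1..k}" "j \<in> {1..n i}" for i j
      unfolding scale_tuple_def
      by (rule intertwining.intertwined_scale[OF I P.poisson_intertwined[of i j, OF that]])
  qed
qed

section \<open>Passing to the closure\<close>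

context hilbert_space
begin

text \<open>
  Convergence in operator norm, bundled with boundedness so that it is preserved by products.
\<close>

definition op_tendsto :: "(nat \<Rightarrow> 'a \<Rightarrow> 'a) \<Rightarrow> ('a \<Rightarrow> 'a) \<Rightarrow> bool" where
  "op_tendsto P P0 \<longleftrightarrow> (\<forall>m. P m \<in> bops H) \<and> P0 \<in> bops H \<and> (\<lambda>m. opnorm H (op_minus H P0 (P m))) \<longlonglongrightarrow> 0"

lemma op_tendsto_id: "op_tendsto (\<lambda>_. id) id"
proof -
  have "opnorm H (op_minus H id id) \<le> 0"
    by (rule opnorm_le) (auto simp: op_minus_def M.minus_eq M.r_neg)
  then have "opnorm H (op_minus H id id) = 0"
    using opnorm_nonneg[OF bops_minus[OF bops_id bops_id]] by simp
  then show ?thesis by (simp add: op_tendsto_def bops_id)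
qed

lemma op_tendsto_comp:
  assumes "op_tendsto P P0" "op_tendsto R R0"
  shows "op_tendsto (\<lambda>m. P m \<circ> R m) (P0 \<circ> R0)"
proof -
  have b: "P m \<in> bops H" "P0 \<in> bops H" "R m \<in> bops H" "R0 \<in> bops H" for m
    using assms by (auto simp: op_tendsto_def)
  define p where "p = (\<lambda>m. opnorm H (op_minus H P0 (P m)))"
  define q where "q = (\<lambda>m. opnorm H (op_minus H R0 (R m)))"
  have pq: "p \<longlonglongrightarrow> 0" "q \<longlonglongrightarrow> 0" using assms by (auto simp: op_tendsto_def p_def q_def)
  have pq0: "0 \<le> p m" "0 \<le> q m" for m unfolding p_def q_def by (intro opnorm_nonneg bops_minus b)+
  have le: "opnorm H (op_minus H (P0 \<circ> R0) (P m \<circ> R m)) \<le> opnorm H P0 * q m + p m * (q m + opnorm H R0)" for m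
  proof (rule opnorm_le)
    show "0 \<le> opnorm H P0 * q m + p m * (q m + opnorm H R0)"
      using pq0 opnorm_nonneg[OF b(2)] opnorm_nonneg[OF b(4)] by simp
    fix x assume x: "x \<in> carrier H"
    have Rx: "R0 x \<in> carrier H" "R m x \<in> carrier H" using bops_in[OF b(3) x] bops_in[OF b(4) x] by auto
    have dR: "hnorm H (R0 x \<ominus> R m x) \<le> q m * hnorm H x"
      using opnorm_bound[OF bops_minus[OF b(4) b(3)] x, of m] by (simp add: op_minus_def q_def)
    have Rm: "hnorm H (R m x) \<le> (q m + opnorm H R0) * hnorm H x"
      using hnorm_le_minus_add[OF Rx(2,1)] dR hnorm_minus_commute[OF Rx] opnorm_bound[OF b(4) x]
      by (simp add: distrib_right)
    have "P0 (R0 x) \<ominus> P m (R m x) = P0 (R0 x \<ominus> R m x) \<oplus> (P0 (R m x) \<ominus> P m (R m x))"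
    proof (rule eq_by_ip)
      fix z assume z: "z \<in> carrier H"
      have "R0 x \<ominus> R m x = R0 x \<oplus> (-1) \<odot> R m x"
        using Rx by (intro eq_by_ip) (auto simp: ip_simps)
      then have "P0 (R0 x \<ominus> R m x) = P0 (R0 x) \<oplus> (-1) \<odot> P0 (R m x)"
        using Rx by (simp add: bops_add[OF b(2)] bops_smult[OF b(2)])
      then show "ip H (P0 (R0 x) \<ominus> P m (R m x)) z = ip H (P0 (R0 x \<ominus> R m x) \<oplus> (P0 (R m x) \<ominus> P m (R m x))) z"
        using Rx z by (simp add: ip_simps bops_in[OF b(2)] bops_in[OF b(1)])
    qed (use Rx in \<open>auto simp: bops_in[OF b(2)] bops_in[OF b(1)]\<close>)
    then have "hnorm H (P0 (R0 x) \<ominus> P m (R m x)) \<le> hnorm H (P0 (R0 x \<ominus> R m x)) + hnorm H (P0 (R m x) \<ominus> P m (R m x))"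
      using hnorm_triangle Rx by (simp add: bops_in[OF b(2)] bops_in[OF b(1)])
    also have "hnorm H (P0 (R0 x \<ominus> R m x)) \<le> opnorm H P0 * (q m * hnorm H x)"
      using opnorm_bound[OF b(2), of "R0 x \<ominus> R m x"] Rx dR opnorm_nonneg[OF b(2)]
      by (meson M.minus_closed mult_left_mono order_trans)
    also have "hnorm H (P0 (R m x) \<ominus> P m (R m x)) \<le> p m * hnorm H (R m x)"
      using opnorm_bound[OF bops_minus[OF b(2) b(1)] Rx(2), of m] by (simp add: op_minus_def p_def)
    also have "\<dots> \<le> p m * ((q m + opnorm H R0) * hnorm H x)"
      by (intro mult_left_mono Rm pq0)
    finally show "hnorm H (op_minus H (P0 \<circ> R0) (P m \<circ> R m) x) \<le> (opnorm H P0 * q m + p m * (q m + opnorm H R0)) * hnorm H x"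
      by (simp add: op_minus_def algebra_simps)
  qed
  have "(\<lambda>m. opnorm H (op_minus H (P0 \<circ> R0) (P m \<circ> R m))) \<longlonglongrightarrow> 0"
  proof (rule Lim_null_comparison)
    show "\<forall>\<^sub>F m in sequentially. norm (opnorm H (op_minus H (P0 \<circ> R0) (P m \<circ> R m))) \<le> opnorm H P0 * q m + p m * (q m + opnorm H R0)"
      using le opnorm_nonneg[OF bops_minus[OF bops_comp[OF b(2,4)] bops_comp[OF b(1,3)]]]
      by (intro always_eventually) simp
    have "(\<lambda>m. opnorm H P0 * q m + p m * (q m + opnorm H R0)) \<longlonglongrightarrow> opnorm H P0 * 0 + 0 * (0 + opnorm H R0)"
      by (intro tendsto_intros pq)
    then show "(\<lambda>m. opnorm H P0 * q m + p m * (q m + opnorm H R0)) \<longlonglongrightarrow> 0" by simp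
  qed
  then show ?thesis using b by (simp add: op_tendsto_def bops_comp)
qed

lemma op_tendsto_scale:
  assumes "op_tendsto P P0"
  shows "op_tendsto (\<lambda>m x. c \<odot> P m x) (\<lambda>x. c \<odot> P0 x)"
proof -
  have b: "P m \<in> bops H" "P0 \<in> bops H" for m
    using assms by (auto simp: op_tendsto_def)
  have le: "opnorm H (op_minus H (\<lambda>x. c \<odot> P0 x) (\<lambda>x. c \<odot> P m x)) \<le> cmod c * opnorm H (op_minus H P0 (P m))" for m
  proof (rule opnorm_le)
    show "0 \<le> cmod c * opnorm H (op_minus H P0 (P m))"
      using opnorm_nonneg[OF bops_minus[OF b(2) b(1)]] by simp
    fix x assume x: "x \<in> carrier H"
    have "c \<odot> P0 x \<ominus> c \<odot> P m x = c \<odot> (P0 x \<ominus> P m x)"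
      using bops_in[OF b(1) x] bops_in[OF b(2) x] by (intro eq_by_ip) (auto simp: ip_simps algebra_simps)
    then show "hnorm H (op_minus H (\<lambda>x. c \<odot> P0 x) (\<lambda>x. c \<odot> P m x) x) \<le> cmod c * opnorm H (op_minus H P0 (P m)) * hnorm H x"
      using opnorm_bound[OF bops_minus[OF b(2) b(1)] x, of m] bops_in[OF b(1) x] bops_in[OF b(2) x]
      by (simp add: op_minus_def hnorm_smult mult.assoc mult_left_mono)
  qed
  have "(\<lambda>m. opnorm H (op_minus H (\<lambda>x. c \<odot> P0 x) (\<lambda>x. c \<odot> P m x))) \<longlonglongrightarrow> 0"
  proof (rule Lim_null_comparison)
    show "\<forall>\<^sub>F m in sequentially. norm (opnorm H (op_minus H (\<lambda>x. c \<odot> P0 x) (\<lambda>x. c \<odot> P m x))) \<le> cmod c * opnorm H (op_minus H P0 (P m))"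
      using le opnorm_nonneg[OF bops_minus[OF bops_scale[OF b(2)] bops_scale[OF b(1)]]]
      by (intro always_eventually) simp
    show "(\<lambda>m. cmod c * opnorm H (op_minus H P0 (P m))) \<longlonglongrightarrow> 0"
      using tendsto_mult[OF tendsto_const[of "cmod c"], of "\<lambda>m. opnorm H (op_minus H P0 (P m))" 0] assms
      by (simp add: op_tendsto_def)
  qed
  then show ?thesis using b by (simp add: op_tendsto_def bops_scale)
qed

lemma op_tendsto_multiword_op:
  assumes X: "\<And>i j. i \<in> {1..k} \<Longrightarrow> j \<in> {1..n i} \<Longrightarrow> op_tendsto (\<lambda>m. Y m i j) (X i j)"
    and \<alpha>: "\<alpha> \<in> multiwords k n"
  shows "op_tendsto (\<lambda>m. multiword_op k (Y m) \<alpha>) (multiword_op k X \<alpha>)"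
proof -
  have w: "op_tendsto (\<lambda>m. word_op (Y m i) w) (word_op (X i) w)" if "i \<in> {1..k}" "set w \<subseteq> {1..n i}" for i w
    using that(2) by (induction w) (auto simp: word_op_def intro!: op_tendsto_id op_tendsto_comp X that(1))
  have "op_tendsto (\<lambda>m. foldr (\<lambda>i T. word_op (Y m i) (\<alpha> i) \<circ> T) is id)
      (foldr (\<lambda>i T. word_op (X i) (\<alpha> i) \<circ> T) is id)" if "set is \<subseteq> {1..k}" for "is"
    using that w[OF _ multiwords_in[OF \<alpha>]]
    by (induction "is") (auto intro!: op_tendsto_id op_tendsto_comp)
  from this[of "[1..<Suc k]"] show ?thesis
    unfolding multiword_op_def by (simp del: upt_Suc add: atLeastLessThanSuc_atLeastAtMost)
qed

end

lemma (in tensor) tensor_op_tendsto: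
  assumes A: "A \<in> bops K" and P: "H.op_tendsto P P0" and T: "T \<in> carrier TS"
  shows "(\<lambda>m. hnorm TS (tensor_op K A (P m) T \<ominus>\<^bsub>TS\<^esub> tensor_op K A P0 T)) \<longlonglongrightarrow> 0"
proof (rule Lim_null_comparison)
  have b: "P m \<in> bops H" "P0 \<in> bops H" for m using P by (auto simp: H.op_tendsto_def)
  note pA = K.adjoint_pair_adj[OF A]
  note ins = tensor_op_in_and_norm(1)[OF pA b(1) T] tensor_op_in_and_norm(1)[OF pA b(2) T]
  have "hnorm TS (tensor_op K A (P m) T \<ominus>\<^bsub>TS\<^esub> tensor_op K A P0 T)
      \<le> opnorm H (op_minus H P0 (P m)) * opnorm K A * hnorm TS T" for m
  proof -
    have "tensor_op K A P0 T \<ominus>\<^bsub>TS\<^esub> tensor_op K A (P m) T = tensor_op K A (op_minus H P0 (P m)) T"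
    proof (rule ts_eqI)
      show "tensor_op K A (op_minus H P0 (P m)) T \<in> carrier TS"
        by (rule tensor_op_in_and_norm(1)[OF pA H.bops_minus[OF b(2) b(1)] T])
      fix x assume x: "x \<in> carrier K"
      show "(tensor_op K A P0 T \<ominus>\<^bsub>TS\<^esub> tensor_op K A (P m) T) x = tensor_op K A (op_minus H P0 (P m)) T x"
        unfolding ts_minus_apply[OF ins(2,1) x] using x by (simp add: tensor_op_def op_minus_def)
    qed (use ins in auto)
    then show ?thesis
      using tensor_op_in_and_norm(2)[OF pA H.bops_minus[OF b(2) b(1)] T, of m]
        TS.hnorm_minus_commute[OF ins(2) ins(1), of m] by simp
  qed
  then show "\<forall>\<^sub>F m in sequentially. norm (hnorm TS (tensor_op K A (P m) T \<ominus>\<^bsub>TS\<^esub> tensor_op K A P0 T))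
      \<le> opnorm H (op_minus H P0 (P m)) * opnorm K A * hnorm TS T"
    using ins by (intro always_eventually) simp
  have "(\<lambda>m. opnorm H (op_minus H P0 (P m)) * opnorm K A * hnorm TS T) \<longlonglongrightarrow> 0 * opnorm K A * hnorm TS T"
    using P by (intro tendsto_intros) (simp add: H.op_tendsto_def)
  then show "(\<lambda>m. opnorm H (op_minus H P0 (P m)) * opnorm K A * hnorm TS T) \<longlonglongrightarrow> 0" by simp
qed

lemma (in hilbert_space) finsum_tendsto:
  assumes "finite J" and in_H: "\<And>j m. j \<in> J \<Longrightarrow> f m j \<in> carrier H" "\<And>j. j \<in> J \<Longrightarrow> g j \<in> carrier H"
    and lim: "\<And>j. j \<in> J \<Longrightarrow> (\<lambda>m. hnorm H (f m j \<ominus> g j)) \<longlonglongrightarrow> 0"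
  shows "(\<lambda>m. hnorm H (finsum H (f m) J \<ominus> finsum H g J)) \<longlonglongrightarrow> 0"
proof (rule Lim_null_comparison)
  have "finsum H (f m) J \<ominus> finsum H g J = finsum H (\<lambda>j. f m j \<ominus> g j) J" for m
    using in_H by (intro eq_by_ip) (auto simp: ip_minus_left ip_finsum_left sum_subtractf)
  then show "\<forall>\<^sub>F m in sequentially. norm (hnorm H (finsum H (f m) J \<ominus> finsum H g J)) \<le> (\<Sum>j\<in>J. hnorm H (f m j \<ominus> g j))"
    using in_H hnorm_finsum[of J "\<lambda>j. f m j \<ominus> g j" for m] by (intro always_eventually) simp
  show "(\<lambda>m. \<Sum>j\<in>J. hnorm H (f m j \<ominus> g j)) \<longlonglongrightarrow> 0"
    using tendsto_sum[of J "\<lambda>j m. hnorm H (f m j \<ominus> g j)" "\<lambda>_. 0"] lim by simp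
qed

text \<open>
  A polynomial is continuous in operator norm, and the right hand side does not depend on \<open>X\<close>.
\<close>

theorem von_neumann_polyball_closure:
  fixes K :: "'k hilb" and H :: "'h hilb"
  assumes K: "hilbert_space K" and H: "hilbert_space H" and X: "X \<in> polyball_closure k n H"
    and A: "\<And>\<alpha>. \<alpha> \<in> multiwords k n \<Longrightarrow> A \<alpha> \<in> bops K"
    and D: "finite D" "D \<subseteq> multidegrees k"
  shows "opnorm (tensor_space K H) (op_sum (tensor_space K H) (homogeneous_part k n K A H (scale_tuple H r X)) D)
    \<le> opnorm (tensor_space K (fock k n)) (op_sum (tensor_space K (fock k n))
        (homogeneous_part k n K A (fock k n) (scale_tuple (fock k n) r creation)) D)" (is "_ \<le> ?C")
proof -
  interpret tensor K H using K H by (simp add: tensor_def)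
  let ?q = "\<lambda>Z. op_sum TS (homogeneous_part k n K A H Z) D"
  have "\<forall>m::nat. \<exists>Y. Y \<in> polyball k n H \<and>
      (\<forall>i\<in>{1..k}. \<forall>j\<in>{1..n i}. opnorm H (op_minus H (X i j) (Y i j)) < 1 / Suc m)"
    using X by (auto simp: polyball_closure_def Bex_def)
  then obtain Y where Y: "\<forall>m::nat. Y m \<in> polyball k n H \<and>
      (\<forall>i\<in>{1..k}. \<forall>j\<in>{1..n i}. opnorm H (op_minus H (X i j) (Y m i j)) < 1 / Suc m)"
    by (rule choice[THEN exE])
  have Xb: "X i j \<in> bops H" and Yb: "Y m i j \<in> bops H" if "i \<in> {1..k}" "j \<in> {1..n i}" for i j m
    using X Y that by (auto simp: polyball_closure_def polyball_def op_tuples_def)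
  have lim0: "H.op_tendsto (\<lambda>m. Y m i j) (X i j)" if ij: "i \<in> {1..k}" "j \<in> {1..n i}" for i j
    unfolding H.op_tendsto_def
  proof (intro conjI allI Xb Yb ij)
    show "(\<lambda>m. opnorm H (op_minus H (X i j) (Y m i j))) \<longlonglongrightarrow> 0"
    proof (rule Lim_null_comparison[OF _ LIMSEQ_Suc[OF lim_1_over_n]])
      have "norm (opnorm H (op_minus H (X i j) (Y m i j))) \<le> 1 / real (Suc m)" for m
      proof -
        have "opnorm H (op_minus H (X i j) (Y m i j)) < 1 / real (Suc m)" using Y ij by blast
        then show ?thesis
          using H.opnorm_nonneg[OF H.bops_minus[OF Xb[OF ij] Yb[OF ij]], of m] by simp
      qed
      then show "\<forall>\<^sub>F m in sequentially. norm (opnorm H (op_minus H (X i j) (Y m i j))) \<le> 1 / of_nat (Suc m)"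
        by simp
    qed
  qed
  have lim: "H.op_tendsto (\<lambda>m. scale_tuple H r (Y m) i j) (scale_tuple H r X i j)"
    if "i \<in> {1..k}" "j \<in> {1..n i}" for i j
    unfolding scale_tuple_def by (rule H.op_tendsto_scale[OF lim0[OF that]])
  have sb: "scale_tuple H r X i j \<in> bops H" "scale_tuple H r (Y m) i j \<in> bops H"
    if "i \<in> {1..k}" "j \<in> {1..n i}" for i j m
    using lim[OF that] by (auto simp: H.op_tendsto_def)
  have C: "0 \<le> ?C"
  proof -
    interpret KG: tensor K "fock k n" using K fock_hilbert by (simp add: tensor_def)
    show ?thesis
    proof (intro KG.TS.opnorm_nonneg KG.TS.bops_sum KG.homogeneous_part_bops A)
      show "scale_tuple (fock k n) r creation i j \<in> bops (fock k n)" if "i \<in> {1..k}" "j \<in> {1..n i}" for i j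
        unfolding scale_tuple_def
        by (rule KG.H.bops_scale[OF KG.H.adjoint_pairD(1)[OF creation_adjoint[of i k j n, OF that]]])
    qed
  qed
  show ?thesis
  proof (rule TS.opnorm_le[OF C])
    fix T assume T: "T \<in> carrier TS"
    let ?J = "\<Union>p\<in>D. multiwords_deg k n p"
    have J: "finite ?J" "\<And>\<alpha>. \<alpha> \<in> ?J \<Longrightarrow> \<alpha> \<in> multiwords k n"
      using D finite_multiwords_deg by (auto simp: multiwords_deg_def)
    have qb: "?q (scale_tuple H r X) \<in> bops TS" "?q (scale_tuple H r (Y m)) \<in> bops TS" for m
      by (rule TS.bops_sum[OF homogeneous_part_bops[OF A sb(1)]],
          assumption+) (rule TS.bops_sum[OF homogeneous_part_bops[OF A sb(2)]], assumption+)
    have term_in: "tensor_op K (A \<alpha>) (multiword_op k (scale_tuple H r X) \<alpha>) T \<in> carrier TS"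
      "tensor_op K (A \<alpha>) (multiword_op k (scale_tuple H r (Y m)) \<alpha>) T \<in> carrier TS" if "\<alpha> \<in> ?J" for \<alpha> m
      using bops_in[OF tensor_op_bops[OF A[OF J(2)[OF that]] H.multiword_op_bops[of k n, OF _ J(2)[OF that]]] T]
        sb by blast+
    have flat: "?q (scale_tuple H r X) T = op_sum TS (\<lambda>\<alpha>. tensor_op K (A \<alpha>) (multiword_op k (scale_tuple H r X) \<alpha>)) ?J T"
      "?q (scale_tuple H r (Y m)) T = op_sum TS (\<lambda>\<alpha>. tensor_op K (A \<alpha>) (multiword_op k (scale_tuple H r (Y m)) \<alpha>)) ?J T" for m
      by (rule partial_sum_flatten[OF _ _ D T], erule A, erule (1) sb(1),
          rule partial_sum_flatten[OF _ _ D T], erule A, erule (1) sb(2))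
    have "(\<lambda>m. hnorm TS (?q (scale_tuple H r (Y m)) T \<ominus>\<^bsub>TS\<^esub> ?q (scale_tuple H r X) T)) \<longlonglongrightarrow> 0"
      unfolding flat unfolding op_sum_def
      by (rule TS.finsum_tendsto[OF J(1) term_in(2) term_in(1)])
         (auto intro!: tensor_op_tendsto T A J(2) H.op_tendsto_multiword_op[of k n] lim)
    then have "(\<lambda>m. hnorm TS (?q (scale_tuple H r (Y m)) T)) \<longlonglongrightarrow> hnorm TS (?q (scale_tuple H r X) T)"
      by (intro TS.tendsto_hnorm bops_in[OF qb(1) T] bops_in[OF qb(2) T])
    then show "hnorm TS (?q (scale_tuple H r X) T) \<le> ?C * hnorm TS T"
    proof (rule LIMSEQ_le_const2, intro exI allI impI)
      fix m
      have "hnorm TS (?q (scale_tuple H r (Y m)) T) \<le> opnorm TS (?q (scale_tuple H r (Y m))) * hnorm TS T"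
        by (rule TS.opnorm_bound[OF qb(2) T])
      also have "\<dots> \<le> ?C * hnorm TS T"
        using Y by (intro mult_right_mono von_neumann_polyball K H A D TS.hnorm_ge_0 T) auto
      finally show "hnorm TS (?q (scale_tuple H r (Y m)) T) \<le> ?C * hnorm TS T" .
    qed
  qed
qed

section \<open>A copy of the Fock space in a given universe\<close>

lemma countable_multiwords: "countable (multiwords k n)"
  unfolding multiwords_def by (intro countable_PiE) auto

lemma real_eq_by_rats:
  assumes "\<And>q :: rat. real_of_rat q < x \<longleftrightarrow> real_of_rat q < y"
  shows "x = y"
proof (rule ccontr)
  assume "x \<noteq> y"
  then consider "x < y" | "y < x" by linarith
  then show False
  proof cases
    case 1
    then obtain q where "x < real_of_rat q" "real_of_rat q < y" using of_rat_dense by blast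
    then show False using assms[of q] by simp
  next
    case 2
    then obtain q where "y < real_of_rat q" "real_of_rat q < x" using of_rat_dense by blast
    then show False using assms[of q] by simp
  qed
qed

text \<open>
  A vector is determined by the rational numbers below the real and imaginary parts of its
  coefficients, and there are only countably many coefficients.  Hence it is coded by a set of
  natural numbers.
\<close>

lemma carrier_fock_lepoll_reals: "carrier (fock k n) \<lesssim> (UNIV :: real set)"
proof -
  let ?W = "multiwords k n"
  define code :: "((nat \<Rightarrow> nat list) \<Rightarrow> complex) \<Rightarrow> nat set" where
    "code f = to_nat ` {(to_nat_on ?W \<alpha>, b, q :: rat) | \<alpha> b q. \<alpha> \<in> ?W \<and> real_of_rat q < (if b then Re (f \<alpha>) else Im (f \<alpha>))}" for f
  have mem: "to_nat (to_nat_on ?W \<alpha>, b, q) \<in> code f \<longleftrightarrow> real_of_rat q < (if b then Re (f \<alpha>) else Im (f \<alpha>))"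
    if "\<alpha> \<in> ?W" for \<alpha> b q f
  proof
    assume "to_nat (to_nat_on ?W \<alpha>, b, q) \<in> code f"
    then obtain \<beta> where "\<beta> \<in> ?W" "to_nat_on ?W \<alpha> = to_nat_on ?W \<beta>"
        "real_of_rat q < (if b then Re (f \<beta>) else Im (f \<beta>))"
      by (auto simp: code_def)
    moreover then have "\<alpha> = \<beta>"
      using inj_on_to_nat_on[OF countable_multiwords[of k n]] that by (auto dest: inj_onD)
    ultimately show "real_of_rat q < (if b then Re (f \<alpha>) else Im (f \<alpha>))" by (simp split: if_splits)
  next
    assume "real_of_rat q < (if b then Re (f \<alpha>) else Im (f \<alpha>))"
    then show "to_nat (to_nat_on ?W \<alpha>, b, q) \<in> code f"
      using that unfolding code_def by blast
  qed
  have "inj_on code (carrier (fock k n))"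
  proof (rule inj_onI)
    fix f g assume fg: "f \<in> carrier (fock k n)" "g \<in> carrier (fock k n)" "code f = code g"
    have "f \<alpha> = g \<alpha>" for \<alpha>
    proof (cases "\<alpha> \<in> ?W")
      case True
      have "Re (f \<alpha>) = Re (g \<alpha>)"
      proof (rule real_eq_by_rats)
        show "real_of_rat q < Re (f \<alpha>) \<longleftrightarrow> real_of_rat q < Re (g \<alpha>)" for q
          using mem[OF True, of True q f] mem[OF True, of True q g] fg(3) by simp
      qed
      moreover have "Im (f \<alpha>) = Im (g \<alpha>)"
      proof (rule real_eq_by_rats)
        show "real_of_rat q < Im (f \<alpha>) \<longleftrightarrow> real_of_rat q < Im (g \<alpha>)" for q
          using mem[OF True, of False q f] mem[OF True, of False q g] fg(3) by simp
      qed
      ultimately show ?thesis by (simp add: complex_eq_iff)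
    next
      case False
      then show ?thesis using fg by (auto simp: fock_iff)
    qed
    then show "f = g" by blast
  qed
  then have "carrier (fock k n) \<lesssim> (UNIV :: nat set set)"
    unfolding lepoll_def by blast
  then show ?thesis
    using nat_sets_eqpoll_reals lepoll_trans eqpoll_imp_lepoll by blast
qed

text \<open>
  The Hilbert space obtained from \<open>H\<close> by renaming its vectors with an injective map \<open>\<Theta>\<close> into another
  type.
\<close>

locale hilbert_copy = hilbert_space H for H :: "'a hilb" (structure) +
  fixes \<Theta> :: "'a \<Rightarrow> 'b"
  assumes inj: "inj_on \<Theta> (carrier H)"
begin

definition \<Psi> :: "'b \<Rightarrow> 'a" where "\<Psi> = inv_into (carrier H) \<Theta>"

definition C :: "'b hilb" where
  "C = \<lparr>carrier = \<Theta> ` carrier H, mult = undefined, one = undefined, zero = \<Theta> \<zero>,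
     add = (\<lambda>x y. \<Theta> (\<Psi> x \<oplus> \<Psi> y)), smult = (\<lambda>c x. \<Theta> (c \<odot> \<Psi> x)), ip = (\<lambda>x y. ip H (\<Psi> x) (\<Psi> y))\<rparr>"

lemma C_simps:
  "carrier C = \<Theta> ` carrier H" "\<zero>\<^bsub>C\<^esub> = \<Theta> \<zero>" "x \<oplus>\<^bsub>C\<^esub> y = \<Theta> (\<Psi> x \<oplus> \<Psi> y)"
  "c \<odot>\<^bsub>C\<^esub> x = \<Theta> (c \<odot> \<Psi> x)" "ip C x y = ip H (\<Psi> x) (\<Psi> y)"
  by (simp_all add: C_def)

lemma \<Psi>_\<Theta> [simp]: "x \<in> carrier H \<Longrightarrow> \<Psi> (\<Theta> x) = x"
  unfolding \<Psi>_def by (rule inv_into_f_f[OF inj])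

lemma \<Theta>_in [simp]: "x \<in> carrier H \<Longrightarrow> \<Theta> x \<in> carrier C"
  by (simp add: C_simps)

lemma \<Psi>_in [simp]: "y \<in> carrier C \<Longrightarrow> \<Psi> y \<in> carrier H"
  by (auto simp: C_simps)

lemma \<Theta>_\<Psi> [simp]: "y \<in> carrier C \<Longrightarrow> \<Theta> (\<Psi> y) = y"
  by (auto simp: C_simps)

lemma hnorm_C: "hnorm C y = hnorm H (\<Psi> y)"
  by (simp add: hnorm_def C_simps)

lemma C_module: "module complex_field C"
proof (rule moduleI)
  show "abelian_group C"
  proof (rule abelian_groupI)
    fix x assume x: "x \<in> carrier C"
    show "\<exists>y\<in>carrier C. y \<oplus>\<^bsub>C\<^esub> x = \<zero>\<^bsub>C\<^esub>"
    proof
      show "\<Theta> (\<ominus> \<Psi> x) \<oplus>\<^bsub>C\<^esub> x = \<zero>\<^bsub>C\<^esub>"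
        using x by (simp add: C_simps(2,3) M.l_neg)
    qed (use x in simp)
  next
    fix x y z assume "x \<in> carrier C" "y \<in> carrier C" "z \<in> carrier C"
    then show "x \<oplus>\<^bsub>C\<^esub> y \<oplus>\<^bsub>C\<^esub> z = x \<oplus>\<^bsub>C\<^esub> (y \<oplus>\<^bsub>C\<^esub> z)"
      by (simp add: C_simps(3) M.a_assoc)
  next
    fix x y assume "x \<in> carrier C" "y \<in> carrier C"
    then show "x \<oplus>\<^bsub>C\<^esub> y = y \<oplus>\<^bsub>C\<^esub> x" by (simp add: C_simps(3) M.a_comm)
  qed (simp_all add: C_simps(2,3))
next
  fix a b :: complex and x y assume "x \<in> carrier C" "y \<in> carrier C"
  then show "(a \<oplus>\<^bsub>complex_field\<^esub> b) \<odot>\<^bsub>C\<^esub> x = a \<odot>\<^bsub>C\<^esub> x \<oplus>\<^bsub>C\<^esub> b \<odot>\<^bsub>C\<^esub> x"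
    "a \<odot>\<^bsub>C\<^esub> (x \<oplus>\<^bsub>C\<^esub> y) = a \<odot>\<^bsub>C\<^esub> x \<oplus>\<^bsub>C\<^esub> a \<odot>\<^bsub>C\<^esub> y"
    "a \<otimes>\<^bsub>complex_field\<^esub> b \<odot>\<^bsub>C\<^esub> x = a \<odot>\<^bsub>C\<^esub> (b \<odot>\<^bsub>C\<^esub> x)"
    "\<one>\<^bsub>complex_field\<^esub> \<odot>\<^bsub>C\<^esub> x = x"
    using smult_l_distr[of a b "\<Psi> x"] by (simp_all add: C_simps(3,4) smult_add smult_smult)
qed (auto intro: cring_complex_field simp: C_simps(4))

lemma \<Psi>_minus:
  assumes "x \<in> carrier C" "y \<in> carrier C"
  shows "\<Psi> (x \<ominus>\<^bsub>C\<^esub> y) = \<Psi> x \<ominus> \<Psi> y"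
proof -
  interpret C: module complex_field C by (rule C_module)
  have n: "\<ominus>\<^bsub>C\<^esub> y \<in> carrier C" using assms by simp
  have "\<Psi> (\<ominus>\<^bsub>C\<^esub> y \<oplus>\<^bsub>C\<^esub> y) = \<Psi> \<zero>\<^bsub>C\<^esub>" using assms by (simp add: C.M.l_neg)
  then have "\<Psi> (\<ominus>\<^bsub>C\<^esub> y) \<oplus> \<Psi> y = \<zero>" using assms n by (simp add: C_simps(2,3))
  then have "\<Psi> (\<ominus>\<^bsub>C\<^esub> y) = \<ominus> \<Psi> y"
    using M.minus_equality[of "\<Psi> (\<ominus>\<^bsub>C\<^esub> y)" "\<Psi> y"] assms n by simp
  then show ?thesis using assms n by (simp add: C.M.minus_eq M.minus_eq C_simps(3))
qed

lemma C_hilbert: "hilbert_space C"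
proof (rule hilbert_space.intro[OF C_module], unfold_locales)
  fix x y z assume "x \<in> carrier C" "y \<in> carrier C" "z \<in> carrier C"
  then show "ip C (x \<oplus>\<^bsub>C\<^esub> y) z = ip C x z + ip C y z"
    by (simp add: C_simps(3,5) ip_add_left)
next
  fix c x y assume "x \<in> carrier C" "y \<in> carrier C"
  then show "ip C (c \<odot>\<^bsub>C\<^esub> x) y = c * ip C x y" "ip C y x = cnj (ip C x y)"
    using ip_cnj[of "\<Psi> x" "\<Psi> y"] by (simp_all add: C_simps(4,5) ip_smult_left)
next
  fix x assume x: "x \<in> carrier C"
  then show "0 \<le> Re (ip C x x)" by (simp add: C_simps(5) ip_nonneg)
  assume "ip C x x = 0"
  then have "\<Psi> x = \<zero>" using x ip_definite[of "\<Psi> x"] by (simp add: C_simps(5))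
  then show "x = \<zero>\<^bsub>C\<^esub>" using \<Theta>_\<Psi>[OF x] by (simp add: C_simps(2))
next
  fix \<sigma> :: "nat \<Rightarrow> 'b"
  assume \<sigma>: "\<And>m. \<sigma> m \<in> carrier C"
    and cauchy: "\<And>e. 0 < e \<Longrightarrow> \<exists>N. \<forall>l\<ge>N. \<forall>m\<ge>N. hnorm C (\<sigma> l \<ominus>\<^bsub>C\<^esub> \<sigma> m) < e"
  have "\<exists>x\<in>carrier H. (\<lambda>m. hnorm H (\<Psi> (\<sigma> m) \<ominus> x)) \<longlonglongrightarrow> 0"
    by (rule complete) (use \<sigma> cauchy in \<open>simp_all add: hnorm_C \<Psi>_minus\<close>)
  then obtain x where x: "x \<in> carrier H" "(\<lambda>m. hnorm H (\<Psi> (\<sigma> m) \<ominus> x)) \<longlonglongrightarrow> 0" by blast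
  show "\<exists>x\<in>carrier C. (\<lambda>m. hnorm C (\<sigma> m \<ominus>\<^bsub>C\<^esub> x)) \<longlonglongrightarrow> 0"
    by (rule bexI[of _ "\<Theta> x"]) (use x \<sigma> in \<open>simp_all add: hnorm_C \<Psi>_minus\<close>)
qed

sublocale C: hilbert_space C by (rule C_hilbert)

lemma \<Theta>_hlinear: "hlinear H C \<Theta>"
  by (auto simp: hlinear_def C_simps(3,4))

definition transport :: "('a \<Rightarrow> 'a) \<Rightarrow> 'b \<Rightarrow> 'b" where
  "transport T = (\<lambda>y. \<Theta> (T (\<Psi> y)))"

lemma transport_adjoint:
  assumes "adjoint_pair H T T'"
  shows "adjoint_pair C (transport T) (transport T')"
proof -
  have b: "transport T \<in> bops C" if T: "T \<in> bops H" for T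
  proof (rule bopsI)
    show "hlinear C C (transport T)"
      using bops_in[OF T] by (auto simp: hlinear_def transport_def C_simps(3,4) bops_add[OF T] bops_smult[OF T])
    show "hnorm C (transport T y) \<le> opnorm H T * hnorm C y" if "y \<in> carrier C" for y
      using opnorm_bound[OF T, of "\<Psi> y"] that bops_in[OF T] by (simp add: hnorm_C transport_def)
  qed
  show ?thesis
    using adjoint_pairD(1-3)[OF assms] b
    by (auto simp: adjoint_pair_def transport_def C_simps(5) bops_in)
qed

end

section \<open>The universal model belongs to the closed polyball\<close>

lemmas fock_minus = ell2_minus[of f "multiwords k n" g, folded fock_def] for f k n g

lemma fock_finsum_apply:
  assumes "\<And>j. j \<in> J \<Longrightarrow> f j \<in> carrier (fock k n)"
  shows "finsum (fock k n) f J \<alpha> = (\<Sum>j\<in>J. f j \<alpha>)"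
proof -
  interpret F: hilbert_space "fock k n" by (rule fock_hilbert)
  show ?thesis using assms
  proof (induction J rule: infinite_finite_induct)
    case (insert i J)
    have "finsum (fock k n) f (insert i J) = f i \<oplus>\<^bsub>fock k n\<^esub> finsum (fock k n) f J"
      using insert by (subst F.M.finsum_insert) auto
    then show ?case using insert by (simp add: fock_simps)
  qed (auto simp: fock_simps)
qed

lemma fock_mult:
  assumes f: "f \<in> carrier (fock k n)" and d: "\<And>\<alpha>. \<bar>d \<alpha>\<bar> \<le> c"
  shows "(\<lambda>\<alpha>. complex_of_real (d \<alpha>) * f \<alpha>) \<in> carrier (fock k n)"
    "hnorm (fock k n) (\<lambda>\<alpha>. complex_of_real (d \<alpha>) * f \<alpha>) \<le> c * hnorm (fock k n) f"
proof -
  let ?g = "\<lambda>\<alpha>. complex_of_real (d \<alpha>) * f \<alpha>"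
  have c: "0 \<le> c" using d[of undefined] by linarith
  have le: "(cmod (?g \<alpha>))\<^sup>2 \<le> c\<^sup>2 * (cmod (f \<alpha>))\<^sup>2" for \<alpha>
  proof -
    have "(cmod (?g \<alpha>))\<^sup>2 = \<bar>d \<alpha>\<bar>\<^sup>2 * (cmod (f \<alpha>))\<^sup>2" by (simp add: norm_mult power_mult_distrib)
    also have "\<dots> \<le> c\<^sup>2 * (cmod (f \<alpha>))\<^sup>2" by (intro mult_right_mono power_mono d) auto
    finally show ?thesis .
  qed
  note s = has_sum_cmult_right[OF fock_hnorm_sum[OF f], of "c\<^sup>2"]
  have "(\<lambda>\<alpha>. (cmod (?g \<alpha>))\<^sup>2) summable_on multiwords k n"
    by (rule summable_on_comparison_test[OF has_sum_imp_summable[OF s] le]) simp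
  then show g: "?g \<in> carrier (fock k n)" using f by (simp add: fock_iff)
  have "(hnorm (fock k n) ?g)\<^sup>2 \<le> c\<^sup>2 * (hnorm (fock k n) f)\<^sup>2"
    by (rule has_sum_mono[OF fock_hnorm_sum[OF g] s le])
  then have "(hnorm (fock k n) ?g)\<^sup>2 \<le> (c * hnorm (fock k n) f)\<^sup>2" by (simp add: power_mult_distrib)
  then show "hnorm (fock k n) ?g \<le> c * hnorm (fock k n) f"
    by (rule power2_le_imp_le) (use c hilbert_space.hnorm_ge_0[OF fock_hilbert f] in simp)
qed

lemma fock_mult_ip:
  assumes f: "f \<in> carrier (fock k n)" and d: "\<And>\<alpha>. 0 \<le> d \<alpha>" "\<And>\<alpha>. d \<alpha> \<le> c"
  shows "Im (ip (fock k n) (\<lambda>\<alpha>. complex_of_real (d \<alpha>) * f \<alpha>) f) = 0"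
    "0 \<le> Re (ip (fock k n) (\<lambda>\<alpha>. complex_of_real (d \<alpha>) * f \<alpha>) f)"
proof -
  have g: "(\<lambda>\<alpha>. complex_of_real (d \<alpha>) * f \<alpha>) \<in> carrier (fock k n)"
    using fock_mult(1)[OF f, of d c] d by (simp add: abs_le_iff)
  have s: "((\<lambda>\<alpha>. complex_of_real (d \<alpha>) * f \<alpha> * cnj (f \<alpha>)) has_sum ip (fock k n) (\<lambda>\<alpha>. complex_of_real (d \<alpha>) * f \<alpha>) f) (multiwords k n)"
    using ell2_ip_has_sum[of _ "multiwords k n" f] g f by (simp add: fock_def)
  have e: "complex_of_real (d \<alpha>) * f \<alpha> * cnj (f \<alpha>) = complex_of_real (d \<alpha> * (cmod (f \<alpha>))\<^sup>2)" for \<alpha>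
    by (simp add: of_real_cmod_sq mult.assoc)
  have "((\<lambda>\<alpha>. Im (complex_of_real (d \<alpha> * (cmod (f \<alpha>))\<^sup>2))) has_sum Im (ip (fock k n) (\<lambda>\<alpha>. complex_of_real (d \<alpha>) * f \<alpha>) f)) (multiwords k n)"
    using has_sum_bounded_linear[OF bounded_linear_Im s[unfolded e]] .
  then show "Im (ip (fock k n) (\<lambda>\<alpha>. complex_of_real (d \<alpha>) * f \<alpha>) f) = 0"
    by (simp only: Im_complex_of_real) (rule has_sum_unique[OF _ has_sum_0]; simp)
  have "((\<lambda>\<alpha>. Re (complex_of_real (d \<alpha> * (cmod (f \<alpha>))\<^sup>2))) has_sum Re (ip (fock k n) (\<lambda>\<alpha>. complex_of_real (d \<alpha>) * f \<alpha>) f)) (multiwords k n)"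
    using has_sum_bounded_linear[OF bounded_linear_Re s[unfolded e]] .
  then show "0 \<le> Re (ip (fock k n) (\<lambda>\<alpha>. complex_of_real (d \<alpha>) * f \<alpha>) f)"
    by (rule has_sum_nonneg) (simp add: d)
qed

locale fock_copy = hilbert_copy "fock k n" \<Theta> for k n and \<Theta> :: "((nat \<Rightarrow> nat list) \<Rightarrow> complex) \<Rightarrow> 'b"
begin

definition S :: "nat \<Rightarrow> nat \<Rightarrow> 'b \<Rightarrow> 'b" where
  "S i j = transport (creation i j)"

lemma S_adjoint:
  "i \<in> {1..k} \<Longrightarrow> j \<in> {1..n i} \<Longrightarrow> adjoint_pair C (S i j) (transport (annihilation k n i j))"
  unfolding S_def by (rule transport_adjoint[OF creation_adjoint[of i k j n]])

lemma S_commute: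
  assumes "s \<in> {1..k}" "t \<in> {1..k}" "s \<noteq> t" "j \<in> {1..n s}" "l \<in> {1..n t}" "x \<in> carrier C"
  shows "S s j (S t l x) = S t l (S s j x)"
proof -
  have "creation s j (creation t l f) = creation t l (creation s j f)" for f
    using assms(3) by (auto simp: creation_def fun_eq_iff fun_upd_twist)
  then show ?thesis
    using creation_norm(1)[of s k j n, OF assms(1,4)] creation_norm(1)[of t k l n, OF assms(2,5)] assms(6)
    by (simp add: S_def transport_def)
qed

lemma S_tuple: "S \<in> op_tuples k n C"
  using S_commute C.adjoint_pairD(1)[OF S_adjoint] by (auto simp: op_tuples_def)

abbreviation "tS t \<equiv> scale_tuple C t S"

lemma tS_adjoint:
  assumes "i \<in> {1..k}" "j \<in> {1..n i}"
  shows "adjoint_pair C (tS t i j) (\<lambda>y. complex_of_real (t i) \<odot>\<^bsub>C\<^esub> transport (annihilation k n i j) y)"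
  using C.adjoint_pair_scale[OF S_adjoint[OF assms], of "complex_of_real (t i)"]
  by (simp add: scale_tuple_def)

lemma tS_tuple: "tS t \<in> op_tuples k n C"
proof -
  have Sin: "S i j x \<in> carrier C" if "i \<in> {1..k}" "j \<in> {1..n i}" "x \<in> carrier C" for i j x
    by (rule bops_in[OF C.adjoint_pairD(1)[OF S_adjoint[OF that(1,2)]] that(3)])
  have "tS t s j (tS t u l x) = tS t u l (tS t s j x)"
    if st: "s \<in> {1..k}" "u \<in> {1..k}" "s \<noteq> u" "j \<in> {1..n s}" "l \<in> {1..n u}" "x \<in> carrier C" for s u j l x
    using bops_smult[OF C.adjoint_pairD(1)[OF S_adjoint[OF st(1,4)]] Sin[OF st(2,5,6)]]
      bops_smult[OF C.adjoint_pairD(1)[OF S_adjoint[OF st(2,5)]] Sin[OF st(1,4,6)]]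
      S_commute[OF st] Sin[OF st(1,4) Sin[OF st(2,5,6)]]
      Sin[OF st(2,5) Sin[OF st(1,4,6)]]
    by (simp add: scale_tuple_def C.smult_smult mult.commute)
  then show ?thesis using C.adjoint_pairD(1)[OF tS_adjoint] by (auto simp: op_tuples_def)
qed

definition diagonal :: "((nat \<Rightarrow> nat list) \<Rightarrow> real) \<Rightarrow> ('b \<Rightarrow> 'b) \<Rightarrow> bool" where
  "diagonal d Y \<longleftrightarrow> (\<forall>y\<in>carrier C. Y y = \<Theta> (\<lambda>\<alpha>. complex_of_real (d \<alpha>) * \<Psi> y \<alpha>))"

lemma diagonal_id: "diagonal (\<lambda>_. 1) id"
  by (simp add: diagonal_def)

text \<open>
  The operator \<open>S i j (S i j)\<^sup>*\<close> is the projection onto the vectors supported on the multi-words whose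
  component \<open>i\<close> starts with \<open>j\<close>.  Each nonempty component starts with exactly one letter, so that
  summation over \<open>j\<close> leaves a diagonal operator.
\<close>

lemma diagonal_Phi:
  assumes i: "i \<in> {1..k}" and Y: "diagonal d Y" and d: "\<And>\<alpha>. \<bar>d \<alpha>\<bar> \<le> c"
  shows "diagonal (\<lambda>\<alpha>. if \<alpha> i = [] then 0 else (t i)\<^sup>2 * d (\<alpha>(i := tl (\<alpha> i)))) (Phi C (n i) (tS t i) Y)"
  unfolding diagonal_def
proof
  fix y assume y: "y \<in> carrier C"
  define f where "f = \<Psi> y"
  have f: "f \<in> carrier (fock k n)" unfolding f_def by (rule \<Psi>_in[OF y])
  have f0: "f \<alpha> = 0" if "\<alpha> \<notin> multiwords k n" for \<alpha> using f that by (auto simp: fock_iff)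
  define a where "a j = (\<lambda>\<alpha>. complex_of_real (t i) * annihilation k n i j f \<alpha>)" for j
  define b where "b j = (\<lambda>\<alpha>. complex_of_real (d \<alpha>) * a j \<alpha>)" for j
  define g where "g j = (\<lambda>\<alpha>. complex_of_real (t i) * creation i j (b j) \<alpha>)" for j
  have sm: "(\<lambda>\<alpha>. z * h \<alpha>) \<in> carrier (fock k n)" if "h \<in> carrier (fock k n)" for z h
    using ell2_smult_closed[of h "multiwords k n" z] that by (simp add: fock_def)
  have an: "annihilation k n i j f \<in> carrier (fock k n)" if "j \<in> {1..n i}" for j
    by (rule annihilation_norm(1)[of i k j n, OF i that f])
  have a: "a j \<in> carrier (fock k n)" if "j \<in> {1..n i}" for j
    unfolding a_def by (rule sm[OF an[OF that]])
  have b: "b j \<in> carrier (fock k n)" if "j \<in> {1..n i}" for j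
    unfolding b_def by (rule fock_mult(1)[OF a[OF that] d])
  have cb: "creation i j (b j) \<in> carrier (fock k n)" if "j \<in> {1..n i}" for j
    by (rule creation_norm(1)[of i k j n, OF i that b[OF that]])
  have g: "g j \<in> carrier (fock k n)" if "j \<in> {1..n i}" for j
    unfolding g_def by (rule sm[OF cb[OF that]])
  have "(tS t i j \<circ> Y \<circ> adj C (tS t i j)) y = \<Theta> (g j)" if j: "j \<in> {1..n i}" for j
  proof -
    have "adj C (tS t i j) y = \<Theta> (a j)"
      using C.adj_eq[OF tS_adjoint[OF i j] y] an[OF j]
      by (simp add: transport_def C_simps(4) f_def[symmetric] fock_simps a_def)
    moreover have "Y (\<Theta> (a j)) = \<Theta> (b j)"
      using Y \<Theta>_in[OF a[OF j]] a[OF j] by (simp add: diagonal_def b_def)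
    moreover have "tS t i j (\<Theta> (b j)) = \<Theta> (g j)"
      using b[OF j] cb[OF j] by (simp add: scale_tuple_def S_def transport_def C_simps(4) fock_simps g_def)
    ultimately show ?thesis by simp
  qed
  then have "Phi C (n i) (tS t i) Y y = finsum C (\<lambda>j. \<Theta> (g j)) {1..n i}"
    unfolding Phi_def op_sum_def using g by (intro C.M.finsum_cong') auto
  also have "\<dots> = \<Theta> (finsum (fock k n) g {1..n i})"
    by (rule hlinear_finsum[OF fock_hilbert C_hilbert \<Theta>_hlinear g, symmetric])
  also have "finsum (fock k n) g {1..n i}
      = (\<lambda>\<alpha>. complex_of_real (if \<alpha> i = [] then 0 else (t i)\<^sup>2 * d (\<alpha>(i := tl (\<alpha> i)))) * f \<alpha>)"
  proof
    fix \<alpha> :: "nat \<Rightarrow> nat list"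
    let ?\<beta> = "\<alpha>(i := tl (\<alpha> i))"
    have gj: "g j \<alpha> = (if \<alpha> i \<noteq> [] \<and> hd (\<alpha> i) = j then complex_of_real ((t i)\<^sup>2 * d ?\<beta>) * f \<alpha> else 0)"
      if j: "j \<in> {1..n i}" for j
    proof (cases "\<alpha> i \<noteq> [] \<and> hd (\<alpha> i) = j")
      case True
      then have p: "push i j ?\<beta> = \<alpha>" by (auto simp: push_def)
      have "annihilation k n i j f ?\<beta> = f \<alpha>"
        using push_in[of i k j n ?\<beta>, OF i j] p f0[of \<alpha>] by (simp add: annihilation_def)
      moreover have "creation i j (b j) \<alpha> = b j ?\<beta>" using True by (simp add: creation_def)
      ultimately have "g j \<alpha> = complex_of_real ((t i)\<^sup>2 * d ?\<beta>) * f \<alpha>"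
        by (simp add: g_def b_def a_def power2_eq_square mult_ac)
      then show ?thesis using True by simp
    next
      case False
      then show ?thesis by (auto simp: g_def creation_def)
    qed
    have "finsum (fock k n) g {1..n i} \<alpha> = (\<Sum>j\<in>{1..n i}. g j \<alpha>)"
      by (rule fock_finsum_apply[OF g])
    also have "\<dots> = (\<Sum>j\<in>{1..n i}. if hd (\<alpha> i) = j then (if \<alpha> i \<noteq> [] then complex_of_real ((t i)\<^sup>2 * d ?\<beta>) * f \<alpha> else 0) else 0)"
      by (rule sum.cong[OF refl]) (auto simp: gj)
    also have "\<dots> = (if hd (\<alpha> i) \<in> {1..n i} then (if \<alpha> i \<noteq> [] then complex_of_real ((t i)\<^sup>2 * d ?\<beta>) * f \<alpha> else 0) else 0)"
      by (simp only: sum.delta' finite_atLeastAtMost)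
    also have "\<dots> = complex_of_real (if \<alpha> i = [] then 0 else (t i)\<^sup>2 * d ?\<beta>) * f \<alpha>"
    proof (cases "\<alpha> \<in> multiwords k n \<and> \<alpha> i \<noteq> []")
      case True
      then have "hd (\<alpha> i) \<in> {1..n i}" using multiwords_in[of \<alpha> k n i] i hd_in_set[of "\<alpha> i"] by blast
      then show ?thesis using True by simp
    qed (use f0[of \<alpha>] in auto)
    finally show "finsum (fock k n) g {1..n i} \<alpha>
      = complex_of_real (if \<alpha> i = [] then 0 else (t i)\<^sup>2 * d ?\<beta>) * f \<alpha>" .
  qed
  finally show "Phi C (n i) (tS t i) Y y
      = \<Theta> (\<lambda>\<alpha>. complex_of_real (if \<alpha> i = [] then 0 else (t i)\<^sup>2 * d (\<alpha>(i := tl (\<alpha> i)))) * \<Psi> y \<alpha>)"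
    by (simp only: f_def)
qed

lemma diagonal_minus:
  assumes "diagonal d Y" "diagonal e Z" "\<And>\<alpha>. \<bar>d \<alpha>\<bar> \<le> c" "\<And>\<alpha>. \<bar>e \<alpha>\<bar> \<le> c'"
  shows "diagonal (\<lambda>\<alpha>. d \<alpha> - e \<alpha>) (op_minus C Y Z)"
  unfolding diagonal_def
proof
  fix y assume y: "y \<in> carrier C"
  note m = fock_mult(1)[OF \<Psi>_in[OF y]]
  let ?d = "\<lambda>\<alpha>. complex_of_real (d \<alpha>) * \<Psi> y \<alpha>" and ?e = "\<lambda>\<alpha>. complex_of_real (e \<alpha>) * \<Psi> y \<alpha>"
  have de: "?d \<in> carrier (fock k n)" "?e \<in> carrier (fock k n)"
    by (rule m[OF assms(3)], rule m[OF assms(4)])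
  have "op_minus C Y Z y = \<Theta> ?d \<ominus>\<^bsub>C\<^esub> \<Theta> ?e"
    using assms(1,2) y by (simp add: op_minus_def diagonal_def)
  also have "\<dots> = \<Theta> (\<Psi> (\<Theta> ?d \<ominus>\<^bsub>C\<^esub> \<Theta> ?e))"
    using de by simp
  also have "\<Psi> (\<Theta> ?d \<ominus>\<^bsub>C\<^esub> \<Theta> ?e) = (\<lambda>\<alpha>. ?d \<alpha> - ?e \<alpha>)"
    using de by (simp add: \<Psi>_minus fock_minus)
  finally show "op_minus C Y Z y = \<Theta> (\<lambda>\<alpha>. complex_of_real (d \<alpha> - e \<alpha>) * \<Psi> y \<alpha>)"
    by (simp add: algebra_simps)
qed

lemma diagonal_norm:
  assumes Y: "diagonal d Y" and d: "\<And>\<alpha>. \<bar>d \<alpha>\<bar> \<le> c" and y: "y \<in> carrier C"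
  shows "hnorm C (Y y) \<le> c * hnorm C y"
proof -
  have "hnorm C (Y y) = hnorm (fock k n) (\<lambda>\<alpha>. complex_of_real (d \<alpha>) * \<Psi> y \<alpha>)"
    using Y y fock_mult(1)[OF \<Psi>_in[OF y] d] by (simp add: diagonal_def hnorm_C)
  also have "\<dots> \<le> c * hnorm (fock k n) (\<Psi> y)" by (rule fock_mult(2)[OF \<Psi>_in[OF y] d])
  finally show ?thesis by (simp add: hnorm_C)
qed

lemma diagonal_bops:
  assumes Y: "diagonal d Y" and d: "\<And>\<alpha>. \<bar>d \<alpha>\<bar> \<le> c"
  shows "Y \<in> bops C"
proof (rule bopsI[OF _ diagonal_norm[OF Y d]])
  note m = fock_mult(1)[OF \<Psi>_in d]
  have Yy: "Y y = \<Theta> (\<lambda>\<alpha>. complex_of_real (d \<alpha>) * \<Psi> y \<alpha>)" if "y \<in> carrier C" for y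
    using Y that by (simp add: diagonal_def)
  have Pa: "\<Psi> (x \<oplus>\<^bsub>C\<^esub> y) = (\<lambda>\<alpha>. \<Psi> x \<alpha> + \<Psi> y \<alpha>)" if "x \<in> carrier C" "y \<in> carrier C" for x y
  proof -
    have "\<Psi> (x \<oplus>\<^bsub>C\<^esub> y) = \<Psi> x \<oplus>\<^bsub>fock k n\<^esub> \<Psi> y" using that by (simp add: C_simps(3))
    then show ?thesis by (simp add: fock_simps)
  qed
  have Ps: "\<Psi> (z \<odot>\<^bsub>C\<^esub> x) = (\<lambda>\<alpha>. z * \<Psi> x \<alpha>)" if "x \<in> carrier C" for z x
  proof -
    have "\<Psi> (z \<odot>\<^bsub>C\<^esub> x) = z \<odot>\<^bsub>fock k n\<^esub> \<Psi> x" using that by (simp add: C_simps(4))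
    then show ?thesis by (simp add: fock_simps)
  qed
  show "hlinear C C Y"
    unfolding hlinear_def
  proof (intro conjI ballI allI)
    show "Y \<in> carrier C \<rightarrow> carrier C" using m by (auto simp: Yy)
    show "Y (x \<oplus>\<^bsub>C\<^esub> y) = Y x \<oplus>\<^bsub>C\<^esub> Y y" if "x \<in> carrier C" "y \<in> carrier C" for x y
      using that m[OF that(1)] m[OF that(2)]
      by (simp add: Yy Pa C_simps(3)[of "\<Theta> _" "\<Theta> _"]) (simp add: fock_simps algebra_simps)
    show "Y (z \<odot>\<^bsub>C\<^esub> x) = z \<odot>\<^bsub>C\<^esub> Y x" if "x \<in> carrier C" for z x
      using that m[OF that]
      by (simp add: Yy Ps C_simps(4)[of _ "\<Theta> _"]) (simp add: fock_simps algebra_simps)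
  qed
qed

text \<open>
  The diagonal of the defect operator of the scaled creation operators.
\<close>

definition dfun :: "(nat \<Rightarrow> real) \<Rightarrow> nat set \<Rightarrow> (nat \<Rightarrow> nat list) \<Rightarrow> real" where
  "dfun t J \<alpha> = (\<Prod>i\<in>J. if \<alpha> i = [] then 1 else 1 - (t i)\<^sup>2)"

lemma dfun_bounds:
  assumes t: "\<And>i. i \<in> J \<Longrightarrow> 0 < t i \<and> t i < 1"
  shows "(\<Prod>i\<in>J. 1 - (t i)\<^sup>2) \<le> dfun t J \<alpha>" "dfun t J \<alpha> \<le> 1" "0 < (\<Prod>i\<in>J. 1 - (t i)\<^sup>2)" "0 \<le> dfun t J \<alpha>"
proof -
  have b: "0 < 1 - (t i)\<^sup>2" "1 - (t i)\<^sup>2 \<le> 1" if "i \<in> J" for i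
    using t[OF that] by (simp_all add: abs_square_less_1)
  show p: "0 < (\<Prod>i\<in>J. 1 - (t i)\<^sup>2)" by (rule prod_pos) (use b in auto)
  show l: "(\<Prod>i\<in>J. 1 - (t i)\<^sup>2) \<le> dfun t J \<alpha>"
    unfolding dfun_def using b by (intro prod_mono) (auto simp: less_imp_le)
  show "dfun t J \<alpha> \<le> 1"
    unfolding dfun_def using b by (intro prod_le_1) (auto simp: less_imp_le)
  show "0 \<le> dfun t J \<alpha>" using p l by linarith
qed

lemma diagonal_Delta:
  assumes t: "\<And>i. i \<in> {1..k} \<Longrightarrow> 0 < t i \<and> t i < 1"
  shows "diagonal (dfun t {1..k}) (Delta k n C (tS t) id)"
proof -
  have "diagonal (dfun t (set is)) (foldr (\<lambda>i Y. op_minus C Y (Phi C (n i) (tS t i) Y)) is id)"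
    if "set is \<subseteq> {1..k}" "distinct is" for "is"
    using that
  proof (induction "is")
    case Nil
    have "dfun t {} = (\<lambda>_. 1)" by (simp add: dfun_def fun_eq_iff)
    then show ?case using diagonal_id by (simp add: id_def)
  next
    case (Cons i "is")
    let ?d = "dfun t (set is)" and ?Y = "foldr (\<lambda>i Y. op_minus C Y (Phi C (n i) (tS t i) Y)) is id"
    have i: "i \<in> {1..k}" "i \<notin> set is" using Cons.prems by auto
    have Y: "diagonal ?d ?Y" by (rule Cons.IH) (use Cons.prems in auto)
    have d: "\<bar>?d \<alpha>\<bar> \<le> 1" for \<alpha>
    proof -
      have ts: "0 < t i \<and> t i < 1" if "i \<in> set is" for i using t Cons.prems(1) that by auto
      show ?thesis using dfun_bounds(2)[of "set is" t \<alpha>, OF ts] dfun_bounds(4)[of "set is" t \<alpha>, OF ts] by simp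
    qed
    have e: "\<bar>if \<alpha> i = [] then 0 else (t i)\<^sup>2 * ?d (\<alpha>(i := tl (\<alpha> i)))\<bar> \<le> (t i)\<^sup>2" for \<alpha>
      using mult_left_mono[OF d[of "\<alpha>(i := tl (\<alpha> i))"], of "(t i)\<^sup>2"] by (simp add: abs_mult)
    have "diagonal (\<lambda>\<alpha>. ?d \<alpha> - (if \<alpha> i = [] then 0 else (t i)\<^sup>2 * ?d (\<alpha>(i := tl (\<alpha> i)))))
        (op_minus C ?Y (Phi C (n i) (tS t i) ?Y))"
      by (rule diagonal_minus[OF Y diagonal_Phi[where t = t, OF i(1) Y d]]) (rule d, rule e)
    moreover have "?d \<alpha> - (if \<alpha> i = [] then 0 else (t i)\<^sup>2 * ?d (\<alpha>(i := tl (\<alpha> i)))) = dfun t (set (i # is)) \<alpha>" for \<alpha>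
    proof -
      have "?d (\<alpha>(i := tl (\<alpha> i))) = ?d \<alpha>"
        unfolding dfun_def using i(2) by (intro prod.cong) auto
      then show ?thesis using i(2) by (simp add: dfun_def algebra_simps)
    qed
    ultimately show ?case by (simp only: foldr.simps o_apply)
  qed
  from this[of "[1..<Suc k]"] show ?thesis
    unfolding Delta_def by (simp del: upt_Suc add: atLeastLessThanSuc_atLeastAtMost)
qed

lemma tS_in_polyball:
  assumes t: "\<And>i. i \<in> {1..k} \<Longrightarrow> 0 < t i \<and> t i < 1"
  shows "tS t \<in> polyball k n C"
proof -
  let ?d = "dfun t {1..k}" and ?D = "Delta k n C (tS t) id"
  define c where "c = (\<Prod>i\<in>{1..k}. 1 - (t i)\<^sup>2)"
  have c: "0 < c" "\<And>\<alpha>. c \<le> ?d \<alpha>" "\<And>\<alpha>. ?d \<alpha> \<le> 1" "\<And>\<alpha>. 0 \<le> ?d \<alpha>"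
    using dfun_bounds[of "{1..k}" t] t unfolding c_def by blast+
  have d: "\<bar>?d \<alpha>\<bar> \<le> 1" for \<alpha> using c(3,4) by simp
  have D: "diagonal ?d ?D" by (rule diagonal_Delta[OF t])
  have contr: "opnorm C (op_sum C (\<lambda>j. tS t i j \<circ> adj C (tS t i j)) {1..n i}) < 1" if i: "i \<in> {1..k}" for i
  proof -
    have P: "diagonal (\<lambda>\<alpha>. if \<alpha> i = [] then 0 else (t i)\<^sup>2 * 1) (op_sum C (\<lambda>j. tS t i j \<circ> adj C (tS t i j)) {1..n i})"
      using diagonal_Phi[OF i diagonal_id, of 1 t] by (simp add: Phi_def)
    have "opnorm C (op_sum C (\<lambda>j. tS t i j \<circ> adj C (tS t i j)) {1..n i}) \<le> (t i)\<^sup>2"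
      by (rule C.opnorm_le[OF zero_le_power2 diagonal_norm[OF P]]) simp_all
    also have "\<dots> < 1" using t[OF i] by (simp add: abs_square_less_1)
    finally show ?thesis .
  qed
  define V where "V y = \<Theta> (\<lambda>\<alpha>. complex_of_real (1 / ?d \<alpha>) * \<Psi> y \<alpha>)" for y
  have Vd: "diagonal (\<lambda>\<alpha>. 1 / ?d \<alpha>) V" by (simp add: diagonal_def V_def)
  have d': "\<bar>1 / ?d \<alpha>\<bar> \<le> 1 / c" for \<alpha>
    using c(1) c(2)[of \<alpha>] c(4)[of \<alpha>] by (simp add: frac_le)
  have nz: "?d \<alpha> \<noteq> 0" for \<alpha> using c(1) c(2)[of \<alpha>] by linarith
  have Dapp: "?D y = \<Theta> (\<lambda>\<alpha>. complex_of_real (?d \<alpha>) * \<Psi> y \<alpha>)" if "y \<in> carrier C" for y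
    using D that by (simp add: diagonal_def)
  have inv: "V (?D y) = y \<and> ?D (V y) = y" if y: "y \<in> carrier C" for y
  proof -
    note m1 = fock_mult(1)[OF \<Psi>_in[OF y] d] and m2 = fock_mult(1)[OF \<Psi>_in[OF y] d']
    have "V (?D y) = \<Theta> (\<Psi> y)"
      using m1 nz by (simp add: Dapp[OF y] V_def flip: mult.assoc of_real_mult)
    moreover have "?D (V y) = \<Theta> (\<Psi> y)"
      using m2 \<Theta>_in[OF m2] nz unfolding V_def by (simp add: Dapp flip: mult.assoc of_real_mult)
    ultimately show ?thesis using y by simp
  qed
  have "positive_invertible C ?D"
    unfolding positive_invertible_def
  proof (intro conjI ballI)
    show "?D \<in> bops C" by (rule diagonal_bops[OF D d])
    show "Im (ip C (?D y) y) = 0" "0 \<le> Re (ip C (?D y) y)" if y: "y \<in> carrier C" for y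
      using fock_mult_ip[OF \<Psi>_in[OF y] c(4) c(3)] fock_mult(1)[OF \<Psi>_in[OF y] d]
      by (simp_all add: Dapp[OF y] C_simps(5))
    show "\<exists>U\<in>bops C. \<forall>x\<in>carrier C. U (?D x) = x \<and> ?D (U x) = x"
      using diagonal_bops[OF Vd d'] inv by blast
  qed
  then show ?thesis using tS_tuple contr by (simp add: polyball_def)
qed

text \<open>
  The scaled tuples with a common factor \<open>1 - \<delta>\<close> lie in the open polyball and approximate \<open>S\<close>.
\<close>

lemma S_in_closure: "S \<in> polyball_closure k n C"
proof -
  have "\<exists>Y\<in>polyball k n C. \<forall>i\<in>{1..k}. \<forall>j\<in>{1..n i}. opnorm C (op_minus C (S i j) (Y i j)) < \<epsilon>"
    if \<epsilon>: "0 < \<epsilon>" for \<epsilon>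
  proof -
    define \<delta> where "\<delta> = min (\<epsilon> / 2) (1 / 2)"
    have \<delta>: "0 < \<delta>" "\<delta> < 1" "\<delta> < \<epsilon>" using \<epsilon> by (auto simp: \<delta>_def)
    have "opnorm C (op_minus C (S i j) (tS (\<lambda>_. 1 - \<delta>) i j)) < \<epsilon>"
      if ij: "i \<in> {1..k}" "j \<in> {1..n i}" for i j
    proof -
      have "opnorm C (op_minus C (S i j) (tS (\<lambda>_. 1 - \<delta>) i j)) \<le> \<delta>"
      proof (rule C.opnorm_le)
        fix y assume y: "y \<in> carrier C"
        have Sy: "S i j y \<in> carrier C" by (rule bops_in[OF C.adjoint_pairD(1)[OF S_adjoint[OF ij]] y])
        have "op_minus C (S i j) (tS (\<lambda>_. 1 - \<delta>) i j) y = complex_of_real \<delta> \<odot>\<^bsub>C\<^esub> S i j y"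
          unfolding op_minus_def scale_tuple_def
          using Sy by (intro C.eq_by_ip) (auto simp: C.ip_minus_left C.ip_smult_left algebra_simps)
        moreover have "hnorm C (S i j y) = hnorm C y"
          using y creation_norm[of i k j n, OF ij \<Psi>_in[OF y]] by (simp add: hnorm_C S_def transport_def)
        ultimately show "hnorm C (op_minus C (S i j) (tS (\<lambda>_. 1 - \<delta>) i j) y) \<le> \<delta> * hnorm C y"
          using Sy \<delta> by (simp add: C.hnorm_smult)
      qed (use \<delta> in simp)
      then show ?thesis using \<delta> by simp
    qed
    moreover have "tS (\<lambda>_. 1 - \<delta>) \<in> polyball k n C"
      by (rule tS_in_polyball) (use \<delta> in simp)
    ultimately show ?thesis by blast
  qed
  then show ?thesis using S_tuple by (simp add: polyball_closure_def)
qed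

end

context fock_copy
begin

lemma copy_intertwining: "intertwining (fock k n) C (\<lambda>_. \<Theta>) {()}"
  using fock_hilbert C_hilbert \<Theta>_hlinear by (simp add: intertwining_def intertwining_axioms_def)

lemma copy_isometry:
  "h \<in> carrier (fock k n) \<Longrightarrow> ((\<lambda>s. (hnorm C (\<Theta> h))\<^sup>2) has_sum (hnorm (fock k n) h)\<^sup>2) {()}"
  by (simp add: has_sum_finite_iff hnorm_C)

lemma copy_intertwined:
  assumes "i \<in> {1..k}" "j \<in> {1..n i}"
  shows "intertwined (fock k n) C (\<lambda>_. \<Theta>) {()} (creation i j) (S i j)"
proof -
  note F = creation_adjoint[of i k j n, OF assms] and S = S_adjoint[OF assms]
  have "\<Theta> (adj (fock k n) (creation i j) h) = adj C (S i j) (\<Theta> h)" if h: "h \<in> carrier (fock k n)" for h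
    using adj_eq[OF F h] C.adj_eq[OF S \<Theta>_in[OF h]] h by (simp add: transport_def)
  then show ?thesis
    using adjoint_pairD(1)[OF F] C.adjoint_pairD(1)[OF S] by (simp add: intertwined_def)
qed

lemma copy_partial_sums:
  fixes K :: "'k hilb"
  assumes K: "hilbert_space K" and A: "\<And>\<alpha>. \<alpha> \<in> multiwords k n \<Longrightarrow> A \<alpha> \<in> bops K"
    and D: "finite D" "D \<subseteq> multidegrees k"
  shows "opnorm (tensor_space K (fock k n)) (op_sum (tensor_space K (fock k n))
        (homogeneous_part k n K A (fock k n) (scale_tuple (fock k n) r creation)) D)
    \<le> opnorm (tensor_space K C) (op_sum (tensor_space K C) (homogeneous_part k n K A C (scale_tuple C r S)) D)"
proof (rule partial_sums_le_of_intertwining[OF K copy_intertwining copy_isometry A _ D])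
  show "intertwined (fock k n) C (\<lambda>_. \<Theta>) {()} (scale_tuple (fock k n) r creation i j) (scale_tuple C r S i j)"
    if "i \<in> {1..k}" "j \<in> {1..n i}" for i j
    unfolding scale_tuple_def
    by (rule intertwining.intertwined_scale[OF copy_intertwining copy_intertwined[OF that]])
qed

text \<open>
  The hypothesis on the power series provides convergence at points of the form \<open>\<rho> Y\<close> with \<open>Y\<close> in the
  polyball, here \<open>Y = t S\<close>.  On the Fock space both scalings can be merged into one.
\<close>

lemma copy_partial_sums_twice:
  fixes K :: "'k hilb"
  assumes K: "hilbert_space K" and A: "\<And>\<alpha>. \<alpha> \<in> multiwords k n \<Longrightarrow> A \<alpha> \<in> bops K"
    and r: "\<And>i. i \<in> {1..k} \<Longrightarrow> r i = \<rho> i * t i"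
    and D: "finite D" "D \<subseteq> multidegrees k"
  shows "opnorm (tensor_space K (fock k n)) (op_sum (tensor_space K (fock k n))
        (homogeneous_part k n K A (fock k n) (scale_tuple (fock k n) r creation)) D)
    \<le> opnorm (tensor_space K C) (op_sum (tensor_space K C)
        (homogeneous_part k n K A C (scale_tuple C \<rho> (scale_tuple C t S))) D)"
proof (rule partial_sums_le_of_intertwining[OF K copy_intertwining copy_isometry A _ D])
  show "intertwined (fock k n) C (\<lambda>_. \<Theta>) {()} (scale_tuple (fock k n) r creation i j)
      (scale_tuple C \<rho> (scale_tuple C t S) i j)"
    if ij: "i \<in> {1..k}" "j \<in> {1..n i}" for i j
  proof -
    have "scale_tuple (fock k n) r creation i j
        = (\<lambda>x. complex_of_real (\<rho> i) \<odot>\<^bsub>fock k n\<^esub> (complex_of_real (t i) \<odot>\<^bsub>fock k n\<^esub> creation i j x))"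
      using r[OF ij(1)] by (simp add: scale_tuple_def fock_simps mult.assoc)
    then show ?thesis
      unfolding scale_tuple_def[of C]
      using intertwining.intertwined_scale[OF copy_intertwining
          intertwining.intertwined_scale[OF copy_intertwining copy_intertwined[OF ij]]]
      by simp
  qed
qed

end

section \<open>Cauchy estimates\<close>

lemma has_sum_finite_sum:
  fixes f :: "'j \<Rightarrow> 'i \<Rightarrow> real"
  assumes "finite J" "\<And>j. j \<in> J \<Longrightarrow> (f j has_sum s j) I"
  shows "((\<lambda>i. \<Sum>j\<in>J. f j i) has_sum (\<Sum>j\<in>J. s j)) I"
  using assms by (induction J rule: finite_induct) (auto intro!: has_sum_add)

definition vacuum :: "nat \<Rightarrow> nat \<Rightarrow> nat list" where
  "vacuum k = (\<lambda>i\<in>{1..k}. [])"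

lemma vacuum_in: "vacuum k \<in> multiwords k n"
  by (auto simp: vacuum_def multiwords_def)

lemma fock_basis_has_sum:
  "\<alpha> \<in> multiwords k n \<Longrightarrow> ((\<lambda>\<beta>. (cmod (fock_basis \<alpha> \<beta>))\<^sup>2) has_sum 1) (multiwords k n)"
  by (rule has_sum_finite_neutralI[of "{\<alpha>}"]) (auto simp: fock_basis_def)

lemma fock_basis_in:
  assumes "\<alpha> \<in> multiwords k n"
  shows "fock_basis \<alpha> \<in> carrier (fock k n)" "hnorm (fock k n) (fock_basis \<alpha>) = 1"
proof -
  show c: "fock_basis \<alpha> \<in> carrier (fock k n)"
    using has_sum_imp_summable[OF fock_basis_has_sum[OF assms]] assms
    by (auto simp: fock_iff fock_basis_def)
  have "(hnorm (fock k n) (fock_basis \<alpha>))\<^sup>2 = 1"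
    by (rule has_sum_unique[OF fock_hnorm_sum[OF c] fock_basis_has_sum[OF assms]])
  then show "hnorm (fock k n) (fock_basis \<alpha>) = 1"
    using hilbert_space.hnorm_ge_0[OF fock_hilbert c] by (simp add: power2_eq_1_iff)
qed

lemma word_op_fock_basis:
  "word_op (scale_tuple (fock k n) r creation i) w (\<lambda>\<gamma>. c * fock_basis \<beta> \<gamma>)
    = (\<lambda>\<gamma>. c * complex_of_real (r i ^ length w) * fock_basis (\<beta>(i := w @ \<beta> i)) \<gamma>)"
proof (induction w)
  case (Cons j w)
  have cr: "creation i j (\<lambda>\<gamma>. z * f \<gamma>) = (\<lambda>\<gamma>. z * creation i j f \<gamma>)" for z f
    by (simp add: creation_def fun_eq_iff)
  have "word_op (scale_tuple (fock k n) r creation i) (j # w) (\<lambda>\<gamma>. c * fock_basis \<beta> \<gamma>)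
      = scale_tuple (fock k n) r creation i j (word_op (scale_tuple (fock k n) r creation i) w (\<lambda>\<gamma>. c * fock_basis \<beta> \<gamma>))"
    by (simp add: word_op_def)
  also have "\<dots> = (\<lambda>\<gamma>. c * complex_of_real (r i ^ length (j # w)) * fock_basis (\<beta>(i := (j # w) @ \<beta> i)) \<gamma>)"
    unfolding Cons.IH by (simp add: scale_tuple_def fock_simps cr creation_fock_basis fun_eq_iff)
  finally show ?case .
qed (simp add: word_op_def)

lemma multiword_op_vacuum:
  assumes \<alpha>: "\<alpha> \<in> multiwords k n"
  shows "multiword_op k (scale_tuple (fock k n) r creation) \<alpha> (\<lambda>\<gamma>. c * fock_basis (vacuum k) \<gamma>)
    = (\<lambda>\<gamma>. c * complex_of_real (\<Prod>i=1..k. r i ^ length (\<alpha> i)) * fock_basis \<alpha> \<gamma>)"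
proof -
  let ?Z = "scale_tuple (fock k n) r creation"
  have "foldr (\<lambda>i T. word_op (?Z i) (\<alpha> i) \<circ> T) is id (\<lambda>\<gamma>. c * fock_basis (vacuum k) \<gamma>)
     = (\<lambda>\<gamma>. c * complex_of_real (\<Prod>i\<in>set is. r i ^ length (\<alpha> i)) * fock_basis (\<lambda>i. if i \<in> set is then \<alpha> i else vacuum k i) \<gamma>)"
    if "set is \<subseteq> {1..k}" "distinct is" for "is"
    using that
  proof (induction "is")
    case (Cons i "is")
    have i: "i \<in> {1..k}" "i \<notin> set is" using Cons.prems by auto
    have e: "(\<lambda>l. if l \<in> set is then \<alpha> l else vacuum k l)(i := \<alpha> i @ (if i \<in> set is then \<alpha> i else vacuum k i))
        = (\<lambda>l. if l \<in> set (i # is) then \<alpha> l else vacuum k l)"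
      using i by (auto simp: fun_eq_iff vacuum_def)
    have "foldr (\<lambda>i T. word_op (?Z i) (\<alpha> i) \<circ> T) (i # is) id (\<lambda>\<gamma>. c * fock_basis (vacuum k) \<gamma>)
        = word_op (?Z i) (\<alpha> i) (foldr (\<lambda>i T. word_op (?Z i) (\<alpha> i) \<circ> T) is id (\<lambda>\<gamma>. c * fock_basis (vacuum k) \<gamma>))"
      by (simp only: foldr.simps o_apply)
    also have "\<dots> = word_op (?Z i) (\<alpha> i) (\<lambda>\<gamma>. c * complex_of_real (\<Prod>i\<in>set is. r i ^ length (\<alpha> i)) *
        fock_basis (\<lambda>i. if i \<in> set is then \<alpha> i else vacuum k i) \<gamma>)"
      using Cons.prems by (subst Cons.IH) auto
    also have "\<dots> = (\<lambda>\<gamma>. c * complex_of_real (\<Prod>i\<in>set is. r i ^ length (\<alpha> i)) * complex_of_real (r i ^ length (\<alpha> i)) *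
        fock_basis (\<lambda>l. if l \<in> set (i # is) then \<alpha> l else vacuum k l) \<gamma>)"
      unfolding word_op_fock_basis e ..
    also have "\<dots> = (\<lambda>\<gamma>. c * complex_of_real (\<Prod>i\<in>set (i # is). r i ^ length (\<alpha> i)) *
        fock_basis (\<lambda>l. if l \<in> set (i # is) then \<alpha> l else vacuum k l) \<gamma>)"
      using i(2) by (simp add: mult_ac)
    finally show ?case .
  qed simp
  from this[of "[1..<Suc k]"]
  have "multiword_op k ?Z \<alpha> (\<lambda>\<gamma>. c * fock_basis (vacuum k) \<gamma>)
      = (\<lambda>\<gamma>. c * complex_of_real (\<Prod>i=1..k. r i ^ length (\<alpha> i)) * fock_basis (\<lambda>i. if i \<in> {1..k} then \<alpha> i else vacuum k i) \<gamma>)"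
    unfolding multiword_op_def by (simp del: upt_Suc add: atLeastLessThanSuc_atLeastAtMost)
  also have "(\<lambda>i. if i \<in> {1..k} then \<alpha> i else vacuum k i) = \<alpha>"
    using \<alpha> by (auto simp: fun_eq_iff vacuum_def multiwords_def PiE_iff extensional_def)
  finally show ?thesis .
qed

lemma scaled_creation_bops:
  assumes "i \<in> {1..k}" "j \<in> {1..n i}"
  shows "scale_tuple (fock k n) r creation i j \<in> bops (fock k n)"
  unfolding scale_tuple_def
  by (intro hilbert_space.bops_scale[OF fock_hilbert]
      hilbert_space.adjoint_pairD(1)[OF fock_hilbert creation_adjoint[of i k j n, OF assms]])

text \<open>
  The operator is \<open>B\<^sup>* B\<close> for the column \<open>B\<close> with entries \<open>A \<alpha>\<close>, and the hypothesis bounds the norm of \<open>B\<close>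
  by \<open>c\<close>.  The Cauchy-Schwarz inequality for finite sums replaces the formation of the column.
\<close>

lemma sum_of_squares_op_bound:
  assumes "hilbert_space K" and A: "\<And>\<alpha>. \<alpha> \<in> J \<Longrightarrow> A \<alpha> \<in> bops K" and "0 \<le> c"
    and bound: "\<And>x. x \<in> carrier K \<Longrightarrow> (\<Sum>\<alpha>\<in>J. (hnorm K (A \<alpha> x))\<^sup>2) \<le> (c * hnorm K x)\<^sup>2"
  shows "sqrt (opnorm K (op_sum K (\<lambda>\<alpha>. adj K (A \<alpha>) \<circ> A \<alpha>) J)) \<le> c"
proof -
  interpret K: hilbert_space K by fact
  let ?B = "op_sum K (\<lambda>\<alpha>. adj K (A \<alpha>) \<circ> A \<alpha>) J"
  have b: "adj K (A \<alpha>) \<circ> A \<alpha> \<in> bops K" if "\<alpha> \<in> J" for \<alpha>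
    by (rule K.bops_comp[OF K.adjoint_pairD(2)[OF K.adjoint_pair_adj[OF A[OF that]]] A[OF that]])
  have B: "?B \<in> bops K" by (rule K.bops_sum[OF b])
  have "opnorm K ?B \<le> c\<^sup>2"
  proof (rule K.opnorm_le)
    fix x assume x: "x \<in> carrier K"
    define y where "y = ?B x"
    have y: "y \<in> carrier K" unfolding y_def by (rule bops_in[OF B x])
    have Ax: "A \<alpha> x \<in> carrier K" "A \<alpha> y \<in> carrier K" if "\<alpha> \<in> J" for \<alpha>
      using bops_in[OF A[OF that]] x y by auto
    have "ip K y y = (\<Sum>\<alpha>\<in>J. ip K ((adj K (A \<alpha>) \<circ> A \<alpha>) x) y)"
      unfolding y_def[of, symmetric]
      using K.ip_op_sum_left[of J "\<lambda>\<alpha>. adj K (A \<alpha>) \<circ> A \<alpha>" x y] b x y by (simp add: y_def)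
    also have "\<dots> = (\<Sum>\<alpha>\<in>J. ip K (A \<alpha> x) (A \<alpha> y))"
      using Ax y by (intro sum.cong refl) (simp add: K.adjoint_pairD(4)[OF K.adjoint_pair_adj[OF A]])
    finally have "(hnorm K y)\<^sup>2 = cmod (\<Sum>\<alpha>\<in>J. ip K (A \<alpha> x) (A \<alpha> y))"
      using y K.ip_self[OF y] by (metis abs_of_nonneg norm_of_real zero_le_power2)
    also have "\<dots> \<le> (\<Sum>\<alpha>\<in>J. cmod (ip K (A \<alpha> x) (A \<alpha> y)))" by (rule norm_sum)
    also have "\<dots> \<le> (\<Sum>\<alpha>\<in>J. hnorm K (A \<alpha> x) * hnorm K (A \<alpha> y))"
      using Ax by (intro sum_mono K.ip_le_hnorm) auto
    finally have 1: "(hnorm K y)\<^sup>2 \<le> (\<Sum>\<alpha>\<in>J. hnorm K (A \<alpha> x) * hnorm K (A \<alpha> y))" .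
    have "((hnorm K y)\<^sup>2)\<^sup>2 \<le> (\<Sum>\<alpha>\<in>J. hnorm K (A \<alpha> x) * hnorm K (A \<alpha> y))\<^sup>2"
      using 1 by (intro power_mono) auto
    also have "\<dots> \<le> (\<Sum>\<alpha>\<in>J. (hnorm K (A \<alpha> x))\<^sup>2) * (\<Sum>\<alpha>\<in>J. (hnorm K (A \<alpha> y))\<^sup>2)"
      by (rule Cauchy_Schwarz_ineq_sum)
    also have "\<dots> \<le> (c * hnorm K x)\<^sup>2 * (c * hnorm K y)\<^sup>2"
      by (intro mult_mono bound x y sum_nonneg) auto
    finally have "((hnorm K y)\<^sup>2)\<^sup>2 \<le> ((c * hnorm K x) * (c * hnorm K y))\<^sup>2"
      by (simp only: power_mult_distrib)
    then have "(hnorm K y)\<^sup>2 \<le> (c * hnorm K x) * (c * hnorm K y)"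
      by (rule power2_le_imp_le) (use x y \<open>0 \<le> c\<close> in auto)
    then have 2: "hnorm K y * hnorm K y \<le> hnorm K y * (c\<^sup>2 * hnorm K x)"
      by (simp add: power2_eq_square mult_ac)
    have "hnorm K y \<le> c\<^sup>2 * hnorm K x"
    proof (cases "hnorm K y = 0")
      case False
      then have "0 < hnorm K y" using K.hnorm_ge_0[OF y] by simp
      then show ?thesis using 2 by simp
    qed (use x in simp)
    then show "hnorm K (?B x) \<le> c\<^sup>2 * hnorm K x" by (simp only: y_def)
  qed simp
  then have "sqrt (opnorm K ?B) \<le> sqrt (c\<^sup>2)" by (rule real_sqrt_le_mono)
  then show ?thesis using \<open>0 \<le> c\<close> by simp
qed

text \<open>
  On the elementary tensor of \<open>x\<close> and the vacuum, the value of the series at \<open>r S\<close> is the sum of the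
  \<open>r\<^sup>\<alpha> A\<^sub>\<alpha> x \<otimes> e\<^sub>\<alpha>\<close>.  These are orthogonal, so the terms of multi-degree \<open>p\<close> contribute at most the
  square of the norm.  The estimate is proved for finite partial sums that contain \<open>p\<close> and passes
  to the limit.
\<close>

theorem cauchy_estimate:
  fixes K :: "'k hilb" and r :: "nat \<Rightarrow> real"
  assumes K: "hilbert_space K"
    and A: "\<And>\<alpha>. \<alpha> \<in> multiwords k n \<Longrightarrow> A \<alpha> \<in> bops K"
    and r: "\<And>i. i \<in> {1..k} \<Longrightarrow> 0 < r i"
    and conv: "\<exists>Q. op_has_sum (tensor_space K (fock k n))
        (homogeneous_part k n K A (fock k n) (scale_tuple (fock k n) r creation)) (multidegrees k) Q"
    and p: "p \<in> multidegrees k"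
  shows "sqrt (opnorm K (op_sum K (\<lambda>\<alpha>. adj K (A \<alpha>) \<circ> A \<alpha>) (multiwords_deg k n p)))
    \<le> 1 / (\<Prod>i=1..k. r i ^ p i) *
      opnorm (tensor_space K (fock k n)) (fps_apply k n K A (fock k n) (scale_tuple (fock k n) r creation))"
proof -
  interpret tensor K "fock k n" using K fock_hilbert by (simp add: tensor_def)
  let ?Z = "scale_tuple (fock k n) r creation" and ?P = "multiwords_deg k n p"
  let ?h = "homogeneous_part k n K A (fock k n) ?Z"
  define R where "R = (\<Prod>i=1..k. r i ^ p i)"
  have R: "0 < R" unfolding R_def using r by (intro prod_pos) auto
  define M where "M = opnorm TS (fps_apply k n K A (fock k n) ?Z)"
  have F: "op_has_sum TS ?h (multidegrees k) (fps_apply k n K A (fock k n) ?Z)"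
    unfolding fps_apply_def op_infsum_def by (rule someI_ex[OF conv])
  have hb: "?h q \<in> bops TS" for q
    by (rule homogeneous_part_bops[OF A scaled_creation_bops])
  have M0: "0 \<le> M" unfolding M_def using F by (intro TS.opnorm_nonneg) (simp add: op_has_sum_def)
  have lim: "((\<lambda>D. opnorm TS (op_sum TS ?h D)) \<longlongrightarrow> M) (finite_subsets_at_top (multidegrees k))"
    unfolding M_def by (rule TS.op_has_sum_opnorm[OF hb F])
  have Pb: "multiword_op k ?Z \<alpha> \<in> bops (fock k n)" if "\<alpha> \<in> multiwords k n" for \<alpha>
    by (rule H.multiword_op_bops[OF scaled_creation_bops that])
  \<comment> \<open>\<open>T x\<close> is the elementary tensor of \<open>x\<close> and the vacuum vector\<close>
  define T where "T x = (\<lambda>y\<in>carrier K. (\<lambda>\<gamma>. ip K x y * fock_basis (vacuum k) \<gamma>))" for x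
  note vac = fock_basis_in[OF vacuum_in[of k n]]
  have T_smult: "T x y = ip K x y \<odot>\<^bsub>fock k n\<^esub> fock_basis (vacuum k)" if "y \<in> carrier K" for x y
    using that by (simp add: T_def fock_simps)
  have T_norm: "hnorm (fock k n) (T x y) = cmod (ip K x y)" if "y \<in> carrier K" for x y
    by (simp only: T_smult[OF that] H.hnorm_smult[OF vac(1)] vac(2) mult_1_right)
  have T_in: "T x \<in> carrier TS" and T_hnorm: "hnorm TS (T x) = hnorm K x" if x: "x \<in> carrier K" for x
  proof -
    have s: "((\<lambda>e. (hnorm (fock k n) (T x e))\<^sup>2) has_sum (hnorm K x)\<^sup>2) E"
      by (rule has_sum_cong[THEN iffD2, OF _ K.parseval[OF E_basis x]]) (simp add: T_norm)
    have "clinear (T x)"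
      unfolding clinear_def
    proof (intro conjI ballI allI)
      show "T x \<in> carrier K \<rightarrow> carrier (fock k n)" using vac by (auto simp: T_smult)
      show "T x (y \<oplus>\<^bsub>K\<^esub> z) = T x y \<oplus>\<^bsub>fock k n\<^esub> T x z" if "y \<in> carrier K" "z \<in> carrier K" for y z
        using that x by (simp add: T_def fock_simps K.ip_add_right distrib_right)
      show "T x (d \<odot>\<^bsub>K\<^esub> y) = cnj d \<odot>\<^bsub>fock k n\<^esub> T x y" if "y \<in> carrier K" for d y
        using that x by (simp add: T_def fock_simps K.ip_smult_right mult.assoc)
      show "\<exists>C. \<forall>y\<in>carrier K. hnorm (fock k n) (T x y) \<le> C * hnorm K y"
        using K.ip_le_hnorm[OF x] by (auto simp: T_norm)
    qed
    then show T: "T x \<in> carrier TS"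
      using has_sum_imp_summable[OF s] by (simp add: ts_iff T_def)
    have "(hnorm TS (T x))\<^sup>2 = (hnorm K x)\<^sup>2" by (rule has_sum_unique[OF ts_hnorm_sum[OF T] s])
    then show "hnorm TS (T x) = hnorm K x" using x T by simp
  qed
  have partial: "(\<Sum>\<alpha>\<in>?P. R\<^sup>2 * (hnorm K (A \<alpha> x))\<^sup>2) \<le> (opnorm TS (op_sum TS ?h D) * hnorm K x)\<^sup>2"
    if D: "finite D" "D \<subseteq> multidegrees k" "p \<in> D" and x: "x \<in> carrier K" for D x
  proof -
    let ?J = "\<Union>q\<in>D. multiwords_deg k n q" and ?q = "op_sum TS ?h D"
    have J: "finite ?J" "\<And>\<alpha>. \<alpha> \<in> ?J \<Longrightarrow> \<alpha> \<in> multiwords k n" "?P \<subseteq> ?J"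
      using D finite_multiwords_deg by (auto simp: multiwords_deg_def)
    have q: "?q \<in> bops TS" by (rule TS.bops_sum[OF hb])
    have qT: "?q (T x) \<in> carrier TS" by (rule bops_in[OF q T_in[OF x]])
    have flat: "?q (T x) = op_sum TS (\<lambda>\<alpha>. tensor_op K (A \<alpha>) (multiword_op k ?Z \<alpha>)) ?J (T x)"
      by (rule partial_sum_flatten[OF _ _ D(1,2) T_in[OF x]], erule A, erule (1) scaled_creation_bops)
    have coeff: "?q (T x) y \<alpha> = ip K (A \<alpha> x) y * complex_of_real (\<Prod>i=1..k. r i ^ length (\<alpha> i))"
      if y: "y \<in> carrier K" and \<alpha>: "\<alpha> \<in> ?J" for y \<alpha>
    proof -
      have tin: "tensor_op K (A \<beta>) (multiword_op k ?Z \<beta>) (T x) \<in> carrier TS" if "\<beta> \<in> ?J" for \<beta>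
        by (rule bops_in[OF tensor_op_bops[OF A[OF J(2)[OF that]] Pb[OF J(2)[OF that]]] T_in[OF x]])
      have val: "tensor_op K (A \<beta>) (multiword_op k ?Z \<beta>) (T x) y
          = (\<lambda>\<gamma>. ip K (A \<beta> x) y * complex_of_real (\<Prod>i=1..k. r i ^ length (\<beta> i)) * fock_basis \<beta> \<gamma>)"
        if \<beta>: "\<beta> \<in> ?J" for \<beta>
      proof -
        note pA = K.adjoint_pair_adj[OF A[OF J(2)[OF \<beta>]]]
        have y': "adj K (A \<beta>) y \<in> carrier K" by (rule bops_in[OF K.adjoint_pairD(2)[OF pA] y])
        have "tensor_op K (A \<beta>) (multiword_op k ?Z \<beta>) (T x) y
            = multiword_op k ?Z \<beta> (\<lambda>\<gamma>. ip K x (adj K (A \<beta>) y) * fock_basis (vacuum k) \<gamma>)"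
          using y y' by (simp add: tensor_op_def T_def)
        then show ?thesis
          by (simp only: multiword_op_vacuum[OF J(2)[OF \<beta>]] K.adjoint_pairD(3)[OF pA x y])
      qed
      have "?q (T x) y = finsum (fock k n) (\<lambda>\<beta>. tensor_op K (A \<beta>) (multiword_op k ?Z \<beta>) (T x) y) ?J"
        unfolding flat unfolding op_sum_def by (rule ts_finsum_apply[OF tin y])
      then have "?q (T x) y \<alpha> = (\<Sum>\<beta>\<in>?J. tensor_op K (A \<beta>) (multiword_op k ?Z \<beta>) (T x) y \<alpha>)"
        using fock_finsum_apply[of ?J "\<lambda>\<beta>. tensor_op K (A \<beta>) (multiword_op k ?Z \<beta>) (T x) y" k n \<alpha>]
          ts_in[OF tin y] by simp
      also have "\<dots> = (\<Sum>\<beta>\<in>?J. if \<beta> = \<alpha> then ip K (A \<beta> x) y * complex_of_real (\<Prod>i=1..k. r i ^ length (\<beta> i)) else 0)"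
        by (rule sum.cong[OF refl]) (simp add: val fock_basis_def)
      also have "\<dots> = ip K (A \<alpha> x) y * complex_of_real (\<Prod>i=1..k. r i ^ length (\<alpha> i))"
        using \<alpha> by (simp only: sum.delta[OF J(1)] if_True)
      finally show ?thesis .
    qed
    have R_eq: "(\<Prod>i=1..k. r i ^ length (\<alpha> i)) = R" if "\<alpha> \<in> ?P" for \<alpha>
      unfolding R_def using that by (intro prod.cong) (auto simp: multiwords_deg_def)
    have AK: "A \<alpha> x \<in> carrier K" if "\<alpha> \<in> ?P" for \<alpha>
      using bops_in[OF A[OF J(2)] x] that J(3) by blast
    have "((\<lambda>e. \<Sum>\<alpha>\<in>?P. R\<^sup>2 * (cmod (ip K (A \<alpha> x) e))\<^sup>2) has_sum (\<Sum>\<alpha>\<in>?P. R\<^sup>2 * (hnorm K (A \<alpha> x))\<^sup>2)) E"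
      by (intro has_sum_finite_sum finite_multiwords_deg has_sum_cmult_right K.parseval[OF E_basis] AK)
    then have "(\<Sum>\<alpha>\<in>?P. R\<^sup>2 * (hnorm K (A \<alpha> x))\<^sup>2) \<le> (hnorm TS (?q (T x)))\<^sup>2"
    proof (rule has_sum_mono[OF _ ts_hnorm_sum[OF qT]])
      fix e assume "e \<in> E"
      then have e: "e \<in> carrier K" by simp
      have "(\<Sum>\<alpha>\<in>?P. R\<^sup>2 * (cmod (ip K (A \<alpha> x) e))\<^sup>2) = (\<Sum>\<alpha>\<in>?P. (cmod (?q (T x) e \<alpha>))\<^sup>2)"
      proof (rule sum.cong[OF refl])
        fix \<alpha> assume \<alpha>: "\<alpha> \<in> ?P"
        then have "?q (T x) e \<alpha> = ip K (A \<alpha> x) e * complex_of_real R"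
          using coeff[OF e subsetD[OF J(3) \<alpha>]] by (simp only: R_eq[OF \<alpha>])
        then show "R\<^sup>2 * (cmod (ip K (A \<alpha> x) e))\<^sup>2 = (cmod (?q (T x) e \<alpha>))\<^sup>2"
          by (simp add: norm_mult power_mult_distrib)
      qed
      also have "\<dots> \<le> (hnorm (fock k n) (?q (T x) e))\<^sup>2"
        using ell2_finite_sum_le[of "?q (T x) e" "multiwords k n" ?P] ts_in[OF qT e] finite_multiwords_deg
        by (auto simp: fock_def multiwords_deg_def)
      finally show "(\<Sum>\<alpha>\<in>?P. R\<^sup>2 * (cmod (ip K (A \<alpha> x) e))\<^sup>2) \<le> (hnorm (fock k n) (?q (T x) e))\<^sup>2" .
    qed
    also have "\<dots> \<le> (opnorm TS ?q * hnorm K x)\<^sup>2"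
      using TS.opnorm_bound[OF q T_in[OF x]] qT by (intro power_mono) (auto simp: T_hnorm[OF x])
    finally show ?thesis .
  qed
  have "sqrt (opnorm K (op_sum K (\<lambda>\<alpha>. adj K (A \<alpha>) \<circ> A \<alpha>) ?P)) \<le> M / R"
  proof (rule sum_of_squares_op_bound[OF K])
    show "A \<alpha> \<in> bops K" if "\<alpha> \<in> ?P" for \<alpha> using that A by (simp add: multiwords_deg_def)
    show "0 \<le> M / R" using M0 R by simp
    fix x assume x: "x \<in> carrier K"
    have "(\<Sum>\<alpha>\<in>?P. R\<^sup>2 * (hnorm K (A \<alpha> x))\<^sup>2) \<le> (M * hnorm K x)\<^sup>2"
    proof (rule tendsto_lowerbound)
      show "((\<lambda>D. (opnorm TS (op_sum TS ?h D) * hnorm K x)\<^sup>2) \<longlongrightarrow> (M * hnorm K x)\<^sup>2)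
          (finite_subsets_at_top (multidegrees k))"
        by (intro tendsto_intros lim)
      show "\<forall>\<^sub>F D in finite_subsets_at_top (multidegrees k).
          (\<Sum>\<alpha>\<in>?P. R\<^sup>2 * (hnorm K (A \<alpha> x))\<^sup>2) \<le> (opnorm TS (op_sum TS ?h D) * hnorm K x)\<^sup>2"
        unfolding eventually_finite_subsets_at_top
        using partial[OF _ _ _ x] p by (intro exI[of _ "{p}"]) auto
    qed simp
    then have "R\<^sup>2 * (\<Sum>\<alpha>\<in>?P. (hnorm K (A \<alpha> x))\<^sup>2) \<le> (M * hnorm K x)\<^sup>2"
      by (simp only: sum_distrib_left)
    then have "(\<Sum>\<alpha>\<in>?P. (hnorm K (A \<alpha> x))\<^sup>2) \<le> (M * hnorm K x)\<^sup>2 / R\<^sup>2"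
      using R by (simp add: pos_le_divide_eq mult.commute)
    then show "(\<Sum>\<alpha>\<in>?P. (hnorm K (A \<alpha> x))\<^sup>2) \<le> (M / R * hnorm K x)\<^sup>2"
      by (simp add: power_mult_distrib power_divide)
  qed
  then show ?thesis by (simp add: M_def R_def)
qed

section \<open>The maximum over the closed polyball\<close>

theorem theorem1p8:
  fixes k :: nat
    and n :: "nat \<Rightarrow> nat"
    and \<rho> r :: "nat \<Rightarrow> real"
    and K :: "'k hilb"
    and A :: "(nat \<Rightarrow> nat list) \<Rightarrow> 'k \<Rightarrow> 'k"
  assumes universe: "(UNIV :: real set) \<lesssim> (UNIV :: 'h set)"
    and "1 \<le> k"
    and "\<forall>i\<in>{1..k}. 1 \<le> n i"
    and "hilbert_space K"
    and "\<forall>i\<in>{1..k}. 0 < \<rho> i"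
    and "free_holomorphic TYPE('h) k n \<rho> K A"
    and "\<forall>i\<in>{1..k}. 0 < r i \<and> r i < \<rho> i"
  shows "(\<forall>p\<in>multidegrees k.
       ereal (sqrt (opnorm K (op_sum K (\<lambda>\<alpha>. adj K (A \<alpha>) \<circ> A \<alpha>) (multiwords_deg k n p))))
         \<le> ereal (1 / (\<Prod>i=1..k. r i ^ p i)) * sup_norm TYPE('h) k n K A r) \<and>
     sup_norm TYPE('h) k n K A r =
       ereal (opnorm (tensor_space K (fock k n))
         (fps_apply k n K A (fock k n) (scale_tuple (fock k n) r creation)))"
proof -
  let ?F = "fock k n" and ?Z = "scale_tuple (fock k n) r creation"
  note K = \<open>hilbert_space K\<close>
  have A: "\<And>\<alpha>. \<alpha> \<in> multiwords k n \<Longrightarrow> A \<alpha> \<in> bops K"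
    using assms(6) by (simp add: free_holomorphic_def)
  have conv: "\<exists>Q. op_has_sum (tensor_space K H) (homogeneous_part k n K A H (scale_tuple H \<rho> X)) (multidegrees k) Q"
    if "hilbert_space H" "X \<in> polyball k n H" for H :: "'h hilb" and X
    using assms(6) that unfolding free_holomorphic_def by blast
  obtain \<Theta> :: "((nat \<Rightarrow> nat list) \<Rightarrow> complex) \<Rightarrow> 'h" where \<Theta>: "inj_on \<Theta> (carrier ?F)"
    using lepoll_trans[OF carrier_fock_lepoll_reals universe] unfolding lepoll_def by blast
  interpret fock_copy k n \<Theta>
    using \<Theta> fock_hilbert by (simp add: fock_copy_def hilbert_copy_def hilbert_copy_axioms_def)
  interpret KF: tensor K ?F using K fock_hilbert by (simp add: tensor_def)
  interpret KC: tensor K C using K C_hilbert by (simp add: tensor_def)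
  have Fb: "homogeneous_part k n K A ?F ?Z q \<in> bops (tensor_space K ?F)" for q
    by (rule KF.homogeneous_part_bops[OF A scaled_creation_bops])
  define t where "t i = r i / \<rho> i" for i
  have t: "0 < t i \<and> t i < 1" "r i = \<rho> i * t i" if "i \<in> {1..k}" for i
  proof -
    have "0 < \<rho> i" "0 < r i" "r i < \<rho> i" using assms(5,7) that by blast+
    then show "0 < t i \<and> t i < 1" "r i = \<rho> i * t i" by (simp_all add: t_def)
  qed
  have tSb: "scale_tuple C \<rho> (tS t) i j \<in> bops C" if "i \<in> {1..k}" "j \<in> {1..n i}" for i j
    unfolding scale_tuple_def[of C \<rho>] by (rule C.bops_scale[OF C.adjoint_pairD(1)[OF tS_adjoint[OF that]]])
  have conv_S: "\<exists>Q. op_has_sum (tensor_space K ?F) (homogeneous_part k n K A ?F ?Z) (multidegrees k) Q"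
  proof (rule op_has_sum_comparison(1)[OF KF.ts_hilbert KC.ts_hilbert Fb])
    show "homogeneous_part k n K A C (scale_tuple C \<rho> (tS t)) q \<in> bops (tensor_space K C)" for q
      by (rule KC.homogeneous_part_bops[OF A tSb])
    show "\<exists>Q. op_has_sum (tensor_space K C) (homogeneous_part k n K A C (scale_tuple C \<rho> (tS t))) (multidegrees k) Q"
      by (rule conv[OF C_hilbert tS_in_polyball[OF t(1)]])
  qed (rule copy_partial_sums_twice[OF K A t(2)])
  have closure: "\<exists>Q. op_has_sum (tensor_space K H) (homogeneous_part k n K A H (scale_tuple H r X)) (multidegrees k) Q"
      "opnorm (tensor_space K H) (fps_apply k n K A H (scale_tuple H r X)) \<le> opnorm (tensor_space K ?F) (fps_apply k n K A ?F ?Z)"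
    if H: "hilbert_space H" and X: "X \<in> polyball_closure k n H" for H :: "'h hilb" and X
  proof -
    interpret KH: tensor K H using K H by (simp add: tensor_def)
    have Xb: "scale_tuple H r X i j \<in> bops H" if "i \<in> {1..k}" "j \<in> {1..n i}" for i j
      unfolding scale_tuple_def using X that
      by (intro KH.H.bops_scale) (simp add: polyball_closure_def op_tuples_def)
    have Hb: "homogeneous_part k n K A H (scale_tuple H r X) q \<in> bops (tensor_space K H)" for q
      by (rule KH.homogeneous_part_bops[OF A Xb])
    note c = op_has_sum_comparison[OF KH.ts_hilbert KF.ts_hilbert Hb Fb
        von_neumann_polyball_closure[OF K H X A] conv_S]
    show "\<exists>Q. op_has_sum (tensor_space K H) (homogeneous_part k n K A H (scale_tuple H r X)) (multidegrees k) Q"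
      by (rule c(1))
    show "opnorm (tensor_space K H) (fps_apply k n K A H (scale_tuple H r X)) \<le> opnorm (tensor_space K ?F) (fps_apply k n K A ?F ?Z)"
      unfolding fps_apply_def by (rule c(2))
  qed
  have rSb: "scale_tuple C r S i j \<in> bops C" if "i \<in> {1..k}" "j \<in> {1..n i}" for i j
    by (rule C.adjoint_pairD(1)[OF tS_adjoint[OF that]])
  have copy: "opnorm (tensor_space K ?F) (fps_apply k n K A ?F ?Z)
      \<le> opnorm (tensor_space K C) (fps_apply k n K A C (scale_tuple C r S))"
    unfolding fps_apply_def
    by (rule op_has_sum_comparison(2)[OF KF.ts_hilbert KC.ts_hilbert Fb
          KC.homogeneous_part_bops[OF A rSb] copy_partial_sums[OF K A] closure(1)[OF C_hilbert S_in_closure]])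
  have sup: "sup_norm TYPE('h) k n K A r = ereal (opnorm (tensor_space K ?F) (fps_apply k n K A ?F ?Z))"
  proof (rule antisym)
    show "sup_norm TYPE('h) k n K A r \<le> ereal (opnorm (tensor_space K ?F) (fps_apply k n K A ?F ?Z))"
      unfolding sup_norm_def by (rule Sup_least) (use closure(2) in auto)
    have "ereal (opnorm (tensor_space K C) (fps_apply k n K A C (scale_tuple C r S))) \<le> sup_norm TYPE('h) k n K A r"
      unfolding sup_norm_def by (rule Sup_upper) (use C_hilbert S_in_closure in blast)
    then show "ereal (opnorm (tensor_space K ?F) (fps_apply k n K A ?F ?Z)) \<le> sup_norm TYPE('h) k n K A r"
      using copy by (meson ereal_less_eq(3) order_trans)
  qed
  have "ereal (sqrt (opnorm K (op_sum K (\<lambda>\<alpha>. adj K (A \<alpha>) \<circ> A \<alpha>) (multiwords_deg k n p))))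
         \<le> ereal (1 / (\<Prod>i=1..k. r i ^ p i)) * sup_norm TYPE('h) k n K A r" if "p \<in> multidegrees k" for p
    unfolding sup times_ereal.simps(1) ereal_less_eq(3)
    by (rule cauchy_estimate[OF K A _ conv_S that]) (use assms(7) in auto)
  then show ?thesis using sup by blast
qed

end
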